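(* Fix $d\in\{2,3\}$. Consider the five Galerkin formulations of the incompressible Navier--Stokes equations (convective, skew-symmetric, rotational, conservative, EMA-conserving) defined in the context, whose solutions $(\mathbf u,p)$ satisfy the divergence constraint only weakly, i.e. $(\operatorname{div}\mathbf u,q)=0$ for all $q\in Q$, while in general $\operatorname{div}\mathbf u\neq 0$ pointwise. Then: (1) the skew-symmetric, rotational and EMA-conserving formulations conserve kinetic energy $E=\frac12\int_\Omega|\mathbf u|^2\,d\mathbf x$ when $\nu=0$ and $\mathbf f=\mathbf 0$; (2) among the five formulations, the EMA-conserving and the conservative formulations, and only these, conserve linear momentum $M=\int_\Omega\mathbf u\,d\mathbf x$ (for $\mathbf f$ with zero linear momentum, $\int_\Omega\mathbf f\,d\mathbf x=\mathbf 0$), and they, and only they, conserve angular momentum $M_{\mathbf x}=\int_\Omega\mathbf u\times\mathbf x\,d\mathbf x$ (for $\mathbf f$ with zero angular momentum, $\int_\Omega\mathbf f\times\mathbf x\,d\mathbf x=\mathbf 0$). Hence the EMA-conserving formulation is the only one of the five formulations that conserves all three quantities.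
   Context: Notation: $\Omega\subset\mathbb R^d$ is a domain, $(\cdot,\cdot)$ and $\|\cdot\|$ are the $L^2(\Omega)$ inner product and norm, $\nu\ge 0$ is the kinematic viscosity, $\mathbf f$ is an external forcing. Convention: $(\nabla\mathbf u)\mathbf v=(\mathbf v\cdot\nabla)\mathbf u$, i.e. $(\nabla \mathbf u)_{ij}=\partial_j u_i$, and $\mathbf D(\mathbf u)=\frac12(\nabla\mathbf u+(\nabla\mathbf u)^T)$. In two dimensions, the curl and the cross product are understood by extending vectors by $0$ in the third component (so $M_{\mathbf x}$ has one nontrivial component when $d=2$). Spaces: $\mathbf X\subset[H^1_0(\Omega)]^d$ and $Q\subset L^2(\Omega)$ are finite-dimensional (piecewise polynomial) finite element velocity and pressure spaces corresponding to an admissible triangulation of $\Omega$ and satisfying the usual inf-sup (LBB) compatibility condition. Galerkin formulation: find $\mathbf u(t)\in\mathbf X$ (differentiable in $t$) and $p(t)\in Q$ such that for all times $t$ and all $\mathbf v\in\mathbf X$, $q\in Q$, $$\Big(\frac{\partial\mathbf u}{\partial t}+NL(\mathbf u),\mathbf v\Big)-(p,\operatorname{div}\mathbf v)+(q,\operatorname{div}\mathbf u)+\nu(\nabla\mathbf u,\nabla\mathbf v)=(\mathbf f,\mathbf v).$$ The five formulations are given by the choices - convective: $NL(\mathbf u)=\mathbf u\cdot\nabla\mathbf u$; - skew-symmetric: $NL(\mathbf u)=\mathbf u\cdot\nabla\mathbf u+\frac12(\operatorname{div}\mathbf u)\mathbf u$; - rotational: $NL(\mathbf u)=(\operatorname{curl}\mathbf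 u)\times\mathbf u$; - conservative: $NL(\mathbf u)=\nabla\cdot(\mathbf u\otimes\mathbf u)=\mathbf u\cdot\nabla\mathbf u+(\operatorname{div}\mathbf u)\mathbf u$; - EMA-conserving: $NL(\mathbf u)=2\mathbf D(\mathbf u)\mathbf u+(\operatorname{div}\mathbf u)\mathbf u$. Standing assumption for linear and angular momentum: there is a subset $\widehat\Omega\subsetneq\Omega$ such that $S=\Omega\setminus\widehat\Omega$ is a strip along $\partial\Omega$ (containing a strip of elements along the boundary), and $\mathbf u$, $p$ and $\mathbf f$ vanish on $S$ at all times. For every $\mathbf g$ that is a constant coordinate vector $\mathbf e_i$ or a field $\mathbf x\times\mathbf e_i$ (when $d=2$: $\mathbf e_1,\mathbf e_2$ and $\mathbf x\times\mathbf e_3$), there is an element $\chi(\mathbf g)\in\mathbf X$ with $\chi(\mathbf g)=\mathbf g$ on $\widehat\Omega$. Meaning of "conserves": a formulation conserves a quantity (under the stated conditions on $\nu,\mathbf f$) if, for every choice of $\Omega,\mathbf X,Q,\nu,\mathbf f$ and every solution $(\mathbf u,p)$ of that formulation satisfying the stated conditions and assumptions, the quantity is constant in time. A formulation does not conserve the quantity if this fails in general, i.e. for some such choice and solution the quantity is not constant in time. *)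

theory Defs
  imports "HOL-Analysis.Analysis"
begin

text \<open>\<open>'d\<close> indexes the coordinates, so \<open>d = CARD('d)\<close>.\<close>

type_synonym 'd point = "(real, 'd) vec"

type_synonym 'd gradient = "((real, 'd) vec, 'd) vec"

section \<open>Lebesgue and Sobolev spaces\<close>

text \<open>Elements of function spaces are represented by functions on the whole Euclidean space, of
  which only the values almost everywhere on the domain \<open>\<Omega>\<close> matter.\<close>

definition L2_on :: "'a::euclidean_space set \<Rightarrow> ('a \<Rightarrow> 'b::euclidean_space) set" where
  "L2_on \<Omega> = {f. set_borel_measurable lebesgue \<Omega> f \<and>
                  set_integrable lebesgue \<Omega> (\<lambda>x. (norm (f x))\<^sup>2)}"

definition l2_inner ::
    "'a::euclidean_space set \<Rightarrow> ('a \<Rightarrow> 'b::euclidean_space) \<Rightarrow> ('a \<Rightarrow> 'b) \<Rightarrow> real" where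
  "l2_inner \<Omega> f g = (LINT x:\<Omega>|lebesgue. inner (f x) (g x))"

definition l2_norm :: "'a::euclidean_space set \<Rightarrow> ('a \<Rightarrow> 'b::euclidean_space) \<Rightarrow> real" where
  "l2_norm \<Omega> f = sqrt (l2_inner \<Omega> f f)"

primrec C_k :: "nat \<Rightarrow> ('a::real_normed_vector \<Rightarrow> 'b::real_normed_vector) \<Rightarrow> bool" where
  "C_k 0 f \<longleftrightarrow> continuous_on UNIV f"
| "C_k (Suc k) f \<longleftrightarrow> f differentiable_on UNIV \<and>
                    (\<forall>v. C_k k (\<lambda>x. frechet_derivative f (at x) v))"

definition test_functions :: "'a::euclidean_space set \<Rightarrow> ('a \<Rightarrow> 'b::real_normed_vector) set" where
  "test_functions \<Omega> = {\<phi>. (\<forall>k. C_k k \<phi>) \<and> compact (closure {x. \<phi> x \<noteq> 0}) \<and>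
                           closure {x. \<phi> x \<noteq> 0} \<subseteq> \<Omega>}"

definition partial_deriv :: "'d::finite \<Rightarrow> ('d point \<Rightarrow> real) \<Rightarrow> 'd point \<Rightarrow> real" where
  "partial_deriv j \<phi> x = frechet_derivative \<phi> (at x) (axis j 1)"

text \<open>Convention: \<open>G x $ i $ j\<close> is \<open>\<partial>\<^sub>j u\<^sub>i\<close> at \<open>x\<close>.\<close>

definition is_weak_grad ::
    "('d::finite point) set \<Rightarrow> ('d point \<Rightarrow> 'd point) \<Rightarrow> ('d point \<Rightarrow> 'd gradient) \<Rightarrow> bool" where
  "is_weak_grad \<Omega> u G \<longleftrightarrow> G \<in> L2_on \<Omega> \<and>
     (\<forall>\<phi> \<in> test_functions \<Omega>. \<forall>i j.
        (LINT x:\<Omega>|lebesgue. u x $ i * partial_deriv j \<phi> x) =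
        - (LINT x:\<Omega>|lebesgue. G x $ i $ j * \<phi> x))"

definition H1 :: "('d::finite point) set \<Rightarrow> ('d point \<Rightarrow> 'd point) set" where
  "H1 \<Omega> = {u \<in> L2_on \<Omega>. \<exists>G. is_weak_grad \<Omega> u G}"

definition weak_grad ::
    "('d::finite point) set \<Rightarrow> ('d point \<Rightarrow> 'd point) \<Rightarrow> 'd point \<Rightarrow> 'd gradient" where
  "weak_grad \<Omega> u = (SOME G. is_weak_grad \<Omega> u G)"

definition weak_div :: "('d::finite point) set \<Rightarrow> ('d point \<Rightarrow> 'd point) \<Rightarrow> 'd point \<Rightarrow> real" where
  "weak_div \<Omega> u x = trace (weak_grad \<Omega> u x)"

definition h1_norm :: "('d::finite point) set \<Rightarrow> ('d point \<Rightarrow> 'd point) \<Rightarrow> real" where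
  "h1_norm \<Omega> u = sqrt ((l2_norm \<Omega> u)\<^sup>2 + (l2_norm \<Omega> (weak_grad \<Omega> u))\<^sup>2)"

definition H10 :: "('d::finite point) set \<Rightarrow> ('d point \<Rightarrow> 'd point) set" where
  "H10 \<Omega> = {u \<in> H1 \<Omega>. \<exists>\<phi> :: nat \<Rightarrow> 'd point \<Rightarrow> 'd point.
               (\<forall>n. \<phi> n \<in> test_functions \<Omega>) \<and>
               (\<lambda>n. h1_norm \<Omega> (\<lambda>x. u x - \<phi> n x)) \<longlonglongrightarrow> 0}"


section \<open>Finite element spaces\<close>

definition admissible_triangulation ::
    "('d::finite point) set set \<Rightarrow> ('d point) set \<Rightarrow> bool" where
  "admissible_triangulation \<T> \<Omega> \<longleftrightarrow> triangulation \<T> \<and>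
     (\<forall>K \<in> \<T>. int CARD('d) simplex K) \<and> \<Union>\<T> = closure \<Omega>"

definition finite_dim_space :: "('a \<Rightarrow> 'b::real_vector) set \<Rightarrow> bool" where
  "finite_dim_space V \<longleftrightarrow>
     (\<exists>B. finite B \<and> V = range (\<lambda>(c :: ('a \<Rightarrow> 'b) \<Rightarrow> real) x. \<Sum>b\<in>B. c b *\<^sub>R b x))"

definition piecewise_polynomial ::
    "'a::euclidean_space set set \<Rightarrow> 'a set \<Rightarrow> ('a \<Rightarrow> 'b::euclidean_space) \<Rightarrow> bool" where
  "piecewise_polynomial \<T> \<Omega> f \<longleftrightarrow>
     (\<forall>K \<in> \<T>. \<exists>P. polynomial_function P \<and> (\<forall>x \<in> interior K \<inter> \<Omega>. f x = P x))"

text \<open>The norm of \<open>L\<^sup>2(\<Omega>)/\<real>\<close>. Using it in the inf-sup condition covers both conventions for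
  the pressure space: zero-mean pressures, and pressures determined up to a constant.\<close>

definition l2_quotient_norm :: "'a::euclidean_space set \<Rightarrow> ('a \<Rightarrow> real) \<Rightarrow> real" where
  "l2_quotient_norm \<Omega> q =
     l2_norm \<Omega> (\<lambda>x. q x - (LINT y:\<Omega>|lebesgue. q y) / measure lebesgue \<Omega>)"

definition inf_sup_condition ::
    "('d::finite point) set \<Rightarrow> ('d point \<Rightarrow> 'd point) set \<Rightarrow> ('d point \<Rightarrow> real) set \<Rightarrow> bool" where
  "inf_sup_condition \<Omega> X Q \<longleftrightarrow>
     (INF q \<in> {q \<in> Q. l2_quotient_norm \<Omega> q \<noteq> 0}.
        SUP v \<in> {v \<in> X. l2_norm \<Omega> (weak_grad \<Omega> v) \<noteq> 0}.
          ereal (l2_inner \<Omega> q (weak_div \<Omega> v) /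
                 (l2_quotient_norm \<Omega> q * l2_norm \<Omega> (weak_grad \<Omega> v)))) > 0"

definition finite_element_pair ::
    "('d::finite point) set set \<Rightarrow> ('d point) set \<Rightarrow>
     ('d point \<Rightarrow> 'd point) set \<Rightarrow> ('d point \<Rightarrow> real) set \<Rightarrow> bool" where
  "finite_element_pair \<T> \<Omega> X Q \<longleftrightarrow>
     open \<Omega> \<and> connected \<Omega> \<and> \<Omega> \<noteq> {} \<and> admissible_triangulation \<T> \<Omega> \<and>
     finite_dim_space X \<and> X \<subseteq> H10 \<Omega> \<and> (\<forall>v \<in> X. piecewise_polynomial \<T> \<Omega> v) \<and>
     finite_dim_space Q \<and> Q \<subseteq> L2_on \<Omega> \<and> (\<forall>q \<in> Q. piecewise_polynomial \<T> \<Omega> q) \<and>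
     inf_sup_condition \<Omega> X Q"


section \<open>The nonlinear terms\<close>

text \<open>Vectors of \<open>\<real>\<^sup>2\<close> and \<open>2 \<times> 2\<close> velocity gradients are extended by zero to three dimensions in
  order to form curls and cross products; for \<open>d = 3\<close> the maps \<open>ext3\<close>, \<open>ext3_mat\<close> and \<open>restr3\<close> are
  the identity. The definitions are only meaningful for the index types \<open>2\<close> and \<open>3\<close>.\<close>

definition ext3 :: "'d::{finite,numeral} point \<Rightarrow> real^3" where
  "ext3 w = vector [w $ 1, w $ 2, if CARD('d) = 3 then w $ 3 else 0]"

definition ext3_mat :: "'d::{finite,numeral} gradient \<Rightarrow> real^3^3" where
  "ext3_mat G = vector [ext3 (G $ 1), ext3 (G $ 2), if CARD('d) = 3 then ext3 (G $ 3) else 0]"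

definition restr3 :: "real^3 \<Rightarrow> 'd::{finite,numeral} point" where
  "restr3 w = (\<chi> i. if i = 1 then w $ 1 else if i = 2 then w $ 2 else w $ 3)"

definition curl_of_grad :: "real^3^3 \<Rightarrow> real^3" where
  "curl_of_grad G = vector [G $ 3 $ 2 - G $ 2 $ 3, G $ 1 $ 3 - G $ 3 $ 1, G $ 2 $ 1 - G $ 1 $ 2]"

definition sym_grad :: "'d::finite gradient \<Rightarrow> 'd gradient" where
  "sym_grad G = (1/2) *\<^sub>R (G + transpose G)"

datatype formulation = Convective | Skew_Symmetric | Rotational | Conservative | EMA_Conserving

text \<open>The nonlinear term at a point, from the velocity gradient \<open>G\<close> and the velocity \<open>w\<close> there:
  \<open>G *v w\<close> is \<open>(u \<cdot> \<nabla>)u\<close> and \<open>trace G\<close> is \<open>div u\<close>.\<close>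

fun NL :: "formulation \<Rightarrow> 'd::{finite,numeral} gradient \<Rightarrow> 'd point \<Rightarrow> 'd point" where
  "NL Convective G w = G *v w"
| "NL Skew_Symmetric G w = G *v w + (1/2 * trace G) *\<^sub>R w"
| "NL Rotational G w = restr3 (cross3 (curl_of_grad (ext3_mat G)) (ext3 w))"
| "NL Conservative G w = G *v w + trace G *\<^sub>R w"
| "NL EMA_Conserving G w = 2 *\<^sub>R (sym_grad G *v w) + trace G *\<^sub>R w"


section \<open>Galerkin solutions\<close>

definition has_L2_time_derivative ::
    "'a::euclidean_space set \<Rightarrow> real set \<Rightarrow> (real \<Rightarrow> 'a \<Rightarrow> 'b::euclidean_space) \<Rightarrow> real \<Rightarrow>
     ('a \<Rightarrow> 'b) \<Rightarrow> bool" where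
  "has_L2_time_derivative \<Omega> I u t u' \<longleftrightarrow>
     ((\<lambda>s. l2_norm \<Omega> (\<lambda>x. (1 / (s - t)) *\<^sub>R (u s x - u t x) - u' x)) \<longlongrightarrow> 0) (at t within I)"

definition galerkin_solution ::
    "formulation \<Rightarrow> ('d::{finite,numeral} point) set \<Rightarrow>
     ('d point \<Rightarrow> 'd point) set \<Rightarrow> ('d point \<Rightarrow> real) set \<Rightarrow>
     real \<Rightarrow> (real \<Rightarrow> 'd point \<Rightarrow> 'd point) \<Rightarrow> real set \<Rightarrow>
     (real \<Rightarrow> 'd point \<Rightarrow> 'd point) \<Rightarrow> (real \<Rightarrow> 'd point \<Rightarrow> real) \<Rightarrow> bool" where
  "galerkin_solution F \<Omega> X Q \<nu> f I u p \<longleftrightarrow>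
     (\<forall>t \<in> I. u t \<in> X \<and> p t \<in> Q \<and>
        (\<exists>u' \<in> X. has_L2_time_derivative \<Omega> I u t u' \<and>
           (\<forall>v \<in> X. \<forall>q \<in> Q.
              l2_inner \<Omega> (\<lambda>x. u' x + NL F (weak_grad \<Omega> (u t) x) (u t x)) v
              - l2_inner \<Omega> (p t) (weak_div \<Omega> v)
              + l2_inner \<Omega> q (weak_div \<Omega> (u t))
              + \<nu> * l2_inner \<Omega> (weak_grad \<Omega> (u t)) (weak_grad \<Omega> v)
              = l2_inner \<Omega> (f t) v)))"

definition galerkin_setting ::
    "formulation \<Rightarrow> ('d::{finite,numeral} point) set set \<Rightarrow> ('d point) set \<Rightarrow>
     ('d point \<Rightarrow> 'd point) set \<Rightarrow> ('d point \<Rightarrow> real) set \<Rightarrow>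
     real \<Rightarrow> (real \<Rightarrow> 'd point \<Rightarrow> 'd point) \<Rightarrow> real \<Rightarrow>
     (real \<Rightarrow> 'd point \<Rightarrow> 'd point) \<Rightarrow> (real \<Rightarrow> 'd point \<Rightarrow> real) \<Rightarrow> bool" where
  "galerkin_setting F \<T> \<Omega> X Q \<nu> f \<tau> u p \<longleftrightarrow>
     finite_element_pair \<T> \<Omega> X Q \<and> \<nu> \<ge> 0 \<and> \<tau> > 0 \<and> (\<forall>t \<in> {0..\<tau>}. f t \<in> L2_on \<Omega>) \<and>
     galerkin_solution F \<Omega> X Q \<nu> f {0..\<tau>} u p"

text \<open>The coordinate vectors \<open>e\<^sub>i\<close> and the fields \<open>x \<times> e\<^sub>i\<close>; for \<open>d = 2\<close> only \<open>x \<times> e\<^sub>3\<close> among the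
  latter is a planar field.\<close>

definition rigid_fields :: "('d::{finite,numeral} point \<Rightarrow> 'd point) set" where
  "rigid_fields =
     range (\<lambda>i x. axis i 1) \<union>
     (\<lambda>i x. restr3 (cross3 (ext3 x) (axis i 1))) ` (if CARD('d) = 3 then UNIV else {3})"

text \<open>\<open>\<Omega> - \<Omega>h\<close> is a strip along the boundary: it contains (the interior of) every element that
  touches the boundary of \<open>\<Omega>\<close>.\<close>

definition boundary_strip_assumption ::
    "('d::{finite,numeral} point) set set \<Rightarrow> ('d point) set \<Rightarrow> ('d point \<Rightarrow> 'd point) set \<Rightarrow>
     (real \<Rightarrow> 'd point \<Rightarrow> 'd point) \<Rightarrow> real \<Rightarrow>
     (real \<Rightarrow> 'd point \<Rightarrow> 'd point) \<Rightarrow> (real \<Rightarrow> 'd point \<Rightarrow> real) \<Rightarrow> bool" where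
  "boundary_strip_assumption \<T> \<Omega> X f \<tau> u p \<longleftrightarrow>
     (\<exists>\<Omega>h. \<Omega>h \<subset> \<Omega> \<and>
        (\<forall>K \<in> \<T>. K \<inter> frontier \<Omega> \<noteq> {} \<longrightarrow> interior K \<inter> \<Omega> \<subseteq> \<Omega> - \<Omega>h) \<and>
        (\<forall>t \<in> {0..\<tau>}. AE x in lebesgue. x \<in> \<Omega> - \<Omega>h \<longrightarrow> u t x = 0 \<and> p t x = 0 \<and> f t x = 0) \<and>
        (\<forall>g \<in> rigid_fields. \<exists>v \<in> X. AE x in lebesgue. x \<in> \<Omega>h \<longrightarrow> v x = g x))"


section \<open>Conservation\<close>

definition kinetic_energy :: "('d::finite point) set \<Rightarrow> ('d point \<Rightarrow> 'd point) \<Rightarrow> real" where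
  "kinetic_energy \<Omega> u = 1/2 * (LINT x:\<Omega>|lebesgue. (norm (u x))\<^sup>2)"

definition linear_momentum :: "('d::finite point) set \<Rightarrow> ('d point \<Rightarrow> 'd point) \<Rightarrow> 'd point" where
  "linear_momentum \<Omega> u = (LINT x:\<Omega>|lebesgue. u x)"

definition angular_momentum ::
    "('d::{finite,numeral} point) set \<Rightarrow> ('d point \<Rightarrow> 'd point) \<Rightarrow> real^3" where
  "angular_momentum \<Omega> u = (LINT x:\<Omega>|lebesgue. cross3 (ext3 (u x)) (ext3 x))"

definition conserves_energy :: "'d::{finite,numeral} itself \<Rightarrow> formulation \<Rightarrow> bool" where
  "conserves_energy _ F \<longleftrightarrow>
     (\<forall>\<T> (\<Omega> :: ('d point) set) X Q \<nu> f \<tau> u p.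
        galerkin_setting F \<T> \<Omega> X Q \<nu> f \<tau> u p \<and> \<nu> = 0 \<and> f = (\<lambda>t x. 0)
        \<longrightarrow> (\<lambda>t. kinetic_energy \<Omega> (u t)) constant_on {0..\<tau>})"

definition conserves_linear_momentum :: "'d::{finite,numeral} itself \<Rightarrow> formulation \<Rightarrow> bool" where
  "conserves_linear_momentum _ F \<longleftrightarrow>
     (\<forall>\<T> (\<Omega> :: ('d point) set) X Q \<nu> f \<tau> u p.
        galerkin_setting F \<T> \<Omega> X Q \<nu> f \<tau> u p \<and> boundary_strip_assumption \<T> \<Omega> X f \<tau> u p \<and>
        (\<forall>t \<in> {0..\<tau>}. linear_momentum \<Omega> (f t) = 0)
        \<longrightarrow> (\<lambda>t. linear_momentum \<Omega> (u t)) constant_on {0..\<tau>})"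

definition conserves_angular_momentum :: "'d::{finite,numeral} itself \<Rightarrow> formulation \<Rightarrow> bool" where
  "conserves_angular_momentum _ F \<longleftrightarrow>
     (\<forall>\<T> (\<Omega> :: ('d point) set) X Q \<nu> f \<tau> u p.
        galerkin_setting F \<T> \<Omega> X Q \<nu> f \<tau> u p \<and> boundary_strip_assumption \<T> \<Omega> X f \<tau> u p \<and>
        (\<forall>t \<in> {0..\<tau>}. angular_momentum \<Omega> (f t) = 0)
        \<longrightarrow> (\<lambda>t. angular_momentum \<Omega> (u t)) constant_on {0..\<tau>})"

end

theory Submission
  imports Defs
begin

text \<open>Conservation follows by testing the weak form with \<open>u\<close> itself for the energy, and with the
  discrete representative \<open>\<chi>(g)\<close> of a rigid motion \<open>g\<close> for the momenta. Finite element
  functions are essentially bounded, so the Leibniz rule survives the approximation of their components by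
  test functions; the nonlinear terms then integrate to zero as divergences of functions vanishing on
  the boundary. Since the zero set of a nonzero polynomial is null, \<open>\<chi>(g)\<close> has the gradient of
  \<open>g\<close> almost everywhere on the support of \<open>u\<close>.

  For the counterexamples, let \<open>X\<close> be a space of piecewise polynomial fields on the Kuhn triangulation of
  \<open>(-3,3)\<^sup>d\<close>, with zero pressure space, so that neither the inf-sup condition nor the discrete divergence
  constraint says anything. A fixed field \<open>\<phi>\<close> supported in \<open>[-1,1]\<^sup>d\<close> gives the
  solution \<open>u = c(t) \<phi>\<close> with \<open>c' = \<kappa> c\<^sup>2\<close> for the force \<open>f = u' + NL(u)\<close>. If \<open>\<kappa>\<close> balances
  the total momentum of \<open>NL(\<phi>)\<close> against that of \<open>\<phi>\<close>, the force has zero momentum, while the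
  momentum of \<open>u\<close> grows like \<open>c\<close>.\<close>

text \<open>Up to a gradient, which integrates to zero against rigid motions, the convective,
  skew-symmetric and rotational terms are the conservative one minus (div u) u, with a factor 1/2 in
  the skew-symmetric case. Their momentum defect is a multiple of the integral of (div u) (u . g),
  so a field is sought for which this is nonzero and parallel to its own momentum. Half of the same
  integral with u in place of g is the energy defect of the conservative form. There the force must
  be zero, so the freedom is moved into the space: X is spanned by the field alone, and the single
  tested equation determines \<open>\<kappa>\<close>.

  The obstacle is that the fields must be piecewise polynomial and yet lie in H10. They are built
  from truncated parabolas max 0 (1 - x_i^2), whose kinks lie on mesh planes, and membership is
  obtained by smoothing the truncation. The radii 1, 2, 3 make room for the strip: the field lives
  in radius 1, the cutoff of the rigid motions is 1 there and 0 beyond radius 2, and elements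
  touching the boundary of the cube of radius 3 stay away from radius less than 2.\<close>

section \<open>Smooth functions and their closure properties\<close>

lemma frechet_deriv_eq:
  "(f has_derivative f') (at x) \<Longrightarrow> frechet_derivative f (at x) = f'"
  using frechet_derivative_at by metis

text \<open>The Leibniz rule leaves one factor underived, whose known order is then one higher than
  the induction hypothesis asks for.\<close>

lemma C_k_Suc_D: "C_k (Suc k) f \<Longrightarrow> C_k k f"
proof (induction k arbitrary: f)
  case 0
  then show ?case
    by (auto intro: differentiable_imp_continuous_on)
next
  case (Suc k)
  show ?case
    unfolding C_k.simps(2)[of k f]
  proof (intro conjI allI)
    show "f differentiable_on UNIV" using Suc.prems by simp
    fix v
    have "C_k (Suc k) (\<lambda>x. frechet_derivative f (at x) v)"
      using Suc.prems unfolding C_k.simps(2)[of "Suc k" f] by blast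
    then show "C_k k (\<lambda>x. frechet_derivative f (at x) v)" by (rule Suc.IH)
  qed
qed

lemma C_k_SucI:
  assumes "\<And>x. (f has_derivative f' x) (at x)" "\<And>v. C_k k (\<lambda>x. f' x v)"
  shows "C_k (Suc k) f"
proof -
  have "f differentiable_on UNIV"
    unfolding differentiable_on_def differentiable_def using assms(1) by auto
  moreover have "frechet_derivative f (at x) = f' x" for x
    using assms(1) by (rule frechet_deriv_eq)
  ultimately show ?thesis using assms(2) by simp
qed

lemma C_k_SucD:
  assumes "C_k (Suc k) f"
  shows "(f has_derivative frechet_derivative f (at x)) (at x)"
    "C_k k (\<lambda>x. frechet_derivative f (at x) v)"
  using assms by (auto simp: differentiable_on_def frechet_derivative_works)

lemma C_k_imp_continuous: "C_k k f \<Longrightarrow> continuous_on UNIV f"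
  by (cases k) (auto intro: differentiable_imp_continuous_on)

lemma C_k_const: "C_k k (\<lambda>x. c)"
proof (induction k arbitrary: c)
  case (Suc k)
  show ?case by (rule C_k_SucI[where f' = "\<lambda>x v. 0"]) (auto intro: Suc)
qed simp

lemma C_k_add: "C_k k f \<Longrightarrow> C_k k g \<Longrightarrow> C_k k (\<lambda>x. f x + g x)"
proof (induction k arbitrary: f g)
  case 0 then show ?case by (auto intro: continuous_intros)
next
  case (Suc k)
  show ?case
    by (rule C_k_SucI, rule has_derivative_add)
       (use Suc.prems in \<open>auto intro!: C_k_SucD(1) Suc.IH C_k_SucD(2) simp del: C_k.simps\<close>)
qed

lemma C_k_bounded_linear:
  assumes "bounded_linear h" "C_k k f"
  shows "C_k k (\<lambda>x. h (f x))"
  using assms(2)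
proof (induction k arbitrary: f)
  case 0 then show ?case by (auto intro: bounded_linear.continuous_on assms)
next
  case (Suc k)
  show ?case
    by (rule C_k_SucI, rule bounded_linear.has_derivative[OF assms(1)], rule C_k_SucD(1)[OF Suc.prems])
       (rule Suc.IH, rule C_k_SucD(2)[OF Suc.prems])
qed

lemma C_k_mult:
  fixes f g :: "'a::real_normed_vector \<Rightarrow> real"
  shows "C_k k f \<Longrightarrow> C_k k g \<Longrightarrow> C_k k (\<lambda>x. f x * g x)"
proof (induction k arbitrary: f g)
  case 0 then show ?case by (auto intro: continuous_intros)
next
  case (Suc k)
  show ?case
    by (rule C_k_SucI, rule has_derivative_mult, rule C_k_SucD(1)[OF Suc.prems(1)],
        rule C_k_SucD(1)[OF Suc.prems(2)], rule C_k_add; rule Suc.IH)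
       (rule C_k_Suc_D[OF Suc.prems(1)] C_k_Suc_D[OF Suc.prems(2)]
             C_k_SucD(2)[OF Suc.prems(1)] C_k_SucD(2)[OF Suc.prems(2)])+
qed

lemma C_k_linear:
  assumes "bounded_linear f" shows "C_k k f"
proof (cases k)
  case 0 then show ?thesis using assms by (simp add: linear_continuous_on)
next
  case (Suc m)
  show ?thesis unfolding Suc
    by (rule C_k_SucI, rule bounded_linear_imp_has_derivative[OF assms], rule C_k_const)
qed

lemma C_k_sum:
  "finite A \<Longrightarrow> (\<And>i. i \<in> A \<Longrightarrow> C_k k (f i)) \<Longrightarrow> C_k k (\<lambda>x. \<Sum>i\<in>A. f i x)"
  by (induction A rule: finite_induct) (auto intro: C_k_const C_k_add)

lemma C_k_prod:
  fixes f :: "'i \<Rightarrow> 'a::real_normed_vector \<Rightarrow> real"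
  shows "finite A \<Longrightarrow> (\<And>i. i \<in> A \<Longrightarrow> C_k k (f i)) \<Longrightarrow> C_k k (\<lambda>x. \<Prod>i\<in>A. f i x)"
  by (induction A rule: finite_induct) (auto intro: C_k_const C_k_mult)

text \<open>A family closed under differentiation can be composed with \<open>g\<close> without a
  higher order chain rule: a derivative of \<open>h (g x)\<close> is a derivative of
  \<open>g\<close> times another member of the family at \<open>g x\<close>, and the induction
  treats all members at once.\<close>

lemma C_k_compose_family:
  fixes g :: "'a::real_normed_vector \<Rightarrow> real" and \<H> :: "(real \<Rightarrow> real) set"
  assumes "\<And>h. h \<in> \<H> \<Longrightarrow> \<exists>h' \<in> \<H>. \<forall>s. (h has_real_derivative h' s) (at s)"
    and "\<And>k. C_k k g" "h \<in> \<H>"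
  shows "C_k k (\<lambda>x. h (g x))"
  using assms(3)
proof (induction k arbitrary: h)
  case 0
  obtain h' where "\<forall>s. (h has_real_derivative h' s) (at s)" using assms(1)[OF 0] by blast
  then have "continuous_on UNIV h"
    by (auto intro!: continuous_at_imp_continuous_on DERIV_isCont)
  moreover have "continuous_on UNIV g" using assms(2)[of 0] by simp
  ultimately show ?case by (auto intro: continuous_on_compose2)
next
  case (Suc k)
  obtain h' where h': "h' \<in> \<H>" "\<forall>s. (h has_real_derivative h' s) (at s)"
    using assms(1)[OF Suc.prems] by blast
  let ?Dg = "\<lambda>x. frechet_derivative g (at x)"
  show ?case
  proof (rule C_k_SucI[where f' = "\<lambda>x v. ?Dg x v * h' (g x)"])
    show "((\<lambda>x. h (g x)) has_derivative (\<lambda>v. ?Dg x v * h' (g x))) (at x)" for x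
      using has_derivative_compose[OF C_k_SucD(1)[OF assms(2)], of h "(*) (h' (g x))" x] h'(2)
      by (simp add: has_field_derivative_def mult.commute)
    show "C_k k (\<lambda>x. ?Dg x v * h' (g x))" for v
      by (intro C_k_mult Suc.IH h' C_k_SucD(2)[OF assms(2)])
  qed
qed

lemma C_k_real_polynomial_function:
  fixes p :: "'a::real_normed_vector \<Rightarrow> real"
  shows "real_polynomial_function p \<Longrightarrow> C_k k p"
  by (induction p rule: real_polynomial_function.induct)
     (auto intro: C_k_linear C_k_const C_k_add C_k_mult)

section \<open>Flat functions and smooth steps\<close>

definition flat_fun :: "real poly \<Rightarrow> real \<Rightarrow> real" where
  "flat_fun p s = (if s > 0 then poly p (1/s) * exp (- (1/s)) else 0)"

lemma tendsto_poly_exp_neg: "((\<lambda>y::real. poly p y * exp (- y)) \<longlongrightarrow> 0) at_top"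
proof -
  have *: "((\<lambda>y::real. y ^ k * exp (- y)) \<longlongrightarrow> 0) at_top" for k
    using tendsto_power_div_exp_0[of k] by (simp add: exp_minus divide_inverse)
  have "((\<lambda>y::real. \<Sum>i\<le>degree p. coeff p i * (y ^ i * exp (- y))) \<longlongrightarrow> (\<Sum>i\<le>degree p. coeff p i * 0)) at_top"
    by (intro tendsto_sum tendsto_mult tendsto_const *)
  then show ?thesis
    by (simp add: poly_altdef sum_distrib_right mult.assoc)
qed

text \<open>In the variable y = 1/s, d/ds is -y^2 d/dy, and it sends p(y) e^(-y) to y^2 (p - p')(y)
  e^(-y). The polynomial factor is carried along so that the family is closed under
  differentiation.\<close>

lemma flat_fun_has_derivative:
  "(flat_fun p has_real_derivative flat_fun ([:0,0,1:] * (p - pderiv p)) s) (at s)"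
proof -
  consider "s < 0" | "s = 0" | "s > 0" by linarith
  then show ?thesis
  proof cases
    case 1
    have "((\<lambda>s. 0) has_real_derivative 0) (at s)" by simp
    then have "(flat_fun p has_real_derivative 0) (at s)"
      by (rule has_field_derivative_transform_within_open[where S = "{..<0}"])
         (use 1 in \<open>auto simp: flat_fun_def\<close>)
    then show ?thesis using 1 by (simp add: flat_fun_def)
  next
    case 2
    have r: "((\<lambda>h. flat_fun p h / h) \<longlongrightarrow> 0) (at_right 0)"
    proof (rule Lim_transform_eventually)
      \<comment> \<open>Dividing by \<open>h\<close> multiplies by y = 1/h, which
        \<open>pCons 0 p\<close> absorbs.\<close>
      show "((\<lambda>h. poly (pCons 0 p) (inverse h) * exp (- (inverse h))) \<longlongrightarrow> 0) (at_right (0::real))"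
        by (rule filterlim_compose[OF tendsto_poly_exp_neg filterlim_inverse_at_top_right])
      show "\<forall>\<^sub>F h in at_right 0. poly (pCons 0 p) (inverse h) * exp (- (inverse h)) = flat_fun p h / h"
        unfolding eventually_at_right_field
        by (intro exI[of _ 1]) (auto simp: flat_fun_def field_simps)
    qed
    have l: "((\<lambda>h. flat_fun p h / h) \<longlongrightarrow> 0) (at_left 0)"
      by (rule Lim_transform_eventually[OF tendsto_const])
         (auto simp: eventually_at_left_field flat_fun_def intro!: exI[of _ "-1"])
    have "((\<lambda>h. flat_fun p h / h) \<longlongrightarrow> 0) (at 0)"
      using l r by (simp add: filterlim_split_at)
    then show ?thesis using 2 by (simp add: DERIV_def flat_fun_def)
  next
    case 3
    have "((\<lambda>s. poly p (1/s) * exp (- (1/s))) has_real_derivative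
       flat_fun ([:0,0,1:] * (p - pderiv p)) s) (at s)"
      using 3 by (auto intro!: derivative_eq_intros simp: flat_fun_def field_simps power2_eq_square)
    then show ?thesis
      by (rule has_field_derivative_transform_within_open[where S = "{0<..}"])
         (use 3 in \<open>auto simp: flat_fun_def\<close>)
  qed
qed

lemma C_k_flat_fun:
  assumes "\<And>k. C_k k g" shows "C_k k (\<lambda>x. flat_fun p (g x))"
proof (rule C_k_compose_family[where \<H> = "range flat_fun" and h = "flat_fun p"])
  fix h assume "h \<in> range flat_fun"
  then show "\<exists>h'\<in>range flat_fun. \<forall>s. (h has_real_derivative h' s) (at s)"
    using flat_fun_has_derivative by blast
qed (use assms in auto)

text \<open>A smooth step with values in [0, 1], tending to the indicator of s > 0 as
  \<open>n\<close> grows. Multiplied by s it smooths the positive part.\<close>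

definition flat_exp :: "nat \<Rightarrow> real \<Rightarrow> real" where
  "flat_exp n s = flat_fun [:1:] (real (Suc n) * s)"

lemma flat_exp_eq: "flat_exp n s = (if s > 0 then exp (- (1 / (real (Suc n) * s))) else 0)"
  by (simp add: flat_exp_def flat_fun_def zero_less_mult_iff)

lemma flat_exp_bounds: "0 \<le> flat_exp n s" "flat_exp n s \<le> 1"
  by (auto simp: flat_exp_eq)

lemma flat_exp_tendsto: "(\<lambda>n. flat_exp n s) \<longlonglongrightarrow> (if s > 0 then 1 else 0)"
proof (cases "s > 0")
  case True
  have "(\<lambda>n. exp (- (1 / s * inverse (real (Suc n))))) \<longlonglongrightarrow> exp (- (1/s * 0))"
    by (intro tendsto_intros LIMSEQ_inverse_real_of_nat)
  then show ?thesis using True by (simp add: flat_exp_eq field_simps)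
qed (simp add: flat_exp_eq)

lemma C_k_flat_exp:
  assumes "\<And>k. C_k k g" shows "C_k k (\<lambda>x. flat_exp n (g x))"
  unfolding flat_exp_def by (intro C_k_flat_fun C_k_mult C_k_const assms)

section \<open>Integrals of derivatives and the fundamental lemma of the calculus of
  variations\<close>

lemma integral_directional_derivative_eq_0:
  fixes w :: "'a::euclidean_space \<Rightarrow> real"
  assumes deriv: "\<And>x. (w has_derivative w' x) (at x)"
    and cont: "continuous_on UNIV (\<lambda>x. w' x v)"
    and "compact K" and supp: "\<And>x. x \<notin> K \<Longrightarrow> w x = 0"
  shows "integral\<^sup>L lborel (\<lambda>x. w' x v) = 0"
proof -
  obtain R where R: "R \<ge> 0" "K \<subseteq> cball 0 R"
    using compact_imp_bounded[OF \<open>compact K\<close>] bounded_subset_cball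
    by (metis bounded_iff mem_cball_0 norm_ge_zero order_trans subsetI)
  \<comment> \<open>If \<open>norm x\<close> is at most \<open>R + norm v\<close>, all points x + t
    v with 0 \<le> t \<le> 1 lie in \<open>B\<close>; for larger \<open>x\<close> both ends of the
    difference quotient lie outside \<open>K\<close>.\<close>
  define B where "B = cball (0::'a) (R + 2 * norm v)"
  obtain C where C: "\<And>x. x \<in> B \<Longrightarrow> \<bar>w' x v\<bar> \<le> C"
  proof -
    have "compact ((\<lambda>x. w' x v) ` B)" unfolding B_def
      by (intro compact_continuous_image continuous_on_subset[OF cont]) auto
    then have "bounded ((\<lambda>x. w' x v) ` B)" by (rule compact_imp_bounded)
    then show ?thesis using that by (auto simp: bounded_iff)
  qed
  have C0: "C \<ge> 0" using C[of 0] R by (auto simp: B_def)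
  have contw: "continuous_on UNIV w"
    using deriv by (meson continuous_at_imp_continuous_on has_derivative_continuous)
  then have bw: "w \<in> borel_measurable borel" by (rule borel_measurable_continuous_onI)
  have intw: "integrable lborel w"
  proof -
    have "integrable lborel (\<lambda>x. indicator K x *\<^sub>R w x)"
      by (intro borel_integrable_compact \<open>compact K\<close> continuous_on_subset[OF contw]) auto
    also have "(\<lambda>x. indicator K x *\<^sub>R w x) = w"
      using supp by (force simp: indicator_def)
    finally show ?thesis .
  qed
  have line: "((\<lambda>t. w (x + t *\<^sub>R v)) has_real_derivative w' (x + t *\<^sub>R v) v) (at t)" for x t
  proof -
    have "((\<lambda>t. w (x + t *\<^sub>R v)) has_derivative (\<lambda>s. w' (x + t *\<^sub>R v) (s *\<^sub>R v))) (at t)"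
      by (rule has_derivative_compose[OF _ deriv]) (auto intro!: derivative_eq_intros)
    moreover have "w' y (s *\<^sub>R v) = w' y v * s" for y s
      using linear_cmul[OF has_derivative_linear[OF deriv]] by simp
    ultimately show ?thesis by (simp add: has_field_derivative_def)
  qed
  define h where "h n = inverse (real (Suc n))" for n
  have h: "h n > 0" "h n \<le> 1" for n by (auto simp: h_def field_simps)
  define f where "f n x = (w (x + h n *\<^sub>R v) - w x) / h n" for n x
  \<comment> \<open>The integrals of the difference quotients are zero by translation invariance.
    The mean value theorem bounds the quotients by \<open>C\<close> on \<open>B\<close>, so the
    limit may be taken under the integral.\<close>
  have "(\<lambda>n. integral\<^sup>L lborel (f n)) \<longlonglongrightarrow> integral\<^sup>L lborel (\<lambda>x. w' x v)"
  proof (rule integral_dominated_convergence[where w = "\<lambda>x. indicator B x * C"])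
    show "(\<lambda>x. w' x v) \<in> borel_measurable lborel"
      using borel_measurable_continuous_onI[OF cont] by simp
    have "(\<lambda>x. w (x + h n *\<^sub>R v)) \<in> borel_measurable borel" for n
      by (intro borel_measurable_continuous_onI continuous_on_compose2[OF contw] continuous_intros) auto
    then show "f n \<in> borel_measurable lborel" for n
      using bw unfolding f_def by measurable
    show "integrable lborel (\<lambda>x. indicator B x * C)"
      unfolding B_def
      by (intro integrable_mult_left integrable_real_indicator) (use emeasure_lborel_cball_finite[of "0::'a"] in auto)
    show "AE x in lborel. (\<lambda>n. f n x) \<longlonglongrightarrow> w' x v"
    proof (rule AE_I2)
      fix x
      have "((\<lambda>t. (w (x + t *\<^sub>R v) - w x) / t) \<longlongrightarrow> w' x v) (at 0)"
        using line[of x 0] by (simp add: DERIV_def)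
      moreover have "filterlim h (at 0) sequentially"
        unfolding h_def filterlim_at using LIMSEQ_inverse_real_of_nat by auto
      ultimately show "(\<lambda>n. f n x) \<longlonglongrightarrow> w' x v"
        unfolding f_def by (rule filterlim_compose)
    qed
    show "AE x in lborel. norm (f n x) \<le> indicator B x * C" for n
    proof (rule AE_I2)
      fix x
      show "norm (f n x) \<le> indicator B x * C"
      proof (cases "norm x \<le> R + norm v")
        case True
        obtain t where t: "0 < t" "t < h n" "w (x + h n *\<^sub>R v) - w (x + 0 *\<^sub>R v) = (h n - 0) * w' (x + t *\<^sub>R v) v"
          using MVT2[of 0 "h n" "\<lambda>t. w (x + t *\<^sub>R v)" "\<lambda>t. w' (x + t *\<^sub>R v) v"] h line by blast
        have "norm (t *\<^sub>R v) \<le> norm v" using t h(2)[of n] by (simp add: mult_left_le_one_le)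
        then have "x + t *\<^sub>R v \<in> B" using True norm_triangle_ineq[of x "t *\<^sub>R v"] by (simp add: B_def)
        moreover have "x \<in> B" unfolding B_def mem_cball_0 using True norm_ge_zero[of v] by linarith
        moreover have "f n x = w' (x + t *\<^sub>R v) v" using t(3) h(1)[of n] by (simp add: f_def)
        ultimately show ?thesis using C by simp
      next
        case False
        have "norm (h n *\<^sub>R v) \<le> norm v" using h[of n] by (simp add: mult_left_le_one_le)
        then have "norm (x + h n *\<^sub>R v) > R"
          using False norm_triangle_ineq4[of "x + h n *\<^sub>R v" "h n *\<^sub>R v"] by simp
        moreover have "norm x > R" using False by (smt (verit) norm_ge_zero)
        ultimately have "w (x + h n *\<^sub>R v) = 0" "w x = 0"
          using R by (auto intro!: supp dest!: subsetD)
        then show ?thesis using C0 by (simp add: f_def)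
      qed
    qed
  qed
  moreover have "integral\<^sup>L lborel (f n) = 0" for n
  proof -
    have "integrable lborel (\<lambda>x. w (h n *\<^sub>R v + x))" "integral\<^sup>L lborel (\<lambda>x. w (h n *\<^sub>R v + x)) = integral\<^sup>L lborel w"
    proof -
      have d: "distr lborel borel ((+) (h n *\<^sub>R v)) = lborel" by (rule lborel_distr_plus)
      show "integrable lborel (\<lambda>x. w (h n *\<^sub>R v + x))"
        using integrable_distr_eq[of "(+) (h n *\<^sub>R v)" lborel borel w] bw d intw by simp
      show "integral\<^sup>L lborel (\<lambda>x. w (h n *\<^sub>R v + x)) = integral\<^sup>L lborel w"
        using integral_distr[of "(+) (h n *\<^sub>R v)" lborel borel w] bw d by simp
    qed
    then show ?thesis using intw by (simp add: f_def[abs_def] add.commute)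
  qed
  ultimately show ?thesis by (simp add: LIMSEQ_const_iff)
qed

text \<open>For a \<le> b the argument of \<open>flat_exp\<close> is positive exactly when a_i < x_i
  < b_i, so these products are smooth approximations of the indicator of the open box.\<close>

definition box_bump :: "'a::euclidean_space \<Rightarrow> 'a \<Rightarrow> nat \<Rightarrow> 'a \<Rightarrow> real" where
  "box_bump a b n x = (\<Prod>i\<in>Basis. flat_exp n ((x \<bullet> i - a \<bullet> i) * (b \<bullet> i - x \<bullet> i)))"

lemma box_bump_support:
  assumes "\<And>i. i \<in> Basis \<Longrightarrow> a \<bullet> i \<le> b \<bullet> i" "box_bump a b n x \<noteq> 0"
  shows "x \<in> cbox a b"
  unfolding mem_box
proof
  fix i :: 'a assume i: "i \<in> Basis"
  then have "flat_exp n ((x \<bullet> i - a \<bullet> i) * (b \<bullet> i - x \<bullet> i)) \<noteq> 0"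
    using assms(2) by (auto simp: box_bump_def)
  then have "(x \<bullet> i - a \<bullet> i) * (b \<bullet> i - x \<bullet> i) > 0"
    by (auto simp: flat_exp_eq split: if_splits)
  then show "a \<bullet> i \<le> x \<bullet> i \<and> x \<bullet> i \<le> b \<bullet> i"
    using assms(1)[OF i] by (auto simp: zero_less_mult_iff)
qed

lemma box_bump_test_function:
  assumes "\<And>i. i \<in> Basis \<Longrightarrow> a \<bullet> i \<le> b \<bullet> i" "cbox a b \<subseteq> U"
  shows "box_bump a b n \<in> test_functions U"
proof -
  have "{x. box_bump a b n x \<noteq> 0} \<subseteq> cbox a b" using box_bump_support[OF assms(1)] by blast
  then have cl: "closure {x. box_bump a b n x \<noteq> 0} \<subseteq> cbox a b" by (rule closure_minimal) (rule closed_cbox)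
  have "C_k k (box_bump a b n)" for k
  proof -
    have *: "C_k k (\<lambda>x. (x \<bullet> i - a \<bullet> i) * (b \<bullet> i - x \<bullet> i))" for k and i :: 'a
      using C_k_mult[OF C_k_add[OF C_k_linear[OF bounded_linear_inner_left] C_k_const]
             C_k_add[OF C_k_const C_k_linear[OF bounded_linear_minus[OF bounded_linear_inner_left]]],
             of k i "- (a \<bullet> i)" "b \<bullet> i" i]
      by simp
    show ?thesis unfolding box_bump_def
      by (intro C_k_prod C_k_flat_exp * finite_Basis)
  qed
  moreover have "compact (closure {x. box_bump a b n x \<noteq> 0})"
    using cl compact_closure bounded_cbox bounded_subset closure_subset by (metis subset_trans)
  ultimately show ?thesis using cl assms(2) by (auto simp: test_functions_def)
qed

lemma box_bump_tendsto:
  assumes "\<And>i. i \<in> Basis \<Longrightarrow> a \<bullet> i < b \<bullet> i"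
  shows "(\<lambda>n. box_bump a b n x) \<longlonglongrightarrow> indicator (box a b) x"
proof -
  have eq: "(if (x \<bullet> i - a \<bullet> i) * (b \<bullet> i - x \<bullet> i) > 0 then 1 else 0) =
      (of_bool (a \<bullet> i < x \<bullet> i \<and> x \<bullet> i < b \<bullet> i) :: real)" if "i \<in> Basis" for i
    using assms[OF that] by (auto simp: zero_less_mult_iff)
  have "(\<lambda>n. box_bump a b n x) \<longlonglongrightarrow>
      (\<Prod>i\<in>Basis. if (x \<bullet> i - a \<bullet> i) * (b \<bullet> i - x \<bullet> i) > 0 then 1 else 0)"
    unfolding box_bump_def by (intro tendsto_prod flat_exp_tendsto)
  also have "(\<Prod>i\<in>Basis. if (x \<bullet> i - a \<bullet> i) * (b \<bullet> i - x \<bullet> i) > 0 then 1 else 0) =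
     (\<Prod>i\<in>Basis. of_bool (a \<bullet> i < x \<bullet> i \<and> x \<bullet> i < b \<bullet> i) :: real)"
    by (rule prod.cong[OF refl eq])
  also have "\<dots> = indicator (box a b) x"
  proof (cases "x \<in> box a b")
    case True
    then show ?thesis by (auto simp: mem_box intro!: prod.neutral)
  next
    case False
    then obtain i where "i \<in> Basis" "\<not> (a \<bullet> i < x \<bullet> i \<and> x \<bullet> i < b \<bullet> i)" by (auto simp: mem_box)
    then show ?thesis using False by (auto simp: prod_zero_iff)
  qed
  finally show ?thesis .
qed

lemma box_bump_bound: "\<bar>box_bump a b n x\<bar> \<le> 1"
  unfolding box_bump_def abs_prod
  by (intro prod_le_1) (use flat_exp_bounds in \<open>auto simp: abs_le_iff intro: order_trans[OF _ flat_exp_bounds(1)]\<close>)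

text \<open>Box bumps converge boundedly to the indicator of a box, so \<open>H\<close> has integral
  zero over every nondegenerate closed box inside \<open>U\<close>; Lebesgue differentiation along
  shrinking boxes then gives zero almost everywhere.\<close>

lemma AE_eq_0_if_orthogonal_test_functions:
  fixes H :: "'a::euclidean_space \<Rightarrow> real"
  assumes "open U" and int: "integrable (lebesgue_on U) H"
    and orth: "\<And>\<psi>. \<psi> \<in> test_functions U \<Longrightarrow> (\<integral>x. H x * \<psi> x \<partial>lebesgue_on U) = 0"
  shows "AE x in lebesgue_on U. H x = 0"
proof -
  have Us: "U \<in> sets lebesgue" using \<open>open U\<close> by simp
  define f where "f x = indicator U x *\<^sub>R H x" for x
  have intf: "integrable lebesgue f"
    using int Us unfolding f_def by (simp add: integrable_restrict_space)
  have box0: "integral (cbox a b) f = 0"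
    if ab: "\<And>i. i \<in> Basis \<Longrightarrow> a \<bullet> i < b \<bullet> i" "cbox a b \<subseteq> U" for a b
  proof -
    have "(\<lambda>n. \<integral>x. H x * box_bump a b n x \<partial>lebesgue_on U) \<longlonglongrightarrow> (\<integral>x. H x * indicator (box a b) x \<partial>lebesgue_on U)"
    proof (rule integral_dominated_convergence[where w = "\<lambda>x. \<bar>H x\<bar>"])
      show "(\<lambda>x. H x * box_bump a b n x) \<in> borel_measurable (lebesgue_on U)" for n
      proof -
        have "continuous_on UNIV (box_bump a b n)"
          using box_bump_test_function[of a b U n] ab
          by (intro C_k_imp_continuous[of 0]) (auto simp: test_functions_def less_imp_le)
        then have "box_bump a b n \<in> borel_measurable (lebesgue_on U)"
          by (metis Us continuous_imp_measurable_on_sets_lebesgue continuous_on_subset subset_UNIV)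
        then show ?thesis using int by measurable
      qed
      have "indicator (box a b) \<in> borel_measurable (lebesgue_on U)"
        by (intro borel_measurable_indicator') (auto simp: sets_restrict_space)
      then show "(\<lambda>x. H x * indicator (box a b) x) \<in> borel_measurable (lebesgue_on U)"
        using int by measurable
      show "integrable (lebesgue_on U) (\<lambda>x. \<bar>H x\<bar>)" using int by simp
      show "AE x in lebesgue_on U. (\<lambda>n. H x * box_bump a b n x) \<longlonglongrightarrow> H x * indicator (box a b) x"
        by (intro AE_I2 tendsto_intros box_bump_tendsto ab)
      show "AE x in lebesgue_on U. norm (H x * box_bump a b n x) \<le> \<bar>H x\<bar>" for n
        by (intro AE_I2) (simp add: abs_mult mult_left_le box_bump_bound)
    qed
    moreover have "(\<integral>x. H x * box_bump a b n x \<partial>lebesgue_on U) = 0" for n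
      by (intro orth box_bump_test_function ab less_imp_le)
    ultimately have "(\<integral>x. H x * indicator (box a b) x \<partial>lebesgue_on U) = 0"
      by (simp add: LIMSEQ_const_iff)
    then have "(\<integral>x. indicator U x *\<^sub>R (H x * indicator (box a b) x) \<partial>lebesgue) = 0"
      using Us by (simp add: integral_restrict_space)
    moreover have "(\<lambda>x. indicator U x *\<^sub>R (H x * indicator (box a b) x)) = (\<lambda>x. indicator (box a b) x *\<^sub>R f x)"
      by (auto simp: f_def)
    ultimately have "(LINT x:box a b|lebesgue. f x) = 0" by (simp add: set_lebesgue_integral_def)
    moreover have "set_integrable lebesgue (box a b) f"
      using intf unfolding set_integrable_def
      by (intro integrable_mult_indicator) auto
    ultimately show ?thesis
      using set_lebesgue_integral_eq_integral(2)[of "box a b" f] integral_open_interval[of a b f] by simp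
  qed
  have "f integrable_on cbox a b" for a b
  proof -
    have "set_integrable lebesgue (cbox a b) f"
      using intf unfolding set_integrable_def
      by (intro integrable_mult_indicator) auto
    then show ?thesis by (rule set_lebesgue_integral_eq_integral(1))
  qed
  then obtain N where N: "negligible N"
    "\<And>x e. \<lbrakk>x \<notin> N; 0 < e\<rbrakk> \<Longrightarrow> \<exists>d>0. \<forall>h. 0 < h \<and> h < d \<longrightarrow>
       norm (integral (cbox x (x + h *\<^sub>R One)) f /\<^sub>R h ^ DIM('a) - f x) < e"
    using integrable_ccontinuous_explicit by blast
  have zero: "H x = 0" if x: "x \<in> U" "x \<notin> N" for x
  proof (rule ccontr)
    assume "H x \<noteq> 0"
    then have "\<bar>f x\<bar> > 0" using x by (simp add: f_def)
    then obtain d where d: "d > 0" "\<And>h. 0 < h \<and> h < d \<Longrightarrow>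
       norm (integral (cbox x (x + h *\<^sub>R One)) f /\<^sub>R h ^ DIM('a) - f x) < \<bar>f x\<bar>"
      using N(2)[OF x(2)] by blast
    obtain e where e: "e > 0" "ball x e \<subseteq> U" using \<open>open U\<close> x(1) openE by blast
    \<comment> \<open>A cube of side \<open>h\<close> with corner \<open>x\<close> stays within
      l1-distance \<open>DIM('a) * h\<close> \<le> e/2 of \<open>x\<close>, hence inside the ball,
      and \<open>h < d\<close> meets the differentiation estimate.\<close>
    define h where "h = min (d/2) (e / (2 * real DIM('a)))"
    have h: "0 < h" "h < d" using d e by (auto simp: h_def min_less_iff_disj)
    have "cbox x (x + h *\<^sub>R One) \<subseteq> ball x e"
    proof
      fix y assume y: "y \<in> cbox x (x + h *\<^sub>R One)"
      have "dist x y \<le> (\<Sum>i\<in>Basis. \<bar>(x - y) \<bullet> i\<bar>)"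
        unfolding dist_norm by (rule norm_le_l1)
      also have "\<dots> \<le> (\<Sum>i\<in>(Basis::'a set). h)"
        using y by (intro sum_mono) (auto simp: mem_box inner_simps abs_le_iff)
      also have "\<dots> = real DIM('a) * h" by simp
      also have "\<dots> \<le> real DIM('a) * (e / (2 * real DIM('a)))"
        by (intro mult_left_mono) (auto simp: h_def)
      also have "\<dots> < e" using e by (simp add: field_simps)
      finally show "y \<in> ball x e" by simp
    qed
    then have "integral (cbox x (x + h *\<^sub>R One)) f = 0"
      using e h by (intro box0) (auto simp: inner_simps)
    then show False using d(2)[of h] h by simp
  qed
  have "N \<in> null_sets lebesgue" using N(1) negligible_iff_null_sets by blast
  then have "AE x in lebesgue. x \<notin> N" by (rule AE_not_in)
  then have "AE x in lebesgue. x \<in> U \<longrightarrow> H x = 0" using zero by auto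
  then show ?thesis using Us by (simp add: AE_restrict_space_iff)
qed

section \<open>Square integrable functions\<close>

definition square_integrable :: "'a measure \<Rightarrow> ('a \<Rightarrow> 'b::euclidean_space) \<Rightarrow> bool" where
  "square_integrable M f \<longleftrightarrow> f \<in> borel_measurable M \<and> integrable M (\<lambda>x. (norm (f x))\<^sup>2)"

text \<open>Trades set integrals for integrals over the measure \<open>lebesgue_on \<Omega>\<close>,
  to which the rules for Bochner integrals apply directly.\<close>

lemma L2_on_iff:
  "\<Omega> \<in> sets lebesgue \<Longrightarrow> f \<in> L2_on \<Omega> \<longleftrightarrow> square_integrable (lebesgue_on \<Omega>) f"
  by (simp add: L2_on_def square_integrable_def set_borel_measurable_def set_integrable_def
      borel_measurable_restrict_space_iff integrable_restrict_space)

lemma LINT_eq_lebesgue_on: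
  "\<Omega> \<in> sets lebesgue \<Longrightarrow> (LINT x:\<Omega>|lebesgue. f x) = integral\<^sup>L (lebesgue_on \<Omega>) f"
  for f :: "'a::euclidean_space \<Rightarrow> 'b::{banach,second_countable_topology}"
  by (simp add: set_lebesgue_integral_def integral_restrict_space)

lemma square_integrable_inner_right [intro]:
  assumes "square_integrable M f" "square_integrable M g"
  shows "integrable M (\<lambda>x. inner (f x) (g x))"
proof (rule Bochner_Integration.integrable_bound)
  show "integrable M (\<lambda>x. (norm (f x))\<^sup>2 + (norm (g x))\<^sup>2)"
    using assms by (auto simp: square_integrable_def)
  show "(\<lambda>x. inner (f x) (g x)) \<in> borel_measurable M"
    using assms by (auto simp: square_integrable_def)
  have "\<bar>inner a b\<bar> \<le> (norm a)\<^sup>2 + (norm b)\<^sup>2" for a b :: 'b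
  proof -
    have "2 * (norm a * norm b) \<le> (norm a)\<^sup>2 + (norm b)\<^sup>2"
      using sum_squares_bound[of "norm a" "norm b"] by (simp add: mult.assoc)
    moreover have "0 \<le> norm a * norm b" by simp
    ultimately show ?thesis using Cauchy_Schwarz_ineq2[of a b] by linarith
  qed
  then show "AE x in M. norm (inner (f x) (g x)) \<le> norm ((norm (f x))\<^sup>2 + (norm (g x))\<^sup>2)"
    by (auto simp: abs_of_nonneg)
qed

lemma square_integrable_mult:
  fixes f g :: "'a \<Rightarrow> real"
  shows "square_integrable M f \<Longrightarrow> square_integrable M g \<Longrightarrow> integrable M (\<lambda>x. f x * g x)"
  using square_integrable_inner_right[of M f g] by simp

lemma square_integrable_add:
  assumes "square_integrable M f" "square_integrable M g"
  shows "square_integrable M (\<lambda>x. f x + g x)"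
  unfolding square_integrable_def
proof
  show "(\<lambda>x. f x + g x) \<in> borel_measurable M" using assms by (auto simp: square_integrable_def)
  have "integrable M (\<lambda>x. (norm (f x))\<^sup>2 + (norm (g x))\<^sup>2 + 2 * inner (f x) (g x))"
    using assms square_integrable_inner_right[OF assms] by (simp add: square_integrable_def)
  then show "integrable M (\<lambda>x. (norm (f x + g x))\<^sup>2)"
    by (simp add: power2_norm_eq_inner inner_simps inner_commute algebra_simps)
qed

lemma square_integrable_scaleR:
  "square_integrable M f \<Longrightarrow> square_integrable M (\<lambda>x. c *\<^sub>R f x)"
  by (auto simp: square_integrable_def power_mult_distrib)

lemma square_integrable_diff:
  assumes "square_integrable M f" "square_integrable M g"
  shows "square_integrable M (\<lambda>x. f x - g x)"
  using square_integrable_add[OF assms(1) square_integrable_scaleR[OF assms(2), of "-1"]] by simp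

lemma square_integrable_bounded_mult:
  fixes f :: "'a \<Rightarrow> real" and g :: "'a \<Rightarrow> 'b::euclidean_space"
  assumes "square_integrable M g" "f \<in> borel_measurable M" "AE x in M. \<bar>f x\<bar> \<le> C"
  shows "square_integrable M (\<lambda>x. f x *\<^sub>R g x)"
  unfolding square_integrable_def
proof
  show "(\<lambda>x. f x *\<^sub>R g x) \<in> borel_measurable M" using assms by (auto simp: square_integrable_def)
  show "integrable M (\<lambda>x. (norm (f x *\<^sub>R g x))\<^sup>2)"
  proof (rule Bochner_Integration.integrable_bound)
    show "integrable M (\<lambda>x. C\<^sup>2 * (norm (g x))\<^sup>2)" using assms by (auto simp: square_integrable_def)
    show "(\<lambda>x. (norm (f x *\<^sub>R g x))\<^sup>2) \<in> borel_measurable M"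
      using assms by (auto simp: square_integrable_def)
    show "AE x in M. norm ((norm (f x *\<^sub>R g x))\<^sup>2) \<le> norm (C\<^sup>2 * (norm (g x))\<^sup>2)"
      using assms(3)
    proof eventually_elim
      case (elim x)
      then have "\<bar>f x\<bar>\<^sup>2 \<le> C\<^sup>2" by (intro power_mono) auto
      then show ?case by (auto simp: power_mult_distrib intro!: mult_right_mono)
    qed
  qed
qed

lemma square_integrable_bounded:
  fixes f :: "'a \<Rightarrow> 'b::euclidean_space"
  assumes "finite_measure M" "f \<in> borel_measurable M" "AE x in M. norm (f x) \<le> C"
  shows "square_integrable M f"
  unfolding square_integrable_def
proof
  show "integrable M (\<lambda>x. (norm (f x))\<^sup>2)"
  proof (rule finite_measure.integrable_const_bound[OF assms(1)])
    show "AE x in M. norm ((norm (f x))\<^sup>2) \<le> C\<^sup>2"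
      using assms(3) by eventually_elim (auto intro: power_mono)
    show "(\<lambda>x. (norm (f x))\<^sup>2) \<in> borel_measurable M" using assms by measurable
  qed
qed (rule assms)

lemma square_integrable_component:
  fixes f :: "'a \<Rightarrow> 'b::euclidean_space ^ 'd"
  assumes "square_integrable M f"
  shows "square_integrable M (\<lambda>x. f x $ i)"
  unfolding square_integrable_def
proof
  show m: "(\<lambda>x. f x $ i) \<in> borel_measurable M"
    using assms borel_measurable_continuous_on[of "\<lambda>v. v $ i" f M] continuous_on_component[OF continuous_on_id]
    by (auto simp: square_integrable_def)
  show "integrable M (\<lambda>x. (norm (f x $ i))\<^sup>2)"
  proof (rule Bochner_Integration.integrable_bound)
    show "integrable M (\<lambda>x. (norm (f x))\<^sup>2)" using assms by (auto simp: square_integrable_def)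
    show "(\<lambda>x. (norm (f x $ i))\<^sup>2) \<in> borel_measurable M" using m by measurable
    show "AE x in M. norm ((norm (f x $ i))\<^sup>2) \<le> norm ((norm (f x))\<^sup>2)"
      by (auto intro!: power_mono Finite_Cartesian_Product.norm_nth_le)
  qed
qed

lemma Cauchy_Schwarz_integral:
  assumes f: "square_integrable M f" and g: "square_integrable M g"
  shows "\<bar>\<integral>x. inner (f x) (g x) \<partial>M\<bar> \<le> sqrt (\<integral>x. (norm (f x))\<^sup>2 \<partial>M) * sqrt (\<integral>x. (norm (g x))\<^sup>2 \<partial>M)"
proof -
  let ?a = "\<integral>x. (norm (f x))\<^sup>2 \<partial>M" and ?b = "\<integral>x. inner (f x) (g x) \<partial>M" and ?c = "\<integral>x. (norm (g x))\<^sup>2 \<partial>M"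
  have quad: "r\<^sup>2 * ?a + 2 * r * ?b + ?c \<ge> 0" for r
  proof -
    have "0 \<le> (\<integral>x. (norm (r *\<^sub>R f x + g x))\<^sup>2 \<partial>M)" by simp
    also have "\<dots> = (\<integral>x. r\<^sup>2 * (norm (f x))\<^sup>2 + 2 * r * inner (f x) (g x) + (norm (g x))\<^sup>2 \<partial>M)"
      by (intro Bochner_Integration.integral_cong refl)
         (simp add: power2_norm_eq_inner inner_simps inner_commute power2_eq_square[of r] algebra_simps)
    also have "\<dots> = r\<^sup>2 * ?a + 2 * r * ?b + ?c"
      using f g square_integrable_inner_right[OF f g] by (simp add: square_integrable_def)
    finally show ?thesis .
  qed
  have a0: "?a \<ge> 0" "?c \<ge> 0" by simp_all
  have "?b\<^sup>2 \<le> ?a * ?c"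
  proof (cases "?a = 0")
    case True
    have "?b = 0"
    proof (rule ccontr)
      assume "?b \<noteq> 0"
      \<comment> \<open>With \<open>?a = 0\<close> the quadratic is linear in \<open>r\<close>, and
        this \<open>r\<close> gives it the value -1.\<close>
      then show False using quad[of "- (?c + 1) / (2 * ?b)"] True a0 by (simp add: field_simps)
    qed
    then show ?thesis using True by simp
  next
    case False
    then have "?a > 0" using a0 by linarith
    then show ?thesis
      using quad[of "- ?b / ?a"] by (simp add: field_simps power2_eq_square)
  qed
  then have "sqrt (?b\<^sup>2) \<le> sqrt (?a * ?c)" by (rule real_sqrt_le_mono)
  then show ?thesis by (simp add: real_sqrt_mult)
qed

lemma tendsto_integral_inner:
  assumes f: "square_integrable M f" and h: "\<And>n. square_integrable M (h n)" and g: "square_integrable M g"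
    and lim: "((\<lambda>n. \<integral>x. (norm (g x - h n x))\<^sup>2 \<partial>M) \<longlongrightarrow> 0) F"
  shows "((\<lambda>n. \<integral>x. inner (f x) (h n x) \<partial>M) \<longlongrightarrow> (\<integral>x. inner (f x) (g x) \<partial>M)) F"
proof -
  have "((\<lambda>n. \<integral>x. inner (f x) (h n x) \<partial>M) - (\<lambda>n. \<integral>x. inner (f x) (g x) \<partial>M)) n =
    - (\<integral>x. inner (f x) (g x - h n x) \<partial>M)" for n
    using square_integrable_inner_right[OF f g] square_integrable_inner_right[OF f h]
    by (simp add: inner_diff_right)
  then have "\<bar>(\<integral>x. inner (f x) (h n x) \<partial>M) - (\<integral>x. inner (f x) (g x) \<partial>M)\<bar> \<le>
     sqrt (\<integral>x. (norm (f x))\<^sup>2 \<partial>M) * sqrt (\<integral>x. (norm (g x - h n x))\<^sup>2 \<partial>M)" for n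
    using Cauchy_Schwarz_integral[OF f square_integrable_diff[OF g h[of n]]] by simp
  then have *: "norm ((\<integral>x. inner (f x) (h n x) \<partial>M) - (\<integral>x. inner (f x) (g x) \<partial>M)) \<le>
     sqrt (\<integral>x. (norm (f x))\<^sup>2 \<partial>M) * sqrt (\<integral>x. (norm (g x - h n x))\<^sup>2 \<partial>M)" for n
    by simp
  have "((\<lambda>n. sqrt (\<integral>x. (norm (f x))\<^sup>2 \<partial>M) * sqrt (\<integral>x. (norm (g x - h n x))\<^sup>2 \<partial>M))
     \<longlongrightarrow> sqrt (\<integral>x. (norm (f x))\<^sup>2 \<partial>M) * sqrt 0) F"
    by (intro tendsto_intros lim)
  then have lim0: "((\<lambda>n. sqrt (\<integral>x. (norm (f x))\<^sup>2 \<partial>M) * sqrt (\<integral>x. (norm (g x - h n x))\<^sup>2 \<partial>M)) \<longlongrightarrow> 0) F"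
    by simp
  have "((\<lambda>n. (\<integral>x. inner (f x) (h n x) \<partial>M) - (\<integral>x. inner (f x) (g x) \<partial>M)) \<longlongrightarrow> 0) F"
    by (rule Lim_null_comparison[OF always_eventually[OF allI[OF *]] lim0])
  then show ?thesis by (rule LIM_zero_cancel)
qed

lemma tendsto_integral_mult:
  fixes f g :: "'a \<Rightarrow> real"
  assumes "square_integrable M f" "\<And>n. square_integrable M (h n)" "square_integrable M g"
    and "((\<lambda>n. \<integral>x. (g x - h n x)\<^sup>2 \<partial>M) \<longlongrightarrow> 0) F"
  shows "((\<lambda>n. \<integral>x. f x * h n x \<partial>M) \<longlongrightarrow> (\<integral>x. f x * g x \<partial>M)) F"
  using tendsto_integral_inner[of M f h g F] assms by simp

subsection \<open>Test functions\<close>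

lemma test_function_C_k: "\<phi> \<in> test_functions \<Omega> \<Longrightarrow> C_k k \<phi>"
  by (simp add: test_functions_def)

lemma test_function_has_derivative:
  "\<phi> \<in> test_functions \<Omega> \<Longrightarrow> (\<phi> has_derivative frechet_derivative \<phi> (at x)) (at x)"
  by (rule C_k_SucD(1)[OF test_function_C_k])

lemma test_functionI:
  assumes "\<And>k. C_k k \<phi>" "compact K" "K \<subseteq> \<Omega>" "\<And>x. x \<notin> K \<Longrightarrow> \<phi> x = 0"
  shows "\<phi> \<in> test_functions \<Omega>"
proof -
  have "closure {x. \<phi> x \<noteq> 0} \<subseteq> K"
    by (rule closure_minimal) (use assms in \<open>auto intro: compact_imp_closed\<close>)
  moreover from this have "compact (closure {x. \<phi> x \<noteq> 0})"
    using compact_Int_closed[OF \<open>compact K\<close> closed_closure] by (metis inf.absorb_iff2)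
  ultimately show ?thesis using assms by (auto simp: test_functions_def)
qed

lemma test_function_support:
  assumes "\<phi> \<in> test_functions \<Omega>"
  obtains K where "compact K" "K \<subseteq> \<Omega>" "\<And>x. x \<notin> K \<Longrightarrow> \<phi> x = 0"
    "\<And>x. x \<notin> K \<Longrightarrow> frechet_derivative \<phi> (at x) = (\<lambda>v. 0)"
proof -
  define K where "K = closure {x. \<phi> x \<noteq> 0}"
  have closed_K: "closed K" by (simp add: K_def)
  have 0: "\<phi> x = 0" if "x \<notin> K" for x
    using that subsetD[OF closure_subset, of x "{x. \<phi> x \<noteq> 0}"] unfolding K_def by blast
  have "frechet_derivative \<phi> (at x) = (\<lambda>v. 0)" if "x \<notin> K" for x
  proof -
    have "((\<lambda>x. 0) has_derivative (\<lambda>v. 0)) (at x)" by simp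
    then have "(\<phi> has_derivative (\<lambda>v. 0)) (at x)"
      by (rule has_derivative_transform_within_open[where s = "- K"])
         (use that in \<open>auto simp: 0 closed_K\<close>)
    then show ?thesis by (rule frechet_deriv_eq)
  qed
  moreover have "compact K" "K \<subseteq> \<Omega>" using assms by (auto simp: test_functions_def K_def)
  ultimately show ?thesis using 0 that by blast
qed

lemma test_function_mult:
  fixes \<phi> \<psi> :: "'a::euclidean_space \<Rightarrow> real"
  assumes "\<phi> \<in> test_functions \<Omega>" "\<And>k. C_k k \<psi>"
  shows "(\<lambda>x. \<phi> x * \<psi> x) \<in> test_functions \<Omega>"
proof -
  obtain K where "compact K" "K \<subseteq> \<Omega>" "\<And>x. x \<notin> K \<Longrightarrow> \<phi> x = 0"
    using test_function_support[OF assms(1)] by metis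
  then show ?thesis
    by (intro test_functionI[of _ K] C_k_mult assms(2) test_function_C_k[OF assms(1)]) auto
qed

lemma partial_deriv_eq:
  "(\<phi> has_derivative D) (at x) \<Longrightarrow> partial_deriv j \<phi> x = D (axis j 1)"
  by (simp add: partial_deriv_def frechet_deriv_eq)

lemma partial_deriv_mult:
  assumes "\<And>k. C_k k \<phi>" "\<And>k. C_k k \<psi>"
  shows "partial_deriv j (\<lambda>x. \<phi> x * \<psi> x) x = \<phi> x * partial_deriv j \<psi> x + partial_deriv j \<phi> x * \<psi> x"
  using has_derivative_mult[OF C_k_SucD(1)[OF assms(1)] C_k_SucD(1)[OF assms(2)], of x]
  by (subst partial_deriv_eq) (auto simp: partial_deriv_def)

lemma C_k_partial_deriv: "(\<And>k. C_k k \<phi>) \<Longrightarrow> C_k k (partial_deriv j \<phi>)"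
  unfolding partial_deriv_def[abs_def] by (rule C_k_SucD(2))

lemma test_function_partial_deriv:
  assumes "\<phi> \<in> test_functions \<Omega>" shows "partial_deriv j \<phi> \<in> test_functions \<Omega>"
proof -
  obtain K where "compact K" "K \<subseteq> \<Omega>" "\<And>x. x \<notin> K \<Longrightarrow> frechet_derivative \<phi> (at x) = (\<lambda>v. 0)"
    using test_function_support[OF assms(1)] by metis
  then show ?thesis
    by (intro test_functionI[of _ K] C_k_partial_deriv test_function_C_k[OF assms(1)])
       (auto simp: partial_deriv_def)
qed

lemma test_function_bounded:
  assumes "\<phi> \<in> test_functions \<Omega>" obtains C where "\<And>x. norm (\<phi> x) \<le> C"
proof -
  obtain K where K: "compact K" "\<And>x. x \<notin> K \<Longrightarrow> \<phi> x = 0"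
    using test_function_support[OF assms(1)] by metis
  have "bounded (\<phi> ` K)"
    by (intro compact_imp_bounded compact_continuous_image K
        continuous_on_subset[OF C_k_imp_continuous[OF test_function_C_k[OF assms, of 0]]]) auto
  then obtain C where C: "\<And>x. x \<in> K \<Longrightarrow> norm (\<phi> x) \<le> C" by (auto simp: bounded_iff)
  have "norm (\<phi> x) \<le> max C 0" for x
    by (cases "x \<in> K") (use C K in \<open>auto simp: le_max_iff_disj\<close>)
  then show ?thesis using that by blast
qed

lemma test_function_integral_eq_lborel:
  fixes \<phi> :: "'a::euclidean_space \<Rightarrow> real"
  assumes \<phi>: "\<phi> \<in> test_functions \<Omega>" and \<Omega>: "\<Omega> \<in> sets lebesgue"
  shows "integral\<^sup>L (lebesgue_on \<Omega>) \<phi> = integral\<^sup>L lborel \<phi>"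
    "integrable (lebesgue_on \<Omega>) \<phi>" "\<phi> \<in> borel_measurable (lebesgue_on \<Omega>)"
proof -
  obtain K where K: "compact K" "K \<subseteq> \<Omega>" "\<And>x. x \<notin> K \<Longrightarrow> \<phi> x = 0"
    using test_function_support[OF assms(1)] by metis
  have cont: "continuous_on UNIV \<phi>" by (rule C_k_imp_continuous[OF test_function_C_k[OF \<phi>, of 0]])
  then have bm: "\<phi> \<in> borel_measurable lborel" by (simp add: borel_measurable_continuous_onI)
  have "integrable lborel (\<lambda>x. indicator K x *\<^sub>R \<phi> x)"
    by (intro borel_integrable_compact K continuous_on_subset[OF cont]) auto
  moreover have "(\<lambda>x. indicator K x *\<^sub>R \<phi> x) = \<phi>" using K by (force simp: indicator_def)
  ultimately have "integrable lborel \<phi>" by simp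
  then have il: "integrable lebesgue \<phi>" using integrable_completion[OF bm] by simp
  have eq: "(\<lambda>x. indicator \<Omega> x *\<^sub>R \<phi> x) = \<phi>" using K by (force simp: indicator_def)
  show "integral\<^sup>L (lebesgue_on \<Omega>) \<phi> = integral\<^sup>L lborel \<phi>"
    using \<Omega> eq integral_completion[OF bm] by (simp add: integral_restrict_space)
  show i: "integrable (lebesgue_on \<Omega>) \<phi>"
    using \<Omega> eq il by (simp add: integrable_restrict_space)
  then show "\<phi> \<in> borel_measurable (lebesgue_on \<Omega>)" by simp
qed

lemma test_function_square_integrable:
  fixes \<phi> :: "'a::euclidean_space \<Rightarrow> real"
  assumes \<phi>: "\<phi> \<in> test_functions \<Omega>" and \<Omega>: "\<Omega> \<in> sets lebesgue"
  shows "square_integrable (lebesgue_on \<Omega>) \<phi>"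
  using test_function_integral_eq_lborel(2)[OF test_function_mult[OF \<phi> test_function_C_k[OF \<phi>]] \<Omega>]
    test_function_integral_eq_lborel(3)[OF \<phi> \<Omega>]
  by (simp add: square_integrable_def power2_eq_square)

lemma integral_partial_deriv_eq_0:
  assumes \<phi>: "\<phi> \<in> test_functions \<Omega>" and \<Omega>: "\<Omega> \<in> sets lebesgue"
  shows "(\<integral>x. partial_deriv j \<phi> x \<partial>lebesgue_on \<Omega>) = 0"
proof -
  obtain K where K: "compact K" "K \<subseteq> \<Omega>" "\<And>x. x \<notin> K \<Longrightarrow> \<phi> x = 0"
    using test_function_support[OF assms(1)] by metis
  have "(\<integral>x. partial_deriv j \<phi> x \<partial>lebesgue_on \<Omega>) = (\<integral>x. partial_deriv j \<phi> x \<partial>lborel)"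
    by (rule test_function_integral_eq_lborel(1)[OF test_function_partial_deriv[OF \<phi>] \<Omega>])
  also have "\<dots> = 0"
    unfolding partial_deriv_def
    by (rule integral_directional_derivative_eq_0[OF test_function_has_derivative[OF \<phi>] _ K(1,3)])
       (rule C_k_imp_continuous[OF C_k_SucD(2)[OF test_function_C_k[OF \<phi>, of "Suc 0"]]])
  finally show ?thesis .
qed

subsection \<open>Scalar functions of class \<open>H\<^sup>1\<^sub>0\<close>\<close>

text \<open>The closure of the test functions in the H1 norm, for a scalar function and with its
  gradient as an explicit argument: \<open>weak_grad\<close> is a choice, which cannot be computed
  with.\<close>

definition H10_scalar :: "('d::finite point) set \<Rightarrow> ('d point \<Rightarrow> real) \<Rightarrow> ('d point \<Rightarrow> 'd point) \<Rightarrow> bool" where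
  "H10_scalar \<Omega> a ga \<longleftrightarrow> \<Omega> \<in> sets lebesgue \<and>
     square_integrable (lebesgue_on \<Omega>) a \<and> square_integrable (lebesgue_on \<Omega>) ga \<and>
     (\<exists>\<psi>. (\<forall>n. \<psi> n \<in> test_functions \<Omega>) \<and>
        (\<lambda>n. \<integral>x. (a x - \<psi> n x)\<^sup>2 \<partial>lebesgue_on \<Omega>) \<longlonglongrightarrow> 0 \<and>
        (\<forall>j. (\<lambda>n. \<integral>x. (ga x $ j - partial_deriv j (\<psi> n) x)\<^sup>2 \<partial>lebesgue_on \<Omega>) \<longlonglongrightarrow> 0))"

lemma H10_scalarD:
  assumes "H10_scalar \<Omega> a ga"
  shows "\<Omega> \<in> sets lebesgue" "square_integrable (lebesgue_on \<Omega>) a"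
    "square_integrable (lebesgue_on \<Omega>) (\<lambda>x. ga x $ j)"
  using assms by (auto simp: H10_scalar_def intro: square_integrable_component)

text \<open>Later limits are all pairings of the approximants with one fixed L2 function, so the
  norm convergence is consumed here once and for all.\<close>

lemma H10_scalar_approx:
  assumes "H10_scalar \<Omega> a ga"
  obtains \<psi> where "\<And>n. \<psi> n \<in> test_functions \<Omega>"
    "\<And>f. square_integrable (lebesgue_on \<Omega>) f \<Longrightarrow>
      (\<lambda>n. \<integral>x. f x * \<psi> n x \<partial>lebesgue_on \<Omega>) \<longlonglongrightarrow> (\<integral>x. f x * a x \<partial>lebesgue_on \<Omega>)"
    "\<And>f j. square_integrable (lebesgue_on \<Omega>) f \<Longrightarrow>
      (\<lambda>n. \<integral>x. f x * partial_deriv j (\<psi> n) x \<partial>lebesgue_on \<Omega>) \<longlonglongrightarrow> (\<integral>x. f x * ga x $ j \<partial>lebesgue_on \<Omega>)"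
proof -
  note \<Omega> = H10_scalarD(1)[OF assms]
  obtain \<psi> where \<psi>: "\<And>n. \<psi> n \<in> test_functions \<Omega>"
        "(\<lambda>n. \<integral>x. (a x - \<psi> n x)\<^sup>2 \<partial>lebesgue_on \<Omega>) \<longlonglongrightarrow> 0"
        "\<And>j. (\<lambda>n. \<integral>x. (ga x $ j - partial_deriv j (\<psi> n) x)\<^sup>2 \<partial>lebesgue_on \<Omega>) \<longlonglongrightarrow> 0"
    using assms unfolding H10_scalar_def by blast
  show ?thesis
    by (rule that[of \<psi>], rule \<psi>(1); rule tendsto_integral_mult, assumption)
       (intro \<psi> H10_scalarD[OF assms] test_function_square_integrable[OF _ \<Omega>] test_function_partial_deriv)+
qed

lemma square_integrable_mult_test_function:
  assumes \<phi>: "\<phi> \<in> test_functions \<Omega>" and f: "square_integrable (lebesgue_on \<Omega>) f" and \<Omega>: "\<Omega> \<in> sets lebesgue"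
  shows "square_integrable (lebesgue_on \<Omega>) (\<lambda>x. f x * \<phi> x :: real)"
proof -
  obtain C where "\<And>x. norm (\<phi> x) \<le> C" using test_function_bounded[OF \<phi>] by blast
  then have "square_integrable (lebesgue_on \<Omega>) (\<lambda>x. \<phi> x *\<^sub>R f x)"
    by (intro square_integrable_bounded_mult[OF f test_function_integral_eq_lborel(3)[OF \<phi> \<Omega>], of C]) auto
  then show ?thesis by (simp add: mult.commute)
qed

lemma H10_scalar_weak_derivative:
  assumes a: "H10_scalar \<Omega> a ga" and \<phi>: "\<phi> \<in> test_functions \<Omega>"
  shows "(\<integral>x. a x * partial_deriv j \<phi> x \<partial>lebesgue_on \<Omega>) = - (\<integral>x. ga x $ j * \<phi> x \<partial>lebesgue_on \<Omega>)"
proof -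
  note \<Omega> = H10_scalarD(1)[OF a]
  obtain \<psi> where \<psi>: "\<And>n. \<psi> n \<in> test_functions \<Omega>"
    "\<And>f. square_integrable (lebesgue_on \<Omega>) f \<Longrightarrow>
      (\<lambda>n. \<integral>x. f x * \<psi> n x \<partial>lebesgue_on \<Omega>) \<longlonglongrightarrow> (\<integral>x. f x * a x \<partial>lebesgue_on \<Omega>)"
    "\<And>f j. square_integrable (lebesgue_on \<Omega>) f \<Longrightarrow>
      (\<lambda>n. \<integral>x. f x * partial_deriv j (\<psi> n) x \<partial>lebesgue_on \<Omega>) \<longlonglongrightarrow> (\<integral>x. f x * ga x $ j \<partial>lebesgue_on \<Omega>)"
    using H10_scalar_approx[OF a] by blast
  note sq = test_function_square_integrable[OF _ \<Omega>]
  have eq: "(\<integral>x. partial_deriv j \<phi> x * \<psi> n x \<partial>lebesgue_on \<Omega>) = - (\<integral>x. \<phi> x * partial_deriv j (\<psi> n) x \<partial>lebesgue_on \<Omega>)" for n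
  proof -
    have "0 = (\<integral>x. partial_deriv j (\<lambda>x. \<phi> x * \<psi> n x) x \<partial>lebesgue_on \<Omega>)"
      by (rule integral_partial_deriv_eq_0[OF test_function_mult[OF \<phi> test_function_C_k[OF \<psi>(1)]] \<Omega>, symmetric])
    also have "\<dots> = (\<integral>x. \<phi> x * partial_deriv j (\<psi> n) x + partial_deriv j \<phi> x * \<psi> n x \<partial>lebesgue_on \<Omega>)"
      by (simp add: partial_deriv_mult test_function_C_k[OF \<phi>] test_function_C_k[OF \<psi>(1)])
    also have "\<dots> = (\<integral>x. \<phi> x * partial_deriv j (\<psi> n) x \<partial>lebesgue_on \<Omega>) + (\<integral>x. partial_deriv j \<phi> x * \<psi> n x \<partial>lebesgue_on \<Omega>)"
      by (intro Bochner_Integration.integral_add square_integrable_mult sq \<phi> \<psi> test_function_partial_deriv)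
    finally show ?thesis by simp
  qed
  have "(\<integral>x. partial_deriv j \<phi> x * a x \<partial>lebesgue_on \<Omega>) = - (\<integral>x. \<phi> x * ga x $ j \<partial>lebesgue_on \<Omega>)"
  proof (rule LIMSEQ_unique)
    show "(\<lambda>n. \<integral>x. partial_deriv j \<phi> x * \<psi> n x \<partial>lebesgue_on \<Omega>) \<longlonglongrightarrow> (\<integral>x. partial_deriv j \<phi> x * a x \<partial>lebesgue_on \<Omega>)"
      by (intro \<psi> sq test_function_partial_deriv \<phi>)
    show "(\<lambda>n. \<integral>x. partial_deriv j \<phi> x * \<psi> n x \<partial>lebesgue_on \<Omega>) \<longlonglongrightarrow> - (\<integral>x. \<phi> x * ga x $ j \<partial>lebesgue_on \<Omega>)"
      unfolding eq by (intro tendsto_minus \<psi> sq \<phi>)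
  qed
  then show ?thesis by (simp add: mult.commute)
qed

text \<open>Only \<open>b\<close> is approximated. The product of \<open>\<phi>\<close> with an
  approximant is again a test function, and it is inserted into the weak derivative of
  \<open>a\<close>.\<close>

lemma H10_scalar_product_rule:
  assumes a: "H10_scalar \<Omega> a ga" and b: "H10_scalar \<Omega> b gb" and \<phi>: "\<phi> \<in> test_functions \<Omega>"
  shows "(\<integral>x. a x * b x * partial_deriv j \<phi> x \<partial>lebesgue_on \<Omega>) =
    - (\<integral>x. (ga x $ j * b x + a x * gb x $ j) * \<phi> x \<partial>lebesgue_on \<Omega>)"
proof -
  note \<Omega> = H10_scalarD(1)[OF a]
  obtain \<psi> where \<psi>: "\<And>n. \<psi> n \<in> test_functions \<Omega>"
    "\<And>f. square_integrable (lebesgue_on \<Omega>) f \<Longrightarrow>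
      (\<lambda>n. \<integral>x. f x * \<psi> n x \<partial>lebesgue_on \<Omega>) \<longlonglongrightarrow> (\<integral>x. f x * b x \<partial>lebesgue_on \<Omega>)"
    "\<And>f j. square_integrable (lebesgue_on \<Omega>) f \<Longrightarrow>
      (\<lambda>n. \<integral>x. f x * partial_deriv j (\<psi> n) x \<partial>lebesgue_on \<Omega>) \<longlonglongrightarrow> (\<integral>x. f x * gb x $ j \<partial>lebesgue_on \<Omega>)"
    using H10_scalar_approx[OF b] by blast
  note sq = test_function_square_integrable[OF _ \<Omega>]
  note sqm = square_integrable_mult_test_function[OF _ _ \<Omega>]
  have eq: "(\<integral>x. a x * partial_deriv j \<phi> x * \<psi> n x \<partial>lebesgue_on \<Omega>) =
      - (\<integral>x. ga x $ j * \<phi> x * \<psi> n x \<partial>lebesgue_on \<Omega>) - (\<integral>x. a x * \<phi> x * partial_deriv j (\<psi> n) x \<partial>lebesgue_on \<Omega>)" for n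
  proof -
    have "- (\<integral>x. ga x $ j * \<phi> x * \<psi> n x \<partial>lebesgue_on \<Omega>) =
        (\<integral>x. a x * partial_deriv j (\<lambda>x. \<phi> x * \<psi> n x) x \<partial>lebesgue_on \<Omega>)"
      using H10_scalar_weak_derivative[OF a test_function_mult[OF \<phi> test_function_C_k[OF \<psi>(1)]]]
      by (simp add: mult.assoc)
    also have "\<dots> = (\<integral>x. a x * \<phi> x * partial_deriv j (\<psi> n) x + a x * partial_deriv j \<phi> x * \<psi> n x \<partial>lebesgue_on \<Omega>)"
      by (simp add: partial_deriv_mult test_function_C_k[OF \<phi>] test_function_C_k[OF \<psi>(1)] algebra_simps)
    also have "\<dots> = (\<integral>x. a x * \<phi> x * partial_deriv j (\<psi> n) x \<partial>lebesgue_on \<Omega>) + (\<integral>x. a x * partial_deriv j \<phi> x * \<psi> n x \<partial>lebesgue_on \<Omega>)"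
      by (intro Bochner_Integration.integral_add square_integrable_mult sqm sq \<phi> \<psi> test_function_partial_deriv H10_scalarD[OF a])
    finally show ?thesis by simp
  qed
  have "(\<integral>x. a x * partial_deriv j \<phi> x * b x \<partial>lebesgue_on \<Omega>) =
     - (\<integral>x. ga x $ j * \<phi> x * b x \<partial>lebesgue_on \<Omega>) - (\<integral>x. a x * \<phi> x * gb x $ j \<partial>lebesgue_on \<Omega>)"
  proof (rule LIMSEQ_unique)
    show "(\<lambda>n. \<integral>x. a x * partial_deriv j \<phi> x * \<psi> n x \<partial>lebesgue_on \<Omega>) \<longlonglongrightarrow> (\<integral>x. a x * partial_deriv j \<phi> x * b x \<partial>lebesgue_on \<Omega>)"
      by (intro \<psi> sqm test_function_partial_deriv \<phi> H10_scalarD[OF a])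
    show "(\<lambda>n. \<integral>x. a x * partial_deriv j \<phi> x * \<psi> n x \<partial>lebesgue_on \<Omega>) \<longlonglongrightarrow>
      - (\<integral>x. ga x $ j * \<phi> x * b x \<partial>lebesgue_on \<Omega>) - (\<integral>x. a x * \<phi> x * gb x $ j \<partial>lebesgue_on \<Omega>)"
      unfolding eq by (intro tendsto_diff tendsto_minus \<psi> sqm \<phi> H10_scalarD[OF a])
  qed
  also have "\<dots> = - ((\<integral>x. ga x $ j * \<phi> x * b x \<partial>lebesgue_on \<Omega>) + (\<integral>x. a x * \<phi> x * gb x $ j \<partial>lebesgue_on \<Omega>))"
    by simp
  also have "\<dots> = - (\<integral>x. ga x $ j * \<phi> x * b x + a x * \<phi> x * gb x $ j \<partial>lebesgue_on \<Omega>)"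
    by (subst Bochner_Integration.integral_add)
       (intro square_integrable_mult sqm \<phi> H10_scalarD[OF a] H10_scalarD[OF b] refl)+
  finally show ?thesis by (simp add: algebra_simps)
qed

text \<open>The integral of the derivative of a b c. The bounds put the product \<open>a b\<close>
  and its formal gradient into L2, so the test function in the product rule can be replaced by
  approximants of \<open>c\<close> and the limit taken.\<close>

lemma H10_scalar_trilinear:
  assumes a: "H10_scalar \<Omega> a ga" and b: "H10_scalar \<Omega> b gb" and c: "H10_scalar \<Omega> c gc"
    and bounded: "AE x in lebesgue_on \<Omega>. \<bar>a x\<bar> \<le> C" "AE x in lebesgue_on \<Omega>. \<bar>b x\<bar> \<le> C"
  shows "(\<integral>x. ga x $ j * b x * c x + a x * gb x $ j * c x + a x * b x * gc x $ j \<partial>lebesgue_on \<Omega>) = 0"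
proof -
  note \<Omega> = H10_scalarD(1)[OF a]
  obtain \<psi> where \<psi>: "\<And>n. \<psi> n \<in> test_functions \<Omega>"
    "\<And>f. square_integrable (lebesgue_on \<Omega>) f \<Longrightarrow>
      (\<lambda>n. \<integral>x. f x * \<psi> n x \<partial>lebesgue_on \<Omega>) \<longlonglongrightarrow> (\<integral>x. f x * c x \<partial>lebesgue_on \<Omega>)"
    "\<And>f j. square_integrable (lebesgue_on \<Omega>) f \<Longrightarrow>
      (\<lambda>n. \<integral>x. f x * partial_deriv j (\<psi> n) x \<partial>lebesgue_on \<Omega>) \<longlonglongrightarrow> (\<integral>x. f x * gc x $ j \<partial>lebesgue_on \<Omega>)"
    using H10_scalar_approx[OF c] by blast
  have meas: "a \<in> borel_measurable (lebesgue_on \<Omega>)" "b \<in> borel_measurable (lebesgue_on \<Omega>)"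
    using H10_scalarD(2)[OF a] H10_scalarD(2)[OF b] by (auto simp: square_integrable_def)
  have sq1: "square_integrable (lebesgue_on \<Omega>) (\<lambda>x. a x * b x)"
    using square_integrable_bounded_mult[OF H10_scalarD(2)[OF b] meas(1) bounded(1)] by simp
  have sq2: "square_integrable (lebesgue_on \<Omega>) (\<lambda>x. ga x $ j * b x + a x * gb x $ j)"
    using square_integrable_bounded_mult[OF H10_scalarD(3)[OF b] meas(1) bounded(1)]
      square_integrable_bounded_mult[OF H10_scalarD(3)[OF a] meas(2) bounded(2)]
    by (intro square_integrable_add) (auto simp: mult.commute)
  have "(\<integral>x. a x * b x * gc x $ j \<partial>lebesgue_on \<Omega>) = - (\<integral>x. (ga x $ j * b x + a x * gb x $ j) * c x \<partial>lebesgue_on \<Omega>)"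
  proof (rule LIMSEQ_unique)
    show "(\<lambda>n. \<integral>x. a x * b x * partial_deriv j (\<psi> n) x \<partial>lebesgue_on \<Omega>) \<longlonglongrightarrow> (\<integral>x. a x * b x * gc x $ j \<partial>lebesgue_on \<Omega>)"
      by (rule \<psi>(3)[OF sq1])
    show "(\<lambda>n. \<integral>x. a x * b x * partial_deriv j (\<psi> n) x \<partial>lebesgue_on \<Omega>) \<longlonglongrightarrow>
       - (\<integral>x. (ga x $ j * b x + a x * gb x $ j) * c x \<partial>lebesgue_on \<Omega>)"
      unfolding H10_scalar_product_rule[OF a b \<psi>(1)] by (intro tendsto_minus \<psi>(2) sq2)
  qed
  then have "(\<integral>x. (ga x $ j * b x + a x * gb x $ j) * c x + a x * b x * gc x $ j \<partial>lebesgue_on \<Omega>) = 0"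
    using square_integrable_mult[OF sq1 H10_scalarD(3)[OF c]] square_integrable_mult[OF sq2 H10_scalarD(2)[OF c]]
    by simp
  then show ?thesis by (simp add: algebra_simps)
qed

text \<open>Pairing with the constant 1, which is square integrable because \<open>\<Omega>\<close>
  has finite measure.\<close>

lemma H10_scalar_integral_gradient:
  assumes a: "H10_scalar \<Omega> a ga" and "\<Omega> \<in> lmeasurable"
  shows "(\<integral>x. ga x $ j \<partial>lebesgue_on \<Omega>) = 0"
proof -
  note \<Omega> = H10_scalarD(1)[OF a]
  obtain \<psi> where \<psi>: "\<And>n. \<psi> n \<in> test_functions \<Omega>"
    "\<And>f. square_integrable (lebesgue_on \<Omega>) f \<Longrightarrow>
      (\<lambda>n. \<integral>x. f x * \<psi> n x \<partial>lebesgue_on \<Omega>) \<longlonglongrightarrow> (\<integral>x. f x * a x \<partial>lebesgue_on \<Omega>)"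
    "\<And>f j. square_integrable (lebesgue_on \<Omega>) f \<Longrightarrow>
      (\<lambda>n. \<integral>x. f x * partial_deriv j (\<psi> n) x \<partial>lebesgue_on \<Omega>) \<longlonglongrightarrow> (\<integral>x. f x * ga x $ j \<partial>lebesgue_on \<Omega>)"
    using H10_scalar_approx[OF a] by blast
  have "square_integrable (lebesgue_on \<Omega>) (\<lambda>x. 1 :: real)"
    by (rule square_integrable_bounded[of _ _ 1]) (auto intro: finite_measure_lebesgue_on assms)
  from \<psi>(3)[OF this, of j] show ?thesis
    by (simp add: integral_partial_deriv_eq_0[OF \<psi>(1) \<Omega>] LIMSEQ_const_iff)
qed

section \<open>Weak gradients of vector fields\<close>

lemma l2_inner_eq:
  "\<Omega> \<in> sets lebesgue \<Longrightarrow> l2_inner \<Omega> f g = (\<integral>x. inner (f x) (g x) \<partial>lebesgue_on \<Omega>)"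
  unfolding l2_inner_def by (rule LINT_eq_lebesgue_on)

lemma l2_norm_power2:
  assumes "\<Omega> \<in> sets lebesgue"
  shows "(l2_norm \<Omega> f)\<^sup>2 = (\<integral>x. (norm (f x))\<^sup>2 \<partial>lebesgue_on \<Omega>)"
  using assms by (simp add: l2_norm_def l2_inner_eq power2_norm_eq_inner[symmetric])

lemma norm_vec_power2:
  fixes x :: "'b::real_inner ^ 'd::finite"
  shows "(norm x)\<^sup>2 = (\<Sum>i\<in>UNIV. (norm (x $ i))\<^sup>2)"
  by (simp add: power2_norm_eq_inner inner_vec_def)

lemma square_integrable_vec:
  fixes f :: "'a \<Rightarrow> 'b::euclidean_space ^ 'd::finite"
  assumes "\<And>i. square_integrable M (\<lambda>x. f x $ i)"
  shows "square_integrable M f"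
proof -
  have "f = (\<lambda>x. \<Sum>i\<in>UNIV. axis i (f x $ i))"
    by (auto simp: vec_eq_iff axis_def sum.delta)
  moreover have "square_integrable M (\<lambda>x. \<Sum>i\<in>A. axis i (f x $ i) :: 'b ^ 'd)" if "finite A" for A
    using that
  proof (induction A rule: finite_induct)
    case empty then show ?case by (simp add: square_integrable_def)
  next
    case (insert i A)
    have "square_integrable M (\<lambda>x. axis i (f x $ i) :: 'b ^ 'd)"
      unfolding square_integrable_def
    proof
      have "continuous_on UNIV (\<lambda>y::'b. axis i y :: 'b ^ 'd)"
        by (intro linear_continuous_on linear_conv_bounded_linear[THEN iffD1] linearI)
           (auto simp: vec_eq_iff axis_def)
      then show "(\<lambda>x. axis i (f x $ i) :: 'b ^ 'd) \<in> borel_measurable M"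
        by (rule borel_measurable_continuous_on) (use assms[of i] in \<open>simp add: square_integrable_def\<close>)
      show "integrable M (\<lambda>x. (norm (axis i (f x $ i) :: 'b ^ 'd))\<^sup>2)"
        using assms[of i] by (simp add: square_integrable_def norm_vec_power2 axis_def if_distrib[of "\<lambda>y. (norm y)\<^sup>2"] cong: if_cong)
    qed
    then show ?case using insert by (simp add: square_integrable_add)
  qed
  ultimately show ?thesis by (metis finite_class.finite_UNIV)
qed

lemma square_integrable_imp_integrable:
  fixes f :: "'a \<Rightarrow> real"
  assumes "finite_measure M" "square_integrable M f"
  shows "integrable M f"
proof -
  have "square_integrable M (\<lambda>x. 1::real)"
    by (rule square_integrable_bounded[OF assms(1), of _ 1]) auto
  from square_integrable_mult[OF assms(2) this] show ?thesis by simp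
qed

lemma integral_test_function_subset:
  fixes f \<psi> :: "'a::euclidean_space \<Rightarrow> real"
  assumes "\<psi> \<in> test_functions U" "U \<subseteq> \<Omega>" "U \<in> sets lebesgue" "\<Omega> \<in> sets lebesgue"
  shows "(\<integral>x. f x * \<psi> x \<partial>lebesgue_on U) = (\<integral>x. f x * \<psi> x \<partial>lebesgue_on \<Omega>)"
proof -
  obtain K where K: "K \<subseteq> U" "\<And>x. x \<notin> K \<Longrightarrow> \<psi> x = 0"
    using test_function_support[OF assms(1)] by metis
  have "(\<lambda>x. indicator U x *\<^sub>R (f x * \<psi> x)) = (\<lambda>x. indicator \<Omega> x *\<^sub>R (f x * \<psi> x))"
  proof
    fix x show "indicator U x *\<^sub>R (f x * \<psi> x) = indicator \<Omega> x *\<^sub>R (f x * \<psi> x)"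
      by (cases "x \<in> K") (use K assms(2) in \<open>auto simp: indicator_def\<close>)
  qed
  then show ?thesis using assms(3,4) by (simp add: integral_restrict_space)
qed

lemma test_functions_mono: "U \<subseteq> \<Omega> \<Longrightarrow> test_functions U \<subseteq> test_functions \<Omega>"
  by (auto simp: test_functions_def)

lemma is_weak_grad_iff:
  assumes "\<Omega> \<in> sets lebesgue"
  shows "is_weak_grad \<Omega> u G \<longleftrightarrow> square_integrable (lebesgue_on \<Omega>) G \<and>
     (\<forall>\<phi> \<in> test_functions \<Omega>. \<forall>i j.
        (\<integral>x. u x $ i * partial_deriv j \<phi> x \<partial>lebesgue_on \<Omega>) = - (\<integral>x. G x $ i $ j * \<phi> x \<partial>lebesgue_on \<Omega>))"
  using assms by (simp add: is_weak_grad_def L2_on_iff LINT_eq_lebesgue_on)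

text \<open>A test function of \<open>U\<close> is one of \<open>\<Omega>\<close>, so against it the
  weak gradient of \<open>u\<close> and the classical gradient of \<open>P\<close> have the same
  integral; the fundamental lemma on \<open>U\<close> identifies them.\<close>

lemma weak_grad_eq_classical_locally:
  assumes \<Omega>: "\<Omega> \<in> lmeasurable" and U: "open U" "bounded U" "U \<subseteq> \<Omega>"
    and G: "is_weak_grad \<Omega> u G" and u: "square_integrable (lebesgue_on \<Omega>) u"
    and P: "\<And>i k. C_k k (\<lambda>x. P x $ i)" and eq: "AE x in lebesgue_on U. u x = P x"
  shows "AE x in lebesgue_on U. G x $ i $ j = partial_deriv j (\<lambda>x. P x $ i) x"
proof -
  have \<Omega>s: "\<Omega> \<in> sets lebesgue" and Us: "U \<in> sets lebesgue" using \<Omega> U by auto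
  have Ul: "U \<in> lmeasurable" using U by (simp add: lmeasurable_open)
  let ?p = "\<lambda>x. P x $ i"
  have sqG: "square_integrable (lebesgue_on \<Omega>) (\<lambda>x. G x $ i $ j)"
    using G by (auto simp: is_weak_grad_iff[OF \<Omega>s] intro!: square_integrable_component)
  have bdd: "integrable (lebesgue_on U) p" if "continuous_on UNIV p" for p :: "'a point \<Rightarrow> real"
  proof -
    have "bounded (p ` closure U)"
      by (intro compact_imp_bounded compact_continuous_image continuous_on_subset[OF that])
         (use U in auto)
    then obtain C where "\<And>x. x \<in> U \<Longrightarrow> norm (p x) \<le> C"
      using closure_subset by (fastforce simp: bounded_iff)
    moreover have "p \<in> borel_measurable (lebesgue_on U)"
      by (metis Us continuous_imp_measurable_on_sets_lebesgue continuous_on_subset subset_UNIV that)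
    ultimately show ?thesis
      by (intro finite_measure.integrable_const_bound[OF finite_measure_lebesgue_on[OF Ul], of _ C])
         (auto intro!: AE_I2)
  qed
  have intG: "integrable (lebesgue_on U) (\<lambda>x. G x $ i $ j)"
  proof -
    have "integrable (lebesgue_on \<Omega>) (\<lambda>x. G x $ i $ j)"
      by (rule square_integrable_imp_integrable[OF finite_measure_lebesgue_on[OF \<Omega>] sqG])
    then have "set_integrable lebesgue \<Omega> (\<lambda>x. G x $ i $ j)"
      using \<Omega>s by (simp add: set_integrable_def integrable_restrict_space)
    then have "set_integrable lebesgue U (\<lambda>x. G x $ i $ j)"
      by (rule set_integrable_subset) (use Us U in auto)
    then show ?thesis using Us by (simp add: set_integrable_def integrable_restrict_space)
  qed
  have contd: "continuous_on UNIV (partial_deriv j ?p)"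
    by (rule C_k_imp_continuous[of 0]) (intro C_k_partial_deriv P)
  have "AE x in lebesgue_on U. G x $ i $ j - partial_deriv j ?p x = 0"
  proof (rule AE_eq_0_if_orthogonal_test_functions[OF U(1)])
    show "integrable (lebesgue_on U) (\<lambda>x. G x $ i $ j - partial_deriv j ?p x)"
      by (intro Bochner_Integration.integrable_diff intG bdd contd)
    fix \<psi> :: "'a point \<Rightarrow> real" assume \<psi>: "\<psi> \<in> test_functions U"
    note \<psi>' = subsetD[OF test_functions_mono[OF U(3)] \<psi>]
    note pd = test_function_partial_deriv[OF \<psi>]
    have "(\<integral>x. G x $ i $ j * \<psi> x \<partial>lebesgue_on U) = (\<integral>x. G x $ i $ j * \<psi> x \<partial>lebesgue_on \<Omega>)"
      by (rule integral_test_function_subset[OF \<psi> U(3) Us \<Omega>s])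
    also have "\<dots> = - (\<integral>x. u x $ i * partial_deriv j \<psi> x \<partial>lebesgue_on \<Omega>)"
      using G \<psi>' by (simp add: is_weak_grad_iff[OF \<Omega>s])
    also have "\<dots> = - (\<integral>x. u x $ i * partial_deriv j \<psi> x \<partial>lebesgue_on U)"
      by (simp add: integral_test_function_subset[OF pd U(3) Us \<Omega>s])
    also have "(\<integral>x. u x $ i * partial_deriv j \<psi> x \<partial>lebesgue_on U) = (\<integral>x. ?p x * partial_deriv j \<psi> x \<partial>lebesgue_on U)"
    proof (rule integral_cong_AE)
      have p: "?p \<in> borel_measurable (lebesgue_on U)"
        using bdd[OF C_k_imp_continuous[OF P[of 0 i]]] by simp
      note d = test_function_integral_eq_lborel(3)[OF pd Us]
      show "(\<lambda>x. ?p x * partial_deriv j \<psi> x) \<in> borel_measurable (lebesgue_on U)" using p d by measurable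
      have "(\<lambda>x. u x $ i) \<in> borel_measurable (lebesgue_on U)"
        using square_integrable_component[OF u, of i] U(3)
        by (auto simp: square_integrable_def intro: measurable_restrict_mono)
      then show "(\<lambda>x. u x $ i * partial_deriv j \<psi> x) \<in> borel_measurable (lebesgue_on U)"
        using d by measurable
      show "AE x in lebesgue_on U. u x $ i * partial_deriv j \<psi> x = ?p x * partial_deriv j \<psi> x"
        using eq by eventually_elim auto
    qed
    finally have 1: "(\<integral>x. G x $ i $ j * \<psi> x \<partial>lebesgue_on U) = - (\<integral>x. ?p x * partial_deriv j \<psi> x \<partial>lebesgue_on U)" .
    have tf: "(\<lambda>x. \<psi> x * partial_deriv j ?p x) \<in> test_functions U"
      by (intro test_function_mult \<psi> C_k_partial_deriv P)
    have tf2: "(\<lambda>x. partial_deriv j \<psi> x * ?p x) \<in> test_functions U"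
      by (intro test_function_mult pd P)
    have "0 = (\<integral>x. partial_deriv j (\<lambda>x. \<psi> x * ?p x) x \<partial>lebesgue_on U)"
      by (rule integral_partial_deriv_eq_0[OF test_function_mult[OF \<psi> P] Us, symmetric])
    also have "\<dots> = (\<integral>x. \<psi> x * partial_deriv j ?p x + partial_deriv j \<psi> x * ?p x \<partial>lebesgue_on U)"
      by (simp add: partial_deriv_mult test_function_C_k[OF \<psi>] P)
    also have "\<dots> = (\<integral>x. \<psi> x * partial_deriv j ?p x \<partial>lebesgue_on U) + (\<integral>x. partial_deriv j \<psi> x * ?p x \<partial>lebesgue_on U)"
      by (intro Bochner_Integration.integral_add test_function_integral_eq_lborel(2)[OF _ Us] tf tf2)
    finally have 2: "(\<integral>x. partial_deriv j ?p x * \<psi> x \<partial>lebesgue_on U) = - (\<integral>x. ?p x * partial_deriv j \<psi> x \<partial>lebesgue_on U)"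
      by (simp add: mult.commute)
    have int1: "integrable (lebesgue_on U) (\<lambda>x. G x $ i $ j * \<psi> x)"
    proof -
      obtain C where C: "\<And>x. norm (\<psi> x) \<le> C" using test_function_bounded[OF \<psi>] by blast
      show ?thesis
        by (rule Bochner_Integration.integrable_bound[OF integrable_mult_right[OF intG, of C]])
           (use intG test_function_integral_eq_lborel(3)[OF \<psi> Us] in
             \<open>auto simp: abs_mult intro!: AE_I2 mult_mono order_trans[OF C[unfolded real_norm_def]] simp: mult.commute[of C]\<close>)
    qed
    have int2: "integrable (lebesgue_on U) (\<lambda>x. partial_deriv j ?p x * \<psi> x)"
      using test_function_integral_eq_lborel(2)[OF tf Us] by (simp add: mult.commute)
    show "(\<integral>x. (G x $ i $ j - partial_deriv j ?p x) * \<psi> x \<partial>lebesgue_on U) = 0"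
      using 1 2 int1 int2 by (simp add: left_diff_distrib)
  qed
  then show ?thesis by simp
qed

text \<open>Makes the choice hidden in \<open>weak_grad\<close> harmless up to null sets.\<close>

lemma weak_grad_unique:
  assumes \<Omega>: "\<Omega> \<in> lmeasurable" "open \<Omega>" and G: "is_weak_grad \<Omega> u G" "is_weak_grad \<Omega> u G'"
  shows "AE x in lebesgue_on \<Omega>. G x = G' x"
proof -
  have \<Omega>s: "\<Omega> \<in> sets lebesgue" using \<Omega> by auto
  have sq: "square_integrable (lebesgue_on \<Omega>) (\<lambda>x. G x $ i $ j)" "square_integrable (lebesgue_on \<Omega>) (\<lambda>x. G' x $ i $ j)" for i j
    using G by (auto simp: is_weak_grad_iff[OF \<Omega>s] intro!: square_integrable_component)
  have "AE x in lebesgue_on \<Omega>. G x $ i $ j - G' x $ i $ j = 0" for i j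
  proof (rule AE_eq_0_if_orthogonal_test_functions[OF \<Omega>(2)])
    show "integrable (lebesgue_on \<Omega>) (\<lambda>x. G x $ i $ j - G' x $ i $ j)"
      by (intro Bochner_Integration.integrable_diff square_integrable_imp_integrable finite_measure_lebesgue_on \<Omega> sq)
    fix \<psi> :: "'a point \<Rightarrow> real" assume \<psi>: "\<psi> \<in> test_functions \<Omega>"
    have "(\<integral>x. G x $ i $ j * \<psi> x \<partial>lebesgue_on \<Omega>) = (\<integral>x. G' x $ i $ j * \<psi> x \<partial>lebesgue_on \<Omega>)"
    proof -
      have "- (\<integral>x. G x $ i $ j * \<psi> x \<partial>lebesgue_on \<Omega>) = (\<integral>x. u x $ i * partial_deriv j \<psi> x \<partial>lebesgue_on \<Omega>)"
        using G(1) \<psi> by (simp add: is_weak_grad_iff[OF \<Omega>s])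
      also have "\<dots> = - (\<integral>x. G' x $ i $ j * \<psi> x \<partial>lebesgue_on \<Omega>)"
        using G(2) \<psi> by (simp add: is_weak_grad_iff[OF \<Omega>s])
      finally show ?thesis by simp
    qed
    then show "(\<integral>x. (G x $ i $ j - G' x $ i $ j) * \<psi> x \<partial>lebesgue_on \<Omega>) = 0"
      using square_integrable_mult[OF sq(1) test_function_square_integrable[OF \<psi> \<Omega>s]]
        square_integrable_mult[OF sq(2) test_function_square_integrable[OF \<psi> \<Omega>s]]
      by (simp add: left_diff_distrib)
  qed
  then have "AE x in lebesgue_on \<Omega>. \<forall>i\<in>UNIV. \<forall>j\<in>UNIV. G x $ i $ j - G' x $ i $ j = 0"
    by (intro AE_finite_allI finite)
  then show ?thesis by eventually_elim (auto simp: vec_eq_iff)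
qed

lemma weak_grad_works:
  "is_weak_grad \<Omega> u G \<Longrightarrow> is_weak_grad \<Omega> u (weak_grad \<Omega> u)"
  unfolding weak_grad_def by (rule someI[of "is_weak_grad \<Omega> u"])

lemma weak_grad_AE_eq:
  assumes "\<Omega> \<in> lmeasurable" "open \<Omega>" "is_weak_grad \<Omega> u G"
  shows "AE x in lebesgue_on \<Omega>. weak_grad \<Omega> u x = G x"
  by (rule weak_grad_unique[OF assms(1,2) weak_grad_works[OF assms(3)] assms(3)])

lemma is_weak_grad_diff:
  assumes \<Omega>: "\<Omega> \<in> sets lebesgue" and G: "is_weak_grad \<Omega> u G" "is_weak_grad \<Omega> v G'"
    and "square_integrable (lebesgue_on \<Omega>) u" "square_integrable (lebesgue_on \<Omega>) v"
  shows "is_weak_grad \<Omega> (\<lambda>x. u x - v x) (\<lambda>x. G x - G' x)"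
  unfolding is_weak_grad_iff[OF \<Omega>]
proof (intro conjI ballI allI)
  have sq: "square_integrable (lebesgue_on \<Omega>) G" "square_integrable (lebesgue_on \<Omega>) G'"
    using G by (auto simp: is_weak_grad_iff[OF \<Omega>])
  show "square_integrable (lebesgue_on \<Omega>) (\<lambda>x. G x - G' x)"
    by (intro square_integrable_diff sq)
  fix \<phi> :: "'a point \<Rightarrow> real" and i j assume \<phi>: "\<phi> \<in> test_functions \<Omega>"
  note s = test_function_square_integrable[OF \<phi> \<Omega>]
    test_function_square_integrable[OF test_function_partial_deriv[OF \<phi>] \<Omega>]
  have "integrable (lebesgue_on \<Omega>) (\<lambda>x. u x $ i * partial_deriv j \<phi> x)"
       "integrable (lebesgue_on \<Omega>) (\<lambda>x. v x $ i * partial_deriv j \<phi> x)"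
       "integrable (lebesgue_on \<Omega>) (\<lambda>x. G x $ i $ j * \<phi> x)"
       "integrable (lebesgue_on \<Omega>) (\<lambda>x. G' x $ i $ j * \<phi> x)"
    by (intro square_integrable_mult square_integrable_component assms sq s)+
  then show "(\<integral>x. (u x - v x) $ i * partial_deriv j \<phi> x \<partial>lebesgue_on \<Omega>) = - (\<integral>x. (G x - G' x) $ i $ j * \<phi> x \<partial>lebesgue_on \<Omega>)"
    using G \<phi> by (simp add: is_weak_grad_iff[OF \<Omega>] left_diff_distrib)
qed

lemma is_weak_grad_if_H10_scalar:
  assumes \<Omega>: "\<Omega> \<in> sets lebesgue" and u: "\<And>i. H10_scalar \<Omega> (\<lambda>x. u x $ i) (\<lambda>x. G x $ i)"
  shows "is_weak_grad \<Omega> u G" "square_integrable (lebesgue_on \<Omega>) u"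
proof -
  have "square_integrable (lebesgue_on \<Omega>) G"
    by (rule square_integrable_vec) (use u in \<open>simp add: H10_scalar_def\<close>)
  then show "is_weak_grad \<Omega> u G"
    using H10_scalar_weak_derivative[OF u] by (simp add: is_weak_grad_iff[OF \<Omega>])
  show "square_integrable (lebesgue_on \<Omega>) u"
    by (rule square_integrable_vec) (use u in \<open>simp add: H10_scalar_def\<close>)
qed

lemma H10_scalar_test_function:
  assumes \<phi>: "\<phi> \<in> test_functions \<Omega>" and \<Omega>: "\<Omega> \<in> sets lebesgue"
  shows "H10_scalar \<Omega> \<phi> (\<lambda>x. \<chi> j. partial_deriv j \<phi> x)"
  unfolding H10_scalar_def
  by (intro conjI \<Omega> test_function_square_integrable[OF \<phi>] square_integrable_vec exI[of _ "\<lambda>n. \<phi>"])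
     (auto intro: \<phi> \<Omega> test_function_square_integrable test_function_partial_deriv)

subsection \<open>Piecewise polynomial fields\<close>

definition classical_grad :: "('d::finite point \<Rightarrow> 'd point) \<Rightarrow> 'd point \<Rightarrow> 'd gradient" where
  "classical_grad \<phi> x = (\<chi> i j. partial_deriv j (\<lambda>x. \<phi> x $ i) x)"

lemma C_k_component: "C_k k \<phi> \<Longrightarrow> C_k k (\<lambda>x. \<phi> x $ i)"
  by (rule C_k_bounded_linear[OF bounded_linear_vec_nth])

lemma test_function_component:
  assumes "\<phi> \<in> test_functions \<Omega>" shows "(\<lambda>x. \<phi> x $ i) \<in> test_functions \<Omega>"
proof -
  obtain K where "compact K" "K \<subseteq> \<Omega>" "\<And>x. x \<notin> K \<Longrightarrow> \<phi> x = 0"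
    using test_function_support[OF assms(1)] by metis
  then show ?thesis
    by (intro test_functionI[of _ K] C_k_component test_function_C_k[OF assms(1)]) auto
qed

lemma test_function_vec:
  fixes \<phi> :: "'a::euclidean_space \<Rightarrow> real ^ 'd::finite"
  assumes "\<And>i. (\<lambda>x. \<phi> x $ i) \<in> test_functions \<Omega>" shows "\<phi> \<in> test_functions \<Omega>"
proof -
  have "\<exists>K. compact K \<and> K \<subseteq> \<Omega> \<and> (\<forall>x. x \<notin> K \<longrightarrow> \<phi> x $ i = 0)" for i
    using test_function_support[OF assms(1)[of i]] by metis
  then obtain K where K: "\<And>i. compact (K i)" "\<And>i. K i \<subseteq> \<Omega>" "\<And>i x. x \<notin> K i \<Longrightarrow> \<phi> x $ i = 0"
    by metis
  have "C_k k (\<lambda>x. \<Sum>i\<in>UNIV. (\<phi> x $ i) *\<^sub>R axis i (1::real))" for k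
    by (intro C_k_sum C_k_bounded_linear[OF bounded_linear_scaleR_left] test_function_C_k[OF assms]) auto
  moreover have "(\<lambda>x. \<Sum>i\<in>UNIV. (\<phi> x $ i) *\<^sub>R axis i (1::real)) = \<phi>"
    by (auto simp: vec_eq_iff axis_def if_distrib[of "\<lambda>y. _ * y"] cong: if_cong)
  ultimately show ?thesis
    by (intro test_functionI[of _ "\<Union>i. K i"]) (use K in \<open>auto simp: vec_eq_iff\<close>)
qed

lemma is_weak_grad_test_function:
  assumes \<phi>: "\<phi> \<in> test_functions \<Omega>" and \<Omega>: "\<Omega> \<in> sets lebesgue"
  shows "is_weak_grad \<Omega> \<phi> (classical_grad \<phi>)" "square_integrable (lebesgue_on \<Omega>) \<phi>"
  using is_weak_grad_if_H10_scalar[OF \<Omega>, of \<phi> "classical_grad \<phi>"]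
    H10_scalar_test_function[OF test_function_component[OF \<phi>] \<Omega>]
  by (simp_all add: classical_grad_def)

lemma integral_component_le:
  fixes f :: "'a \<Rightarrow> 'b::euclidean_space ^ 'd::finite"
  assumes "square_integrable M f"
  shows "(\<integral>x. (norm (f x $ i))\<^sup>2 \<partial>M) \<le> (\<integral>x. (norm (f x))\<^sup>2 \<partial>M)"
  using square_integrable_component[OF assms, of i] assms
  by (intro integral_mono) (auto simp: square_integrable_def intro!: power_mono Finite_Cartesian_Product.norm_nth_le)

lemma integral_vec_power2:
  fixes f :: "'a \<Rightarrow> 'b::euclidean_space ^ 'd::finite"
  assumes "square_integrable M f"
  shows "(\<integral>x. (norm (f x))\<^sup>2 \<partial>M) = (\<Sum>i\<in>UNIV. \<integral>x. (norm (f x $ i))\<^sup>2 \<partial>M)"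
  unfolding norm_vec_power2[of "f _"]
  using square_integrable_component[OF assms]
  by (subst Bochner_Integration.integral_sum) (auto simp: square_integrable_def)

lemma l2_norm_cong_AE:
  assumes "\<Omega> \<in> sets lebesgue" "AE x in lebesgue_on \<Omega>. f x = g x"
    "f \<in> borel_measurable (lebesgue_on \<Omega>)" "g \<in> borel_measurable (lebesgue_on \<Omega>)"
  shows "l2_norm \<Omega> f = l2_norm \<Omega> g"
  unfolding l2_norm_def l2_inner_eq[OF assms(1)] using assms(2-4)
  by (intro arg_cong[where f = sqrt] integral_cong_AE) auto

text \<open>\<open>h1_norm\<close> refers to the chosen weak gradient of the difference; here it is
  replaced by the difference of two known gradients.\<close>

lemma h1_norm_power2_diff_test_function:
  assumes \<Omega>: "\<Omega> \<in> lmeasurable" "open \<Omega>" and G: "is_weak_grad \<Omega> u G" "square_integrable (lebesgue_on \<Omega>) u"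
    and \<phi>: "\<phi> \<in> test_functions \<Omega>"
  shows "(h1_norm \<Omega> (\<lambda>x. u x - \<phi> x))\<^sup>2 =
     (\<integral>x. (norm (u x - \<phi> x))\<^sup>2 \<partial>lebesgue_on \<Omega>) + (\<integral>x. (norm (G x - classical_grad \<phi> x))\<^sup>2 \<partial>lebesgue_on \<Omega>)"
proof -
  have \<Omega>s: "\<Omega> \<in> sets lebesgue" using \<Omega> by auto
  have wg: "is_weak_grad \<Omega> (\<lambda>x. u x - \<phi> x) (\<lambda>x. G x - classical_grad \<phi> x)"
    by (intro is_weak_grad_diff \<Omega>s G is_weak_grad_test_function \<phi>)
  have "l2_norm \<Omega> (weak_grad \<Omega> (\<lambda>x. u x - \<phi> x)) = l2_norm \<Omega> (\<lambda>x. G x - classical_grad \<phi> x)"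
    by (intro l2_norm_cong_AE \<Omega>s weak_grad_AE_eq \<Omega> wg)
       (use wg weak_grad_works[OF wg] in \<open>auto simp: is_weak_grad_iff[OF \<Omega>s] square_integrable_def\<close>)
  then show ?thesis
    by (simp add: h1_norm_def l2_norm_power2[OF \<Omega>s])
qed

lemma H10_weak_grad:
  assumes "u \<in> H10 \<Omega>" shows "is_weak_grad \<Omega> u (weak_grad \<Omega> u)"
  using assms weak_grad_works by (auto simp: H10_def H1_def)

lemma H10_imp_square_integrable:
  "\<Omega> \<in> sets lebesgue \<Longrightarrow> u \<in> H10 \<Omega> \<Longrightarrow> square_integrable (lebesgue_on \<Omega>) u"
  by (simp add: H10_def H1_def L2_on_iff)

lemma H10_imp_H10_scalar:
  assumes \<Omega>: "\<Omega> \<in> lmeasurable" "open \<Omega>" and u: "u \<in> H10 \<Omega>"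
  shows "H10_scalar \<Omega> (\<lambda>x. u x $ i) (\<lambda>x. weak_grad \<Omega> u x $ i)"
proof -
  have \<Omega>s: "\<Omega> \<in> sets lebesgue" using \<Omega> by auto
  let ?G = "weak_grad \<Omega> u"
  note wg = H10_weak_grad[OF u]
  have sqG: "square_integrable (lebesgue_on \<Omega>) ?G" using wg by (simp add: is_weak_grad_iff[OF \<Omega>s])
  note squ = H10_imp_square_integrable[OF \<Omega>s u]
  obtain \<phi> where \<phi>: "\<And>n. \<phi> n \<in> test_functions \<Omega>" "(\<lambda>n. h1_norm \<Omega> (\<lambda>x. u x - \<phi> n x)) \<longlonglongrightarrow> 0"
    using u by (auto simp: H10_def)
  have "(\<lambda>n. (h1_norm \<Omega> (\<lambda>x. u x - \<phi> n x))\<^sup>2) \<longlonglongrightarrow> 0\<^sup>2" by (intro tendsto_power \<phi>)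
  then have lim: "(\<lambda>n. (\<integral>x. (norm (u x - \<phi> n x))\<^sup>2 \<partial>lebesgue_on \<Omega>) + (\<integral>x. (norm (?G x - classical_grad (\<phi> n) x))\<^sup>2 \<partial>lebesgue_on \<Omega>)) \<longlonglongrightarrow> 0"
    using h1_norm_power2_diff_test_function[OF \<Omega> wg squ \<phi>(1)] by simp
  have sqd: "square_integrable (lebesgue_on \<Omega>) (\<lambda>x. ?G x - classical_grad (\<phi> n) x)" for n
    using is_weak_grad_test_function(1)[OF \<phi>(1)[of n] \<Omega>s]
    by (intro square_integrable_diff sqG) (simp add: is_weak_grad_iff[OF \<Omega>s])
  have sqd': "square_integrable (lebesgue_on \<Omega>) (\<lambda>x. u x - \<phi> n x)" for n
    by (intro square_integrable_diff squ is_weak_grad_test_function \<phi> \<Omega>s)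
  show ?thesis
    unfolding H10_scalar_def
  proof (intro conjI exI[of _ "\<lambda>n x. \<phi> n x $ i"] allI \<Omega>s test_function_component \<phi> square_integrable_component squ sqG)
    have "(\<integral>x. (u x $ i - \<phi> n x $ i)\<^sup>2 \<partial>lebesgue_on \<Omega>) \<le>
       (\<integral>x. (norm (u x - \<phi> n x))\<^sup>2 \<partial>lebesgue_on \<Omega>) + (\<integral>x. (norm (?G x - classical_grad (\<phi> n) x))\<^sup>2 \<partial>lebesgue_on \<Omega>)" for n
    proof (rule add_increasing2)
      show "(\<integral>x. (u x $ i - \<phi> n x $ i)\<^sup>2 \<partial>lebesgue_on \<Omega>) \<le> (\<integral>x. (norm (u x - \<phi> n x))\<^sup>2 \<partial>lebesgue_on \<Omega>)"
        using integral_component_le[OF sqd'[of n], of i] by simp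
    qed simp
    then show "(\<lambda>n. \<integral>x. (u x $ i - \<phi> n x $ i)\<^sup>2 \<partial>lebesgue_on \<Omega>) \<longlonglongrightarrow> 0"
      by (intro tendsto_sandwich[OF _ _ tendsto_const lim] always_eventually allI) auto
    fix j
    have "(\<integral>x. (?G x $ i $ j - partial_deriv j (\<lambda>x. \<phi> n x $ i) x)\<^sup>2 \<partial>lebesgue_on \<Omega>) \<le>
       (\<integral>x. (norm (u x - \<phi> n x))\<^sup>2 \<partial>lebesgue_on \<Omega>) + (\<integral>x. (norm (?G x - classical_grad (\<phi> n) x))\<^sup>2 \<partial>lebesgue_on \<Omega>)" for n
    proof (rule add_increasing)
      have "(\<integral>x. (?G x $ i $ j - partial_deriv j (\<lambda>x. \<phi> n x $ i) x)\<^sup>2 \<partial>lebesgue_on \<Omega>) \<le>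
          (\<integral>x. (norm (?G x $ i - classical_grad (\<phi> n) x $ i))\<^sup>2 \<partial>lebesgue_on \<Omega>)"
        using integral_component_le[OF square_integrable_component[OF sqd[of n], of i], of j]
        by (simp add: classical_grad_def)
      also have "\<dots> \<le> (\<integral>x. (norm (?G x - classical_grad (\<phi> n) x))\<^sup>2 \<partial>lebesgue_on \<Omega>)"
        using integral_component_le[OF sqd[of n], of i] by simp
      finally show "(\<integral>x. (?G x $ i $ j - partial_deriv j (\<lambda>x. \<phi> n x $ i) x)\<^sup>2 \<partial>lebesgue_on \<Omega>) \<le>
          (\<integral>x. (norm (?G x - classical_grad (\<phi> n) x))\<^sup>2 \<partial>lebesgue_on \<Omega>)" .
    qed simp
    then show "(\<lambda>n. \<integral>x. (?G x $ i $ j - partial_deriv j (\<lambda>x. \<phi> n x $ i) x)\<^sup>2 \<partial>lebesgue_on \<Omega>) \<longlonglongrightarrow> 0"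
      by (intro tendsto_sandwich[OF _ _ tendsto_const lim] always_eventually allI) auto
  qed
qed

text \<open>The components come with unrelated approximating sequences, but their n-th members form
  one test field, and the squared H1 distance is a finite sum over components.\<close>

lemma H10I:
  assumes \<Omega>: "\<Omega> \<in> lmeasurable" "open \<Omega>" and u: "\<And>i. H10_scalar \<Omega> (\<lambda>x. u x $ i) (\<lambda>x. G x $ i)"
  shows "u \<in> H10 \<Omega>"
proof -
  have \<Omega>s: "\<Omega> \<in> sets lebesgue" using \<Omega> by auto
  note wg = is_weak_grad_if_H10_scalar(1)[OF \<Omega>s u] and squ = is_weak_grad_if_H10_scalar(2)[OF \<Omega>s u]
  have sqG: "square_integrable (lebesgue_on \<Omega>) G" using wg by (simp add: is_weak_grad_iff[OF \<Omega>s])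
  have "\<forall>i. \<exists>\<psi>. (\<forall>n. \<psi> n \<in> test_functions \<Omega>) \<and>
        (\<lambda>n. \<integral>x. (u x $ i - \<psi> n x)\<^sup>2 \<partial>lebesgue_on \<Omega>) \<longlonglongrightarrow> 0 \<and>
        (\<forall>j. (\<lambda>n. \<integral>x. (G x $ i $ j - partial_deriv j (\<psi> n) x)\<^sup>2 \<partial>lebesgue_on \<Omega>) \<longlonglongrightarrow> 0)"
    using u by (simp add: H10_scalar_def)
  from choice[OF this] obtain \<psi> where \<psi>: "\<And>i n. \<psi> i n \<in> test_functions \<Omega>"
        "\<And>i. (\<lambda>n. \<integral>x. (u x $ i - \<psi> i n x)\<^sup>2 \<partial>lebesgue_on \<Omega>) \<longlonglongrightarrow> 0"
        "\<And>i j. (\<lambda>n. \<integral>x. (G x $ i $ j - partial_deriv j (\<psi> i n) x)\<^sup>2 \<partial>lebesgue_on \<Omega>) \<longlonglongrightarrow> 0"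
    by auto
  define \<phi> where "\<phi> n x = (\<chi> i. \<psi> i n x)" for n x
  have \<phi>: "\<phi> n \<in> test_functions \<Omega>" for n
    by (rule test_function_vec) (simp add: \<phi>_def \<psi>)
  have sqd: "square_integrable (lebesgue_on \<Omega>) (\<lambda>x. G x - classical_grad (\<phi> n) x)" for n
    using is_weak_grad_test_function(1)[OF \<phi>[of n] \<Omega>s]
    by (intro square_integrable_diff sqG) (simp add: is_weak_grad_iff[OF \<Omega>s])
  have sqd': "square_integrable (lebesgue_on \<Omega>) (\<lambda>x. u x - \<phi> n x)" for n
    by (intro square_integrable_diff squ is_weak_grad_test_function \<phi> \<Omega>s)
  have "(h1_norm \<Omega> (\<lambda>x. u x - \<phi> n x))\<^sup>2 =
     (\<Sum>i\<in>UNIV. \<integral>x. (u x $ i - \<psi> i n x)\<^sup>2 \<partial>lebesgue_on \<Omega>) +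
     (\<Sum>i\<in>UNIV. \<Sum>j\<in>UNIV. \<integral>x. (G x $ i $ j - partial_deriv j (\<psi> i n) x)\<^sup>2 \<partial>lebesgue_on \<Omega>)" for n
    unfolding h1_norm_power2_diff_test_function[OF \<Omega> wg squ \<phi>] integral_vec_power2[OF sqd]
      integral_vec_power2[OF sqd'] integral_vec_power2[OF square_integrable_component[OF sqd]]
    by (simp add: classical_grad_def \<phi>_def)
  moreover have "(\<lambda>n. (\<Sum>i\<in>UNIV. \<integral>x. (u x $ i - \<psi> i n x)\<^sup>2 \<partial>lebesgue_on \<Omega>) +
     (\<Sum>i\<in>UNIV. \<Sum>j\<in>UNIV. \<integral>x. (G x $ i $ j - partial_deriv j (\<psi> i n) x)\<^sup>2 \<partial>lebesgue_on \<Omega>)) \<longlonglongrightarrow>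
     (\<Sum>i\<in>(UNIV::'a set). 0) + (\<Sum>i\<in>(UNIV::'a set). \<Sum>j\<in>(UNIV::'a set). 0)"
    by (intro tendsto_add tendsto_sum \<psi>)
  ultimately have "(\<lambda>n. (h1_norm \<Omega> (\<lambda>x. u x - \<phi> n x))\<^sup>2) \<longlonglongrightarrow> 0" by simp
  then have "(\<lambda>n. sqrt ((h1_norm \<Omega> (\<lambda>x. u x - \<phi> n x))\<^sup>2)) \<longlonglongrightarrow> sqrt 0"
    by (rule tendsto_real_sqrt)
  moreover have "h1_norm \<Omega> w \<ge> 0" for w :: "'a point \<Rightarrow> 'a point" by (simp add: h1_norm_def)
  ultimately have "(\<lambda>n. h1_norm \<Omega> (\<lambda>x. u x - \<phi> n x)) \<longlonglongrightarrow> 0" by simp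
  then show ?thesis using \<phi> wg squ by (auto simp: H10_def H1_def L2_on_iff[OF \<Omega>s])
qed

section \<open>Zero sets of polynomials\<close>

lemma real_polynomial_function_line_finite_zeros:
  fixes p :: "'a::real_normed_vector \<Rightarrow> real"
  assumes "real_polynomial_function p" "p a \<noteq> 0"
  shows "finite {s. p (a + s *\<^sub>R y) = 0}"
proof -
  have "polynomial_function (\<lambda>s::real. a + s *\<^sub>R y)"
    by (intro polynomial_function_add polynomial_function_const polynomial_function_bounded_linear
        bounded_linear_scaleR_left)
  from real_polynomial_function_compose[OF this assms(1)]
  have "real_polynomial_function (\<lambda>s. p (a + s *\<^sub>R y))" by (simp add: o_def)
  then obtain c n where eq: "(\<lambda>s. p (a + s *\<^sub>R y)) = (\<lambda>s. \<Sum>i\<le>n. c i * s ^ i)"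
    by (auto simp: real_polynomial_function_iff_sum)
  have "\<exists>i\<le>n. c i \<noteq> 0"
  proof (rule ccontr)
    assume "\<not> (\<exists>i\<le>n. c i \<noteq> 0)"
    then have "(\<Sum>i\<le>n. c i * 0 ^ i) = 0" by (intro sum.neutral) auto
    then show False using fun_cong[OF eq, of 0] assms(2) by simp
  qed
  then have "finite {s. (\<Sum>i\<le>n. c i * s ^ i) = 0}" by (simp add: polyfun_finite_roots)
  then show ?thesis by (simp add: fun_cong[OF eq])
qed

text \<open>Scaling a bounded piece of the zero set about a point \<open>a\<close> with \<open>p a \<noteq> 0\<close> by infinitely many
  factors yields sets of no smaller measure, but every point lies in only finitely many of them.\<close>

lemma negligible_real_polynomial_function_zeros:
  fixes p :: "'a::euclidean_space \<Rightarrow> real"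
  assumes p: "real_polynomial_function p" "p a \<noteq> 0"
  shows "negligible {x. p x = 0}"
proof -
  have contp: "continuous_on UNIV p" by (rule C_k_imp_continuous[OF C_k_real_polynomial_function[OF p(1), of 0]])
  have null: "{y \<in> cball 0 R. p (a + y) = 0} \<in> null_sets lebesgue" if "R > 0" for R
  proof -
    define Z where "Z = {y \<in> cball 0 R. p (a + y) = 0}"
    have Zc: "closed Z"
    proof -
      have "Z = cball 0 R \<inter> (\<lambda>y. p (a + y)) -` {0}" by (auto simp: Z_def)
      moreover have "continuous_on (cball 0 R) (\<lambda>y. p (a + y))"
        by (intro continuous_on_compose2[OF contp] continuous_intros) auto
      ultimately show ?thesis by (simp add: continuous_closed_preimage)
    qed
    \<comment> \<open>Distinct factors between 1 and 2: scaling by them does not decrease the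
      measure and stays within a fixed ball.\<close>
    define t where "t n = 1 + inverse (real (Suc n))" for n
    have t: "1 \<le> t n" "t n \<le> 2" for n by (auto simp: t_def field_simps)
    define S where "S n = (\<lambda>x. t n *\<^sub>R x + 0) ` Z" for n
    have Sc: "closed (S n)" for n
      unfolding S_def using t[of n] Zc closed_scaling[of Z "t n"] by simp
    have Sm: "S n \<in> sets lebesgue" for n using Sc by auto
    have Sb: "S n \<subseteq> cball 0 (2 * R)" for n
    proof
      fix x assume "x \<in> S n"
      then obtain z where "x = t n *\<^sub>R z" "norm z \<le> R" by (auto simp: S_def Z_def)
      then show "x \<in> cball 0 (2 * R)" using t[of n] by (auto intro!: mult_mono)
    qed
    have mS: "emeasure lebesgue Z \<le> emeasure lebesgue (S n)" for n
    proof -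
      have "emeasure lebesgue (S n) = ennreal (\<bar>t n\<bar> ^ DIM('a)) * emeasure lebesgue Z"
        unfolding S_def by (rule emeasure_lebesgue_affine)
      moreover have "1 \<le> \<bar>t n\<bar> ^ DIM('a)" using t[of n] by (intro one_le_power) simp
      then have "1 * emeasure lebesgue Z \<le> ennreal (\<bar>t n\<bar> ^ DIM('a)) * emeasure lebesgue Z"
        by (intro mult_right_mono) auto
      ultimately show ?thesis by simp
    qed
    \<comment> \<open>The intersection of the \<open>A N\<close> is the set of points in infinitely
      many \<open>S n\<close>. Since \<open>x \<in> S n\<close> makes \<open>p\<close> vanish at
      parameter \<open>inverse (t n)\<close> on the line from \<open>a\<close> in direction
      \<open>x\<close>, it is empty, and continuity of the measure from above leaves no room for
      \<open>Z\<close>.\<close>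
    define A where "A N = (\<Union>n\<in>{N..}. S n)" for N
    have "(INF N. emeasure lebesgue (A N)) = emeasure lebesgue (\<Inter>N. A N)"
    proof (rule INF_emeasure_decseq)
      show "range A \<subseteq> sets lebesgue" using Sm by (auto simp: A_def)
      show "decseq A" unfolding A_def decseq_def by fastforce
      show "emeasure lebesgue (A N) \<noteq> \<infinity>" for N
      proof -
        have "emeasure lebesgue (A N) \<le> emeasure lebesgue (cball (0::'a) (2 * R))"
          using Sb by (intro emeasure_mono) (auto simp: A_def)
        also have "\<dots> < \<infinity>" using emeasure_lborel_cball_finite[of "0::'a" "2 * R"] by simp
        finally show ?thesis by simp
      qed
    qed
    moreover have "(\<Inter>N. A N) = {}"
    proof (rule ccontr)
      assume "(\<Inter>N. A N) \<noteq> {}"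
      then obtain x where x: "\<And>N. \<exists>n\<ge>N. x \<in> S n" by (fastforce simp: A_def)
      have "infinite {n. x \<in> S n}" using x by (auto simp: infinite_nat_iff_unbounded_le)
      moreover have "inj (\<lambda>n. inverse (t n))" by (auto simp: inj_def t_def)
      ultimately have "infinite ((\<lambda>n. inverse (t n)) ` {n. x \<in> S n})"
        by (metis finite_imageD inj_on_subset subset_UNIV)
      moreover have "(\<lambda>n. inverse (t n)) ` {n. x \<in> S n} \<subseteq> {s. p (a + s *\<^sub>R x) = 0}"
      proof clarify
        fix n assume "x \<in> S n"
        then obtain z where "x = t n *\<^sub>R z" "p (a + z) = 0" by (auto simp: S_def Z_def)
        then show "p (a + inverse (t n) *\<^sub>R x) = 0" using t[of n] by simp
      qed
      ultimately show False
        using real_polynomial_function_line_finite_zeros[OF p] finite_subset by blast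
    qed
    ultimately have "(INF N. emeasure lebesgue (A N)) = 0" by simp
    moreover have "emeasure lebesgue Z \<le> (INF N. emeasure lebesgue (A N))"
    proof (rule INF_greatest)
      fix N
      have "emeasure lebesgue (S N) \<le> emeasure lebesgue (A N)"
        using Sm by (intro emeasure_mono) (auto simp: A_def)
      then show "emeasure lebesgue Z \<le> emeasure lebesgue (A N)" using mS order_trans by blast
    qed
    ultimately have "emeasure lebesgue Z = 0" by simp
    moreover have "Z \<in> sets lebesgue" using Zc by auto
    ultimately show ?thesis unfolding Z_def by (simp add: null_sets_def)
  qed
  have "negligible (\<Union>n. {y \<in> cball 0 (real (Suc n)). p (a + y) = 0})"
    by (rule negligible_countable_Union) (use null in \<open>auto simp: negligible_iff_null_sets\<close>)
  moreover have "{y. p (a + y) = 0} \<subseteq> (\<Union>n. {y \<in> cball 0 (real (Suc n)). p (a + y) = 0})"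
  proof
    fix y assume "y \<in> {y. p (a + y) = 0}"
    moreover obtain n where "norm y \<le> real n" using real_arch_simple by blast
    ultimately show "y \<in> (\<Union>n. {y \<in> cball 0 (real (Suc n)). p (a + y) = 0})"
      by (intro UN_I[of n]) auto
  qed
  ultimately have "negligible {y. p (a + y) = 0}" by (rule negligible_subset)
  then have "negligible ((+) a ` {y. p (a + y) = 0})" by (rule negligible_translation)
  moreover have "(+) a ` {y. p (a + y) = 0} = {x. p x = 0}"
    by (auto simp: image_iff intro!: exI[of _ "_ - a"])
  ultimately show ?thesis by simp
qed

lemma polynomial_function_component:
  fixes P :: "'a::real_normed_vector \<Rightarrow> real ^ 'd::finite"
  shows "polynomial_function P \<Longrightarrow> real_polynomial_function (\<lambda>x. P x $ i)"
  using bounded_linear_vec_nth unfolding polynomial_function_def o_def by blast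

lemma C_k_polynomial_component:
  fixes P :: "'a::real_normed_vector \<Rightarrow> real ^ 'd::finite"
  shows "polynomial_function P \<Longrightarrow> C_k k (\<lambda>x. P x $ i)"
  by (rule C_k_real_polynomial_function[OF polynomial_function_component])

text \<open>Either the two polynomials are identical, or some component of their difference is a
  nonzero polynomial and they agree on a null set only.\<close>

lemma classical_grad_cong_polynomial_AE:
  fixes P g :: "'d::finite point \<Rightarrow> 'd point"
  assumes "polynomial_function P" "polynomial_function g"
  shows "AE x in lebesgue. P x = g x \<longrightarrow> classical_grad P x = classical_grad g x"
proof (cases "P = g")
  case False
  then obtain a where "P a \<noteq> g a" by blast
  then obtain i where i: "P a $ i \<noteq> g a $ i" by (auto simp: vec_eq_iff)
  have "real_polynomial_function (\<lambda>x. P x $ i - g x $ i)"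
    by (intro real_polynomial_function_diff polynomial_function_component assms)
  then have "negligible {x. P x $ i - g x $ i = 0}"
    by (rule negligible_real_polynomial_function_zeros[of _ a]) (use i in auto)
  then have "AE x in lebesgue. x \<notin> {x. P x $ i - g x $ i = 0}"
    by (intro AE_not_in) (simp add: negligible_iff_null_sets)
  then show ?thesis by eventually_elim auto
qed simp

section \<open>Finite element functions on a triangulated domain\<close>

locale fe_domain =
  fixes \<T> :: "('d::finite point) set set" and \<Omega> :: "('d point) set"
  assumes open_\<Omega>: "open \<Omega>" and adm: "admissible_triangulation \<T> \<Omega>"
begin

lemma finite_\<T>: "finite \<T>" and compact_K: "K \<in> \<T> \<Longrightarrow> compact K" and convex_K: "K \<in> \<T> \<Longrightarrow> convex K"
  and Union_\<T>: "\<Union>\<T> = closure \<Omega>"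
  using adm by (auto simp: admissible_triangulation_def triangulation_def
      intro: compact_simplex convex_simplex)

lemma bounded_\<Omega>: "bounded \<Omega>"
proof -
  have "compact (closure \<Omega>)" unfolding Union_\<T>[symmetric] using finite_\<T> compact_K by blast
  then show ?thesis using bounded_closure_image compact_imp_bounded bounded_subset closure_subset by blast
qed

lemma lmeasurable_\<Omega>: "\<Omega> \<in> lmeasurable"
  using bounded_\<Omega> open_\<Omega> by (rule lmeasurable_open)

lemma sets_\<Omega>: "\<Omega> \<in> sets lebesgue"
  using lmeasurable_\<Omega> by auto

lemma finite_measure_\<Omega>: "finite_measure (lebesgue_on \<Omega>)"
  by (rule finite_measure_lebesgue_on[OF lmeasurable_\<Omega>])

lemma AE_lebesgue_on_iff: "(AE x in lebesgue_on \<Omega>. P x) \<longleftrightarrow> (AE x in lebesgue. x \<in> \<Omega> \<longrightarrow> P x)"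
  using sets_\<Omega> by (simp add: AE_restrict_space_iff)

lemma open_piece: "open (interior K \<inter> \<Omega>)" using open_\<Omega> by auto

text \<open>Frontiers of convex sets are null, so almost every point of \<open>\<Omega>\<close> is
  interior to one of the finitely many elements.\<close>

lemma AE_pieces:
  assumes "\<And>K. K \<in> \<T> \<Longrightarrow> AE x in lebesgue_on (interior K \<inter> \<Omega>). P x"
  shows "AE x in lebesgue_on \<Omega>. P x"
proof -
  have "AE x in lebesgue. \<forall>K\<in>\<T>. x \<notin> frontier K"
    using finite_\<T> by (intro AE_finite_allI AE_not_in)
      (auto simp: negligible_iff_null_sets[symmetric] intro: negligible_convex_frontier convex_K)
  moreover have "AE x in lebesgue. \<forall>K\<in>\<T>. x \<in> interior K \<inter> \<Omega> \<longrightarrow> P x"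
  proof (intro AE_finite_allI finite_\<T>)
    fix K assume "K \<in> \<T>"
    have "interior K \<inter> \<Omega> \<in> sets lebesgue" using open_piece by simp
    then show "AE x in lebesgue. x \<in> interior K \<inter> \<Omega> \<longrightarrow> P x"
      using assms[OF \<open>K \<in> \<T>\<close>] by (simp add: AE_restrict_space_iff)
  qed
  ultimately have "AE x in lebesgue. x \<in> \<Omega> \<longrightarrow> P x"
  proof eventually_elim
    case (elim x)
    show ?case
    proof
      assume "x \<in> \<Omega>"
      then obtain K where K: "K \<in> \<T>" "x \<in> K" using Union_\<T> closure_subset by blast
      then have "x \<in> interior K"
        using elim(1) compact_imp_closed[OF compact_K[OF K(1)]] by (auto simp: frontier_def)
      then show "P x" using elim(2) K \<open>x \<in> \<Omega>\<close> by blast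
    qed
  qed
  then show ?thesis by (simp add: AE_lebesgue_on_iff)
qed

lemma piecewise_polynomial_grad:
  assumes v: "v \<in> H10 \<Omega>" "piecewise_polynomial \<T> \<Omega> v" and K: "K \<in> \<T>"
  obtains P where "polynomial_function P" "\<And>x. x \<in> interior K \<inter> \<Omega> \<Longrightarrow> v x = P x"
    "AE x in lebesgue_on (interior K \<inter> \<Omega>). weak_grad \<Omega> v x = classical_grad P x"
proof -
  obtain P where P: "polynomial_function P" "\<And>x. x \<in> interior K \<inter> \<Omega> \<Longrightarrow> v x = P x"
    using v(2) K by (auto simp: piecewise_polynomial_def)
  have b: "bounded (interior K \<inter> \<Omega>)" using bounded_\<Omega> by (simp add: bounded_subset)
  have "AE x in lebesgue_on (interior K \<inter> \<Omega>). weak_grad \<Omega> v x $ i $ j = partial_deriv j (\<lambda>x. P x $ i) x" for i j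
    by (rule weak_grad_eq_classical_locally[OF lmeasurable_\<Omega> open_piece b _ H10_weak_grad[OF v(1)]
          H10_imp_square_integrable[OF sets_\<Omega> v(1)]])
       (use P in \<open>auto intro: C_k_polynomial_component AE_I2\<close>)
  then have "AE x in lebesgue_on (interior K \<inter> \<Omega>). \<forall>i\<in>UNIV. \<forall>j\<in>UNIV. weak_grad \<Omega> v x $ i $ j = partial_deriv j (\<lambda>x. P x $ i) x"
    by (intro AE_finite_allI finite)
  then have "AE x in lebesgue_on (interior K \<inter> \<Omega>). weak_grad \<Omega> v x = classical_grad P x"
    by eventually_elim (auto simp: vec_eq_iff classical_grad_def)
  then show ?thesis using P that by blast
qed

text \<open>On an element the function agrees inside with a polynomial, which is bounded together
  with its gradient on the whole compact simplex. These bounds feed the trilinear identity.\<close>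

lemma piecewise_polynomial_bounded:
  assumes v: "v \<in> H10 \<Omega>" "piecewise_polynomial \<T> \<Omega> v"
  obtains C where "AE x in lebesgue_on \<Omega>. norm (v x) \<le> C \<and> norm (weak_grad \<Omega> v x) \<le> C"
proof -
  have "\<exists>C. AE x in lebesgue_on (interior K \<inter> \<Omega>). norm (v x) \<le> C \<and> norm (weak_grad \<Omega> v x) \<le> C"
    if K: "K \<in> \<T>" for K
  proof -
    obtain P where P: "polynomial_function P" "\<And>x. x \<in> interior K \<inter> \<Omega> \<Longrightarrow> v x = P x"
      "AE x in lebesgue_on (interior K \<inter> \<Omega>). weak_grad \<Omega> v x = classical_grad P x"
      using piecewise_polynomial_grad[OF v K] by metis
    have "continuous_on UNIV P"
      by (rule continuous_on_componentwise[THEN iffD2] continuous_on_vec_lambda continuous_on_polymonial_function P)+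
    then have "bounded (P ` K)"
      by (intro compact_imp_bounded compact_continuous_image compact_K K) (auto intro: continuous_on_subset)
    then obtain C1 where C1: "\<And>x. x \<in> K \<Longrightarrow> norm (P x) \<le> C1" by (auto simp: bounded_iff)
    have "continuous_on UNIV (classical_grad P)"
      unfolding classical_grad_def[abs_def]
      by (intro continuous_on_vec_lambda C_k_imp_continuous[of 0] C_k_partial_deriv C_k_polynomial_component P)
    then have "bounded (classical_grad P ` K)"
      by (intro compact_imp_bounded compact_continuous_image compact_K K) (auto intro: continuous_on_subset)
    then obtain C2 where C2: "\<And>x. x \<in> K \<Longrightarrow> norm (classical_grad P x) \<le> C2" by (auto simp: bounded_iff)
    have "AE x in lebesgue_on (interior K \<inter> \<Omega>). x \<in> interior K \<inter> \<Omega>"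
      by (rule AE_I2) simp
    with P(3) have "AE x in lebesgue_on (interior K \<inter> \<Omega>). norm (v x) \<le> max C1 C2 \<and> norm (weak_grad \<Omega> v x) \<le> max C1 C2"
    proof eventually_elim
      case (elim x)
      then have "x \<in> K" using interior_subset by blast
      then show ?case using elim P(2)[OF elim(2)] C1[of x] C2[of x] by auto
    qed
    then show ?thesis by blast
  qed
  then have "\<forall>K\<in>\<T>. \<exists>C. AE x in lebesgue_on (interior K \<inter> \<Omega>). norm (v x) \<le> C \<and> norm (weak_grad \<Omega> v x) \<le> C"
    by blast
  from bchoice[OF this] obtain C where C: "\<And>K. K \<in> \<T> \<Longrightarrow>
      AE x in lebesgue_on (interior K \<inter> \<Omega>). norm (v x) \<le> C K \<and> norm (weak_grad \<Omega> v x) \<le> C K"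
    by auto
  have "AE x in lebesgue_on \<Omega>. norm (v x) \<le> (\<Sum>K\<in>\<T>. \<bar>C K\<bar>) \<and> norm (weak_grad \<Omega> v x) \<le> (\<Sum>K\<in>\<T>. \<bar>C K\<bar>)"
  proof (rule AE_pieces)
    fix K assume K: "K \<in> \<T>"
    have le: "C K \<le> (\<Sum>K\<in>\<T>. \<bar>C K\<bar>)"
      using member_le_sum[OF K, of "\<lambda>K. \<bar>C K\<bar>"] finite_\<T> by simp
    from C[OF K] show "AE x in lebesgue_on (interior K \<inter> \<Omega>). norm (v x) \<le> (\<Sum>K\<in>\<T>. \<bar>C K\<bar>) \<and> norm (weak_grad \<Omega> v x) \<le> (\<Sum>K\<in>\<T>. \<bar>C K\<bar>)"
      by eventually_elim (use le in auto)
  qed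
  then show ?thesis by (rule that)
qed

text \<open>The set where \<open>v\<close> equals \<open>g\<close> may have no interior, so the
  equation cannot just be differentiated; the dichotomy for polynomials settles it on each element.
  With \<open>g = 0\<close> it shows that the gradient vanishes almost everywhere where the function
  does.\<close>

lemma piecewise_polynomial_grad_cong:
  assumes v: "v \<in> H10 \<Omega>" "piecewise_polynomial \<T> \<Omega> v" and g: "polynomial_function g"
  shows "AE x in lebesgue_on \<Omega>. v x = g x \<longrightarrow> weak_grad \<Omega> v x = classical_grad g x"
proof (rule AE_pieces)
  fix K assume K: "K \<in> \<T>"
  obtain P where P: "polynomial_function P" "\<And>x. x \<in> interior K \<inter> \<Omega> \<Longrightarrow> v x = P x"
    "AE x in lebesgue_on (interior K \<inter> \<Omega>). weak_grad \<Omega> v x = classical_grad P x"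
    using piecewise_polynomial_grad[OF v K] by metis
  have "AE x in lebesgue_on (interior K \<inter> \<Omega>). x \<in> interior K \<inter> \<Omega>"
    by (rule AE_I2) simp
  moreover have "AE x in lebesgue_on (interior K \<inter> \<Omega>). P x = g x \<longrightarrow> classical_grad P x = classical_grad g x"
    using classical_grad_cong_polynomial_AE[OF P(1) g] open_piece
    by (subst AE_restrict_space_iff) auto
  ultimately show "AE x in lebesgue_on (interior K \<inter> \<Omega>). v x = g x \<longrightarrow> weak_grad \<Omega> v x = classical_grad g x"
    using P(3)
  proof eventually_elim
    case (elim x)
    then show ?case using P(2)[OF elim(1)] by metis
  qed
qed

end

section \<open>Essentially bounded functions\<close>

definition ess_bounded :: "'a measure \<Rightarrow> ('a \<Rightarrow> real) \<Rightarrow> bool" where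
  "ess_bounded M f \<longleftrightarrow> f \<in> borel_measurable M \<and> (\<exists>C. AE x in M. \<bar>f x\<bar> \<le> C)"

lemma ess_bounded_const: "ess_bounded M (\<lambda>x. c)"
  unfolding ess_bounded_def by (intro conjI exI[of _ "\<bar>c\<bar>"]) auto

lemma ess_bounded_add:
  assumes "ess_bounded M f" "ess_bounded M g" shows "ess_bounded M (\<lambda>x. f x + g x)"
proof -
  obtain C D where "AE x in M. \<bar>f x\<bar> \<le> C" "AE x in M. \<bar>g x\<bar> \<le> D"
    using assms by (auto simp: ess_bounded_def)
  then have "AE x in M. \<bar>f x + g x\<bar> \<le> C + D" by eventually_elim linarith
  then show ?thesis using assms by (auto simp: ess_bounded_def)
qed

lemma ess_bounded_mult:
  assumes "ess_bounded M f" "ess_bounded M g" shows "ess_bounded M (\<lambda>x. f x * g x)"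
proof -
  obtain C D where "AE x in M. \<bar>f x\<bar> \<le> C" "AE x in M. \<bar>g x\<bar> \<le> D"
    using assms by (auto simp: ess_bounded_def)
  then have "AE x in M. \<bar>f x * g x\<bar> \<le> C * D"
    by eventually_elim (auto simp: abs_mult intro: mult_mono order_trans[OF abs_ge_zero])
  then show ?thesis using assms by (auto simp: ess_bounded_def)
qed

lemma ess_bounded_uminus: "ess_bounded M f \<Longrightarrow> ess_bounded M (\<lambda>x. - f x)"
  using ess_bounded_mult[OF ess_bounded_const[of M "-1"], of f] by simp

lemma ess_bounded_diff: "ess_bounded M f \<Longrightarrow> ess_bounded M g \<Longrightarrow> ess_bounded M (\<lambda>x. f x - g x)"
  using ess_bounded_add[OF _ ess_bounded_uminus, of M f g] by simp

lemma ess_bounded_sum: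
  "finite A \<Longrightarrow> (\<And>i. i \<in> A \<Longrightarrow> ess_bounded M (f i)) \<Longrightarrow> ess_bounded M (\<lambda>x. \<Sum>i\<in>A. f i x)"
  by (induction A rule: finite_induct) (auto intro: ess_bounded_const ess_bounded_add)

lemmas ess_bounded_intros =
  ess_bounded_const ess_bounded_add ess_bounded_mult ess_bounded_uminus ess_bounded_diff ess_bounded_sum finite

text \<open>Together with the closure rules this makes every polynomial expression in finite element
  functions and their gradients integrable.\<close>

lemma ess_bounded_integrable:
  assumes "finite_measure M" "ess_bounded M f" shows "integrable M f"
proof -
  obtain C where "AE x in M. \<bar>f x\<bar> \<le> C" using assms by (auto simp: ess_bounded_def)
  then show ?thesis
    using assms by (intro finite_measure.integrable_const_bound[of M _ C]) (auto simp: ess_bounded_def)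
qed

lemma ess_bounded_mult_square_integrable:
  fixes f g :: "'a \<Rightarrow> real"
  assumes "finite_measure M" "ess_bounded M f" "square_integrable M g"
  shows "integrable M (\<lambda>x. f x * g x)"
proof -
  obtain C where "AE x in M. \<bar>f x\<bar> \<le> C" using assms by (auto simp: ess_bounded_def)
  then have "square_integrable M (\<lambda>x. f x *\<^sub>R g x)"
    using assms by (intro square_integrable_bounded_mult[of M g f C]) (auto simp: ess_bounded_def)
  then show ?thesis using square_integrable_imp_integrable[OF assms(1)] by simp
qed

lemma ess_bounded_square_integrable:
  assumes "finite_measure M" "ess_bounded M f" shows "square_integrable M f"
proof -
  obtain C where "AE x in M. norm (f x) \<le> C" using assms(2) by (auto simp: ess_bounded_def)
  with assms show ?thesis by (intro square_integrable_bounded[of M f C]) (auto simp: ess_bounded_def)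
qed

lemma integrable_vec:
  fixes f :: "'a \<Rightarrow> real ^ 'n::finite"
  assumes "\<And>i. integrable M (\<lambda>x. f x $ i)" shows "integrable M f"
proof -
  have "integrable M (\<lambda>x. \<Sum>i\<in>UNIV. f x $ i *\<^sub>R axis i (1::real))"
    by (intro Bochner_Integration.integrable_sum integrable_scaleR_left assms)
  moreover have "(\<lambda>x. \<Sum>i\<in>UNIV. f x $ i *\<^sub>R axis i (1::real)) = f"
    by (auto simp: vec_eq_iff axis_def if_distrib[of "\<lambda>y. _ * y"] cong: if_cong)
  ultimately show ?thesis by simp
qed

lemma integral_vec_nth:
  fixes f :: "'a \<Rightarrow> real ^ 'n::finite"
  assumes "integrable M f" shows "integral\<^sup>L M f $ i = (\<integral>x. f x $ i \<partial>M)"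
  by (rule integral_bounded_linear[OF bounded_linear_vec_nth assms, symmetric])

section \<open>Time derivatives of L2 pairings\<close>

lemma l2_norm_Cauchy_Schwarz:
  assumes "\<Omega> \<in> sets lebesgue" "square_integrable (lebesgue_on \<Omega>) f" "square_integrable (lebesgue_on \<Omega>) g"
  shows "\<bar>\<integral>x. inner (f x) (g x) \<partial>lebesgue_on \<Omega>\<bar> \<le> l2_norm \<Omega> f * l2_norm \<Omega> g"
  using Cauchy_Schwarz_integral[OF assms(2,3)] assms(1)
  by (simp add: l2_norm_def l2_inner_eq power2_norm_eq_inner)

lemma eventually_at_within_ne: "eventually (\<lambda>s. s \<in> I \<and> s \<noteq> t) (at t within I)"
  by (simp add: eventually_at_filter)

lemma l2_inner_has_derivative:
  assumes \<Omega>: "\<Omega> \<in> sets lebesgue" and u: "\<And>s. s \<in> I \<Longrightarrow> square_integrable (lebesgue_on \<Omega>) (u s)" and t: "t \<in> I"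
    and u': "square_integrable (lebesgue_on \<Omega>) u'" and v: "square_integrable (lebesgue_on \<Omega>) v"
    and d: "has_L2_time_derivative \<Omega> I u t u'"
  shows "((\<lambda>s. l2_inner \<Omega> (u s) v) has_real_derivative l2_inner \<Omega> u' v) (at t within I)"
  unfolding has_field_derivative_iff
proof (rule LIM_zero_cancel, rule Lim_null_comparison)
  let ?w = "\<lambda>s x. (1 / (s - t)) *\<^sub>R (u s x - u t x) - u' x"
  show "((\<lambda>s. l2_norm \<Omega> (?w s) * l2_norm \<Omega> v) \<longlongrightarrow> 0) (at t within I)"
    using tendsto_mult_right[OF d[unfolded has_L2_time_derivative_def], of "l2_norm \<Omega> v"] by simp
  show "\<forall>\<^sub>F s in at t within I. norm ((l2_inner \<Omega> (u s) v - l2_inner \<Omega> (u t) v) / (s - t) - l2_inner \<Omega> u' v)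
      \<le> l2_norm \<Omega> (?w s) * l2_norm \<Omega> v"
    using eventually_at_within_ne
  proof eventually_elim
    case (elim s)
    have sq: "square_integrable (lebesgue_on \<Omega>) (?w s)"
      by (intro square_integrable_diff square_integrable_scaleR u u' t) (use elim in auto)
    have "(l2_inner \<Omega> (u s) v - l2_inner \<Omega> (u t) v) / (s - t) - l2_inner \<Omega> u' v =
        (\<integral>x. (1 / (s - t)) * (inner (u s x) (v x) - inner (u t x) (v x)) - inner (u' x) (v x) \<partial>lebesgue_on \<Omega>)"
      using square_integrable_inner_right[OF u[of s] v] square_integrable_inner_right[OF u[OF t] v]
        square_integrable_inner_right[OF u' v] elim
      by (simp add: l2_inner_eq[OF \<Omega>])
    also have "\<dots> = (\<integral>x. inner (?w s x) (v x) \<partial>lebesgue_on \<Omega>)"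
      by (simp add: inner_diff_left)
    finally have "(l2_inner \<Omega> (u s) v - l2_inner \<Omega> (u t) v) / (s - t) - l2_inner \<Omega> u' v =
        (\<integral>x. inner (?w s x) (v x) \<partial>lebesgue_on \<Omega>)" .
    then show ?case using l2_norm_Cauchy_Schwarz[OF \<Omega> sq v] by simp
  qed
qed

text \<open>Expand |u s|^2 = |u t|^2 + 2 (u s - u t, u t) + |u s - u t|^2. The pairing is
  differentiated by the preceding lemma, and the last term is of second order because the difference
  quotients converge in L2.\<close>

lemma l2_norm_power2_has_derivative:
  assumes \<Omega>: "\<Omega> \<in> sets lebesgue" and u: "\<And>s. s \<in> I \<Longrightarrow> square_integrable (lebesgue_on \<Omega>) (u s)" and t: "t \<in> I"
    and u': "square_integrable (lebesgue_on \<Omega>) u'"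
    and d: "has_L2_time_derivative \<Omega> I u t u'"
  shows "((\<lambda>s. l2_inner \<Omega> (u s) (u s)) has_real_derivative 2 * l2_inner \<Omega> u' (u t)) (at t within I)"
proof -
  let ?w = "\<lambda>s x. (1 / (s - t)) *\<^sub>R (u s x - u t x) - u' x"
  let ?N = "\<lambda>f. l2_inner \<Omega> f f"
  have dec: "\<forall>\<^sub>F s in at t within I. ?N (u s) = ?N (u t) + 2 * (l2_inner \<Omega> (u s) (u t) - l2_inner \<Omega> (u t) (u t)) + ?N (\<lambda>x. u s x - u t x)"
    using eventually_at_within_ne
  proof eventually_elim
    case (elim s)
    then show ?case
      using square_integrable_inner_right[OF u[of s] u[of s]] square_integrable_inner_right[OF u[OF t] u[OF t]]
        square_integrable_inner_right[OF u[of s] u[OF t]]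
      by (simp add: l2_inner_eq[OF \<Omega>] inner_diff_left inner_diff_right inner_commute)
  qed
  have rest: "((\<lambda>s. ?N (\<lambda>x. u s x - u t x)) has_real_derivative 0) (at t within I)"
    unfolding has_field_derivative_iff
  proof (rule Lim_null_comparison)
    have "((\<lambda>s. \<bar>s - t\<bar> * (2 * (l2_norm \<Omega> (?w s))\<^sup>2 + 2 * ?N u')) \<longlongrightarrow> \<bar>t - t\<bar> * (2 * 0\<^sup>2 + 2 * ?N u')) (at t within I)"
      by (intro tendsto_intros d[unfolded has_L2_time_derivative_def])
    then show "((\<lambda>s. \<bar>s - t\<bar> * (2 * (l2_norm \<Omega> (?w s))\<^sup>2 + 2 * ?N u')) \<longlongrightarrow> 0) (at t within I)" by simp
    show "\<forall>\<^sub>F s in at t within I. norm ((?N (\<lambda>x. u s x - u t x) - ?N (\<lambda>x. u t x - u t x)) / (s - t))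
       \<le> \<bar>s - t\<bar> * (2 * (l2_norm \<Omega> (?w s))\<^sup>2 + 2 * ?N u')"
      using eventually_at_within_ne
    proof eventually_elim
      case (elim s)
      have sq: "square_integrable (lebesgue_on \<Omega>) (?w s)"
        by (intro square_integrable_diff square_integrable_scaleR u u' t) (use elim in auto)
      \<comment> \<open>The parallelogram identity yields |a + b|^2 \<le> 2 |a|^2 + 2 |b|^2, which
        separates the error of the difference quotient from the derivative.\<close>
      have pw: "inner (u s x - u t x) (u s x - u t x) \<le> (s - t)\<^sup>2 * (2 * (norm (?w s x))\<^sup>2 + 2 * (norm (u' x))\<^sup>2)" for x
      proof -
        have "u s x - u t x = (s - t) *\<^sub>R (?w s x + u' x)" using elim by simp
        then have "inner (u s x - u t x) (u s x - u t x) = (s - t)\<^sup>2 * (norm (?w s x + u' x))\<^sup>2"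
          by (metis norm_scaleR power2_abs power2_norm_eq_inner power_mult_distrib)
        also have "(norm (?w s x + u' x))\<^sup>2 \<le> 2 * (norm (?w s x))\<^sup>2 + 2 * (norm (u' x))\<^sup>2"
        proof -
          have "(norm (a + b))\<^sup>2 + (norm (a - b))\<^sup>2 = 2 * (norm a)\<^sup>2 + 2 * (norm b)\<^sup>2" for a b :: 'b
            by (simp add: power2_norm_eq_inner inner_simps inner_commute)
          then show ?thesis by (smt (verit) zero_le_power2)
        qed
        finally show ?thesis by (simp add: mult_left_mono)
      qed
      have "?N (\<lambda>x. u s x - u t x) \<le> (\<integral>x. (s - t)\<^sup>2 * (2 * (norm (?w s x))\<^sup>2 + 2 * (norm (u' x))\<^sup>2) \<partial>lebesgue_on \<Omega>)"
        unfolding l2_inner_eq[OF \<Omega>]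
        by (intro integral_mono pw square_integrable_inner_right square_integrable_diff u t integrable_mult_right Bochner_Integration.integrable_add)
           (use sq u' elim in \<open>auto simp: square_integrable_def\<close>)
      also have "\<dots> = (s - t)\<^sup>2 * (2 * (l2_norm \<Omega> (?w s))\<^sup>2 + 2 * ?N u')"
        using sq u' by (simp add: l2_norm_power2[OF \<Omega>] l2_inner_eq[OF \<Omega>] square_integrable_def power2_norm_eq_inner[symmetric])
      finally have le: "?N (\<lambda>x. u s x - u t x) \<le> (s - t)\<^sup>2 * (2 * (l2_norm \<Omega> (?w s))\<^sup>2 + 2 * ?N u')" .
      have "?N (\<lambda>x. u s x - u t x) \<ge> 0" by (simp add: l2_inner_eq[OF \<Omega>])
      then have "norm ((?N (\<lambda>x. u s x - u t x) - ?N (\<lambda>x. u t x - u t x)) / (s - t)) = ?N (\<lambda>x. u s x - u t x) / \<bar>s - t\<bar>"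
        by (simp add: l2_inner_eq[OF \<Omega>])
      also have "\<dots> \<le> (s - t)\<^sup>2 * (2 * (l2_norm \<Omega> (?w s))\<^sup>2 + 2 * ?N u') / \<bar>s - t\<bar>"
        by (intro divide_right_mono le) simp
      also have "\<dots> = \<bar>s - t\<bar> * (2 * (l2_norm \<Omega> (?w s))\<^sup>2 + 2 * ?N u')"
      proof -
        have "(s - t)\<^sup>2 * c / \<bar>s - t\<bar> = \<bar>s - t\<bar> * c" for c
        proof -
          have "r\<^sup>2 * c / \<bar>r\<bar> = \<bar>r\<bar> * c" if "r \<noteq> 0" for r :: real
            using that by (cases "r > 0") (auto simp: power2_eq_square)
          then show ?thesis using elim by simp
        qed
        then show ?thesis .
      qed
      finally show ?case .
    qed
  qed
  have D: "((\<lambda>s. ?N (u t) + 2 * (l2_inner \<Omega> (u s) (u t) - l2_inner \<Omega> (u t) (u t)) + ?N (\<lambda>x. u s x - u t x))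
     has_real_derivative 2 * l2_inner \<Omega> u' (u t)) (at t within I)"
    by (rule DERIV_cong[OF DERIV_add[OF DERIV_add[OF DERIV_const
          DERIV_cmult[OF DERIV_diff[OF l2_inner_has_derivative[OF \<Omega> u t u' u[OF t] d] DERIV_const]]] rest]]) auto
  have at_t: "?N (u t) = ?N (u t) + 2 * (l2_inner \<Omega> (u t) (u t) - l2_inner \<Omega> (u t) (u t)) + ?N (\<lambda>x. u t x - u t x)"
    by (simp add: l2_inner_eq[OF \<Omega>])
  show ?thesis
    by (rule iffD2[OF has_field_derivative_cong_eventually[OF dec at_t] D])
qed

lemma constant_on_if_derivative_0:
  fixes f :: "real \<Rightarrow> real"
  assumes "\<And>t. t \<in> {0..\<tau>} \<Longrightarrow> (f has_real_derivative 0) (at t within {0..\<tau>})"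
  shows "f constant_on {0..\<tau>}"
  using has_field_derivative_zero_constant[of "{0..\<tau>}" f] assms
  by (auto simp: constant_on_def)

section \<open>Integral identities for the nonlinear and viscous terms\<close>

lemma antisym_quadratic_form_0:
  fixes W :: "'d::finite gradient" and w :: "'d point"
  assumes "\<And>i j. W $ i $ j = - W $ j $ i"
  shows "(\<Sum>i\<in>UNIV. \<Sum>j\<in>UNIV. w $ i * w $ j * W $ i $ j) = 0"
proof -
  have "(\<Sum>i\<in>UNIV. \<Sum>j\<in>UNIV. w $ i * w $ j * W $ i $ j) = (\<Sum>i\<in>UNIV. \<Sum>j\<in>UNIV. w $ j * w $ i * W $ j $ i)"
    by (rule sum.swap)
  also have "\<dots> = - (\<Sum>i\<in>UNIV. \<Sum>j\<in>UNIV. w $ i * w $ j * W $ i $ j)"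
    unfolding sum_negf[symmetric]
    by (intro sum.cong refl) (use assms in \<open>metis mult.commute mult_minus_right\<close>)
  finally show ?thesis by simp
qed

lemma inner_matrix_vector: "inner (G *v w) v = (\<Sum>i\<in>UNIV. \<Sum>j\<in>UNIV. G $ i $ j * w $ j * v $ i)"
  for w v :: "'d::finite point"
  by (simp add: inner_vec_def matrix_vector_mult_def sum_distrib_right)

lemma trace_mult_inner: "trace G * inner w v = (\<Sum>i\<in>UNIV. \<Sum>j\<in>UNIV. G $ j $ j * w $ i * v $ i)"
  for w v :: "'d::finite point"
  by (simp add: inner_vec_def trace_def sum_distrib_left sum_distrib_right mult.assoc)

lemma inner_transpose_vector: "inner (transpose G *v w) v = (\<Sum>i\<in>UNIV. \<Sum>j\<in>UNIV. G $ j $ i * w $ j * v $ i)"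
  for w v :: "'d::finite point"
  by (simp add: inner_matrix_vector transpose_def)

lemma sym_grad_mult: "2 *\<^sub>R (sym_grad G *v w) = G *v w + transpose G *v w"
  by (simp add: sym_grad_def scaleR_matrix_vector_assoc[symmetric] matrix_vector_mult_add_rdistrib)

locale fe_velocity_space = fe_domain \<T> \<Omega> for \<T> :: "('d::finite point) set set" and \<Omega> +
  fixes X :: "('d point \<Rightarrow> 'd point) set"
  assumes X_H10: "X \<subseteq> H10 \<Omega>" and X_pp: "v \<in> X \<Longrightarrow> piecewise_polynomial \<T> \<Omega> v"
begin

lemma X_square_integrable: "v \<in> X \<Longrightarrow> square_integrable (lebesgue_on \<Omega>) v"
  using X_H10 by (auto intro: H10_imp_square_integrable sets_\<Omega>)

lemma X_H10_scalar: "v \<in> X \<Longrightarrow> H10_scalar \<Omega> (\<lambda>x. v x $ i) (\<lambda>x. weak_grad \<Omega> v x $ i)"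
  using X_H10 by (auto intro: H10_imp_H10_scalar lmeasurable_\<Omega> open_\<Omega>)

lemma X_ess_bounded:
  assumes "v \<in> X"
  shows "ess_bounded (lebesgue_on \<Omega>) (\<lambda>x. v x $ i)" "ess_bounded (lebesgue_on \<Omega>) (\<lambda>x. weak_grad \<Omega> v x $ i $ j)"
proof -
  obtain C where C: "AE x in lebesgue_on \<Omega>. norm (v x) \<le> C \<and> norm (weak_grad \<Omega> v x) \<le> C"
    using piecewise_polynomial_bounded[of v] assms X_H10 X_pp by blast
  have "AE x in lebesgue_on \<Omega>. \<bar>v x $ i\<bar> \<le> C"
    using C by eventually_elim (use component_le_norm_cart order_trans in blast)
  moreover have "AE x in lebesgue_on \<Omega>. \<bar>weak_grad \<Omega> v x $ i $ j\<bar> \<le> C"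
    using C
  proof eventually_elim
    case (elim x)
    have "\<bar>weak_grad \<Omega> v x $ i $ j\<bar> \<le> norm (weak_grad \<Omega> v x $ i)" by (rule component_le_norm_cart)
    also have "\<dots> \<le> norm (weak_grad \<Omega> v x)" by (rule Finite_Cartesian_Product.norm_nth_le)
    finally show ?case using elim by linarith
  qed
  ultimately show "ess_bounded (lebesgue_on \<Omega>) (\<lambda>x. v x $ i)"
    "ess_bounded (lebesgue_on \<Omega>) (\<lambda>x. weak_grad \<Omega> v x $ i $ j)"
    using H10_scalarD(2,3)[OF X_H10_scalar[OF assms]]
    by (auto simp: ess_bounded_def square_integrable_def)
qed

lemmas X_integrable = ess_bounded_integrable[OF finite_measure_\<Omega>]

lemma trilinear:
  assumes "u \<in> X" "v \<in> X" "w \<in> X"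
  shows "(\<integral>x. weak_grad \<Omega> u x $ i $ j * v x $ k * w x $ l + u x $ i * weak_grad \<Omega> v x $ k $ j * w x $ l
            + u x $ i * v x $ k * weak_grad \<Omega> w x $ l $ j \<partial>lebesgue_on \<Omega>) = 0"
proof -
  obtain C D where C: "AE x in lebesgue_on \<Omega>. \<bar>u x $ i\<bar> \<le> C" and D: "AE x in lebesgue_on \<Omega>. \<bar>v x $ k\<bar> \<le> D"
    using X_ess_bounded(1)[OF assms(1)] X_ess_bounded(1)[OF assms(2)] unfolding ess_bounded_def by metis
  have "AE x in lebesgue_on \<Omega>. \<bar>u x $ i\<bar> \<le> max C D" using C by eventually_elim auto
  moreover have "AE x in lebesgue_on \<Omega>. \<bar>v x $ k\<bar> \<le> max C D" using D by eventually_elim auto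
  ultimately show ?thesis
    by (intro H10_scalar_trilinear X_H10_scalar assms)
qed

text \<open>The index functions select the components entering each summand, so the energy and
  momentum identities below are instances with different contraction patterns.\<close>

lemma trilinear_sum:
  assumes "u \<in> X" "v \<in> X" "w \<in> X"
  shows "(\<integral>x. (\<Sum>m\<in>UNIV. \<Sum>n\<in>UNIV. weak_grad \<Omega> u x $ i m n $ j m n * v x $ k m n * w x $ l m n
            + u x $ i m n * weak_grad \<Omega> v x $ k m n $ j m n * w x $ l m n
            + u x $ i m n * v x $ k m n * weak_grad \<Omega> w x $ l m n $ j m n) \<partial>lebesgue_on \<Omega>) = 0"
  (is "(\<integral>x. (\<Sum>m\<in>UNIV. \<Sum>n\<in>UNIV. ?T m n x) \<partial>_) = 0")
proof -
  have "ess_bounded (lebesgue_on \<Omega>) (?T m n)" for m n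
    by (intro ess_bounded_intros X_ess_bounded assms)
  then have int: "integrable (lebesgue_on \<Omega>) (?T m n)" for m n
    by (rule X_integrable)
  have "(\<integral>x. (\<Sum>m\<in>UNIV. \<Sum>n\<in>UNIV. ?T m n x) \<partial>lebesgue_on \<Omega>) = (\<Sum>m\<in>UNIV. \<Sum>n\<in>UNIV. \<integral>x. ?T m n x \<partial>lebesgue_on \<Omega>)"
    by (subst Bochner_Integration.integral_sum, intro Bochner_Integration.integrable_sum int)
       (intro sum.cong refl Bochner_Integration.integral_sum int)
  also have "\<dots> = 0"
    by (intro sum.neutral ballI trilinear assms)
  finally show ?thesis .
qed

text \<open>Twice the integrand is the divergence of |u|^2 u.\<close>

lemma energy_identity:
  assumes "u \<in> X"
  shows "(\<integral>x. inner (weak_grad \<Omega> u x *v u x + (1/2 * trace (weak_grad \<Omega> u x)) *\<^sub>R u x) (u x) \<partial>lebesgue_on \<Omega>) = 0"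
proof -
  have E: "inner (G *v w + (1/2 * trace G) *\<^sub>R w) w =
      1/2 * (\<Sum>m\<in>UNIV. \<Sum>n\<in>UNIV. G $ m $ n * w $ m * w $ n + w $ m * G $ m $ n * w $ n + w $ m * w $ m * G $ n $ n)"
    for G :: "'d gradient" and w :: "'d point"
    using inner_matrix_vector[of G w w] trace_mult_inner[of G w w]
    by (simp add: inner_add_left sum.distrib sum_distrib_left mult_ac)
  show ?thesis
    unfolding E integral_mult_right_zero
      trilinear_sum[OF assms assms assms, of "\<lambda>m n. m" "\<lambda>m n. n" "\<lambda>m n. m" "\<lambda>m n. n"]
    by simp
qed

text \<open>The integrand is the divergence of (u . v) u minus the contraction of the symmetric
  tensor of products \<open>u\<^sub>m u\<^sub>n\<close> with the gradient of \<open>v\<close>, which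
  is antisymmetric where \<open>u\<close> is nonzero.\<close>

lemma convective_momentum_identity:
  assumes u: "u \<in> X" and v: "v \<in> X"
    and AE: "AE x in lebesgue_on \<Omega>. u x = 0 \<or> (\<forall>i j. weak_grad \<Omega> v x $ i $ j = - weak_grad \<Omega> v x $ j $ i)"
  shows "(\<integral>x. inner (weak_grad \<Omega> u x *v u x + trace (weak_grad \<Omega> u x) *\<^sub>R u x) (v x) \<partial>lebesgue_on \<Omega>) = 0"
proof -
  let ?G = "weak_grad \<Omega> u" and ?V = "weak_grad \<Omega> v"
  let ?T = "\<lambda>x. \<Sum>m\<in>UNIV. \<Sum>n\<in>UNIV. ?G x $ m $ n * u x $ n * v x $ m + u x $ m * ?G x $ n $ n * v x $ m + u x $ m * u x $ n * ?V x $ m $ n"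
  let ?R = "\<lambda>x. \<Sum>m\<in>UNIV. \<Sum>n\<in>UNIV. u x $ m * u x $ n * ?V x $ m $ n"
  have "inner (?G x *v u x + trace (?G x) *\<^sub>R u x) (v x) = ?T x - ?R x" for x
    using inner_matrix_vector[of "?G x" "u x" "v x"] trace_mult_inner[of "?G x" "u x" "v x"]
    by (simp add: inner_add_left sum.distrib mult_ac)
  moreover have "(\<integral>x. ?T x - ?R x \<partial>lebesgue_on \<Omega>) = (\<integral>x. ?T x \<partial>lebesgue_on \<Omega>) - (\<integral>x. ?R x \<partial>lebesgue_on \<Omega>)"
    by (intro Bochner_Integration.integral_diff X_integrable ess_bounded_intros X_ess_bounded u v)
  moreover have "(\<integral>x. ?T x \<partial>lebesgue_on \<Omega>) = 0"
    using trilinear_sum[OF u u v, of "\<lambda>m n. m" "\<lambda>m n. n" "\<lambda>m n. n" "\<lambda>m n. m"] .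
  moreover have "(\<integral>x. ?R x \<partial>lebesgue_on \<Omega>) = 0"
  proof (rule integral_eq_zero_AE)
    show "AE x in lebesgue_on \<Omega>. ?R x = 0"
      using AE by eventually_elim (auto intro: antisym_quadratic_form_0)
  qed
  ultimately show ?thesis by simp
qed

text \<open>The transposed gradient applied to \<open>u\<close> is the gradient of |u|^2 / 2.
  Integration by parts moves the derivative to the divergence of \<open>v\<close>, the trace of a
  matrix that is antisymmetric where \<open>u\<close> is nonzero.\<close>

lemma transpose_momentum_identity:
  assumes u: "u \<in> X" and v: "v \<in> X"
    and AE: "AE x in lebesgue_on \<Omega>. u x = 0 \<or> (\<forall>i j. weak_grad \<Omega> v x $ i $ j = - weak_grad \<Omega> v x $ j $ i)"
  shows "(\<integral>x. inner (transpose (weak_grad \<Omega> u x) *v u x) (v x) \<partial>lebesgue_on \<Omega>) = 0"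
proof -
  let ?G = "weak_grad \<Omega> u" and ?V = "weak_grad \<Omega> v"
  let ?T = "\<lambda>x. \<Sum>m\<in>UNIV. \<Sum>n\<in>UNIV. ?G x $ n $ m * u x $ n * v x $ m + u x $ n * ?G x $ n $ m * v x $ m + u x $ n * u x $ n * ?V x $ m $ m"
  let ?R = "\<lambda>x. \<Sum>m\<in>UNIV. \<Sum>n\<in>UNIV. u x $ n * u x $ n * ?V x $ m $ m"
  have "2 * inner (transpose (?G x) *v u x) (v x) = ?T x - ?R x" for x
    using inner_transpose_vector[of "?G x" "u x" "v x"]
    by (simp add: sum.distrib sum_distrib_left mult_ac)
  then have "2 * (\<integral>x. inner (transpose (?G x) *v u x) (v x) \<partial>lebesgue_on \<Omega>) = (\<integral>x. ?T x - ?R x \<partial>lebesgue_on \<Omega>)"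
    by (simp flip: integral_mult_right_zero)
  also have "\<dots> = (\<integral>x. ?T x \<partial>lebesgue_on \<Omega>) - (\<integral>x. ?R x \<partial>lebesgue_on \<Omega>)"
    by (intro Bochner_Integration.integral_diff X_integrable ess_bounded_intros X_ess_bounded u v)
  also have "(\<integral>x. ?T x \<partial>lebesgue_on \<Omega>) = 0"
    using trilinear_sum[OF u u v, of "\<lambda>m n. n" "\<lambda>m n. m" "\<lambda>m n. n" "\<lambda>m n. m"] .
  also have "(\<integral>x. ?R x \<partial>lebesgue_on \<Omega>) = 0"
  proof (rule integral_eq_zero_AE)
    have diag: "W $ m $ m = 0" if "\<forall>i j. W $ i $ j = - W $ j $ i" for W :: "'d gradient" and m
    proof -
      have "W $ m $ m = - W $ m $ m" using that by blast
      then show ?thesis by simp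
    qed
    show "AE x in lebesgue_on \<Omega>. ?R x = 0"
      using AE
    proof eventually_elim
      case (elim x)
      then show ?case
      proof
        assume "\<forall>i j. ?V x $ i $ j = - ?V x $ j $ i"
        from diag[OF this] show ?thesis by simp
      qed simp
    qed
  qed
  finally show ?thesis by simp
qed

text \<open>Where the gradient of \<open>u\<close> is nonzero, that of \<open>v\<close> is the
  constant matrix \<open>W\<close>. What remains is \<open>W\<close> contracted with the integral of
  the gradient of \<open>u\<close>, which is zero.\<close>

lemma viscous_momentum_identity:
  assumes u: "u \<in> X" and v: "v \<in> X"
    and AE: "AE x in lebesgue_on \<Omega>. weak_grad \<Omega> u x = 0 \<or> weak_grad \<Omega> v x = W"
  shows "l2_inner \<Omega> (weak_grad \<Omega> u) (weak_grad \<Omega> v) = 0"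
proof -
  let ?G = "weak_grad \<Omega> u" and ?V = "weak_grad \<Omega> v"
  have "l2_inner \<Omega> ?G ?V = (\<integral>x. (\<Sum>m\<in>UNIV. \<Sum>n\<in>UNIV. ?G x $ m $ n * ?V x $ m $ n) \<partial>lebesgue_on \<Omega>)"
    by (simp add: l2_inner_eq[OF sets_\<Omega>] inner_vec_def)
  also have "\<dots> = (\<integral>x. (\<Sum>m\<in>UNIV. \<Sum>n\<in>UNIV. ?G x $ m $ n * W $ m $ n) \<partial>lebesgue_on \<Omega>)"
  proof (rule integral_cong_AE)
    have "ess_bounded (lebesgue_on \<Omega>) (\<lambda>x. \<Sum>m\<in>UNIV. \<Sum>n\<in>UNIV. ?G x $ m $ n * ?V x $ m $ n)"
      "ess_bounded (lebesgue_on \<Omega>) (\<lambda>x. \<Sum>m\<in>UNIV. \<Sum>n\<in>UNIV. ?G x $ m $ n * W $ m $ n)"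
      by (intro ess_bounded_intros X_ess_bounded u v)+
    then show "(\<lambda>x. \<Sum>m\<in>UNIV. \<Sum>n\<in>UNIV. ?G x $ m $ n * ?V x $ m $ n) \<in> borel_measurable (lebesgue_on \<Omega>)"
      "(\<lambda>x. \<Sum>m\<in>UNIV. \<Sum>n\<in>UNIV. ?G x $ m $ n * W $ m $ n) \<in> borel_measurable (lebesgue_on \<Omega>)"
      by (auto simp: ess_bounded_def)
    show "AE x in lebesgue_on \<Omega>. (\<Sum>m\<in>UNIV. \<Sum>n\<in>UNIV. ?G x $ m $ n * ?V x $ m $ n) =
        (\<Sum>m\<in>UNIV. \<Sum>n\<in>UNIV. ?G x $ m $ n * W $ m $ n)"
      using AE by eventually_elim auto
  qed
  also have "\<dots> = (\<Sum>m\<in>UNIV. \<Sum>n\<in>UNIV. \<integral>x. ?G x $ m $ n * W $ m $ n \<partial>lebesgue_on \<Omega>)"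
    by (subst Bochner_Integration.integral_sum, intro X_integrable ess_bounded_intros X_ess_bounded u)
       (intro sum.cong refl Bochner_Integration.integral_sum X_integrable ess_bounded_intros X_ess_bounded u)
  also have "\<dots> = 0"
    by (simp add: H10_scalar_integral_gradient[OF X_H10_scalar[OF u] lmeasurable_\<Omega>])
  finally show ?thesis .
qed

lemma velocity_inner_has_derivative:
  assumes "\<And>s. s \<in> I \<Longrightarrow> u s \<in> X" "t \<in> I" "u' \<in> X" "v \<in> X" "has_L2_time_derivative \<Omega> I u t u'"
  shows "((\<lambda>s. l2_inner \<Omega> (u s) v) has_real_derivative l2_inner \<Omega> u' v) (at t within I)"
  by (rule l2_inner_has_derivative[OF sets_\<Omega> _ assms(2) _ _ assms(5)])
     (auto intro: X_square_integrable assms)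

lemma velocity_norm_has_derivative:
  assumes "\<And>s. s \<in> I \<Longrightarrow> u s \<in> X" "t \<in> I" "u' \<in> X" "has_L2_time_derivative \<Omega> I u t u'"
  shows "((\<lambda>s. l2_inner \<Omega> (u s) (u s)) has_real_derivative 2 * l2_inner \<Omega> u' (u t)) (at t within I)"
  by (rule l2_norm_power2_has_derivative[OF sets_\<Omega> _ assms(2) _ assms(4)])
     (auto intro: X_square_integrable assms)

end

subsection \<open>Conservation laws\<close>

text \<open>The only property of the index types \<open>2\<close> and \<open>3\<close> used for the conservation results.\<close>

definition restr3_adjoint :: "'d::{finite,numeral} itself \<Rightarrow> bool" where
  "restr3_adjoint _ \<longleftrightarrow> (\<forall>z (w :: 'd point). inner (restr3 z) w = inner z (ext3 w))"

lemma restr3_adjoint_2: "restr3_adjoint TYPE(2)"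
  unfolding restr3_adjoint_def restr3_def ext3_def
  by (auto simp: inner_vec_def sum_2 sum_3)

lemma restr3_adjoint_3: "restr3_adjoint TYPE(3)"
  unfolding restr3_adjoint_def restr3_def ext3_def
  by (auto simp: inner_vec_def sum_3)

lemma ext3_nth:
  "ext3 w $ 1 = w $ 1" "ext3 w $ 2 = w $ 2" "ext3 (w :: 'd::{finite,numeral} point) $ 3 = (if CARD('d) = 3 then w $ 3 else 0)"
  by (simp_all add: ext3_def)

lemma linear_ext3: "linear ext3"
  by (rule linearI) (auto simp: vec_eq_iff forall_3 ext3_nth algebra_simps)

lemma cross3_nth:
  "cross3 a b $ 1 = a $ 2 * b $ 3 - a $ 3 * b $ 2"
  "cross3 a b $ 2 = a $ 3 * b $ 1 - a $ 1 * b $ 3"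
  "cross3 a b $ 3 = a $ 1 * b $ 2 - a $ 2 * b $ 1"
  by (simp_all add: cross3_def)

lemma cross3_cyclic: "inner (cross3 a b) c = inner (cross3 c a) b"
  by (simp add: inner_vec_def sum_3 cross3_nth algebra_simps)

lemma classical_grad_linear:
  assumes "linear g"
  shows "classical_grad g x $ i $ j = g (axis j 1) $ i"
proof -
  have "linear (\<lambda>x. g x $ i)"
    using assms by (auto simp: linear_iff)
  then have "((\<lambda>x. g x $ i) has_derivative (\<lambda>x. g x $ i)) (at x)"
    by (rule linear_imp_has_derivative)
  from partial_deriv_eq[OF this] show ?thesis by (simp add: classical_grad_def)
qed

lemma classical_grad_const: "classical_grad (\<lambda>x. c) x = 0"
  by (simp add: classical_grad_def partial_deriv_def vec_eq_iff)

text \<open>The j-th component is the determinant of x, e_i, e_j, linear in x and antisymmetric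
  under the exchange of the outer two vectors.\<close>

lemma rigid_field_linear:
  assumes "restr3_adjoint TYPE('d)"
  defines "g \<equiv> \<lambda>i (x :: 'd::{finite,numeral} point). restr3 (cross3 (ext3 x) (axis i 1)) :: 'd point"
  shows "linear (g i)" "g i (axis k 1) $ j = - g i (axis j 1) $ k"
proof -
  have comp: "g i x $ j = inner (cross3 (ext3 x) (axis i 1)) (ext3 (axis j 1 :: 'd point))" for x j
  proof -
    have "g i x $ j = inner (g i x) (axis j 1)" by (simp add: inner_axis)
    then show ?thesis using assms(1) by (simp add: g_def restr3_adjoint_def)
  qed
  note le = linear_add[OF linear_ext3] linear_cmul[OF linear_ext3]
  show "linear (g i)"
    by (rule linearI) (auto simp: vec_eq_iff comp le cross_add_left cross_mult_left inner_add_left)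
  show "g i (axis k 1) $ j = - g i (axis j 1) $ k"
    unfolding comp by (simp add: inner_vec_def sum_3 cross3_nth algebra_simps)
qed

lemma polynomial_function_linear: "linear (g :: 'a::euclidean_space \<Rightarrow> 'b::euclidean_space) \<Longrightarrow> polynomial_function g"
  by (simp add: polynomial_function_bounded_linear linear_conv_bounded_linear)

lemma rigid_field_grad:
  assumes d: "restr3_adjoint TYPE('d)" and g: "g \<in> (rigid_fields :: ('d::{finite,numeral} point \<Rightarrow> 'd point) set)"
  obtains W where "polynomial_function g" "\<And>x. classical_grad g x = W" "\<And>i j. W $ i $ j = - W $ j $ i"
proof (cases "\<exists>i. g = (\<lambda>x. axis i 1)")
  case True
  then show ?thesis by (auto intro!: that[of 0] simp: classical_grad_const)
next
  case False
  then obtain i where g: "g = (\<lambda>x. restr3 (cross3 (ext3 x) (axis i 1)))"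
    using g by (auto simp: rigid_fields_def)
  note l = rigid_field_linear[OF d, where i = i, folded g]
  show ?thesis
  proof (rule that)
    show "polynomial_function g" by (rule polynomial_function_linear[OF l(1)])
    show "classical_grad g x = (\<chi> j k. g (axis k 1) $ j)" for x
      by (simp add: vec_eq_iff classical_grad_linear[OF l(1)])
    show "(\<chi> j k. g (axis k 1) $ j) $ j $ k = - (\<chi> j k. g (axis k 1) $ j) $ k $ j" for j k
      using l(2)[of k j] by (simp add: g)
  qed
qed

text \<open>Each term is linear in the velocity argument. Hence the forces of the counterexamples
  vanish where the velocity does, whichever representative of the gradient is used there.\<close>

lemma NL_zero_velocity:
  assumes "restr3_adjoint TYPE('d)"
  shows "NL F (G :: 'd::{finite,numeral} gradient) 0 = 0"
proof -
  have "restr3 0 = (0 :: 'd point)" by (simp add: restr3_def vec_eq_iff)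
  then show ?thesis by (cases F) (auto simp: linear_0[OF linear_ext3])
qed

lemma ess_bounded_NL:
  fixes w :: "'a \<Rightarrow> 'd::{finite,numeral} point" and G :: "'a \<Rightarrow> 'd gradient"
  assumes w: "\<And>i. ess_bounded M (\<lambda>x. w x $ i)" and G: "\<And>i j. ess_bounded M (\<lambda>x. G x $ i $ j)"
  shows "ess_bounded M (\<lambda>x. NL F (G x) (w x) $ i)"
proof -
  have c: "ess_bounded M (\<lambda>x. ext3 (w x) $ k)" for k
    using exhaust_3[of k] w
    by (cases "CARD('d) = 3") (auto simp: ext3_nth intro: ess_bounded_const)
  have c': "ess_bounded M (\<lambda>x. ext3 (G x $ j) $ k)" for j k
    using exhaust_3[of k] G
    by (cases "CARD('d) = 3") (auto simp: ext3_nth intro: ess_bounded_const)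
  have c'': "ess_bounded M (\<lambda>x. ext3_mat (G x) $ j $ k)" for j k
    using exhaust_3[of j] c'
    by (cases "CARD('d) = 3") (auto simp: ext3_mat_def intro: ess_bounded_const)
  have curl: "ess_bounded M (\<lambda>x. curl_of_grad (ext3_mat (G x)) $ k)" for k
    using exhaust_3[of k] by (auto simp: curl_of_grad_def intro!: ess_bounded_diff c'')
  have cr: "ess_bounded M (\<lambda>x. cross3 (curl_of_grad (ext3_mat (G x))) (ext3 (w x)) $ k)" for k
    using exhaust_3[of k] by (auto simp: cross3_nth intro!: ess_bounded_diff ess_bounded_mult curl c)
  have half: "ess_bounded M (\<lambda>x. h x / 2)" if "ess_bounded M h" for h
    using ess_bounded_mult[OF ess_bounded_const[of _ "1/2"] that] by simp
  show ?thesis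
  proof (cases F)
    case Rotational
    then show ?thesis using cr by (cases "i = 1"; cases "i = 2") (auto simp: restr3_def)
  qed (auto simp: matrix_vector_mult_def trace_def sym_grad_def transpose_def intro!: w G ess_bounded_intros half)
qed

locale galerkin_problem = fe_velocity_space \<T> \<Omega> X
  for \<T> :: "('d::{finite,numeral} point) set set" and \<Omega> X +
  fixes Q F \<nu> f \<tau> u p
  assumes restr3_adjoint: "restr3_adjoint TYPE('d)"
    and setting: "galerkin_setting F \<T> \<Omega> X Q \<nu> f \<tau> u p"

lemma galerkin_problemI:
  assumes "restr3_adjoint TYPE('d)" "galerkin_setting F \<T> (\<Omega> :: ('d::{finite,numeral} point) set) X Q \<nu> f \<tau> u p"
  shows "galerkin_problem \<T> \<Omega> X Q F \<nu> f \<tau> u p"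
  using assms by unfold_locales (auto simp: galerkin_setting_def finite_element_pair_def)

context galerkin_problem
begin

lemma solution:
  assumes "t \<in> {0..\<tau>}"
  obtains u' where "u' \<in> X" "has_L2_time_derivative \<Omega> {0..\<tau>} u t u'"
    "\<And>v q. v \<in> X \<Longrightarrow> q \<in> Q \<Longrightarrow>
              l2_inner \<Omega> (\<lambda>x. u' x + NL F (weak_grad \<Omega> (u t) x) (u t x)) v
              - l2_inner \<Omega> (p t) (weak_div \<Omega> v)
              + l2_inner \<Omega> q (weak_div \<Omega> (u t))
              + \<nu> * l2_inner \<Omega> (weak_grad \<Omega> (u t)) (weak_grad \<Omega> v)
              = l2_inner \<Omega> (f t) v"
  using setting assms unfolding galerkin_setting_def galerkin_solution_def by blast

lemma u_X: "t \<in> {0..\<tau>} \<Longrightarrow> u t \<in> X" and p_Q: "t \<in> {0..\<tau>} \<Longrightarrow> p t \<in> Q"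
  and f_L2: "t \<in> {0..\<tau>} \<Longrightarrow> square_integrable (lebesgue_on \<Omega>) (f t)"
  using setting by (auto simp: galerkin_setting_def galerkin_solution_def L2_on_iff[OF sets_\<Omega>])

text \<open>Testing with q = 0 removes the divergence constraint from the momentum balance.\<close>

lemma zero_in_Q: "(\<lambda>x. 0) \<in> Q"
proof -
  have "finite_dim_space Q" using setting by (simp add: galerkin_setting_def finite_element_pair_def)
  then obtain B where "Q = range (\<lambda>(c :: ('d point \<Rightarrow> real) \<Rightarrow> real) x. \<Sum>b\<in>B. c b *\<^sub>R b x)"
    by (auto simp: finite_dim_space_def)
  then show ?thesis by (auto intro!: image_eqI[of _ _ "\<lambda>b. 0"])
qed

lemma NL_inner_integrable:
  assumes "w \<in> X" "v \<in> X"
  shows "integrable (lebesgue_on \<Omega>) (\<lambda>x. inner (NL F (weak_grad \<Omega> w x) (w x)) (v x))"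
  unfolding inner_vec_def
  by (simp, intro X_integrable ess_bounded_intros ess_bounded_NL X_ess_bounded assms)

lemma l2_inner_add_NL:
  assumes "u' \<in> X" "w \<in> X" "v \<in> X"
  shows "l2_inner \<Omega> (\<lambda>x. u' x + NL F (weak_grad \<Omega> w x) (w x)) v =
    l2_inner \<Omega> u' v + (\<integral>x. inner (NL F (weak_grad \<Omega> w x) (w x)) (v x) \<partial>lebesgue_on \<Omega>)"
  using square_integrable_inner_right[OF X_square_integrable[OF assms(1)] X_square_integrable[OF assms(3)]]
    NL_inner_integrable[OF assms(2,3)]
  by (simp add: l2_inner_eq[OF sets_\<Omega>] inner_add_left)

text \<open>The rotational term is a cross product with the velocity and pointwise orthogonal to it.
  A matrix and its transpose define the same quadratic form, so the EMA term tested with the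
  velocity is twice the skew-symmetric one.\<close>

lemma NL_energy:
  assumes F: "F \<in> {Skew_Symmetric, Rotational, EMA_Conserving}" and w: "w \<in> X"
  shows "(\<integral>x. inner (NL F (weak_grad \<Omega> w x) (w x)) (w x) \<partial>lebesgue_on \<Omega>) = 0"
proof -
  consider "F = Skew_Symmetric" | "F = Rotational" | "F = EMA_Conserving" using F by auto
  then show ?thesis
  proof cases
    case 1 then show ?thesis using energy_identity[OF w] by simp
  next
    case 2
    then have "inner (NL F G v) v = 0" for G and v :: "'d point"
      using restr3_adjoint by (simp add: restr3_adjoint_def dot_cross_self)
    then show ?thesis by simp
  next
    case 3
    have "inner (transpose G *v v) v = inner (G *v v) v" for G and v :: "'d point"
      by (metis dot_lmul_matrix inner_commute transpose_matrix_vector)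
    then have "inner (NL F G v) v = 2 * inner (G *v v + (1/2 * trace G) *\<^sub>R v) v" for G and v :: "'d point"
      using 3 by (simp add: sym_grad_mult inner_add_left algebra_simps)
    then show ?thesis using energy_identity[OF w] by simp
  qed
qed

theorem energy_conserved:
  assumes F: "F \<in> {Skew_Symmetric, Rotational, EMA_Conserving}" and "\<nu> = 0" "f = (\<lambda>t x. 0)"
  shows "(\<lambda>t. kinetic_energy \<Omega> (u t)) constant_on {0..\<tau>}"
proof -
  have eq: "kinetic_energy \<Omega> w = 1/2 * l2_inner \<Omega> w w" for w :: "'d point \<Rightarrow> 'd point"
    by (simp add: kinetic_energy_def l2_inner_def power2_norm_eq_inner)
  have "(\<lambda>t. l2_inner \<Omega> (u t) (u t)) constant_on {0..\<tau>}"
  proof (rule constant_on_if_derivative_0)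
    fix t assume t: "t \<in> {0..\<tau>}"
    from solution[OF t] obtain u' where u': "u' \<in> X" "has_L2_time_derivative \<Omega> {0..\<tau>} u t u'"
      and eqn: "\<And>v q. v \<in> X \<Longrightarrow> q \<in> Q \<Longrightarrow>
              l2_inner \<Omega> (\<lambda>x. u' x + NL F (weak_grad \<Omega> (u t) x) (u t x)) v
              - l2_inner \<Omega> (p t) (weak_div \<Omega> v)
              + l2_inner \<Omega> q (weak_div \<Omega> (u t))
              + \<nu> * l2_inner \<Omega> (weak_grad \<Omega> (u t)) (weak_grad \<Omega> v)
              = l2_inner \<Omega> (f t) v" by blast
    \<comment> \<open>The test pair is \<open>u t\<close> and \<open>p t\<close>, for which the two
      pressure terms cancel.\<close>
    have "l2_inner \<Omega> u' (u t) = 0"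
      using eqn[OF u_X[OF t] p_Q[OF t]] NL_energy[OF F u_X[OF t]] assms(2,3)
      by (simp add: l2_inner_add_NL[OF u'(1) u_X[OF t] u_X[OF t]] l2_inner_eq[OF sets_\<Omega>, of "\<lambda>x. 0"])
    then show "((\<lambda>t. l2_inner \<Omega> (u t) (u t)) has_real_derivative 0) (at t within {0..\<tau>})"
      using velocity_norm_has_derivative[OF u_X t u'] by simp
  qed
  then show ?thesis unfolding constant_on_def eq by metis
qed

text \<open>Serves both momenta, \<open>g\<close> being a translation or a rotation. Where
  \<open>u\<close>, \<open>p\<close>, \<open>f\<close> are not all zero, \<open>v\<close> is a rigid
  motion with antisymmetric gradient \<open>W\<close>; testing with \<open>v\<close> and q = 0 then
  annihilates the nonlinear, pressure and viscous terms, and the force by its zero momentum.\<close>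

lemma momentum_conserved:
  assumes F: "F \<in> {EMA_Conserving, Conservative}"
    and v: "v \<in> X" and g: "polynomial_function g" "\<And>x. classical_grad g x = W" "\<And>i j. W $ i $ j = - W $ j $ i"
    and vg: "\<And>t. t \<in> {0..\<tau>} \<Longrightarrow> AE x in lebesgue_on \<Omega>. u t x = 0 \<and> p t x = 0 \<and> f t x = 0 \<or> v x = g x"
    and f0: "\<And>t. t \<in> {0..\<tau>} \<Longrightarrow> (\<integral>x. inner (f t x) (g x) \<partial>lebesgue_on \<Omega>) = 0"
  shows "\<exists>c. \<forall>t\<in>{0..\<tau>}. (\<integral>x. inner (u t x) (g x) \<partial>lebesgue_on \<Omega>) = c"
proof -
  have meas_g: "g \<in> borel_measurable (lebesgue_on \<Omega>)"
    by (meson continuous_imp_measurable_on_sets_lebesgue continuous_on_polymonial_function g(1) sets_\<Omega>)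
  have swap: "l2_inner \<Omega> w v = (\<integral>x. inner (w x) (g x) \<partial>lebesgue_on \<Omega>)"
    if "w \<in> borel_measurable (lebesgue_on \<Omega>)" "AE x in lebesgue_on \<Omega>. w x = 0 \<or> v x = g x" for w
    unfolding l2_inner_eq[OF sets_\<Omega>]
  proof (rule integral_cong_AE)
    have "v \<in> borel_measurable (lebesgue_on \<Omega>)"
      using X_square_integrable[OF v] by (simp add: square_integrable_def)
    then show "(\<lambda>x. inner (w x) (v x)) \<in> borel_measurable (lebesgue_on \<Omega>)" using that by measurable
    show "(\<lambda>x. inner (w x) (g x)) \<in> borel_measurable (lebesgue_on \<Omega>)" using that meas_g by measurable
    show "AE x in lebesgue_on \<Omega>. inner (w x) (v x) = inner (w x) (g x)"
      using that(2) by eventually_elim auto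
  qed
  have tr: "trace W = 0"
  proof -
    have "W $ i $ i = 0" for i using g(3)[of i i] by simp
    then show ?thesis by (simp add: trace_def)
  qed
  have "(\<lambda>t. l2_inner \<Omega> (u t) v) constant_on {0..\<tau>}"
  proof (rule constant_on_if_derivative_0)
    fix t assume t: "t \<in> {0..\<tau>}"
    from solution[OF t] obtain u' where u': "u' \<in> X" "has_L2_time_derivative \<Omega> {0..\<tau>} u t u'"
      and eqn: "\<And>v q. v \<in> X \<Longrightarrow> q \<in> Q \<Longrightarrow>
              l2_inner \<Omega> (\<lambda>x. u' x + NL F (weak_grad \<Omega> (u t) x) (u t x)) v
              - l2_inner \<Omega> (p t) (weak_div \<Omega> v)
              + l2_inner \<Omega> q (weak_div \<Omega> (u t))
              + \<nu> * l2_inner \<Omega> (weak_grad \<Omega> (u t)) (weak_grad \<Omega> v)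
              = l2_inner \<Omega> (f t) v" by blast
    have uH: "u t \<in> H10 \<Omega>" and vH: "v \<in> H10 \<Omega>" using u_X[OF t] v X_H10 by auto
    have gv: "AE x in lebesgue_on \<Omega>. v x = g x \<longrightarrow> weak_grad \<Omega> v x = W"
      using piecewise_polynomial_grad_cong[OF vH X_pp[OF v] g(1)] by (simp add: g(2))
    \<comment> \<open>The comparison with the zero polynomial: the gradient of \<open>u t\<close>
      vanishes where \<open>u t\<close> does.\<close>
    have gu: "AE x in lebesgue_on \<Omega>. u t x = 0 \<longrightarrow> weak_grad \<Omega> (u t) x = 0"
      using piecewise_polynomial_grad_cong[OF uH X_pp[OF u_X[OF t]] polynomial_function_const[of 0]]
      by (simp add: classical_grad_const)
    have AE: "AE x in lebesgue_on \<Omega>. u t x = 0 \<and> p t x = 0 \<and> f t x = 0 \<and> weak_grad \<Omega> (u t) x = 0 \<or> v x = g x \<and> weak_grad \<Omega> v x = W"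
      using vg[OF t] gv gu by eventually_elim auto
    have anti: "AE x in lebesgue_on \<Omega>. u t x = 0 \<or> (\<forall>i j. weak_grad \<Omega> v x $ i $ j = - weak_grad \<Omega> v x $ j $ i)"
      using AE by eventually_elim (use g(3) in auto)
    have nl: "(\<integral>x. inner (NL F (weak_grad \<Omega> (u t) x) (u t x)) (v x) \<partial>lebesgue_on \<Omega>) = 0"
    proof (cases "F = Conservative")
      case True
      then show ?thesis using convective_momentum_identity[OF u_X[OF t] v anti] by simp
    next
      case False
      then have E: "F = EMA_Conserving" using F by simp
      let ?a = "\<lambda>x. inner (weak_grad \<Omega> (u t) x *v u t x + trace (weak_grad \<Omega> (u t) x) *\<^sub>R u t x) (v x)"
      let ?b = "\<lambda>x. inner (transpose (weak_grad \<Omega> (u t) x) *v u t x) (v x)"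
      have "inner (NL F (weak_grad \<Omega> (u t) x) (u t x)) (v x) = ?a x + ?b x" for x
        using E by (simp add: sym_grad_mult inner_add_left)
      moreover have "integrable (lebesgue_on \<Omega>) ?a"
        unfolding inner_add_left inner_matrix_vector inner_scaleR_left trace_mult_inner
        by (intro X_integrable ess_bounded_intros X_ess_bounded u_X t v)
      moreover have "integrable (lebesgue_on \<Omega>) ?b"
        unfolding inner_transpose_vector
        by (intro X_integrable ess_bounded_intros X_ess_bounded u_X t v)
      ultimately show ?thesis
        using convective_momentum_identity[OF u_X[OF t] v anti] transpose_momentum_identity[OF u_X[OF t] v anti]
        by simp
    qed
    have pr: "l2_inner \<Omega> (p t) (weak_div \<Omega> v) = 0"
      unfolding l2_inner_eq[OF sets_\<Omega>]
    proof (rule integral_eq_zero_AE)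
      show "AE x in lebesgue_on \<Omega>. inner (p t x) (weak_div \<Omega> v x) = 0"
        using AE by eventually_elim (elim disjE conjE, simp_all add: weak_div_def tr)
    qed
    have vis: "l2_inner \<Omega> (weak_grad \<Omega> (u t)) (weak_grad \<Omega> v) = 0"
      by (rule viscous_momentum_identity[OF u_X[OF t] v, of W]) (use AE in eventually_elim, auto)
    have fv: "l2_inner \<Omega> (f t) v = 0"
    proof -
      have "AE x in lebesgue_on \<Omega>. f t x = 0 \<or> v x = g x" using vg[OF t] by eventually_elim auto
      then show ?thesis using swap[of "f t"] f_L2[OF t] f0[OF t] by (simp add: square_integrable_def)
    qed
    have "l2_inner \<Omega> u' v = 0"
      using eqn[OF v zero_in_Q] nl pr vis fv
      by (simp add: l2_inner_add_NL[OF u'(1) u_X[OF t] v] l2_inner_eq[OF sets_\<Omega>, of "\<lambda>x. 0"])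
    then show "((\<lambda>t. l2_inner \<Omega> (u t) v) has_real_derivative 0) (at t within {0..\<tau>})"
      using velocity_inner_has_derivative[OF u_X t u'(1) v u'(2)] by simp
  qed
  then obtain c where c: "\<And>t. t \<in> {0..\<tau>} \<Longrightarrow> l2_inner \<Omega> (u t) v = c" by (auto simp: constant_on_def)
  show ?thesis
  proof (intro exI[of _ c] ballI)
    fix t assume t: "t \<in> {0..\<tau>}"
    have "AE x in lebesgue_on \<Omega>. u t x = 0 \<or> v x = g x" using vg[OF t] by eventually_elim auto
    moreover have "u t \<in> borel_measurable (lebesgue_on \<Omega>)"
      using X_square_integrable[OF u_X[OF t]] by (simp add: square_integrable_def)
    ultimately show "(\<integral>x. inner (u t x) (g x) \<partial>lebesgue_on \<Omega>) = c"
      using swap[of "u t"] c[OF t] by simp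
  qed
qed

lemma boundary_stripD:
  assumes "boundary_strip_assumption \<T> \<Omega> X f \<tau> u p" "g \<in> rigid_fields"
  shows "\<exists>v\<in>X. \<forall>t\<in>{0..\<tau>}. AE x in lebesgue_on \<Omega>. u t x = 0 \<and> p t x = 0 \<and> f t x = 0 \<or> v x = g x"
proof -
  obtain \<Omega>h where S: "\<And>t. t \<in> {0..\<tau>} \<Longrightarrow> AE x in lebesgue. x \<in> \<Omega> - \<Omega>h \<longrightarrow> u t x = 0 \<and> p t x = 0 \<and> f t x = 0"
    and "\<exists>v\<in>X. AE x in lebesgue. x \<in> \<Omega>h \<longrightarrow> v x = g x"
    using assms unfolding boundary_strip_assumption_def by blast
  then obtain v where v: "v \<in> X" "AE x in lebesgue. x \<in> \<Omega>h \<longrightarrow> v x = g x" by blast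
  have "AE x in lebesgue_on \<Omega>. u t x = 0 \<and> p t x = 0 \<and> f t x = 0 \<or> v x = g x" if "t \<in> {0..\<tau>}" for t
    unfolding AE_lebesgue_on_iff using S[OF that] v(2) by eventually_elim auto
  with v(1) show ?thesis by blast
qed

theorem linear_momentum_conserved:
  assumes F: "F \<in> {EMA_Conserving, Conservative}" and strip: "boundary_strip_assumption \<T> \<Omega> X f \<tau> u p"
    and f0: "\<And>t. t \<in> {0..\<tau>} \<Longrightarrow> linear_momentum \<Omega> (f t) = 0"
  shows "(\<lambda>t. linear_momentum \<Omega> (u t)) constant_on {0..\<tau>}"
proof -
  have comp: "linear_momentum \<Omega> w $ i = (\<integral>x. inner (w x) (axis i 1) \<partial>lebesgue_on \<Omega>)"
    if "square_integrable (lebesgue_on \<Omega>) w" for w and i :: 'd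
  proof -
    have "integrable (lebesgue_on \<Omega>) w"
      by (intro integrable_vec square_integrable_imp_integrable[OF finite_measure_\<Omega>] square_integrable_component that)
    then show ?thesis
      by (simp add: linear_momentum_def LINT_eq_lebesgue_on[OF sets_\<Omega>] integral_vec_nth inner_axis)
  qed
  have "\<exists>c. \<forall>t\<in>{0..\<tau>}. linear_momentum \<Omega> (u t) $ i = c" for i
  proof -
    have g: "(\<lambda>x. axis i 1) \<in> (rigid_fields :: ('d point \<Rightarrow> 'd point) set)" by (auto simp: rigid_fields_def)
    obtain W where W: "\<And>x. classical_grad (\<lambda>x::'d point. axis i 1) x = W" "\<And>i j. W $ i $ j = - W $ j $ i"
      using rigid_field_grad[OF restr3_adjoint g] by metis
    obtain v where v: "v \<in> X" "\<And>t. t \<in> {0..\<tau>} \<Longrightarrow> AE x in lebesgue_on \<Omega>. u t x = 0 \<and> p t x = 0 \<and> f t x = 0 \<or> v x = axis i 1"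
      using boundary_stripD[OF strip g] by blast
    have f0': "(\<integral>x. inner (f t x) (axis i 1) \<partial>lebesgue_on \<Omega>) = 0" if "t \<in> {0..\<tau>}" for t
      using comp[OF f_L2[OF that], of i] f0[OF that] by simp
    obtain c where "\<And>t. t \<in> {0..\<tau>} \<Longrightarrow> (\<integral>x. inner (u t x) (axis i 1) \<partial>lebesgue_on \<Omega>) = c"
      using momentum_conserved[OF F v(1) polynomial_function_const W v(2) f0'] by blast
    then show ?thesis using comp[OF X_square_integrable[OF u_X]] by auto
  qed
  then obtain c where "\<And>i t. t \<in> {0..\<tau>} \<Longrightarrow> linear_momentum \<Omega> (u t) $ i = c i" by metis
  then show ?thesis unfolding constant_on_def
    by (intro exI[of _ "\<chi> i. c i"]) (auto simp: vec_eq_iff)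
qed

lemma angular_integrable:
  assumes "square_integrable (lebesgue_on \<Omega>) (w :: 'd point \<Rightarrow> 'd point)"
  shows "integrable (lebesgue_on \<Omega>) (\<lambda>x. cross3 (ext3 (w x)) (ext3 x))"
proof -
  obtain R where R: "\<And>x. x \<in> \<Omega> \<Longrightarrow> norm x \<le> R" using bounded_\<Omega> by (auto simp: bounded_iff)
  have x: "ess_bounded (lebesgue_on \<Omega>) (\<lambda>x. x $ i)" for i
    unfolding ess_bounded_def
  proof (intro conjI exI[of _ R] AE_I2)
    show "(\<lambda>x. x $ i) \<in> borel_measurable (lebesgue_on \<Omega>)"
      by (intro continuous_imp_measurable_on_sets_lebesgue sets_\<Omega> continuous_intros)
    show "\<bar>x $ i\<bar> \<le> R" if "x \<in> space (lebesgue_on \<Omega>)" for x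
      using that R[of x] component_le_norm_cart[of x i] by auto
  qed
  have x3: "ess_bounded (lebesgue_on \<Omega>) (\<lambda>x. ext3 x $ k)" for k
    using exhaust_3[of k] x by (cases "CARD('d) = 3") (auto simp: ext3_nth intro: ess_bounded_const)
  have w3: "square_integrable (lebesgue_on \<Omega>) (\<lambda>x. ext3 (w x) $ k)" for k
    using exhaust_3[of k] square_integrable_component[OF assms]
    by (cases "CARD('d) = 3") (auto simp: ext3_nth square_integrable_def)
  have "integrable (lebesgue_on \<Omega>) (\<lambda>x. ext3 (w x) $ k * ext3 x $ l)" for k l
    using ess_bounded_mult_square_integrable[OF finite_measure_\<Omega> x3 w3] by (simp add: mult.commute)
  note i = this
  show ?thesis
  proof (rule integrable_vec)
    fix k :: 3
    consider "k = 1" | "k = 2" | "k = 3" using exhaust_3 by blast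
    then show "integrable (lebesgue_on \<Omega>) (\<lambda>x. cross3 (ext3 (w x)) (ext3 x) $ k)"
      by cases (simp_all only: cross3_nth Bochner_Integration.integrable_diff[OF i i])
  qed
qed

text \<open>By cyclicity of the triple product, component \<open>i\<close> of the angular momentum
  is the pairing with the field x \<times> e_i.\<close>

theorem angular_momentum_conserved:
  assumes F: "F \<in> {EMA_Conserving, Conservative}" and strip: "boundary_strip_assumption \<T> \<Omega> X f \<tau> u p"
    and f0: "\<And>t. t \<in> {0..\<tau>} \<Longrightarrow> angular_momentum \<Omega> (f t) = 0"
  shows "(\<lambda>t. angular_momentum \<Omega> (u t)) constant_on {0..\<tau>}"
proof -
  define g where "g i x = (restr3 (cross3 (ext3 x) (axis i 1)) :: 'd point)" for i and x :: "'d point"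
  have comp: "angular_momentum \<Omega> w $ i = (\<integral>x. inner (w x) (g i x) \<partial>lebesgue_on \<Omega>)"
    if "square_integrable (lebesgue_on \<Omega>) w" for w i
  proof -
    have "inner (w x) (g i x) = cross3 (ext3 (w x)) (ext3 x) $ i" for x
    proof -
      have "inner (w x) (g i x) = inner (cross3 (ext3 x) (axis i 1)) (ext3 (w x))"
        using restr3_adjoint by (simp add: g_def restr3_adjoint_def inner_commute[of "w x"])
      also have "\<dots> = inner (cross3 (ext3 (w x)) (ext3 x)) (axis i 1)" by (rule cross3_cyclic)
      finally show ?thesis by (simp add: inner_axis)
    qed
    then show ?thesis
      by (simp add: angular_momentum_def LINT_eq_lebesgue_on[OF sets_\<Omega>] integral_vec_nth[OF angular_integrable[OF that]])
  qed
  have "\<exists>c. \<forall>t\<in>{0..\<tau>}. angular_momentum \<Omega> (u t) $ i = c" for i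
  proof (cases "CARD('d) = 3 \<or> i = 3")
    case True
    then have g: "g i \<in> (rigid_fields :: ('d point \<Rightarrow> 'd point) set)" by (auto simp: rigid_fields_def g_def[abs_def])
    obtain W where W: "polynomial_function (g i)" "\<And>x. classical_grad (g i) x = W" "\<And>i j. W $ i $ j = - W $ j $ i"
      using rigid_field_grad[OF restr3_adjoint g] by metis
    obtain v where v: "v \<in> X" "\<And>t. t \<in> {0..\<tau>} \<Longrightarrow> AE x in lebesgue_on \<Omega>. u t x = 0 \<and> p t x = 0 \<and> f t x = 0 \<or> v x = g i x"
      using boundary_stripD[OF strip g] by blast
    have f0': "(\<integral>x. inner (f t x) (g i x) \<partial>lebesgue_on \<Omega>) = 0" if "t \<in> {0..\<tau>}" for t
      using comp[OF f_L2[OF that], of i] f0[OF that] by simp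
    obtain c where "\<And>t. t \<in> {0..\<tau>} \<Longrightarrow> (\<integral>x. inner (u t x) (g i x) \<partial>lebesgue_on \<Omega>) = c"
      using momentum_conserved[OF F v(1) W v(2) f0'] by blast
    then show ?thesis using comp[OF X_square_integrable[OF u_X]] by auto
  next
    case False
    \<comment> \<open>In the plane the first two components are identically zero, and no rigid field
      is at hand to test them with.\<close>
    then have "cross3 (ext3 a) (ext3 b) $ i = 0" for a b :: "'d point"
      using exhaust_3[of i] by (auto simp: cross3_nth ext3_nth)
    then have "angular_momentum \<Omega> (u t) $ i = 0" if "t \<in> {0..\<tau>}" for t
      by (simp add: angular_momentum_def LINT_eq_lebesgue_on[OF sets_\<Omega>]
          integral_vec_nth[OF angular_integrable[OF X_square_integrable[OF u_X[OF that]]]])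
    then show ?thesis by blast
  qed
  then obtain c where "\<And>i t. t \<in> {0..\<tau>} \<Longrightarrow> angular_momentum \<Omega> (u t) $ i = c i" by metis
  then show ?thesis unfolding constant_on_def
    by (intro exI[of _ "\<chi> i. c i"]) (auto simp: vec_eq_iff)
qed

end

lemma conserves_energyI:
  assumes "restr3_adjoint TYPE('d)" "F \<in> {Skew_Symmetric, Rotational, EMA_Conserving}"
  shows "conserves_energy TYPE('d::{finite,numeral}) F"
  unfolding conserves_energy_def
  using galerkin_problem.energy_conserved[OF galerkin_problemI[OF assms(1)] assms(2)] by blast

lemma conserves_momentumI:
  assumes "restr3_adjoint TYPE('d)" "F \<in> {EMA_Conserving, Conservative}"
  shows "conserves_linear_momentum TYPE('d::{finite,numeral}) F" "conserves_angular_momentum TYPE('d) F"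
  unfolding conserves_linear_momentum_def conserves_angular_momentum_def
  using galerkin_problem.linear_momentum_conserved[OF galerkin_problemI[OF assms(1)] assms(2)]
    galerkin_problem.angular_momentum_conserved[OF galerkin_problemI[OF assms(1)] assms(2)]
  by blast+

subsection \<open>Limits of smooth functions\<close>

text \<open>Locally bounded pointwise limits of smooth functions together with their gradients, all of
  them vanishing off \<open>S\<close>. For compact \<open>S \<subseteq> \<Omega>\<close> such functions are in \<open>H\<^sup>1\<^sub>0(\<Omega>)\<close> by dominated
  convergence.\<close>

definition smooth_limit :: "('d::finite point) set \<Rightarrow> ('d point \<Rightarrow> real) \<Rightarrow> ('d point \<Rightarrow> 'd point) \<Rightarrow> bool" where
  "smooth_limit S w g \<longleftrightarrow> (\<exists>W. (\<forall>n k. C_k k (W n)) \<and> (\<forall>n x. x \<notin> S \<longrightarrow> W n x = 0) \<and>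
     (\<forall>R. \<exists>C. \<forall>n x. norm x \<le> R \<longrightarrow> \<bar>W n x\<bar> \<le> C \<and> (\<forall>j. \<bar>partial_deriv j (W n) x\<bar> \<le> C)) \<and>
     (\<forall>x. (\<lambda>n. W n x) \<longlonglongrightarrow> w x) \<and> (\<forall>x j. (\<lambda>n. partial_deriv j (W n) x) \<longlonglongrightarrow> g x $ j))"

lemma smooth_limitE:
  assumes "smooth_limit S w g"
  obtains W where "\<And>n k. C_k k (W n)" "\<And>n x. x \<notin> S \<Longrightarrow> W n x = 0"
    "\<And>R. \<exists>C. \<forall>n x. norm x \<le> R \<longrightarrow> \<bar>W n x\<bar> \<le> C \<and> (\<forall>j. \<bar>partial_deriv j (W n) x\<bar> \<le> C)"
    "\<And>x. (\<lambda>n. W n x) \<longlonglongrightarrow> w x" "\<And>x j. (\<lambda>n. partial_deriv j (W n) x) \<longlonglongrightarrow> g x $ j"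
  using assms unfolding smooth_limit_def by auto

lemma C_k_locally_bounded:
  fixes w :: "'d::finite point \<Rightarrow> real"
  assumes "\<And>k. C_k k w"
  shows "\<exists>C. \<forall>x. norm x \<le> R \<longrightarrow> \<bar>w x\<bar> \<le> C \<and> (\<forall>j. \<bar>partial_deriv j w x\<bar> \<le> C)"
proof -
  have bd: "\<exists>C. \<forall>x. norm x \<le> R \<longrightarrow> \<bar>h x\<bar> \<le> C" if "continuous_on UNIV h" for h :: "'d point \<Rightarrow> real"
  proof -
    have "bounded (h ` cball 0 R)"
      by (intro compact_imp_bounded compact_continuous_image continuous_on_subset[OF that]) auto
    then obtain C where "\<forall>x\<in>cball 0 R. \<bar>h x\<bar> \<le> C" by (auto simp: bounded_iff)
    then show ?thesis by (intro exI[of _ C]) auto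
  qed
  obtain C0 where C0: "\<forall>x. norm x \<le> R \<longrightarrow> \<bar>w x\<bar> \<le> C0"
    using bd[OF C_k_imp_continuous[OF assms[of 0]]] by blast
  have "\<exists>C. \<forall>x. norm x \<le> R \<longrightarrow> \<bar>partial_deriv j w x\<bar> \<le> C" for j
    by (rule bd[OF C_k_imp_continuous[of 0]]) (rule C_k_partial_deriv[OF assms])
  then obtain C1 where C1: "\<And>j x. norm x \<le> R \<Longrightarrow> \<bar>partial_deriv j w x\<bar> \<le> C1 j" by metis
  have "\<bar>partial_deriv j w x\<bar> \<le> \<bar>C0\<bar> + (\<Sum>j\<in>UNIV. \<bar>C1 j\<bar>)" if "norm x \<le> R" for j x
    using C1[OF that, of j] member_le_sum[of j UNIV "\<lambda>j. \<bar>C1 j\<bar>"] by simp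
  moreover have "\<bar>w x\<bar> \<le> \<bar>C0\<bar> + (\<Sum>j\<in>UNIV. \<bar>C1 j\<bar>)" if "norm x \<le> R" for x
  proof -
    have "\<bar>w x\<bar> \<le> \<bar>C0\<bar>" using C0 that by (meson abs_ge_self order_trans)
    then show ?thesis by (intro add_increasing2 sum_nonneg) auto
  qed
  ultimately show ?thesis by blast
qed

lemma smooth_limit_C_k:
  assumes "\<And>k. C_k k w" "\<And>x. x \<notin> S \<Longrightarrow> w x = 0" "\<And>x j. partial_deriv j w x = g x $ j"
  shows "smooth_limit S w g"
  unfolding smooth_limit_def
  by (intro exI[of _ "\<lambda>n. w"]) (use assms C_k_locally_bounded[OF assms(1)] in auto)

lemma smooth_limit_const: "smooth_limit UNIV (\<lambda>x. c) (\<lambda>x. 0)"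
  by (rule smooth_limit_C_k) (auto simp: C_k_const partial_deriv_def)

lemma smooth_limit_polynomial:
  assumes "real_polynomial_function P" "\<And>x. (P has_derivative D x) (at x)"
  shows "smooth_limit UNIV P (\<lambda>x. \<chi> j. D x (axis j 1))"
  by (rule smooth_limit_C_k) (use assms in \<open>auto intro: C_k_real_polynomial_function simp: partial_deriv_eq[OF assms(2)]\<close>)

lemma partial_deriv_add:
  assumes "\<And>k. C_k k \<phi>" "\<And>k. C_k k \<psi>"
  shows "partial_deriv j (\<lambda>x. \<phi> x + \<psi> x) x = partial_deriv j \<phi> x + partial_deriv j \<psi> x"
  using has_derivative_add[OF C_k_SucD(1)[OF assms(1)] C_k_SucD(1)[OF assms(2)], of x]
  by (subst partial_deriv_eq) (auto simp: partial_deriv_def)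

lemma smooth_limit_add:
  assumes "smooth_limit S v gv" "smooth_limit S w gw"
  shows "smooth_limit S (\<lambda>x. v x + w x) (\<lambda>x. gv x + gw x)"
proof -
  obtain V where V: "\<And>n k. C_k k (V n)" "\<And>n x. x \<notin> S \<Longrightarrow> V n x = 0"
    "\<And>R. \<exists>C. \<forall>n x. norm x \<le> R \<longrightarrow> \<bar>V n x\<bar> \<le> C \<and> (\<forall>j. \<bar>partial_deriv j (V n) x\<bar> \<le> C)"
    "\<And>x. (\<lambda>n. V n x) \<longlonglongrightarrow> v x" "\<And>x j. (\<lambda>n. partial_deriv j (V n) x) \<longlonglongrightarrow> gv x $ j"
    using smooth_limitE[OF assms(1)] by blast
  obtain W where W: "\<And>n k. C_k k (W n)" "\<And>n x. x \<notin> S \<Longrightarrow> W n x = 0"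
    "\<And>R. \<exists>C. \<forall>n x. norm x \<le> R \<longrightarrow> \<bar>W n x\<bar> \<le> C \<and> (\<forall>j. \<bar>partial_deriv j (W n) x\<bar> \<le> C)"
    "\<And>x. (\<lambda>n. W n x) \<longlonglongrightarrow> w x" "\<And>x j. (\<lambda>n. partial_deriv j (W n) x) \<longlonglongrightarrow> gw x $ j"
    using smooth_limitE[OF assms(2)] by blast
  show ?thesis
    unfolding smooth_limit_def
  proof (intro exI[of _ "\<lambda>n x. V n x + W n x"] conjI allI impI)
    show "C_k k (\<lambda>x. V n x + W n x)" for n k by (intro C_k_add V W)
    show "x \<notin> S \<Longrightarrow> V n x + W n x = 0" for n x using V(2) W(2) by simp
    show "(\<lambda>n. V n x + W n x) \<longlonglongrightarrow> v x + w x" for x by (intro tendsto_add V W)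
    show "(\<lambda>n. partial_deriv j (\<lambda>x. V n x + W n x) x) \<longlonglongrightarrow> (gv x + gw x) $ j" for x j
      unfolding partial_deriv_add[OF V(1) W(1)] vector_add_component by (intro tendsto_add V W)
    fix R
    obtain C where C: "\<forall>n x. norm x \<le> R \<longrightarrow> \<bar>V n x\<bar> \<le> C \<and> (\<forall>j. \<bar>partial_deriv j (V n) x\<bar> \<le> C)" using V(3) by blast
    obtain D where D: "\<forall>n x. norm x \<le> R \<longrightarrow> \<bar>W n x\<bar> \<le> D \<and> (\<forall>j. \<bar>partial_deriv j (W n) x\<bar> \<le> D)" using W(3) by blast
    show "\<exists>C. \<forall>n x. norm x \<le> R \<longrightarrow> \<bar>V n x + W n x\<bar> \<le> C \<and> (\<forall>j. \<bar>partial_deriv j (\<lambda>x. V n x + W n x) x\<bar> \<le> C)"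
      unfolding partial_deriv_add[OF V(1) W(1)]
      by (rule exI[of _ "C + D"]) (use C D in \<open>auto intro!: order_trans[OF abs_triangle_ineq] add_mono\<close>)
  qed
qed

lemma smooth_limit_mult:
  assumes "smooth_limit S v gv" "smooth_limit T w gw"
  shows "smooth_limit (S \<inter> T) (\<lambda>x. v x * w x) (\<lambda>x. v x *\<^sub>R gw x + w x *\<^sub>R gv x)"
proof -
  obtain V where V: "\<And>n k. C_k k (V n)" "\<And>n x. x \<notin> S \<Longrightarrow> V n x = 0"
    "\<And>R. \<exists>C. \<forall>n x. norm x \<le> R \<longrightarrow> \<bar>V n x\<bar> \<le> C \<and> (\<forall>j. \<bar>partial_deriv j (V n) x\<bar> \<le> C)"
    "\<And>x. (\<lambda>n. V n x) \<longlonglongrightarrow> v x" "\<And>x j. (\<lambda>n. partial_deriv j (V n) x) \<longlonglongrightarrow> gv x $ j"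
    using smooth_limitE[OF assms(1)] by blast
  obtain W where W: "\<And>n k. C_k k (W n)" "\<And>n x. x \<notin> T \<Longrightarrow> W n x = 0"
    "\<And>R. \<exists>C. \<forall>n x. norm x \<le> R \<longrightarrow> \<bar>W n x\<bar> \<le> C \<and> (\<forall>j. \<bar>partial_deriv j (W n) x\<bar> \<le> C)"
    "\<And>x. (\<lambda>n. W n x) \<longlonglongrightarrow> w x" "\<And>x j. (\<lambda>n. partial_deriv j (W n) x) \<longlonglongrightarrow> gw x $ j"
    using smooth_limitE[OF assms(2)] by blast
  show ?thesis
    unfolding smooth_limit_def
  proof (intro exI[of _ "\<lambda>n x. V n x * W n x"] conjI allI impI)
    show "C_k k (\<lambda>x. V n x * W n x)" for n k by (intro C_k_mult V W)
    show "x \<notin> S \<inter> T \<Longrightarrow> V n x * W n x = 0" for n x using V(2) W(2) by auto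
    show "(\<lambda>n. V n x * W n x) \<longlonglongrightarrow> v x * w x" for x by (intro tendsto_mult V W)
    show "(\<lambda>n. partial_deriv j (\<lambda>x. V n x * W n x) x) \<longlonglongrightarrow> (v x *\<^sub>R gw x + w x *\<^sub>R gv x) $ j" for x j
      unfolding partial_deriv_mult[OF V(1) W(1)] vector_add_component vector_scaleR_component
        real_scaleR_def mult.commute[of "w x"]
      by (intro tendsto_add tendsto_mult V W)
    fix R
    obtain C where C: "\<forall>n x. norm x \<le> R \<longrightarrow> \<bar>V n x\<bar> \<le> C \<and> (\<forall>j. \<bar>partial_deriv j (V n) x\<bar> \<le> C)" using V(3) by blast
    obtain D where D: "\<forall>n x. norm x \<le> R \<longrightarrow> \<bar>W n x\<bar> \<le> D \<and> (\<forall>j. \<bar>partial_deriv j (W n) x\<bar> \<le> D)" using W(3) by blast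
    have m: "\<bar>a * b\<bar> \<le> \<bar>C\<bar> * \<bar>D\<bar>" if "\<bar>a\<bar> \<le> C" "\<bar>b\<bar> \<le> D" for a b
      unfolding abs_mult by (intro mult_mono) (use that in auto)
    show "\<exists>C. \<forall>n x. norm x \<le> R \<longrightarrow> \<bar>V n x * W n x\<bar> \<le> C \<and> (\<forall>j. \<bar>partial_deriv j (\<lambda>x. V n x * W n x) x\<bar> \<le> C)"
      unfolding partial_deriv_mult[OF V(1) W(1)]
    proof (intro exI[of _ "\<bar>C\<bar> * \<bar>D\<bar> + \<bar>C\<bar> * \<bar>D\<bar>"] allI impI conjI)
      fix n x j assume x: "norm (x :: 'a point) \<le> R"
      have "\<bar>V n x * W n x\<bar> \<le> \<bar>C\<bar> * \<bar>D\<bar>" by (rule m) (use C D x in auto)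
      then show "\<bar>V n x * W n x\<bar> \<le> \<bar>C\<bar> * \<bar>D\<bar> + \<bar>C\<bar> * \<bar>D\<bar>" by (rule order_trans) simp
      have "\<bar>V n x * partial_deriv j (W n) x\<bar> \<le> \<bar>C\<bar> * \<bar>D\<bar>" by (rule m) (use C D x in auto)
      moreover have "\<bar>partial_deriv j (V n) x * W n x\<bar> \<le> \<bar>C\<bar> * \<bar>D\<bar>" by (rule m) (use C D x in auto)
      ultimately show "\<bar>V n x * partial_deriv j (W n) x + partial_deriv j (V n) x * W n x\<bar> \<le> \<bar>C\<bar> * \<bar>D\<bar> + \<bar>C\<bar> * \<bar>D\<bar>"
        by linarith
    qed
  qed
qed

lemma smooth_limit_cmult: "smooth_limit S w g \<Longrightarrow> smooth_limit S (\<lambda>x. c * w x) (\<lambda>x. c *\<^sub>R g x)"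
  using smooth_limit_mult[OF smooth_limit_const, of S w g c] by simp

lemma smooth_limit_0: "smooth_limit S (\<lambda>x. 0) (\<lambda>x. 0)"
  by (rule smooth_limit_C_k) (auto simp: C_k_const partial_deriv_def)

lemma smooth_limit_mono:
  assumes "smooth_limit S w g" "S \<subseteq> T" shows "smooth_limit T w g"
proof -
  have "x \<notin> T \<Longrightarrow> x \<notin> S" for x using assms(2) by blast
  then show ?thesis using assms(1) unfolding smooth_limit_def by (elim exE conjE) (intro exI conjI; simp)
qed

text \<open>A factor depending on one coordinate is supported in an unbounded slab; only the
  intersection over all coordinates is a compact cube.\<close>

lemma smooth_limit_prod:
  assumes "finite A" "\<And>i. i \<in> A \<Longrightarrow> \<exists>g. smooth_limit (S i) (w i) g"
  shows "\<exists>g. smooth_limit (\<Inter>i\<in>A. S i) (\<lambda>x. \<Prod>i\<in>A. w i x) g"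
  using assms
proof (induction A rule: finite_induct)
  case empty then show ?case using smooth_limit_const by auto
next
  case (insert i A)
  then obtain g h where "smooth_limit (S i) (w i) g" "smooth_limit (\<Inter>i\<in>A. S i) (\<lambda>x. \<Prod>i\<in>A. w i x) h" by blast
  from smooth_limit_mult[OF this] show ?case using insert by auto
qed

lemma smooth_limit_sum:
  assumes "finite A" "\<And>i. i \<in> A \<Longrightarrow> \<exists>g. smooth_limit S (w i) g"
  shows "\<exists>g. smooth_limit S (\<lambda>x. \<Sum>i\<in>A. w i x) g"
  using assms
proof (induction A rule: finite_induct)
  case empty then show ?case using smooth_limit_0 by auto
next
  case (insert i A)
  then obtain g h where "smooth_limit S (w i) g" "smooth_limit S (\<lambda>x. \<Sum>i\<in>A. w i x) h" by blast
  from smooth_limit_add[OF this] show ?case using insert by auto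
qed

lemma flat_exp_has_derivative:
  "((\<lambda>s. s * flat_exp n s) has_real_derivative
     (if s > 0 then (1 + 1 / (real (Suc n) * s)) * exp (- (1 / (real (Suc n) * s))) else 0)) (at s)"
proof -
  let ?c = "real (Suc n)"
  have "((\<lambda>s. flat_fun [:1:] (?c * s)) has_real_derivative flat_fun ([:0,0,1:] * ([:1:] - pderiv [:1:])) (?c * s) * ?c) (at s)"
    by (rule DERIV_chain2[OF flat_fun_has_derivative]) (auto intro!: derivative_eq_intros)
  from DERIV_mult[OF DERIV_ident this]
  have "((\<lambda>s. s * flat_exp n s) has_real_derivative
      1 * flat_fun [:1:] (?c * s) + flat_fun ([:0,0,1:] * ([:1:] - pderiv [:1:])) (?c * s) * ?c * s) (at s)"
    by (simp only: flat_exp_def)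
  moreover have "1 * flat_fun [:1:] (?c * s) + flat_fun ([:0,0,1:] * ([:1:] - pderiv [:1:])) (?c * s) * ?c * s =
      (if s > 0 then (1 + 1 / (?c * s)) * exp (- (1 / (?c * s))) else 0)"
  proof (cases "s > 0")
    case True
    then have "?c * s > 0" by simp
    then show ?thesis using True
      by (simp add: flat_fun_def pderiv_pCons field_simps del: of_nat_Suc)
  next
    case False
    then have "\<not> ?c * s > 0" by (simp add: zero_less_mult_iff)
    then show ?thesis using False by (simp add: flat_fun_def del: of_nat_Suc)
  qed
  ultimately show ?thesis by simp
qed

text \<open>The approximants are \<open>q * flat_exp n q\<close>. With y = 1 / ((n + 1) q) their
  derivative carries the factor (1 + y) e^(-y), which is at most 1 because 1 + y \<le> e^y and tends
  to 1 where q > 0. Where q \<le> 0 it is 0, hence the value of the gradient there.\<close>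

lemma smooth_limit_positive_part:
  assumes q: "\<And>k. C_k k q"
  shows "smooth_limit {x. q x \<ge> 0} (\<lambda>x. max 0 (q x)) (\<lambda>x. if q x > 0 then \<chi> j. partial_deriv j q x else 0)"
proof -
  define b where "b n s = (if s > 0 then (1 + 1 / (real (Suc n) * s)) * exp (- (1 / (real (Suc n) * s))) else 0)" for n s
  have b01: "0 \<le> b n s" "b n s \<le> 1" for n s
  proof -
    show "0 \<le> b n s" by (auto simp: b_def intro!: mult_nonneg_nonneg add_nonneg_nonneg)
    show "b n s \<le> 1"
    proof (cases "s > 0")
      case True
      let ?y = "1 / (real (Suc n) * s)"
      have "(1 + ?y) * exp (- ?y) \<le> exp ?y * exp (- ?y)"
        by (intro mult_right_mono exp_ge_add_one_self) simp
      also have "\<dots> = 1" by (simp add: exp_minus_inverse)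
      finally show ?thesis using True by (simp add: b_def)
    qed (simp add: b_def)
  qed
  have blim: "(\<lambda>n. b n s) \<longlonglongrightarrow> (if s > 0 then 1 else 0)" for s
  proof (cases "s > 0")
    case True
    have "(\<lambda>n. (1 + inverse (real (Suc n)) * (1/s)) * exp (- (inverse (real (Suc n)) * (1/s)))) \<longlonglongrightarrow> (1 + 0 * (1/s)) * exp (- (0 * (1/s)))"
      by (intro tendsto_intros LIMSEQ_inverse_real_of_nat)
    then show ?thesis using True by (simp add: b_def field_simps)
  qed (simp add: b_def)
  define W where "W n x = q x * flat_exp n (q x)" for n x
  have pd: "partial_deriv j (W n) x = b n (q x) * partial_deriv j q x" for n j x
  proof -
    have "((\<lambda>s. s * flat_exp n s) has_derivative (*) (b n (q x))) (at (q x))"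
      using flat_exp_has_derivative[of n "q x"] by (simp add: has_field_derivative_def b_def)
    from has_derivative_compose[OF C_k_SucD(1)[OF q] this]
    show ?thesis unfolding W_def[abs_def]
      by (subst partial_deriv_eq) (auto simp: partial_deriv_def)
  qed
  show ?thesis
    unfolding smooth_limit_def
  proof (intro exI[of _ W] conjI allI impI)
    show "C_k k (W n)" for n k unfolding W_def[abs_def] by (intro C_k_mult C_k_flat_exp q)
    show "x \<notin> {x. 0 \<le> q x} \<Longrightarrow> W n x = 0" for n x by (simp add: W_def flat_exp_eq)
    have "(\<lambda>n. W n x) \<longlonglongrightarrow> q x * (if q x > 0 then 1 else 0)" for x
      unfolding W_def by (intro tendsto_mult tendsto_const flat_exp_tendsto)
    moreover have "q x * (if q x > 0 then 1 else 0) = max 0 (q x)" for x by simp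
    ultimately show "(\<lambda>n. W n x) \<longlonglongrightarrow> max 0 (q x)" for x by metis
    show "(\<lambda>n. partial_deriv j (W n) x) \<longlonglongrightarrow> (if q x > 0 then \<chi> j. partial_deriv j q x else 0) $ j" for x j
    proof -
      have "(\<lambda>n. partial_deriv j (W n) x) \<longlonglongrightarrow> (if q x > 0 then 1 else 0) * partial_deriv j q x"
        unfolding pd by (intro tendsto_mult tendsto_const blim)
      also have "(if q x > 0 then 1 else 0) * partial_deriv j q x = (if q x > 0 then \<chi> j. partial_deriv j q x else 0) $ j"
        by simp
      finally show ?thesis .
    qed
    fix R
    obtain C where C: "\<forall>x. norm x \<le> R \<longrightarrow> \<bar>q x\<bar> \<le> C \<and> (\<forall>j. \<bar>partial_deriv j q x\<bar> \<le> C)"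
      using C_k_locally_bounded[OF q] by blast
    have "\<bar>W n x\<bar> \<le> C" "\<bar>partial_deriv j (W n) x\<bar> \<le> C" if "norm x \<le> R" for n x j
    proof -
      have "\<bar>q x\<bar> * \<bar>flat_exp n (q x)\<bar> \<le> \<bar>q x\<bar> * 1"
        by (intro mult_left_mono) (use flat_exp_bounds[of n "q x"] in auto)
      then show "\<bar>W n x\<bar> \<le> C" using C that by (fastforce simp: W_def abs_mult)
      have "\<bar>b n (q x)\<bar> * \<bar>partial_deriv j q x\<bar> \<le> 1 * \<bar>partial_deriv j q x\<bar>"
        by (intro mult_right_mono) (use b01[of n "q x"] in auto)
      moreover have "\<bar>partial_deriv j q x\<bar> \<le> C" using C that by blast
      ultimately show "\<bar>partial_deriv j (W n) x\<bar> \<le> C" by (simp add: pd abs_mult)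
    qed
    then show "\<exists>C. \<forall>n x. norm x \<le> R \<longrightarrow> \<bar>W n x\<bar> \<le> C \<and> (\<forall>j. \<bar>partial_deriv j (W n) x\<bar> \<le> C)" by blast
  qed
qed

lemma smooth_limit_H10_scalar:
  assumes w: "smooth_limit S w g" and S: "compact S" "S \<subseteq> \<Omega>" and \<Omega>: "open \<Omega>" "bounded \<Omega>"
  shows "H10_scalar \<Omega> w g" "ess_bounded (lebesgue_on \<Omega>) w" "ess_bounded (lebesgue_on \<Omega>) (\<lambda>x. g x $ j)"
proof -
  have lm: "\<Omega> \<in> lmeasurable" using \<Omega> by (simp add: lmeasurable_open)
  then have \<Omega>s: "\<Omega> \<in> sets lebesgue" by auto
  note fm = finite_measure_lebesgue_on[OF lm]
  obtain W where W: "\<And>n k. C_k k (W n)" "\<And>n x. x \<notin> S \<Longrightarrow> W n x = 0"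
    "\<And>R. \<exists>C. \<forall>n x. norm x \<le> R \<longrightarrow> \<bar>W n x\<bar> \<le> C \<and> (\<forall>j. \<bar>partial_deriv j (W n) x\<bar> \<le> C)"
    "\<And>x. (\<lambda>n. W n x) \<longlonglongrightarrow> w x" "\<And>x j. (\<lambda>n. partial_deriv j (W n) x) \<longlonglongrightarrow> g x $ j"
    using smooth_limitE[OF w] by blast
  have test: "W n \<in> test_functions \<Omega>" for n
    by (rule test_functionI[OF W(1) S W(2)])
  obtain R where R: "\<And>x. x \<in> \<Omega> \<Longrightarrow> norm x \<le> R" using \<Omega>(2) by (auto simp: bounded_iff)
  obtain C where "\<forall>n x. norm x \<le> R \<longrightarrow> \<bar>W n x\<bar> \<le> C \<and> (\<forall>j. \<bar>partial_deriv j (W n) x\<bar> \<le> C)" using W(3) by blast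
  then have C: "\<And>n x. x \<in> \<Omega> \<Longrightarrow> \<bar>W n x\<bar> \<le> C" "\<And>n x j. x \<in> \<Omega> \<Longrightarrow> \<bar>partial_deriv j (W n) x\<bar> \<le> C"
    using R by auto
  have lim: "ess_bounded (lebesgue_on \<Omega>) f \<and> (\<lambda>n. \<integral>x. (f x - h n x)\<^sup>2 \<partial>lebesgue_on \<Omega>) \<longlonglongrightarrow> 0"
    if h: "\<And>n. h n \<in> test_functions \<Omega>" "\<And>n x. x \<in> \<Omega> \<Longrightarrow> \<bar>h n x\<bar> \<le> C" "\<And>x. (\<lambda>n. h n x) \<longlonglongrightarrow> f x"
    for f and h :: "nat \<Rightarrow> 'a point \<Rightarrow> real"
  proof
    have hm: "h n \<in> borel_measurable (lebesgue_on \<Omega>)" for n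
      by (rule test_function_integral_eq_lborel(3)[OF h(1) \<Omega>s])
    have fC: "\<bar>f x\<bar> \<le> C" if "x \<in> \<Omega>" for x
      by (rule Lim_bounded[OF tendsto_rabs[OF h(3)], of 0]) (use h(2)[OF that] in auto)
    have fm': "f \<in> borel_measurable (lebesgue_on \<Omega>)"
      by (rule borel_measurable_LIMSEQ_real[OF h(3) hm])
    show "ess_bounded (lebesgue_on \<Omega>) f"
      unfolding ess_bounded_def using fm' fC by (intro conjI exI[of _ C] AE_I2) auto
    have "(\<lambda>n. \<integral>x. (f x - h n x)\<^sup>2 \<partial>lebesgue_on \<Omega>) \<longlonglongrightarrow> (\<integral>x. 0 \<partial>lebesgue_on \<Omega>)"
    proof (rule integral_dominated_convergence[where w = "\<lambda>x. (2 * C)\<^sup>2"])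
      show "(\<lambda>x. (f x - h n x)\<^sup>2) \<in> borel_measurable (lebesgue_on \<Omega>)" for n using fm' hm by measurable
      show "integrable (lebesgue_on \<Omega>) (\<lambda>x. (2 * C)\<^sup>2)"
        by (rule finite_measure.integrable_const[OF fm])
      show "AE x in lebesgue_on \<Omega>. (\<lambda>n. (f x - h n x)\<^sup>2) \<longlonglongrightarrow> 0"
      proof (rule AE_I2)
        fix x
        have "(\<lambda>n. (f x - h n x)\<^sup>2) \<longlonglongrightarrow> (f x - f x)\<^sup>2" by (intro tendsto_intros h)
        then show "(\<lambda>n. (f x - h n x)\<^sup>2) \<longlonglongrightarrow> 0" by simp
      qed
      show "AE x in lebesgue_on \<Omega>. norm ((f x - h n x)\<^sup>2) \<le> (2 * C)\<^sup>2" for n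
      proof (rule AE_I2)
        fix x assume "x \<in> space (lebesgue_on \<Omega>)"
        then have "\<bar>f x - h n x\<bar> \<le> 2 * C" using fC[of x] h(2)[of x n] by auto
        then have "\<bar>f x - h n x\<bar>\<^sup>2 \<le> (2 * C)\<^sup>2" by (intro power_mono) auto
        then show "norm ((f x - h n x)\<^sup>2) \<le> (2 * C)\<^sup>2" by simp
      qed
    qed simp
    then show "(\<lambda>n. \<integral>x. (f x - h n x)\<^sup>2 \<partial>lebesgue_on \<Omega>) \<longlonglongrightarrow> 0" by simp
  qed
  have lw: "ess_bounded (lebesgue_on \<Omega>) w" "(\<lambda>n. \<integral>x. (w x - W n x)\<^sup>2 \<partial>lebesgue_on \<Omega>) \<longlonglongrightarrow> 0"
    using lim[of W w] test C W by auto
  have lg: "ess_bounded (lebesgue_on \<Omega>) (\<lambda>x. g x $ j)"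
    "(\<lambda>n. \<integral>x. (g x $ j - partial_deriv j (W n) x)\<^sup>2 \<partial>lebesgue_on \<Omega>) \<longlonglongrightarrow> 0" for j
    using lim[of "\<lambda>n. partial_deriv j (W n)" "\<lambda>x. g x $ j"] test_function_partial_deriv[OF test] C W by auto
  show "ess_bounded (lebesgue_on \<Omega>) w" "ess_bounded (lebesgue_on \<Omega>) (\<lambda>x. g x $ j)" by (fact lw lg)+
  show "H10_scalar \<Omega> w g"
    unfolding H10_scalar_def
  proof (intro conjI exI[of _ W] allI test lw lg \<Omega>s)
    show "square_integrable (lebesgue_on \<Omega>) w" by (rule ess_bounded_square_integrable[OF fm lw(1)])
    show "square_integrable (lebesgue_on \<Omega>) g"
      by (rule square_integrable_vec) (rule ess_bounded_square_integrable[OF fm lg(1)])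
  qed
qed

subsection \<open>The Kuhn triangulation\<close>

text \<open>The simplices of the Kuhn (Freudenthal) triangulation: the part of the unit cube with lower
  corner \<open>z\<close> in which the coordinates relative to \<open>z\<close> decrease along the enumeration \<open>r\<close> of the axes.\<close>

definition kuhn_alcove :: "('d \<Rightarrow> int) \<Rightarrow> ('d \<Rightarrow> nat) \<Rightarrow> ('d::finite point) set" where
  "kuhn_alcove z r = {x. (\<forall>i. 0 \<le> x $ i - z i \<and> x $ i - z i \<le> 1) \<and>
                    (\<forall>i j. r i \<le> r j \<longrightarrow> x $ j - z j \<le> x $ i - z i)}"

lemma kuhn_alcoveD:
  assumes "x \<in> kuhn_alcove z r"
  shows "z i \<le> x $ i" "x $ i \<le> z i + 1" "r i \<le> r j \<Longrightarrow> x $ j - z j \<le> x $ i - z i"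
  using assms by (auto simp: kuhn_alcove_def)
    (smt (verit))+

lemma convex_kuhn_alcove: "convex (kuhn_alcove z r)"
proof -
  have "kuhn_alcove z r = (\<Inter>i. {x. inner (axis i 1) x \<ge> z i} \<inter> {x. inner (axis i 1) x \<le> z i + 1}) \<inter>
      (\<Inter>(i, j) \<in> {(i, j). r i \<le> r j}. {x. inner (axis j 1 - axis i 1) x \<le> z j - z i})"
    by (fastforce simp: kuhn_alcove_def inner_axis inner_axis' inner_diff_left algebra_simps)
  moreover have "convex \<dots>"
    by (intro convex_Int convex_INT ballI) (auto intro: convex_halfspace_ge convex_halfspace_le)
  ultimately show ?thesis by simp
qed

text \<open>An alcove is cut out by slabs \<open>a \<le> l(x) \<le> a + 1\<close> with integers \<open>a\<close>, for the functionals
  \<open>l = x\<^sub>i\<close> and \<open>l = x\<^sub>i - x\<^sub>j\<close>. A point of two alcoves for which the integers differ lies on the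
  boundary of the slab, hence so does every segment through it inside the slab.\<close>

lemma slab_segment:
  fixes a a' :: int and l lx ly t :: real
  assumes "of_int a \<le> lx" "lx \<le> of_int a + 1" "of_int a \<le> ly" "ly \<le> of_int a + 1" "0 < t" "t < 1"
    and l: "l = (1 - t) * lx + t * ly" and "of_int a' \<le> l" "l \<le> of_int a' + 1"
  shows "of_int a' \<le> lx" "lx \<le> of_int a' + 1" "of_int a' \<le> ly" "ly \<le> of_int a' + 1"
proof -
  have "a' = a \<or> l = a \<or> l = a + 1"
  proof (rule ccontr)
    assume *: "\<not> ?thesis"
    have lo: "a \<le> l"
    proof -
      have "(1 - t) * a + t * a \<le> (1 - t) * lx + t * ly" using assms by (intro add_mono mult_left_mono) auto
      then show ?thesis unfolding l by (simp add: algebra_simps)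
    qed
    have hi: "l \<le> a + 1"
    proof -
      have "(1 - t) * lx + t * ly \<le> (1 - t) * (a + 1) + t * (a + 1)" using assms by (intro add_mono mult_left_mono) auto
      then show ?thesis unfolding l by (simp add: algebra_simps)
    qed
    have "a < l" "l < a + 1" using lo hi * by auto
    then have "real_of_int a < real_of_int (a' + 1)" "real_of_int a' < real_of_int (a + 1)" using assms by auto
    then have "a < a' + 1" "a' < a + 1" by (simp_all only: of_int_less_iff)
    then show False using * by simp
  qed
  then consider "a' = a" | "l = a" | "l = a + 1" by blast
  then have "a' = a \<or> lx = l \<and> ly = l"
  proof cases
    case 2
    have "(1 - t) * (lx - a) + t * (ly - a) = 0" using 2 l by (simp add: algebra_simps)
    moreover have "(1 - t) * (lx - a) \<ge> 0" "t * (ly - a) \<ge> 0" using assms by auto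
    ultimately have "(1 - t) * (lx - a) = 0" "t * (ly - a) = 0" by linarith+
    then show ?thesis using 2 assms by auto
  next
    case 3
    have "(1 - t) * (a + 1 - lx) + t * (a + 1 - ly) = 0" using 3 l by (simp add: algebra_simps)
    moreover have "(1 - t) * (a + 1 - lx) \<ge> 0" "t * (a + 1 - ly) \<ge> 0" using assms by auto
    ultimately have "(1 - t) * (a + 1 - lx) = 0" "t * (a + 1 - ly) = 0" by linarith+
    then show ?thesis using 3 assms by auto
  qed simp
  then show "of_int a' \<le> lx" "lx \<le> of_int a' + 1" "of_int a' \<le> ly" "ly \<le> of_int a' + 1" using assms by auto
qed

text \<open>If \<open>i\<close> precedes \<open>j\<close> in the order \<open>r\<close>, its
  relative coordinate is the larger one and the difference of the two lies in [0, 1], otherwise in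
  [-1, 0]; this is the shift by 0 or 1 in the slab.\<close>

lemma kuhn_alcove_slabs:
  assumes "inj r"
  shows "x \<in> kuhn_alcove z r \<longleftrightarrow> (\<forall>i. z i \<le> x $ i \<and> x $ i \<le> z i + 1) \<and>
    (\<forall>i j. i \<noteq> j \<longrightarrow> real_of_int (z i - z j - (if r i < r j then 0 else 1)) \<le> x $ i - x $ j \<and>
        x $ i - x $ j \<le> real_of_int (z i - z j - (if r i < r j then 0 else 1)) + 1)" (is "?L \<longleftrightarrow> ?R")
proof
  assume L: ?L
  show ?R
  proof (intro conjI allI impI)
    fix i j :: 'a assume "i \<noteq> j"
    then have "r i \<noteq> r j" using assms by (auto dest: injD)
    then have "r i < r j \<and> x $ j - z j \<le> x $ i - z i \<or> \<not> r i < r j \<and> x $ i - z i \<le> x $ j - z j"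
      using kuhn_alcoveD(3)[OF L, of i j] kuhn_alcoveD(3)[OF L, of j i] by linarith
    then show "real_of_int (z i - z j - (if r i < r j then 0 else 1)) \<le> x $ i - x $ j"
      "x $ i - x $ j \<le> real_of_int (z i - z j - (if r i < r j then 0 else 1)) + 1"
      using kuhn_alcoveD(1,2)[OF L, of i] kuhn_alcoveD(1,2)[OF L, of j] by auto
  qed (use kuhn_alcoveD[OF L] in auto)
next
  assume R: ?R
  show ?L
    unfolding kuhn_alcove_def
  proof (intro CollectI conjI allI impI)
    fix i j assume ij: "r i \<le> r j"
    show "x $ j - z j \<le> x $ i - z i"
    proof (cases "i = j")
      case False
      then have "r i < r j" using ij assms by (metis injD le_neq_implies_less)
      then show ?thesis using R False by (smt (verit) of_int_diff of_int_0)
    qed simp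
  qed (use R in \<open>smt (verit)\<close>)+
qed

text \<open>A segment of the first alcove with an inner point in the second has its endpoints in
  every slab of the second, and the slabs determine the alcove.\<close>

lemma kuhn_alcove_Int_face_of:
  assumes r: "inj r" "inj r'"
  shows "kuhn_alcove z r \<inter> kuhn_alcove z' r' face_of kuhn_alcove z r"
  unfolding face_of_def
proof (intro conjI ballI impI)
  show "convex (kuhn_alcove z r \<inter> kuhn_alcove z' r')" by (intro convex_Int convex_kuhn_alcove)
  fix x y p assume x: "x \<in> kuhn_alcove z r" and y: "y \<in> kuhn_alcove z r"
    and p: "p \<in> kuhn_alcove z r \<inter> kuhn_alcove z' r'" and seg: "p \<in> open_segment x y"
  obtain t where t: "0 < t" "t < 1" "p = (1 - t) *\<^sub>R x + t *\<^sub>R y"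
    using seg by (auto simp: in_segment)
  note X = x[unfolded kuhn_alcove_slabs[OF r(1)]] and Y = y[unfolded kuhn_alcove_slabs[OF r(1)]]
  have P: "p \<in> kuhn_alcove z' r'" using p by simp
  note P = P[unfolded kuhn_alcove_slabs[OF r(2)]]
  have c: "of_int (z' i) \<le> x $ i \<and> x $ i \<le> of_int (z' i) + 1 \<and> of_int (z' i) \<le> y $ i \<and> y $ i \<le> of_int (z' i) + 1" for i
    using slab_segment[of "z i" "x $ i" "y $ i" t "p $ i" "z' i"] X Y P t by auto
  have d: "real_of_int (z' i - z' j - (if r' i < r' j then 0 else 1)) \<le> x $ i - x $ j \<and>
        x $ i - x $ j \<le> real_of_int (z' i - z' j - (if r' i < r' j then 0 else 1)) + 1 \<and>
       real_of_int (z' i - z' j - (if r' i < r' j then 0 else 1)) \<le> y $ i - y $ j \<and>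
        y $ i - y $ j \<le> real_of_int (z' i - z' j - (if r' i < r' j then 0 else 1)) + 1" if "i \<noteq> j" for i j
  proof -
    have "p $ i - p $ j = (1 - t) * (x $ i - x $ j) + t * (y $ i - y $ j)"
      unfolding t(3) by (simp add: algebra_simps)
    from slab_segment[OF X[THEN conjunct2, rule_format, OF that, THEN conjunct1]
        X[THEN conjunct2, rule_format, OF that, THEN conjunct2]
        Y[THEN conjunct2, rule_format, OF that, THEN conjunct1]
        Y[THEN conjunct2, rule_format, OF that, THEN conjunct2] t(1,2) this
        P[THEN conjunct2, rule_format, OF that, THEN conjunct1]
        P[THEN conjunct2, rule_format, OF that, THEN conjunct2]]
    show ?thesis by blast
  qed
  have "x \<in> kuhn_alcove z' r'" "y \<in> kuhn_alcove z' r'"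
    unfolding kuhn_alcove_slabs[OF r(2)] by (intro conjI allI impI; use c d in blast)+
  then show "x \<in> kuhn_alcove z r \<inter> kuhn_alcove z' r'" "y \<in> kuhn_alcove z r \<inter> kuhn_alcove z' r'"
    using x y by auto
qed auto

text \<open>The corner \<open>z\<close> plus the first \<open>k\<close> unit vectors in the order
  \<open>r\<close>: the vertices form a monotone lattice path from \<open>z\<close> to the opposite
  corner of its cube.\<close>

definition kuhn_vertex :: "('d \<Rightarrow> int) \<Rightarrow> ('d \<Rightarrow> nat) \<Rightarrow> nat \<Rightarrow> 'd::finite point" where
  "kuhn_vertex z r k = (\<chi> i. z i + (if r i < k then 1 else 0))"

text \<open>In the order \<open>r\<close> the relative coordinates decrease from at most 1 to at
  least 0. The successive drops, including the first from 1 and the last to 0, are the barycentric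
  coordinates.\<close>

lemma kuhn_alcove_eq_hull:
  assumes r: "bij_betw r (UNIV :: 'd set) {..<CARD('d)}"
  shows "kuhn_alcove z r = convex hull (kuhn_vertex z r ` {..CARD('d::finite)})"
proof
  show "convex hull (kuhn_vertex z r ` {..CARD('d)}) \<subseteq> kuhn_alcove z r"
  proof (rule hull_minimal)
    show "kuhn_vertex z r ` {..CARD('d)} \<subseteq> kuhn_alcove z r" by (auto simp: kuhn_vertex_def kuhn_alcove_def)
  qed (rule convex_kuhn_alcove)
  show "kuhn_alcove z r \<subseteq> convex hull (kuhn_vertex z r ` {..CARD('d)})"
  proof
    fix x assume x: "x \<in> kuhn_alcove z r"
    let ?n = "CARD('d)"
    define s where "s = inv_into UNIV r"
    have inj: "inj r" and img: "range r = {..<?n}" using r by (auto simp: bij_betw_def)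
    have rs: "r (s k) = k" if "k < ?n" for k
      using that img by (auto simp: s_def intro!: f_inv_into_f)
    have sr: "s (r i) = i" for i using inj by (simp add: s_def)
    have rlt: "r i < ?n" for i using img by auto
    \<comment> \<open>The sequence is padded with 1 in front and 0 behind, so the relative
      coordinate of rank \<open>k\<close> sits at index \<open>Suc k\<close>.\<close>
    define Y where "Y k = (if k = 0 then 1 else if k \<le> ?n then x $ s (k - 1) - z (s (k - 1)) else 0)" for k
    have Y_dec: "Y (Suc k) \<le> Y k" if kn: "k \<le> ?n" for k
    proof -
      consider "k = 0" | "0 < k" "k < ?n" | "0 < k" "k = ?n" using kn by linarith
      then show ?thesis
      proof cases
        case 1 then show ?thesis using kuhn_alcoveD(2)[OF x, of "s 0"] by (auto simp: Y_def)
      next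
        case 2
        then have "r (s (k - 1)) \<le> r (s k)" by (simp add: rs)
        from kuhn_alcoveD(3)[OF x this] show ?thesis using 2 by (simp add: Y_def)
      next
        case 3 then show ?thesis using kuhn_alcoveD(1)[OF x, of "s (k - 1)"] by (simp add: Y_def)
      qed
    qed
    define lam where "lam k = Y k - Y (Suc k)" for k
    have tele: "(\<Sum>k=m..?n. lam k) = Y m" if "m \<le> Suc ?n" for m
    proof -
      have "(\<Sum>k=m..?n. lam k) = - (\<Sum>k=m..?n. Y (Suc k) - Y k)"
        by (simp add: lam_def sum_negf[symmetric])
      also have "\<dots> = Y m - Y (Suc ?n)" by (simp add: sum_Suc_diff[OF that])
      finally show ?thesis by (simp add: Y_def)
    qed
    have "x = (\<Sum>k\<le>?n. lam k *\<^sub>R kuhn_vertex z r k)"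
    proof (simp only: vec_eq_iff, rule allI)
      fix i
      have "(\<Sum>k\<le>?n. lam k *\<^sub>R kuhn_vertex z r k) $ i = (\<Sum>k\<le>?n. lam k * z i + (if r i < k then lam k else 0))"
        by (simp add: kuhn_vertex_def algebra_simps) (intro sum.cong, auto)
      also have "\<dots> = (\<Sum>k\<le>?n. lam k) * z i + (\<Sum>k\<le>?n. if r i < k then lam k else 0)"
        by (simp add: sum.distrib sum_distrib_right)
      also have "(\<Sum>k\<le>?n. if r i < k then lam k else 0) = (\<Sum>k=Suc (r i)..?n. lam k)"
        by (rule sum.mono_neutral_cong_right) auto
      also have "\<dots> = Y (Suc (r i))" using rlt[of i] by (intro tele) simp
      also have "\<dots> = x $ i - z i" using rlt[of i] by (simp add: Y_def sr)
      also have "(\<Sum>k\<le>?n. lam k) = 1" using tele[of 0] by (simp add: Y_def atLeast0AtMost)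
      finally show "x $ i = (\<Sum>k\<le>?n. lam k *\<^sub>R kuhn_vertex z r k) $ i" by simp
    qed
    moreover have "(\<Sum>k\<le>?n. lam k *\<^sub>R kuhn_vertex z r k) \<in> convex hull (kuhn_vertex z r ` {..?n})"
    proof (rule convex_sum)
      show "(\<Sum>k\<le>?n. lam k) = 1" using tele[of 0] by (simp add: Y_def atLeast0AtMost)
      show "0 \<le> lam k" if "k \<in> {..?n}" for k using Y_dec[of k] that by (simp add: lam_def)
    qed (auto intro: hull_inc)
    ultimately show "x \<in> convex hull (kuhn_vertex z r ` {..?n})" by simp
  qed
qed

lemma interior_kuhn_alcove_nonempty:
  assumes "inj (r :: 'd::finite \<Rightarrow> nat)" "\<And>i. r i < CARD('d)"
  shows "interior (kuhn_alcove z r) \<noteq> {}"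
proof -
  let ?n = "real CARD('d)"
  \<comment> \<open>The relative coordinates are n/(n+1), ..., 1/(n+1) along \<open>r\<close>:
    strictly decreasing and strictly between 0 and 1.\<close>
  define p :: "'d point" where "p = (\<chi> i. z i + (?n - r i) / (?n + 1))"
  define U where "U = (\<Inter>i. {x :: 'd point. z i < x $ i} \<inter> {x. x $ i < z i + 1}) \<inter> (\<Inter>(i, j) \<in> {(i, j). r i < r j}. {x. x $ j - z j < x $ i - z i})"
  have "open U" unfolding U_def
    by (intro open_Int open_INT finite ballI) (auto intro!: open_Collect_less continuous_intros finite)
  moreover have "U \<subseteq> kuhn_alcove z r"
  proof
    fix x assume x: "x \<in> U"
    have "x $ j - z j \<le> x $ i - z i" if "r i \<le> r j" for i j
    proof (cases "i = j")
      case False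
      then have "r i < r j" using that assms(1) by (metis injD le_neq_implies_less)
      then show ?thesis using x by (fastforce simp: U_def)
    qed simp
    moreover have "z i < x $ i \<and> x $ i < z i + 1" for i using x unfolding U_def by blast
    then have "0 \<le> x $ i - z i \<and> x $ i - z i \<le> 1" for i by (smt (verit) of_int_1 of_int_add)
    ultimately show "x \<in> kuhn_alcove z r" by (simp add: kuhn_alcove_def)
  qed
  moreover have "p \<in> U"
  proof -
    have "0 < (?n - r i) / (?n + 1) \<and> (?n - r i) / (?n + 1) < 1" for i
      using assms(2)[of i] by (auto simp: field_simps)
    moreover have "(?n - r j) / (?n + 1) < (?n - r i) / (?n + 1)" if "r i < r j" for i j
      using that by (intro divide_strict_right_mono) auto
    ultimately show ?thesis by (auto simp: U_def p_def)
  qed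
  ultimately show ?thesis using interior_maximal by blast
qed

text \<open>The nonempty interior forces full affine dimension n. At most n + 1 vertices can only
  span it if they are distinct and affinely independent.\<close>

lemma simplex_kuhn_alcove:
  assumes r: "bij_betw r (UNIV :: 'd::finite set) {..<CARD('d)}"
  shows "int CARD('d) simplex kuhn_alcove z r"
proof -
  let ?C = "kuhn_vertex z r ` {..CARD('d)}"
  have "inj r" "\<And>i. r i < CARD('d)" using r by (auto simp: bij_betw_def)
  then have "aff_dim (kuhn_alcove z r) = int CARD('d)"
    using aff_dim_nonempty_interior[OF interior_kuhn_alcove_nonempty[of r z]] by simp
  then have ad: "aff_dim ?C = int CARD('d)"
    by (simp add: kuhn_alcove_eq_hull[OF r] aff_dim_convex_hull)
  have "card ?C \<le> Suc CARD('d)" using card_image_le[of "{..CARD('d)}" "kuhn_vertex z r"] by simp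
  moreover have "int CARD('d) \<le> int (card ?C) - 1" using aff_dim_le_card[of ?C] ad by simp
  ultimately have c: "int (card ?C) = int CARD('d) + 1" by linarith
  then have "\<not> affine_dependent ?C" using ad by (simp add: affine_independent_iff_card)
  then show ?thesis unfolding simplex_def using c kuhn_alcove_eq_hull[OF r] by blast
qed

text \<open>Applied to the relative coordinates of a point in a unit cube, it finds an alcove
  containing the point.\<close>

lemma ex_antitone_enumeration:
  fixes y :: "'d::finite \<Rightarrow> real"
  shows "\<exists>r. bij_betw r (UNIV :: 'd set) {..<CARD('d)} \<and> (\<forall>i j. r i \<le> r j \<longrightarrow> y j \<le> y i)"
proof -
  obtain xs :: "'d list" where xs: "set xs = UNIV" "distinct xs" using finite_distinct_list[of "UNIV :: 'd set"] by auto
  define ys where "ys = sort_key (\<lambda>i. - y i) xs"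
  have ys: "set ys = UNIV" "distinct ys" "length ys = CARD('d)"
    using xs distinct_card[of xs] by (auto simp: ys_def)
  have srt: "sorted (map (\<lambda>i. - y i) ys)" by (simp add: ys_def)
  have bij: "bij_betw ((!) ys) {..<CARD('d)} UNIV"
    using bij_betw_nth[of ys "{..<CARD('d)}" UNIV] ys by simp
  define r where "r = inv_into {..<CARD('d)} ((!) ys)"
  have "bij_betw r UNIV {..<CARD('d)}" unfolding r_def by (rule bij_betw_inv_into[OF bij])
  moreover have "y j \<le> y i" if "r i \<le> r j" for i j
  proof -
    have n: "ys ! r k = k" "r k < CARD('d)" for k
      using bij_betw_inv_into_right[OF bij, of k] bij_betw_apply[OF bij_betw_inv_into[OF bij], of k]
      by (auto simp: r_def)
    have "map (\<lambda>i. - y i) ys ! r i \<le> map (\<lambda>i. - y i) ys ! r j"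
      by (rule sorted_nth_mono[OF srt that]) (simp add: ys n)
    then show ?thesis by (simp add: ys n)
  qed
  ultimately show ?thesis by blast
qed

definition kuhn_triangulation :: "int \<Rightarrow> ('d::finite point) set set" where
  "kuhn_triangulation N = {kuhn_alcove z r | z r. (\<forall>i. z i \<in> {-N..<N}) \<and> bij_betw r UNIV {..<CARD('d)}}"

definition cube :: "real \<Rightarrow> ('d::finite point) set" where
  "cube a = {x. \<forall>i. \<bar>x $ i\<bar> < a}"

definition ccube :: "real \<Rightarrow> ('d::finite point) set" where
  "ccube a = {x. \<forall>i. \<bar>x $ i\<bar> \<le> a}"

lemma cube_eq_box: "cube a = box (\<chi> i. - a) (\<chi> i. a)" and ccube_eq_cbox: "ccube a = cbox (\<chi> i. - a) (\<chi> i. a)"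
  by (auto simp: cube_def ccube_def mem_box_cart abs_less_iff abs_le_iff; smt (verit))+

lemma kuhn_triangulationE:
  assumes "K \<in> kuhn_triangulation N"
  obtains z r where "K = kuhn_alcove z r" "\<And>i. - N \<le> z i" "\<And>i. z i < N" "bij_betw r UNIV {..<CARD('d)}" "inj (r :: 'd::finite \<Rightarrow> nat)"
  using assms unfolding kuhn_triangulation_def bij_betw_def by auto

lemma finite_kuhn_triangulation: "finite (kuhn_triangulation N :: ('d::finite point) set set)"
proof -
  let ?Z = "UNIV \<rightarrow>\<^sub>E {-N..<N} :: ('d \<Rightarrow> int) set" and ?R = "UNIV \<rightarrow>\<^sub>E {..<CARD('d)} :: ('d \<Rightarrow> nat) set"
  have "kuhn_triangulation N \<subseteq> (\<lambda>(z, r). kuhn_alcove z r) ` (?Z \<times> ?R)"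
  proof
    fix K :: "('d point) set" assume "K \<in> kuhn_triangulation N"
    then obtain z r where K: "K = kuhn_alcove z r" "\<forall>i. z i \<in> {-N..<N}" "bij_betw r UNIV {..<CARD('d)}"
      unfolding kuhn_triangulation_def by blast
    have "z \<in> ?Z" using K(2) by (simp add: PiE_UNIV_domain Pi_def)
    moreover have "r \<in> ?R" using bij_betw_apply[OF K(3)] by (auto simp: PiE_UNIV_domain Pi_def)
    ultimately show "K \<in> (\<lambda>(z, r). kuhn_alcove z r) ` (?Z \<times> ?R)" using K(1) by auto
  qed
  moreover have "finite ((\<lambda>(z, r). kuhn_alcove z r) ` (?Z \<times> ?R))"
    by (intro finite_imageI finite_cartesian_product finite_PiE) auto
  ultimately show ?thesis by (rule finite_subset)
qed

lemma Union_kuhn_triangulation: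
  assumes "N > 0"
  shows "\<Union>(kuhn_triangulation N) = (ccube (real_of_int N) :: ('d::finite point) set)"
proof
  show "\<Union>(kuhn_triangulation N) \<subseteq> (ccube (real_of_int N) :: ('d point) set)"
  proof
    fix x :: "'d point" assume "x \<in> \<Union>(kuhn_triangulation N)"
    then obtain K where x: "x \<in> K" and K: "K \<in> kuhn_triangulation N" by blast
    obtain z r where z: "K = kuhn_alcove z r" "\<And>i. - N \<le> z i" "\<And>i. z i < N"
      using K by (elim kuhn_triangulationE) blast
    have "\<bar>x $ i\<bar> \<le> real_of_int N" for i
    proof -
      have "real_of_int (- N) \<le> z i" "real_of_int (z i + 1) \<le> real_of_int N"
        using z(2)[of i] z(3)[of i] by (simp_all only: of_int_le_iff)
      then show ?thesis using kuhn_alcoveD(1,2)[OF x[unfolded z(1)], of i] by auto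
    qed
    then show "x \<in> ccube (real_of_int N)" by (simp add: ccube_def)
  qed
  show "(ccube (real_of_int N) :: ('d point) set) \<subseteq> \<Union>(kuhn_triangulation N)"
  proof
    fix x :: "'d point" assume "x \<in> ccube (real_of_int N)"
    then have x: "- N \<le> x $ i" "x $ i \<le> N" for i by (auto simp: ccube_def abs_le_iff) (smt (verit))
    \<comment> \<open>On the upper face, where x_i = N, the floor alone would name a cube outside
      the grid.\<close>
    define z where "z i = min (N - 1) \<lfloor>x $ i\<rfloor>" for i
    have z: "- N \<le> z i" "z i < N" "0 \<le> x $ i - z i" "x $ i - z i \<le> 1" for i
    proof -
      have "- N \<le> \<lfloor>x $ i\<rfloor>" using x(1)[of i] by (simp add: le_floor_iff)
      then show "- N \<le> z i" "z i < N" using assms by (auto simp: z_def)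
      have "z i \<le> \<lfloor>x $ i\<rfloor>" by (simp add: z_def)
      then show "0 \<le> x $ i - z i" by (simp add: le_floor_iff)
      show "x $ i - z i \<le> 1"
      proof (cases "\<lfloor>x $ i\<rfloor> \<le> N - 1")
        case True
        then have "z i = \<lfloor>x $ i\<rfloor>" by (simp add: z_def)
        then show ?thesis using real_of_int_floor_add_one_ge[of "x $ i"] by linarith
      next
        case False
        then show ?thesis using x(2)[of i] by (simp add: z_def)
      qed
    qed
    obtain r :: "'d \<Rightarrow> nat" where r: "bij_betw r UNIV {..<CARD('d)}" "\<And>i j. r i \<le> r j \<Longrightarrow> x $ j - z j \<le> x $ i - z i"
      using ex_antitone_enumeration[of "\<lambda>i. x $ i - z i"] by blast
    have "x \<in> kuhn_alcove z r" using z r(2) by (auto simp: kuhn_alcove_def)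
    moreover have "kuhn_alcove z r \<in> kuhn_triangulation N"
      using z r(1) by (auto simp: kuhn_triangulation_def)
    ultimately show "x \<in> \<Union>(kuhn_triangulation N)" by blast
  qed
qed

lemma admissible_kuhn_triangulation:
  assumes "N > 0"
  shows "admissible_triangulation (kuhn_triangulation N) (cube (real_of_int N) :: ('d::finite point) set)"
  unfolding admissible_triangulation_def triangulation_def
proof (intro conjI ballI allI impI)
  show fin: "finite (kuhn_triangulation N)" by (rule finite_kuhn_triangulation)
  show s: "int CARD('d) simplex K" if "K \<in> kuhn_triangulation N" for K :: "('d point) set"
    using that simplex_kuhn_alcove by (elim kuhn_triangulationE) blast
  show "\<exists>n. n simplex K" if "K \<in> kuhn_triangulation N" for K :: "('d point) set" using s[OF that] by blast
  have face: "K \<inter> K' face_of K" if "K \<in> kuhn_triangulation N" "K' \<in> kuhn_triangulation N" for K K' :: "('d point) set"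
    using that kuhn_alcove_Int_face_of by (elim kuhn_triangulationE) blast
  fix K K' :: "('d point) set" assume "K \<in> kuhn_triangulation N \<and> K' \<in> kuhn_triangulation N"
  then show "K \<inter> K' face_of K" using face[of K K'] by blast
next
  have "(cube (real_of_int N) :: ('d point) set) \<noteq> {}"
  proof -
    have "0 \<in> (cube (real_of_int N) :: ('d point) set)" using assms by (simp add: cube_def)
    then show ?thesis by blast
  qed
  then show "\<Union>(kuhn_triangulation N) = closure (cube (real_of_int N) :: ('d point) set)"
    unfolding Union_kuhn_triangulation[OF assms] by (simp add: cube_eq_box ccube_eq_cbox)
qed

section \<open>A finite element space on the cube\<close>

definition pw_poly :: "('d::finite point \<Rightarrow> real) \<Rightarrow> bool" where
  "pw_poly f \<longleftrightarrow> (\<forall>K \<in> kuhn_triangulation 3. \<exists>P. real_polynomial_function P \<and> (\<forall>x\<in>K. f x = P x))"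

lemma pw_poly_polynomial: "real_polynomial_function P \<Longrightarrow> pw_poly P"
  by (auto simp: pw_poly_def)

lemma pw_poly_add: "pw_poly f \<Longrightarrow> pw_poly g \<Longrightarrow> pw_poly (\<lambda>x. f x + g x)"
  unfolding pw_poly_def by (metis (no_types, lifting) real_polynomial_function.intros(3))

lemma pw_poly_mult: "pw_poly f \<Longrightarrow> pw_poly g \<Longrightarrow> pw_poly (\<lambda>x. f x * g x)"
  unfolding pw_poly_def by (metis (no_types, lifting) real_polynomial_function.intros(4))

lemma pw_poly_sum: "finite A \<Longrightarrow> (\<And>i. i \<in> A \<Longrightarrow> pw_poly (f i)) \<Longrightarrow> pw_poly (\<lambda>x. \<Sum>i\<in>A. f i x)"
  by (induction A rule: finite_induct) (auto intro: pw_poly_add pw_poly_polynomial)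

lemma pw_poly_prod: "finite A \<Longrightarrow> (\<And>i. i \<in> A \<Longrightarrow> pw_poly (f i)) \<Longrightarrow> pw_poly (\<lambda>x. \<Prod>i\<in>A. f i x)"
  by (induction A rule: finite_induct) (auto intro: pw_poly_mult pw_poly_polynomial)

lemma real_polynomial_function_coord: "real_polynomial_function (\<lambda>x::'d::finite point. x $ i)"
  by (intro real_polynomial_function.intros(1) bounded_linear_vec_nth)

text \<open>The kinks |x_i| = m lie on planes of the integer grid, so on each alcove the maximum is
  always the same one of its two arguments.\<close>

lemma pw_poly_coord_hat: "pw_poly (\<lambda>x::'d::finite point. max 0 ((of_int m)\<^sup>2 - (x $ i)\<^sup>2))" if "m \<ge> 0"
  unfolding pw_poly_def
proof
  fix K :: "'d point set" assume "K \<in> kuhn_triangulation 3"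
  then obtain z r where K: "K = kuhn_alcove z r" by (elim kuhn_triangulationE) blast
  consider "- m \<le> z i" "z i + 1 \<le> m" | "m \<le> z i" | "z i + 1 \<le> - m" by linarith
  then show "\<exists>P. real_polynomial_function P \<and> (\<forall>x\<in>K. max 0 ((of_int m)\<^sup>2 - (x $ i)\<^sup>2) = P x)"
  proof cases
    case 1
    have "(x $ i)\<^sup>2 \<le> (of_int m)\<^sup>2" if "x \<in> K" for x
    proof -
      have "real_of_int (- m) \<le> z i" "real_of_int (z i + 1) \<le> m" using 1 by (simp_all only: of_int_le_iff)
      then have "\<bar>x $ i\<bar> \<le> real_of_int m" using kuhn_alcoveD(1,2)[OF that[unfolded K], of i] by auto
      then show ?thesis using power_mono[of "\<bar>x $ i\<bar>" "real_of_int m" 2] by simp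
    qed
    then show ?thesis
      by (intro exI[of _ "\<lambda>x. (of_int m)\<^sup>2 - (x $ i)\<^sup>2"])
         (auto intro!: real_polynomial_function_diff real_polynomial_function_power real_polynomial_function_coord)
  next
    case 2
    have "(of_int m)\<^sup>2 \<le> (x $ i)\<^sup>2" if "x \<in> K" for x
    proof -
      have "real_of_int m \<le> z i" using 2 by simp
      then have "real_of_int m \<le> x $ i" using kuhn_alcoveD(1)[OF that[unfolded K], of i] by linarith
      then show ?thesis using \<open>m \<ge> 0\<close> by (intro power_mono) auto
    qed
    then show ?thesis by (intro exI[of _ "\<lambda>x. 0"]) auto
  next
    case 3
    have "(of_int m)\<^sup>2 \<le> (x $ i)\<^sup>2" if "x \<in> K" for x
    proof -
      have "real_of_int (z i + 1) \<le> real_of_int (- m)" using 3 by (simp only: of_int_le_iff)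
      then have "real_of_int m \<le> - x $ i" using kuhn_alcoveD(2)[OF that[unfolded K], of i] by simp
      then have "(of_int m)\<^sup>2 \<le> (- x $ i)\<^sup>2" using \<open>m \<ge> 0\<close> by (intro power_mono) auto
      then show ?thesis by simp
    qed
    then show ?thesis by (intro exI[of _ "\<lambda>x. 0"]) auto
  qed
qed

lemma smooth_limit_coord_hat:
  assumes "m \<ge> 0"
  shows "\<exists>g. smooth_limit {x::'d::finite point. \<bar>x $ i\<bar> \<le> m} (\<lambda>x. max 0 (m\<^sup>2 - (x $ i)\<^sup>2)) g"
proof -
  have "{x::'d point. m\<^sup>2 - (x $ i)\<^sup>2 \<ge> 0} = {x. \<bar>x $ i\<bar> \<le> m}"
    using assms by (auto simp: abs_le_square_iff[symmetric])
  moreover have "C_k k (\<lambda>x::'d point. m\<^sup>2 - (x $ i)\<^sup>2)" for k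
    by (intro C_k_real_polynomial_function real_polynomial_function_diff real_polynomial_function_power
        real_polynomial_function_coord real_polynomial_function.intros(2))
  ultimately show ?thesis using smooth_limit_positive_part[of "\<lambda>x::'d point. m\<^sup>2 - (x $ i)\<^sup>2"] by auto
qed

lemma ccube_eq_INT: "ccube m = (\<Inter>i\<in>UNIV. {x. \<bar>x $ i\<bar> \<le> m})"
  by (auto simp: ccube_def)

text \<open>Truncated parabolas instead of a smooth cutoff, because the fields must be piecewise
  polynomial on the mesh.\<close>

definition bump :: "'d::finite point \<Rightarrow> real" where
  "bump x = (\<Prod>i\<in>UNIV. max 0 (1 - (x $ i)\<^sup>2))"

text \<open>Each factor is 1 for |x_i| \<le> 1, (4 - x_i^2)/3 up to |x_i| = 2 and 0 beyond:
  subtracting the smaller hat flattens the top of the larger one.\<close>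

definition plateau :: "'d::finite point \<Rightarrow> real" where
  "plateau x = (\<Prod>i\<in>UNIV. (max 0 (4 - (x $ i)\<^sup>2) - max 0 (1 - (x $ i)\<^sup>2)) / 3)"

lemma ex_bump_grad: "\<exists>g. smooth_limit (ccube 1) bump g"
  unfolding bump_def[abs_def] ccube_eq_INT
  by (rule smooth_limit_prod) (use smooth_limit_coord_hat[of 1] in auto)

lemma pw_poly_bump: "pw_poly bump"
  unfolding bump_def[abs_def] by (rule pw_poly_prod) (use pw_poly_coord_hat[of 1] in auto)

lemma bump_eq_0: "1 \<le> \<bar>x $ i\<bar> \<Longrightarrow> bump x = 0"
  using abs_le_square_iff[of 1 "x $ i"] unfolding bump_def
  by (intro prod_zero bexI[of _ i]) auto

lemma bump_nonneg: "bump x \<ge> 0"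
  unfolding bump_def by (intro prod_nonneg) auto

lemma bump_pos: "x \<in> cube 1 \<Longrightarrow> bump x > 0"
  unfolding bump_def by (intro prod_pos) (auto simp: cube_def abs_square_less_1)

lemma smooth_limit_plateau: "\<exists>g. smooth_limit (ccube 2) plateau g"
  unfolding plateau_def[abs_def] ccube_eq_INT
proof (rule smooth_limit_prod)
  fix i :: 'a
  obtain g where g: "smooth_limit {x::'a point. \<bar>x $ i\<bar> \<le> 2} (\<lambda>x. max 0 (4 - (x $ i)\<^sup>2)) g"
    using smooth_limit_coord_hat[of 2 i] by auto
  obtain h where "smooth_limit {x::'a point. \<bar>x $ i\<bar> \<le> 1} (\<lambda>x. max 0 (1 - (x $ i)\<^sup>2)) h"
    using smooth_limit_coord_hat[of 1 i] by auto
  then have h: "smooth_limit {x::'a point. \<bar>x $ i\<bar> \<le> 2} (\<lambda>x. max 0 (1 - (x $ i)\<^sup>2)) h"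
    by (rule smooth_limit_mono) auto
  from smooth_limit_cmult[OF smooth_limit_add[OF g smooth_limit_cmult[OF h, of "-1"]], of "1/3"]
  show "\<exists>g. smooth_limit {x::'a point. \<bar>x $ i\<bar> \<le> 2} (\<lambda>x. (max 0 (4 - (x $ i)\<^sup>2) - max 0 (1 - (x $ i)\<^sup>2)) / 3) g"
    by auto
qed auto

lemma pw_poly_plateau: "pw_poly plateau"
  unfolding plateau_def[abs_def]
proof (rule pw_poly_prod)
  fix i :: 'a
  have "pw_poly (\<lambda>x::'a point. 1/3 * (max 0 (4 - (x $ i)\<^sup>2) + (-1) * max 0 (1 - (x $ i)\<^sup>2)))"
  proof (intro pw_poly_mult pw_poly_add)
    show "pw_poly (\<lambda>x::'a point. max 0 (4 - (x $ i)\<^sup>2))" using pw_poly_coord_hat[of 2 i] by simp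
    show "pw_poly (\<lambda>x::'a point. max 0 (1 - (x $ i)\<^sup>2))" using pw_poly_coord_hat[of 1 i] by simp
  qed (rule pw_poly_polynomial[OF real_polynomial_function.intros(2)])+
  then show "pw_poly (\<lambda>x::'a point. (max 0 (4 - (x $ i)\<^sup>2) - max 0 (1 - (x $ i)\<^sup>2)) / 3)" by simp
qed auto

lemma plateau_eq_1: "x \<in> cube 1 \<Longrightarrow> plateau x = 1"
  unfolding plateau_def
proof (intro prod.neutral ballI)
  fix i assume "x \<in> cube 1"
  then have "(x $ i)\<^sup>2 < 1" by (simp add: cube_def abs_square_less_1)
  then show "(max 0 (4 - (x $ i)\<^sup>2) - max 0 (1 - (x $ i)\<^sup>2)) / 3 = 1" by (simp add: max_def)
qed

text \<open>The closed cube of radius 2 is compact in the open cube of radius 3, as membership in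
  H10 requires, and holds both the counterexample fields and the cut off rigid motions.\<close>

definition fe_field :: "('d::finite point \<Rightarrow> 'd point) \<Rightarrow> bool" where
  "fe_field v \<longleftrightarrow> (\<forall>i. (\<exists>g. smooth_limit (ccube 2) (\<lambda>x. v x $ i) g) \<and> pw_poly (\<lambda>x. v x $ i))"

definition fun_span :: "('a \<Rightarrow> 'b::real_vector) set \<Rightarrow> ('a \<Rightarrow> 'b) set" where
  "fun_span B = range (\<lambda>(c :: ('a \<Rightarrow> 'b) \<Rightarrow> real) x. \<Sum>b\<in>B. c b *\<^sub>R b x)"

lemma fun_span_scaled_base:
  assumes "finite B" "b \<in> B" shows "(\<lambda>x. a *\<^sub>R b x) \<in> fun_span B"
proof -
  have "(\<lambda>x. a *\<^sub>R b x) = (\<lambda>x. \<Sum>b'\<in>B. (if b' = b then a else 0) *\<^sub>R b' x)"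
    using assms by (auto simp: if_distrib[of "\<lambda>c. c *\<^sub>R _"] cong: if_cong)
  then show ?thesis unfolding fun_span_def
    by (intro image_eqI[where x = "\<lambda>b'. if b' = b then a else 0"]) auto
qed

lemma fun_span_base: "finite B \<Longrightarrow> b \<in> B \<Longrightarrow> b \<in> fun_span B"
  using fun_span_scaled_base[of B b 1] by simp

lemma fe_field_fun_span:
  assumes "finite B" "\<And>b. b \<in> B \<Longrightarrow> fe_field b" "v \<in> fun_span B"
  shows "fe_field v"
proof -
  obtain c where v: "v = (\<lambda>x. \<Sum>b\<in>B. c b *\<^sub>R b x)" using assms(3) by (auto simp: fun_span_def)
  have "\<exists>g. smooth_limit (ccube 2) (\<lambda>x. \<Sum>b\<in>B. c b * b x $ i) g" for i
  proof (rule smooth_limit_sum[OF assms(1)])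
    fix b assume "b \<in> B"
    then obtain g where "smooth_limit (ccube 2) (\<lambda>x. b x $ i) g" using assms(2) by (auto simp: fe_field_def)
    then show "\<exists>g. smooth_limit (ccube 2) (\<lambda>x. c b * b x $ i) g" using smooth_limit_cmult by blast
  qed
  moreover have "pw_poly (\<lambda>x. \<Sum>b\<in>B. c b * b x $ i)" for i
    using assms(2)
    by (intro pw_poly_sum[OF assms(1)] pw_poly_mult[OF pw_poly_polynomial[OF real_polynomial_function.intros(2)]])
       (simp add: fe_field_def)
  ultimately show ?thesis by (simp add: fe_field_def v)
qed

lemma compact_ccube: "compact (ccube a)" and open_cube: "open (cube a)" and bounded_cube: "bounded (cube a)"
  by (auto simp: ccube_eq_cbox cube_eq_box intro: open_box compact_cbox bounded_box)

lemma ccube_subset_cube: "a < b \<Longrightarrow> ccube a \<subseteq> cube b" and ccube_mono: "a \<le> b \<Longrightarrow> ccube a \<subseteq> ccube b"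
  by (auto simp: ccube_def cube_def intro: le_less_trans order_trans)

lemma lmeasurable_cube: "cube a \<in> lmeasurable"
  by (rule lmeasurable_open[OF bounded_cube open_cube])

lemma sets_cube: "cube a \<in> sets lebesgue"
  using lmeasurable_cube by auto

lemma fe_field_H10:
  assumes "fe_field v" shows "v \<in> H10 (cube 3)"
proof -
  have "\<forall>i. \<exists>g. smooth_limit (ccube 2) (\<lambda>x. v x $ i) g" using assms by (simp add: fe_field_def)
  from choice[OF this] obtain g where g: "\<And>i. smooth_limit (ccube 2) (\<lambda>x. v x $ i) (g i)" by blast
  show ?thesis
    by (rule H10I[OF lmeasurable_cube open_cube, where G = "\<lambda>x. \<chi> i. g i x"])
       (simp add: smooth_limit_H10_scalar(1)[OF g compact_ccube ccube_subset_cube[of 2 3] open_cube bounded_cube])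
qed

lemma fe_field_piecewise_polynomial:
  assumes "fe_field v" shows "piecewise_polynomial (kuhn_triangulation 3) \<Omega> v"
  unfolding piecewise_polynomial_def
proof
  fix K :: "'a point set" assume K: "K \<in> kuhn_triangulation 3"
  have "\<forall>i. \<exists>P. real_polynomial_function P \<and> (\<forall>x\<in>K. v x $ i = P x)"
    using assms K by (auto simp: fe_field_def pw_poly_def)
  from choice[OF this] obtain P where P: "\<And>i. real_polynomial_function (P i)" "\<And>i x. x \<in> K \<Longrightarrow> v x $ i = P i x" by blast
  have "polynomial_function (\<lambda>x. \<chi> i. P i x)"
    unfolding polynomial_function_iff_Basis_inner
    by (auto simp: Basis_vec_def inner_axis P)
  then show "\<exists>P. polynomial_function P \<and> (\<forall>x\<in>interior K \<inter> \<Omega>. v x = P x)"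
    using P(2) interior_subset by (intro exI[of _ "\<lambda>x. \<chi> i. P i x"]) (auto simp: vec_eq_iff)
qed

text \<open>The infimum is over the empty set and equals plus infinity.\<close>

lemma inf_sup_condition_0: "inf_sup_condition \<Omega> X {\<lambda>x. 0}"
proof -
  have "l2_quotient_norm \<Omega> (\<lambda>x. 0) = 0"
    by (simp add: l2_quotient_norm_def l2_norm_def l2_inner_def set_lebesgue_integral_def)
  then have e: "{q \<in> {\<lambda>x. 0}. l2_quotient_norm \<Omega> q \<noteq> 0} = {}" by auto
  show ?thesis unfolding inf_sup_condition_def e by (simp add: top_ereal_def)
qed

lemma finite_element_pair_cube:
  assumes "finite B" "\<And>b. b \<in> B \<Longrightarrow> fe_field b"
  shows "finite_element_pair (kuhn_triangulation 3) (cube 3) (fun_span B) {\<lambda>x. 0}"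
proof -
  have f: "fe_field v" if "v \<in> fun_span B" for v using fe_field_fun_span[OF assms that] .
  have "finite_dim_space (fun_span B)" using assms(1) by (auto simp: finite_dim_space_def fun_span_def)
  moreover have "finite_dim_space {\<lambda>x::'a point. 0::real}"
    unfolding finite_dim_space_def by (intro exI[of _ "{}"]) auto
  moreover have "(\<lambda>x::'a point. 0::real) \<in> L2_on (cube 3)"
    by (simp add: L2_on_iff[OF sets_cube] square_integrable_def)
  moreover have "piecewise_polynomial (kuhn_triangulation 3) (cube 3) (\<lambda>x::'a point. 0::real)"
    unfolding piecewise_polynomial_def by (intro ballI exI[of _ "\<lambda>x. 0"]) auto
  moreover have "connected (cube 3 :: 'a point set)" by (simp add: cube_eq_box convex_connected)
  moreover have "0 \<in> (cube 3 :: 'a point set)" by (simp add: cube_def)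
  moreover have "admissible_triangulation (kuhn_triangulation 3) (cube 3 :: 'a point set)"
    using admissible_kuhn_triangulation[of 3] by simp
  ultimately show ?thesis
    unfolding finite_element_pair_def
    using open_cube[of 3] fe_field_H10[OF f] fe_field_piecewise_polynomial[OF f] inf_sup_condition_0 by auto
qed

lemma fe_velocity_space_cube:
  assumes "finite B" "\<And>b. b \<in> B \<Longrightarrow> fe_field b"
  shows "fe_velocity_space (kuhn_triangulation 3) (cube 3) (fun_span B)"
  using finite_element_pair_cube[OF assms] by unfold_locales (auto simp: finite_element_pair_def)

section \<open>Scaling in time and bump fields\<close>

lemma restr3_scaleR: "restr3 (c *\<^sub>R z) = c *\<^sub>R restr3 z"
  by (simp add: restr3_def vec_eq_iff)

lemma NL_scaleR: "NL F (c *\<^sub>R G) (c *\<^sub>R w) = c\<^sup>2 *\<^sub>R NL F G w"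
proof -
  have m: "(c *\<^sub>R A) *v (c *\<^sub>R w) = c\<^sup>2 *\<^sub>R (A *v w)" for A :: "'a gradient"
    by (simp add: matrix_vector_mult_def vec_eq_iff sum_distrib_left power2_eq_square mult_ac)
  have t: "trace (c *\<^sub>R G) = c * trace G" by (simp add: trace_def sum_distrib_left)
  have s: "sym_grad (c *\<^sub>R G) = c *\<^sub>R sym_grad G"
    by (simp add: sym_grad_def transpose_def vec_eq_iff distrib_left)
  have e: "ext3_mat (c *\<^sub>R G) = c *\<^sub>R ext3_mat G"
    by (simp add: ext3_mat_def vec_eq_iff forall_3 linear_cmul[OF linear_ext3])
  have cu: "curl_of_grad (c *\<^sub>R A) = c *\<^sub>R curl_of_grad A" for A
    by (simp add: curl_of_grad_def vec_eq_iff forall_3 right_diff_distrib)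
  show ?thesis
    by (cases F) (simp_all add: m t s e cu linear_cmul[OF linear_ext3] cross_mult_left cross_mult_right
        restr3_scaleR scaleR_add_right power2_eq_square mult_ac)
qed

lemma l2_norm_scaleR: "l2_norm \<Omega> (\<lambda>x. a *\<^sub>R f x) = \<bar>a\<bar> * l2_norm \<Omega> f"
proof -
  have "l2_inner \<Omega> (\<lambda>x. a *\<^sub>R f x) (\<lambda>x. a *\<^sub>R f x) = a\<^sup>2 * l2_inner \<Omega> f f"
    unfolding l2_inner_def set_lebesgue_integral_def
    by (simp add: power2_eq_square mult_ac flip: integral_mult_right_zero)
  then show ?thesis by (simp add: l2_norm_def real_sqrt_mult)
qed

lemma has_L2_time_derivative_scaleR:
  assumes "(c has_real_derivative c') (at t within I)"
  shows "has_L2_time_derivative \<Omega> I (\<lambda>s x. c s *\<^sub>R \<phi> x) t (\<lambda>x. c' *\<^sub>R \<phi> x)"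
proof -
  have "(1 / (s - t)) *\<^sub>R (c s *\<^sub>R \<phi> x - c t *\<^sub>R \<phi> x) - c' *\<^sub>R \<phi> x = ((c s - c t) / (s - t) - c') *\<^sub>R \<phi> x" for s x
    by (simp add: scaleR_diff_left[symmetric])
  moreover have "((\<lambda>s. \<bar>(c s - c t) / (s - t) - c'\<bar> * l2_norm \<Omega> \<phi>) \<longlongrightarrow> \<bar>c' - c'\<bar> * l2_norm \<Omega> \<phi>) (at t within I)"
    using assms unfolding has_field_derivative_iff by (intro tendsto_intros)
  ultimately show ?thesis by (simp add: has_L2_time_derivative_def l2_norm_scaleR)
qed

text \<open>The gradient is kept explicit so that nonlinear terms can be computed. The field
  vanishes outside the open cube because that cube becomes the inner region of the strip
  assumption.\<close>

definition bump_field :: "('d::finite point \<Rightarrow> 'd point) \<Rightarrow> ('d point \<Rightarrow> 'd gradient) \<Rightarrow> bool" where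
  "bump_field \<phi> G \<longleftrightarrow> (\<forall>i. smooth_limit (ccube 1) (\<lambda>x. \<phi> x $ i) (\<lambda>x. G x $ i) \<and> pw_poly (\<lambda>x. \<phi> x $ i)) \<and>
     (\<forall>x. x \<notin> cube 1 \<longrightarrow> \<phi> x = 0)"

lemma bump_fieldD:
  assumes "bump_field \<phi> G"
  shows "smooth_limit (ccube 1) (\<lambda>x. \<phi> x $ i) (\<lambda>x. G x $ i)" "x \<notin> cube 1 \<Longrightarrow> \<phi> x = 0" "fe_field \<phi>"
proof -
  show s: "smooth_limit (ccube 1) (\<lambda>x. \<phi> x $ i) (\<lambda>x. G x $ i)" for i using assms by (simp add: bump_field_def)
  show "x \<notin> cube 1 \<Longrightarrow> \<phi> x = 0" using assms by (simp add: bump_field_def)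
  have "ccube 1 \<subseteq> (ccube 2 :: 'a point set)" by (rule ccube_mono) simp
  then show "fe_field \<phi>" using assms smooth_limit_mono[OF s] unfolding fe_field_def bump_field_def by blast
qed

lemma bump_field_ess_bounded:
  assumes "bump_field \<phi> G"
  shows "ess_bounded (lebesgue_on (cube 3)) (\<lambda>x. \<phi> x $ i)" "ess_bounded (lebesgue_on (cube 3)) (\<lambda>x. G x $ i $ j)"
    "H10_scalar (cube 3) (\<lambda>x. \<phi> x $ i) (\<lambda>x. G x $ i)"
  using smooth_limit_H10_scalar[OF bump_fieldD(1)[OF assms] compact_ccube ccube_subset_cube[of 1 3] open_cube bounded_cube]
  by auto

lemma bump_field_weak_grad:
  assumes "bump_field \<phi> G"
  shows "AE x in lebesgue_on (cube 3). weak_grad (cube 3) (\<lambda>x. c *\<^sub>R \<phi> x) x = c *\<^sub>R G x"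
proof -
  have "H10_scalar (cube 3) (\<lambda>x. (c *\<^sub>R \<phi> x) $ i) (\<lambda>x. (c *\<^sub>R G x) $ i)" for i
    using smooth_limit_H10_scalar(1)[OF smooth_limit_cmult[OF bump_fieldD(1)[OF assms, of i], of c]
        compact_ccube ccube_subset_cube[of 1 3] open_cube bounded_cube]
    by simp
  from is_weak_grad_if_H10_scalar(1)[OF sets_cube this]
  show ?thesis by (rule weak_grad_AE_eq[OF lmeasurable_cube open_cube])
qed

subsection \<open>Blow-up solutions\<close>

text \<open>The blow-up profile \<open>c' = \<kappa> c\<^sup>2\<close>, \<open>c(0) = 1\<close>: the nonlinear term scales like \<open>c\<^sup>2\<close>, so
  \<open>u = c \<phi>\<close> satisfies \<open>u' + NL(u) = c\<^sup>2 (\<kappa> \<phi> + NL(\<phi>))\<close>.\<close>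

definition blowup :: "real \<Rightarrow> real \<Rightarrow> real" where
  "blowup \<kappa> t = 1 / (1 - \<kappa> * t)"

text \<open>The time interval is short enough for \<open>\<kappa> * t\<close> \<le> 1/2, so the
  profile stays finite for either sign of \<open>\<kappa>\<close>.\<close>

lemma blowup_denominator_pos:
  fixes \<kappa> t :: real
  assumes "\<kappa> \<noteq> 0" "t \<in> {0..1 / (2 * \<bar>\<kappa>\<bar>)}" shows "1 - \<kappa> * t > 0"
proof -
  have "\<kappa> * t \<le> \<bar>\<kappa>\<bar> * t" using assms(2) by (intro mult_right_mono) auto
  also have "\<dots> \<le> \<bar>\<kappa>\<bar> * (1 / (2 * \<bar>\<kappa>\<bar>))" using assms(2) by (intro mult_left_mono) auto
  also have "\<dots> = 1/2" using assms(1) by simp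
  finally show ?thesis by simp
qed

lemma blowup_has_derivative:
  assumes "\<kappa> \<noteq> 0" "t \<in> {0..1 / (2 * \<bar>\<kappa>\<bar>)}"
  shows "(blowup \<kappa> has_real_derivative \<kappa> * (blowup \<kappa> t)\<^sup>2) (at t within I)"
  unfolding blowup_def[abs_def]
  using blowup_denominator_pos[OF assms]
  by (auto intro!: derivative_eq_intros simp: power2_eq_square field_simps)

lemma blowup_0: "blowup \<kappa> 0 = 1"
  by (simp add: blowup_def)

text \<open>According to the sign of \<open>\<kappa>\<close> the denominator ends at 1/2 or 3/2, so
  the profile ends at 2 or 2/3.\<close>

lemma blowup_end:
  assumes "\<kappa> \<noteq> 0"
  shows "blowup \<kappa> (1 / (2 * \<bar>\<kappa>\<bar>)) \<noteq> 1" "(blowup \<kappa> (1 / (2 * \<bar>\<kappa>\<bar>)))\<^sup>2 \<noteq> 1"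
proof -
  have "1 - \<kappa> * (1 / (2 * \<bar>\<kappa>\<bar>)) = (if \<kappa> > 0 then 1/2 else 3/2)" using assms by auto
  then show "blowup \<kappa> (1 / (2 * \<bar>\<kappa>\<bar>)) \<noteq> 1" "(blowup \<kappa> (1 / (2 * \<bar>\<kappa>\<bar>)))\<^sup>2 \<noteq> 1"
    by (auto simp: blowup_def power2_eq_square)
qed

text \<open>Only the pairings of the force with the space are prescribed. This admits the momentum
  examples, whose force is the full residual, and the energy example, whose force is zero while the
  residual is orthogonal to a one-dimensional space.\<close>

lemma galerkin_setting_blowup:
  fixes \<phi> :: "'d::{finite,numeral} point \<Rightarrow> 'd point"
  assumes B: "finite B" "\<And>b. b \<in> B \<Longrightarrow> fe_field b" and \<phi>: "\<phi> \<in> B" "bump_field \<phi> G" and \<kappa>: "\<kappa> \<noteq> 0"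
    and f: "\<And>t. f t \<in> L2_on (cube 3)"
    and eqn: "\<And>t v. v \<in> fun_span B \<Longrightarrow> l2_inner (cube 3) (f t) v =
        (\<integral>x. (blowup \<kappa> t)\<^sup>2 * inner (\<kappa> *\<^sub>R \<phi> x + NL F (G x) (\<phi> x)) (v x) \<partial>lebesgue_on (cube 3))"
  shows "galerkin_setting F (kuhn_triangulation 3) (cube 3) (fun_span B) {\<lambda>x. 0} 0 f (1 / (2 * \<bar>\<kappa>\<bar>))
      (\<lambda>t x. blowup \<kappa> t *\<^sub>R \<phi> x) (\<lambda>t x. 0)"
proof -
  interpret fe_velocity_space "kuhn_triangulation 3" "cube 3" "fun_span B"
    by (rule fe_velocity_space_cube[OF B])
  let ?M = "lebesgue_on (cube 3 :: 'd point set)" and ?c = "blowup \<kappa>"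
  have sp: "(\<lambda>x. a *\<^sub>R \<phi> x) \<in> fun_span B" for a by (rule fun_span_scaled_base[OF B(1) \<phi>(1)])
  have main: "l2_inner (cube 3) (\<lambda>x. (\<kappa> * (?c t)\<^sup>2) *\<^sub>R \<phi> x +
       NL F (weak_grad (cube 3) (\<lambda>x. ?c t *\<^sub>R \<phi> x) x) (?c t *\<^sub>R \<phi> x)) v = l2_inner (cube 3) (f t) v"
    if v: "v \<in> fun_span B" for t v
  proof -
    let ?N = "\<lambda>x. NL F (weak_grad (cube 3) (\<lambda>x. ?c t *\<^sub>R \<phi> x) x) (?c t *\<^sub>R \<phi> x)"
    let ?N' = "\<lambda>x. NL F (G x) (\<phi> x)"
    have e1: "ess_bounded ?M (\<lambda>x. ?N x $ i)" for i
      by (intro ess_bounded_NL X_ess_bounded[OF sp])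
    have e2: "ess_bounded ?M (\<lambda>x. ?N' x $ i)" for i
      by (intro ess_bounded_NL bump_field_ess_bounded[OF \<phi>(2)])
    have b1: "ess_bounded ?M (\<lambda>x. inner ((\<kappa> * (?c t)\<^sup>2) *\<^sub>R \<phi> x + ?N x) (v x))"
      unfolding inner_vec_def
      by (simp, intro ess_bounded_intros e1 X_ess_bounded[OF v] bump_field_ess_bounded[OF \<phi>(2)])
    have b2: "ess_bounded ?M (\<lambda>x. (?c t)\<^sup>2 * inner (\<kappa> *\<^sub>R \<phi> x + ?N' x) (v x))"
      unfolding inner_vec_def
      by (simp, intro ess_bounded_intros e2 X_ess_bounded[OF v] bump_field_ess_bounded[OF \<phi>(2)])
    show ?thesis
      unfolding eqn[OF v] unfolding l2_inner_eq[OF sets_\<Omega>]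
    proof (rule integral_cong_AE)
      show "AE x in ?M. inner ((\<kappa> * (?c t)\<^sup>2) *\<^sub>R \<phi> x + ?N x) (v x) = (?c t)\<^sup>2 * inner (\<kappa> *\<^sub>R \<phi> x + ?N' x) (v x)"
        using bump_field_weak_grad[OF \<phi>(2), of "?c t"]
      proof eventually_elim
        case (elim x)
        have "?N x = (?c t)\<^sup>2 *\<^sub>R ?N' x" unfolding elim by (rule NL_scaleR)
        then show ?case by (simp add: inner_add_left distrib_left mult_ac)
      qed
    qed (use b1 b2 in \<open>auto simp: ess_bounded_def\<close>)
  qed
  have zero: "l2_inner (cube 3) (\<lambda>x. 0) g = 0" for g :: "'d point \<Rightarrow> real"
    by (simp add: l2_inner_eq[OF sets_\<Omega>])
  have "galerkin_solution F (cube 3) (fun_span B) {\<lambda>x. 0} 0 f {0..1 / (2 * \<bar>\<kappa>\<bar>)}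
      (\<lambda>t x. ?c t *\<^sub>R \<phi> x) (\<lambda>t x. 0)"
    unfolding galerkin_solution_def
  proof (intro ballI conjI)
    fix t assume t: "t \<in> {0..1 / (2 * \<bar>\<kappa>\<bar>)}"
    show "(\<lambda>x. ?c t *\<^sub>R \<phi> x) \<in> fun_span B" by (rule sp)
    show "\<exists>u'\<in>fun_span B. has_L2_time_derivative (cube 3) {0..1 / (2 * \<bar>\<kappa>\<bar>)} (\<lambda>t x. ?c t *\<^sub>R \<phi> x) t u' \<and>
       (\<forall>v\<in>fun_span B. \<forall>q\<in>{\<lambda>x. 0}.
         l2_inner (cube 3) (\<lambda>x. u' x + NL F (weak_grad (cube 3) (\<lambda>x. ?c t *\<^sub>R \<phi> x) x) (?c t *\<^sub>R \<phi> x)) v -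
         l2_inner (cube 3) (\<lambda>x. 0) (weak_div (cube 3) v) +
         l2_inner (cube 3) q (weak_div (cube 3) (\<lambda>x. ?c t *\<^sub>R \<phi> x)) +
         0 * l2_inner (cube 3) (weak_grad (cube 3) (\<lambda>x. ?c t *\<^sub>R \<phi> x)) (weak_grad (cube 3) v) =
         l2_inner (cube 3) (f t) v)"
      by (intro bexI[of _ "\<lambda>x. (\<kappa> * (?c t)\<^sup>2) *\<^sub>R \<phi> x"] conjI
          has_L2_time_derivative_scaleR[OF blowup_has_derivative[OF \<kappa> t]] sp ballI)
         (simp add: main zero)
  qed simp
  then show ?thesis
    unfolding galerkin_setting_def using finite_element_pair_cube[OF B] \<kappa> f by simp
qed

text \<open>The inner region is the cube of radius 1. An element meeting the boundary has some z_i
  equal to 2 or -3 and so lies where |x_i| \<ge> 2. The cutoff is 1 on the inner region and turns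
  rigid motions into members of the space without altering them there.\<close>

lemma boundary_strip_blowup:
  fixes \<phi> :: "'d::{finite,numeral} point \<Rightarrow> 'd point"
  assumes d: "restr3_adjoint TYPE('d)" and \<phi>: "bump_field \<phi> G"
    and rigid: "\<And>g. g \<in> rigid_fields \<Longrightarrow> (\<lambda>x. plateau x *\<^sub>R g x) \<in> X"
  shows "boundary_strip_assumption (kuhn_triangulation 3) (cube 3) X
     (\<lambda>t x. (c t)\<^sup>2 *\<^sub>R (\<kappa> *\<^sub>R \<phi> x + NL F (G x) (\<phi> x))) \<tau> (\<lambda>t x. c t *\<^sub>R \<phi> x) (\<lambda>t x. 0)"
  unfolding boundary_strip_assumption_def
proof (intro exI[of _ "cube 1"] conjI ballI impI AE_I2)
  show "cube 1 \<subset> (cube 3 :: 'd point set)"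
  proof
    show "cube 1 \<subseteq> (cube 3 :: 'd point set)" by (auto simp: cube_def intro: less_trans)
    have "(\<chi> i. 2) \<in> (cube 3 :: 'd point set)" "(\<chi> i. 2) \<notin> (cube 1 :: 'd point set)" by (auto simp: cube_def)
    then show "cube 1 \<noteq> (cube 3 :: 'd point set)" by metis
  qed
  show "interior K \<inter> cube 3 \<subseteq> cube 3 - cube 1"
    if K3: "K \<in> kuhn_triangulation 3" and Kf: "K \<inter> frontier (cube 3) \<noteq> {}" for K :: "'d point set"
  proof -
    obtain z r where K: "K = kuhn_alcove z r" and z: "\<And>i. - 3 \<le> z i" "\<And>i. z i < 3"
      using K3 by (elim kuhn_triangulationE) blast
    obtain y where y: "y \<in> K" "y \<in> frontier (cube 3)" using Kf by blast
    then have "y \<notin> cube 3" using interior_open[OF open_cube] by (auto simp: frontier_def)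
    then have "\<exists>i. \<not> \<bar>y $ i\<bar> < 3" by (simp add: cube_def)
    then obtain i where "\<bar>y $ i\<bar> \<ge> 3" by (auto simp: not_less)
    then have "z i = 2 \<or> z i = -3"
      using kuhn_alcoveD(1,2)[OF y(1)[unfolded K], of i] z[of i] by linarith
    then have "x \<notin> cube 1" if "x \<in> K" for x
      using kuhn_alcoveD(1,2)[OF that[unfolded K], of i] by (auto simp: cube_def intro!: exI[of _ i])
    then show ?thesis using interior_subset by blast
  qed
  fix t x assume "x \<in> cube 3 - (cube 1 :: 'd point set)"
  then have "\<phi> x = 0" using bump_fieldD(2)[OF \<phi>] by blast
  then show "c t *\<^sub>R \<phi> x = 0" "(c t)\<^sup>2 *\<^sub>R (\<kappa> *\<^sub>R \<phi> x + NL F (G x) (\<phi> x)) = 0"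
    by (simp_all add: NL_zero_velocity[OF d])
next
  fix g :: "'d point \<Rightarrow> 'd point" assume "g \<in> rigid_fields"
  then show "\<exists>v\<in>X. AE x in lebesgue. x \<in> cube 1 \<longrightarrow> v x = g x"
    by (intro bexI[OF _ rigid]) (auto simp: plateau_eq_1)
qed simp

lemma fe_field_plateau:
  fixes g :: "'d::finite point \<Rightarrow> 'd point"
  assumes "polynomial_function g" shows "fe_field (\<lambda>x. plateau x *\<^sub>R g x)"
  unfolding fe_field_def
proof (intro allI conjI)
  fix i
  have p: "real_polynomial_function (\<lambda>x. g x $ i)" by (rule polynomial_function_component[OF assms])
  obtain h where h: "smooth_limit (ccube 2) (plateau :: 'd point \<Rightarrow> real) h" using smooth_limit_plateau by blast
  have "smooth_limit UNIV (\<lambda>x. g x $ i) (\<lambda>x. \<chi> j. frechet_derivative (\<lambda>x. g x $ i) (at x) (axis j 1))"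
    by (rule smooth_limit_polynomial[OF p]) (rule C_k_SucD(1)[OF C_k_real_polynomial_function[OF p]])
  from smooth_limit_mult[OF h this] show "\<exists>g'. smooth_limit (ccube 2) (\<lambda>x. (plateau x *\<^sub>R g x) $ i) g'" by auto
  show "pw_poly (\<lambda>x. (plateau x *\<^sub>R g x) $ i)"
    using pw_poly_mult[OF pw_poly_plateau pw_poly_polynomial[OF p]] by simp
qed

lemma constant_onD: "f constant_on A \<Longrightarrow> x \<in> A \<Longrightarrow> y \<in> A \<Longrightarrow> f x = f y"
  by (auto simp: constant_on_def)

lemma conserves_energyD:
  assumes "conserves_energy TYPE('d::{finite,numeral}) F"
    and "galerkin_setting F \<T> (\<Omega> :: ('d point) set) X Q 0 (\<lambda>t x. 0) \<tau> u p"
  shows "(\<lambda>t. kinetic_energy \<Omega> (u t)) constant_on {0..\<tau>}"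
  using assms unfolding conserves_energy_def by blast

lemma conserves_linear_momentumD:
  assumes "conserves_linear_momentum TYPE('d::{finite,numeral}) F"
    and "galerkin_setting F \<T> (\<Omega> :: ('d point) set) X Q \<nu> f \<tau> u p" "boundary_strip_assumption \<T> \<Omega> X f \<tau> u p"
    and "\<And>t. linear_momentum \<Omega> (f t) = 0"
  shows "(\<lambda>t. linear_momentum \<Omega> (u t)) constant_on {0..\<tau>}"
  using assms unfolding conserves_linear_momentum_def by blast

lemma conserves_angular_momentumD:
  assumes "conserves_angular_momentum TYPE('d::{finite,numeral}) F"
    and "galerkin_setting F \<T> (\<Omega> :: ('d point) set) X Q \<nu> f \<tau> u p" "boundary_strip_assumption \<T> \<Omega> X f \<tau> u p"
    and "\<And>t. angular_momentum \<Omega> (f t) = 0"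
  shows "(\<lambda>t. angular_momentum \<Omega> (u t)) constant_on {0..\<tau>}"
  using assms unfolding conserves_angular_momentum_def by blast

theorem momentum_counterexample:
  fixes \<phi> :: "'d::{finite,numeral} point \<Rightarrow> 'd point" and F :: formulation
  assumes d: "restr3_adjoint TYPE('d)" and \<phi>: "bump_field \<phi> G" and \<kappa>: "\<kappa> \<noteq> 0"
  defines "h \<equiv> \<lambda>x. \<kappa> *\<^sub>R \<phi> x + NL F (G x) (\<phi> x)"
  shows "linear_momentum (cube 3) h = 0 \<Longrightarrow> linear_momentum (cube 3) \<phi> \<noteq> 0 \<Longrightarrow> \<not> conserves_linear_momentum TYPE('d) F"
    "angular_momentum (cube 3) h = 0 \<Longrightarrow> angular_momentum (cube 3) \<phi> \<noteq> 0 \<Longrightarrow> \<not> conserves_angular_momentum TYPE('d) F"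
proof -
  let ?c = "blowup \<kappa>" and ?\<tau> = "1 / (2 * \<bar>\<kappa>\<bar>)" and ?M = "lebesgue_on (cube 3 :: 'd point set)"
  \<comment> \<open>The strip assumption demands representatives of the rigid motions, so they join
    \<open>\<phi>\<close> in the basis.\<close>
  define B :: "('d point \<Rightarrow> 'd point) set" where "B = insert \<phi> ((\<lambda>g x. plateau x *\<^sub>R g x) ` rigid_fields)"
  have "finite (rigid_fields :: ('d point \<Rightarrow> 'd point) set)" by (simp add: rigid_fields_def)
  then have B: "finite B" by (simp add: B_def)
  have BF: "fe_field b" if "b \<in> B" for b
  proof -
    have "polynomial_function g" if "g \<in> rigid_fields" for g :: "'d point \<Rightarrow> 'd point"
      using rigid_field_grad[OF d that] by metis
    then show ?thesis using that bump_fieldD(3)[OF \<phi>] by (auto simp: B_def intro: fe_field_plateau)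
  qed
  have \<phi>B: "\<phi> \<in> B" by (simp add: B_def)
  let ?f = "\<lambda>t x. (?c t)\<^sup>2 *\<^sub>R h x" and ?u = "\<lambda>t x. ?c t *\<^sub>R \<phi> x"
  have hb: "ess_bounded ?M (\<lambda>x. ((?c t)\<^sup>2 *\<^sub>R h x) $ i)" for t i
    unfolding h_def vector_scaleR_component vector_add_component real_scaleR_def
    by (intro ess_bounded_intros ess_bounded_NL bump_field_ess_bounded[OF \<phi>])
  have f: "?f t \<in> L2_on (cube 3)" for t
    unfolding L2_on_iff[OF sets_cube]
    by (intro square_integrable_vec ess_bounded_square_integrable finite_measure_lebesgue_on[OF lmeasurable_cube] hb)
  have gs: "galerkin_setting F (kuhn_triangulation 3) (cube 3) (fun_span B) {\<lambda>x. 0} 0 ?f ?\<tau> ?u (\<lambda>t x. 0)"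
    by (rule galerkin_setting_blowup[OF B BF \<phi>B \<phi> \<kappa> f]) (auto simp: l2_inner_eq[OF sets_cube] h_def)
  have bs: "boundary_strip_assumption (kuhn_triangulation 3) (cube 3) (fun_span B) ?f ?\<tau> ?u (\<lambda>t x. 0)"
    unfolding h_def
    by (rule boundary_strip_blowup[OF d \<phi>]) (intro fun_span_base B, simp add: B_def)
  have t01: "0 \<in> {0..?\<tau>}" "?\<tau> \<in> {0..?\<tau>}" by auto
  {
    assume h0: "linear_momentum (cube 3) h = 0" and \<phi>0: "linear_momentum (cube 3) \<phi> \<noteq> 0"
    have s: "linear_momentum (cube 3) (\<lambda>x. a *\<^sub>R w x) = a *\<^sub>R linear_momentum (cube 3) w" for a and w :: "'d point \<Rightarrow> 'd point"
      by (simp add: linear_momentum_def LINT_eq_lebesgue_on[OF sets_cube])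
    have z: "linear_momentum (cube 3) (?f t) = 0" for t by (simp add: s h0)
    show "\<not> conserves_linear_momentum TYPE('d) F"
    proof
      assume c: "conserves_linear_momentum TYPE('d) F"
      have const: "(\<lambda>t. linear_momentum (cube 3) (?u t)) constant_on {0..?\<tau>}"
        by (rule conserves_linear_momentumD[OF c gs bs z])
      have "?c 0 *\<^sub>R linear_momentum (cube 3) \<phi> = ?c ?\<tau> *\<^sub>R linear_momentum (cube 3) \<phi>"
        using constant_onD[OF const t01] by (simp only: s)
      then show False using \<phi>0 blowup_end(1)[OF \<kappa>] blowup_0[of \<kappa>] unfolding scaleR_cancel_right by simp
    qed
  next
    assume h0: "angular_momentum (cube 3) h = 0" and \<phi>0: "angular_momentum (cube 3) \<phi> \<noteq> 0"
    have s: "angular_momentum (cube 3) (\<lambda>x. a *\<^sub>R w x) = a *\<^sub>R angular_momentum (cube 3) w" for a and w :: "'d point \<Rightarrow> 'd point"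
      by (simp add: angular_momentum_def LINT_eq_lebesgue_on[OF sets_cube] linear_cmul[OF linear_ext3] cross_mult_left)
    have z: "angular_momentum (cube 3) (?f t) = 0" for t by (simp add: s h0)
    show "\<not> conserves_angular_momentum TYPE('d) F"
    proof
      assume c: "conserves_angular_momentum TYPE('d) F"
      have const: "(\<lambda>t. angular_momentum (cube 3) (?u t)) constant_on {0..?\<tau>}"
        by (rule conserves_angular_momentumD[OF c gs bs z])
      have "?c 0 *\<^sub>R angular_momentum (cube 3) \<phi> = ?c ?\<tau> *\<^sub>R angular_momentum (cube 3) \<phi>"
        using constant_onD[OF const t01] by (simp only: s)
      then show False using \<phi>0 blowup_end(1)[OF \<kappa>] blowup_0[of \<kappa>] unfolding scaleR_cancel_right by simp
    qed
  }
qed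

text \<open>The force must be zero and cannot be adjusted to the solution. Spanning the space by
  \<open>\<phi>\<close> alone leaves one tested equation, and \<open>h\<close> says that
  \<open>\<kappa>\<close> solves it.\<close>

theorem energy_counterexample:
  fixes \<phi> :: "'d::{finite,numeral} point \<Rightarrow> 'd point"
  assumes \<phi>: "bump_field \<phi> G" and \<kappa>: "\<kappa> \<noteq> 0"
    and h: "(\<integral>x. inner (\<kappa> *\<^sub>R \<phi> x + NL F (G x) (\<phi> x)) (\<phi> x) \<partial>lebesgue_on (cube 3)) = 0"
    and e: "kinetic_energy (cube 3) \<phi> \<noteq> 0"
  shows "\<not> conserves_energy TYPE('d) F"
proof
  let ?c = "blowup \<kappa>" and ?\<tau> = "1 / (2 * \<bar>\<kappa>\<bar>)"
  let ?u = "\<lambda>t x. ?c t *\<^sub>R \<phi> x"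
  assume cons: "conserves_energy TYPE('d) F"
  have gs: "galerkin_setting F (kuhn_triangulation 3) (cube 3) (fun_span {\<phi>}) {\<lambda>x. 0} 0 (\<lambda>t x. 0) ?\<tau> ?u (\<lambda>t x. 0)"
  proof (rule galerkin_setting_blowup[OF _ _ _ \<phi> \<kappa>])
    show "(\<lambda>x. 0) \<in> L2_on (cube 3)" by (simp add: L2_on_iff[OF sets_cube] square_integrable_def)
    fix t and v :: "'d point \<Rightarrow> 'd point" assume "v \<in> fun_span {\<phi>}"
    then obtain a where v: "v = (\<lambda>x. a *\<^sub>R \<phi> x)" by (auto simp: fun_span_def)
    show "l2_inner (cube 3) (\<lambda>x. 0) v =
        (\<integral>x. (?c t)\<^sup>2 * inner (\<kappa> *\<^sub>R \<phi> x + NL F (G x) (\<phi> x)) (v x) \<partial>lebesgue_on (cube 3))"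
      unfolding v inner_scaleR_right integral_mult_right_zero h by (simp add: l2_inner_eq[OF sets_cube])
  qed (use bump_fieldD(3)[OF \<phi>] in auto)
  have s: "kinetic_energy (cube 3) (?u t) = (?c t)\<^sup>2 * kinetic_energy (cube 3) \<phi>" for t
    by (simp add: kinetic_energy_def LINT_eq_lebesgue_on[OF sets_cube] power_mult_distrib)
  have const: "(\<lambda>t. kinetic_energy (cube 3) (?u t)) constant_on {0..?\<tau>}"
    by (rule conserves_energyD[OF cons gs])
  have "kinetic_energy (cube 3) (?u 0) = kinetic_energy (cube 3) (?u ?\<tau>)"
    by (rule constant_onD[OF const]) auto
  then show False using e blowup_end(2)[OF \<kappa>] by (simp add: s blowup_0)
qed

subsection \<open>Integrals over the cube\<close>

abbreviation cube_measure :: "('d::finite point) measure" where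
  "cube_measure \<equiv> lebesgue_on (cube 3)"

lemma finite_cube_measure: "finite_measure cube_measure"
  by (rule finite_measure_lebesgue_on[OF lmeasurable_cube])

text \<open>Any representative serves: its values are only ever integrated, by parts or in the
  pairing with test functions.\<close>

definition bump_grad :: "'d::finite point \<Rightarrow> 'd point" where
  "bump_grad = (SOME g. smooth_limit (ccube 1) bump g)"

lemma smooth_limit_bump: "smooth_limit (ccube 1) bump bump_grad"
  unfolding bump_grad_def by (rule someI_ex[OF ex_bump_grad])

lemma ess_bounded_continuous:
  assumes "continuous_on UNIV (f :: 'd::finite point \<Rightarrow> real)" shows "ess_bounded cube_measure f"
proof -
  have "bounded (f ` ccube 3)"
    by (intro compact_imp_bounded compact_continuous_image compact_ccube continuous_on_subset[OF assms]) auto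
  then obtain C where C: "\<And>x. x \<in> ccube 3 \<Longrightarrow> \<bar>f x\<bar> \<le> C" by (auto simp: bounded_iff)
  have "cube 3 \<subseteq> (ccube 3 :: 'd point set)" by (auto simp: cube_def ccube_def intro: less_imp_le)
  then have "\<And>x. x \<in> cube 3 \<Longrightarrow> \<bar>f x\<bar> \<le> C" using C by blast
  moreover have "f \<in> borel_measurable cube_measure"
    by (rule continuous_imp_measurable_on_sets_lebesgue[OF continuous_on_subset[OF assms] sets_cube]) simp
  ultimately show ?thesis unfolding ess_bounded_def by (intro conjI exI[of _ C] AE_I2) auto
qed

lemma ess_bounded_polynomial: "real_polynomial_function P \<Longrightarrow> ess_bounded cube_measure P"
  by (rule ess_bounded_continuous[OF C_k_imp_continuous[OF C_k_real_polynomial_function[of _ 0]]])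

lemma ess_bounded_bump: "ess_bounded cube_measure bump" "ess_bounded cube_measure (\<lambda>x. bump_grad x $ j)"
  using smooth_limit_H10_scalar[OF smooth_limit_bump compact_ccube ccube_subset_cube[of 1 3] open_cube bounded_cube]
  by auto

lemmas cube_integrable = ess_bounded_integrable[OF finite_cube_measure]

definition poly_deriv :: "('d::finite point \<Rightarrow> real) \<Rightarrow> 'd \<Rightarrow> ('d point \<Rightarrow> real) \<Rightarrow> bool" where
  "poly_deriv P j dP \<longleftrightarrow> real_polynomial_function P \<and> real_polynomial_function dP \<and> (\<forall>x. partial_deriv j P x = dP x)"

lemma poly_deriv_const: "poly_deriv (\<lambda>x. c) j (\<lambda>x. 0)"
  by (auto simp: poly_deriv_def partial_deriv_def)

lemma has_derivative_coord: "((\<lambda>x::'d::finite point. x $ i) has_derivative (\<lambda>h. h $ i)) (at x)"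
  by (rule bounded_linear_imp_has_derivative[OF bounded_linear_vec_nth])

lemma poly_deriv_coord: "poly_deriv (\<lambda>x. x $ i) j (\<lambda>x. if i = j then 1 else 0)"
  unfolding poly_deriv_def
  by (auto simp: partial_deriv_eq[OF has_derivative_coord] axis_def intro: real_polynomial_function_coord)

lemma poly_deriv_add:
  "poly_deriv P j dP \<Longrightarrow> poly_deriv Q j dQ \<Longrightarrow> poly_deriv (\<lambda>x. P x + Q x) j (\<lambda>x. dP x + dQ x)"
  unfolding poly_deriv_def by (auto simp: partial_deriv_add C_k_real_polynomial_function)

lemma poly_deriv_mult:
  "poly_deriv P j dP \<Longrightarrow> poly_deriv Q j dQ \<Longrightarrow> poly_deriv (\<lambda>x. P x * Q x) j (\<lambda>x. P x * dQ x + dP x * Q x)"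
  unfolding poly_deriv_def by (auto simp: partial_deriv_mult C_k_real_polynomial_function)

lemma poly_deriv_power:
  assumes "poly_deriv P j dP" shows "poly_deriv (\<lambda>x. P x ^ n) j (\<lambda>x. real n * P x ^ (n - 1) * dP x)"
proof (induction n)
  case 0 then show ?case using poly_deriv_const[of 1] by simp
next
  case (Suc n)
  have "P x * (real n * P x ^ (n - 1) * dP x) + dP x * P x ^ n = real (Suc n) * P x ^ (Suc n - 1) * dP x" for x
    by (cases n) (auto simp: algebra_simps)
  with poly_deriv_mult[OF assms Suc] show ?case by simp
qed

lemma poly_deriv_cong: "poly_deriv P j dP \<Longrightarrow> (\<And>x. dP x = dP' x) \<Longrightarrow> poly_deriv P j dP'"
  by (metis ext)

lemmas poly_deriv_intros = poly_deriv_const poly_deriv_coord poly_deriv_add poly_deriv_mult poly_deriv_power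

lemma smooth_limit_bump_power:
  "smooth_limit (ccube 1) (\<lambda>x. bump x ^ Suc n) (\<lambda>x. (real (Suc n) * bump x ^ n) *\<^sub>R bump_grad x)"
proof (induction n)
  case 0 then show ?case using smooth_limit_bump by simp
next
  case (Suc n)
  have "bump x *\<^sub>R ((real (Suc n) * bump x ^ n) *\<^sub>R bump_grad x) + bump x ^ Suc n *\<^sub>R bump_grad x =
      (real (Suc (Suc n)) * bump x ^ Suc n) *\<^sub>R bump_grad x" for x :: "'a point"
    by (simp add: vec_eq_iff algebra_simps)
  with smooth_limit_mult[OF smooth_limit_bump Suc] show ?case by (simp only: Int_absorb power_Suc[of _ "Suc n"])
qed

lemma ess_bounded_power: "ess_bounded M f \<Longrightarrow> ess_bounded M (\<lambda>x. f x ^ n)"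
  by (induction n) (auto intro: ess_bounded_intros)

definition ibp_term :: "nat \<Rightarrow> ('d::finite point \<Rightarrow> real) \<Rightarrow> 'd \<Rightarrow> ('d point \<Rightarrow> real) \<Rightarrow> 'd point \<Rightarrow> real" where
  "ibp_term n P j dP x = real (Suc n) * P x * bump x ^ n * bump_grad x $ j + dP x * bump x ^ Suc n"

lemma ibp_term_ess_bounded: "poly_deriv P j dP \<Longrightarrow> ess_bounded cube_measure (ibp_term n P j dP)"
  unfolding ibp_term_def[abs_def] poly_deriv_def
  by (intro ess_bounded_intros ess_bounded_power ess_bounded_bump ess_bounded_polynomial) auto

text \<open>This is the integral of \<open>\<partial>\<^sub>j(P bump\<^sup>n\<^sup>+\<^sup>1)\<close>.\<close>

lemma integral_ibp_term:
  assumes "poly_deriv P j dP" shows "(\<integral>x. ibp_term n P j dP x \<partial>cube_measure) = 0"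
proof -
  have P: "real_polynomial_function P" "\<And>x. partial_deriv j P x = dP x" using assms by (auto simp: poly_deriv_def)
  let ?D = "\<lambda>x. \<chi> j. frechet_derivative P (at x) (axis j 1)"
  have "smooth_limit UNIV P ?D"
    by (rule smooth_limit_polynomial[OF P(1)]) (rule C_k_SucD(1)[OF C_k_real_polynomial_function[OF P(1)]])
  from smooth_limit_mult[OF this smooth_limit_bump_power[of n]]
  have "smooth_limit (ccube 1) (\<lambda>x. P x * bump x ^ Suc n)
      (\<lambda>x. P x *\<^sub>R (real (Suc n) * bump x ^ n) *\<^sub>R bump_grad x + bump x ^ Suc n *\<^sub>R ?D x)"
    by (simp only: Int_UNIV_left)
  from H10_scalar_integral_gradient[OF smooth_limit_H10_scalar(1)[OF this compact_ccube ccube_subset_cube open_cube bounded_cube] lmeasurable_cube, of 3 j]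
  have "(\<integral>x. P x * (real (Suc n) * bump x ^ n * bump_grad x $ j) + bump x ^ Suc n * partial_deriv j P x \<partial>cube_measure) = 0"
    by (simp add: partial_deriv_def mult.assoc del: power_Suc of_nat_Suc)
  moreover have "ibp_term n P j dP x = P x * (real (Suc n) * bump x ^ n * bump_grad x $ j) + bump x ^ Suc n * partial_deriv j P x" for x
    by (simp add: ibp_term_def P(2))
  ultimately show ?thesis by (simp only:)
qed

text \<open>Three divergence terms suffice for every evaluation below; the shorter ones put the zero
  polynomial into a slot.\<close>

lemma integral_by_parts:
  assumes "poly_deriv P i dP" "poly_deriv Q j dQ" "poly_deriv S k dS"
    and r: "ess_bounded cube_measure r"
    and eq: "\<And>x. f x = ibp_term n P i dP x + ibp_term n Q j dQ x + ibp_term n S k dS x + r x"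
  shows "(\<integral>x. f x \<partial>cube_measure) = (\<integral>x. r x \<partial>cube_measure)"
  unfolding eq
  using cube_integrable[OF ibp_term_ess_bounded[OF assms(1)]] cube_integrable[OF ibp_term_ess_bounded[OF assms(2)]]
    cube_integrable[OF ibp_term_ess_bounded[OF assms(3)]] cube_integrable[OF r]
    integral_ibp_term[OF assms(1)] integral_ibp_term[OF assms(2)] integral_ibp_term[OF assms(3)]
  by simp

definition flip :: "'d::finite \<Rightarrow> 'd point \<Rightarrow> 'd point" where
  "flip i x = (\<chi> k. if k = i then - x $ k else x $ k)"

text \<open>The reflection preserves Lebesgue measure and the cube, so the integral equals its
  negative.\<close>

lemma integral_flip_odd:
  fixes f :: "'d::finite point \<Rightarrow> real"
  assumes f: "ess_bounded cube_measure f" and odd: "\<And>x. f (flip i x) = - f x"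
  shows "(\<integral>x. f x \<partial>cube_measure) = 0"
proof -
  \<comment> \<open>The diagonal entries of the reflection, in the form of the change of variables
    theorem for diagonal affine maps.\<close>
  define c :: "'d point \<Rightarrow> real" where "c b = (if b = axis i 1 then -1 else 1)" for b
  have c0: "c b \<noteq> 0" for b by (simp add: c_def)
  define T where "T x = 0 + (\<Sum>b\<in>Basis. (c b * (x \<bullet> b)) *\<^sub>R b)" for x :: "'d point"
  have T_nth: "T x $ k = flip i x $ k" for x k
  proof -
    have "T x $ k = T x \<bullet> axis k 1" by (simp add: inner_axis)
    also have "\<dots> = c (axis k 1) * (x \<bullet> axis k 1)"
      unfolding T_def by (simp add: inner_sum_left_Basis axis_in_Basis_iff)
    also have "\<dots> = flip i x $ k" by (simp add: c_def flip_def inner_axis axis_eq_axis)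
    finally show ?thesis .
  qed
  then have T: "T x = flip i x" for x by (simp add: vec_eq_iff)
  have "(\<Prod>b\<in>Basis. \<bar>c b\<bar>) = 1" by (rule prod.neutral) (simp add: c_def)
  then have leb: "lebesgue = distr lebesgue lebesgue T"
    using lebesgue_affine_euclidean[of c 0, OF c0] by (simp add: T_def[abs_def] density_1)
  have Tm: "T \<in> lebesgue \<rightarrow>\<^sub>M lebesgue"
    using lebesgue_affine_measurable[of c 0, OF c0] by (simp add: T_def[abs_def])
  let ?g = "\<lambda>x. indicator (cube 3) x *\<^sub>R f x"
  have gm: "?g \<in> borel_measurable lebesgue"
    using f by (simp add: ess_bounded_def borel_measurable_restrict_space_iff sets_cube)
  have "(\<integral>x. ?g x \<partial>lebesgue) = (\<integral>x. ?g x \<partial>distr lebesgue lebesgue T)" using leb by simp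
  also have "\<dots> = (\<integral>x. ?g (T x) \<partial>lebesgue)" by (rule integral_distr[OF Tm gm])
  also have "\<dots> = (\<integral>x. - ?g x \<partial>lebesgue)"
  proof -
    have "indicator (cube 3) (flip i x) = (indicator (cube 3) x :: real)" for x
    proof -
      have "\<bar>flip i x $ k\<bar> = \<bar>x $ k\<bar>" for k by (simp add: flip_def)
      then show ?thesis by (simp add: indicator_def cube_def)
    qed
    then show ?thesis by (simp add: T odd)
  qed
  finally have "(\<integral>x. ?g x \<partial>lebesgue) = 0" by simp
  then show ?thesis by (simp add: integral_restrict_space sets_cube)
qed

lemma bump_flip: "bump (flip i x) = bump x"
  unfolding bump_def flip_def by (intro prod.cong) auto

text \<open>A zero integral would make \<open>U\<close> a null set, which a nonempty open set is
  not.\<close>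

lemma integral_pos:
  fixes f :: "'d::finite point \<Rightarrow> real"
  assumes f: "ess_bounded cube_measure f" and nn: "\<And>x. f x \<ge> 0" and U: "open U" "U \<subseteq> cube 3" "U \<noteq> {}"
    and pos: "\<And>x. x \<in> U \<Longrightarrow> f x > 0"
  shows "(\<integral>x. f x \<partial>cube_measure) > 0"
proof (rule ccontr)
  assume "\<not> ?thesis"
  then have "(\<integral>x. f x \<partial>cube_measure) = 0"
    using integral_nonneg_AE[of f cube_measure] nn by fastforce
  then have "AE x in cube_measure. f x = 0"
    using integral_nonneg_eq_0_iff_AE[OF cube_integrable[OF f]] nn by simp
  then have "AE x in lebesgue. x \<in> cube 3 \<longrightarrow> f x = 0" by (simp add: AE_restrict_space_iff sets_cube)
  then have "AE x in lebesgue. x \<notin> U"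
    by eventually_elim (use U(2) pos in force)
  then have "U \<in> null_sets lebesgue" using U(1) by (simp add: AE_iff_null_sets)
  then show False using open_not_negligible[OF U(1,3)] by (simp add: negligible_iff_null_sets)
qed

text \<open>The first two components of the nonlinear term of a planar field \<open>(a, b)\<close> (or \<open>(a, b, 0)\<close>) with
  partial derivatives \<open>a\<^sub>1, a\<^sub>2, b\<^sub>1, b\<^sub>2\<close>.\<close>

fun planar_NL1 :: "formulation \<Rightarrow> real \<Rightarrow> real \<Rightarrow> real \<Rightarrow> real \<Rightarrow> real \<Rightarrow> real \<Rightarrow> real" where
  "planar_NL1 Convective a b a1 a2 b1 b2 = a1 * a + a2 * b"
| "planar_NL1 Skew_Symmetric a b a1 a2 b1 b2 = a1 * a + a2 * b + (a1 + b2) / 2 * a"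
| "planar_NL1 Rotational a b a1 a2 b1 b2 = - (b1 - a2) * b"
| "planar_NL1 Conservative a b a1 a2 b1 b2 = a1 * a + a2 * b + (a1 + b2) * a"
| "planar_NL1 EMA_Conserving a b a1 a2 b1 b2 = 2 * a1 * a + (a2 + b1) * b + (a1 + b2) * a"

fun planar_NL2 :: "formulation \<Rightarrow> real \<Rightarrow> real \<Rightarrow> real \<Rightarrow> real \<Rightarrow> real \<Rightarrow> real \<Rightarrow> real" where
  "planar_NL2 Convective a b a1 a2 b1 b2 = b1 * a + b2 * b"
| "planar_NL2 Skew_Symmetric a b a1 a2 b1 b2 = b1 * a + b2 * b + (a1 + b2) / 2 * b"
| "planar_NL2 Rotational a b a1 a2 b1 b2 = (b1 - a2) * a"
| "planar_NL2 Conservative a b a1 a2 b1 b2 = b1 * a + b2 * b + (a1 + b2) * b"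
| "planar_NL2 EMA_Conserving a b a1 a2 b1 b2 = 2 * b2 * b + (a2 + b1) * a + (a1 + b2) * b"

lemma NL_2:
  fixes G :: "2 gradient" and w :: "2 point"
  shows "NL F G w $ 1 = planar_NL1 F (w $ 1) (w $ 2) (G $ 1 $ 1) (G $ 1 $ 2) (G $ 2 $ 1) (G $ 2 $ 2)"
    "NL F G w $ 2 = planar_NL2 F (w $ 1) (w $ 2) (G $ 1 $ 1) (G $ 1 $ 2) (G $ 2 $ 1) (G $ 2 $ 2)"
  by (cases F; simp add: matrix_vector_mult_def trace_def sum_2 sym_grad_def transpose_def restr3_def
      cross3_nth curl_of_grad_def ext3_mat_def ext3_nth field_simps)+

lemma NL_3:
  fixes G :: "3 gradient" and w :: "3 point"
  assumes "w $ 3 = 0" "G $ 3 = 0"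
  shows "NL F G w $ 1 = planar_NL1 F (w $ 1) (w $ 2) (G $ 1 $ 1) (G $ 1 $ 2) (G $ 2 $ 1) (G $ 2 $ 2)"
    "NL F G w $ 2 = planar_NL2 F (w $ 1) (w $ 2) (G $ 1 $ 1) (G $ 1 $ 2) (G $ 2 $ 1) (G $ 2 $ 2)"
    "F \<in> {Convective, Skew_Symmetric} \<Longrightarrow> NL F G w $ 3 = 0"
    "NL Rotational G w $ 3 = - G $ 2 $ 3 * w $ 2 - G $ 1 $ 3 * w $ 1"
  using assms
  by (cases F; simp add: matrix_vector_mult_def trace_def sum_3 sym_grad_def transpose_def restr3_def
      cross3_nth curl_of_grad_def ext3_mat_def ext3_nth field_simps)+

section \<open>Planar counterexample fields\<close>

definition planar_field ::
    "('d::{finite,numeral} point \<Rightarrow> real) \<Rightarrow> ('d point \<Rightarrow> real) \<Rightarrow> 'd point \<Rightarrow> 'd point" where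
  "planar_field p q x = (\<chi> i. if i = 1 then p x * bump x else if i = 2 then q x * bump x else 0)"

definition planar_grad ::
    "('d::{finite,numeral} point \<Rightarrow> real) \<Rightarrow> ('d \<Rightarrow> 'd point \<Rightarrow> real) \<Rightarrow> ('d point \<Rightarrow> real) \<Rightarrow> ('d \<Rightarrow> 'd point \<Rightarrow> real) \<Rightarrow>
     'd point \<Rightarrow> 'd gradient" where
  "planar_grad p dp q dq x = (\<chi> i j. if i = 1 then p x * bump_grad x $ j + bump x * dp j x
     else if i = 2 then q x * bump_grad x $ j + bump x * dq j x else 0)"

lemma bump_field_planar:
  assumes p: "\<And>j. poly_deriv p j (dp j)" and q: "\<And>j. poly_deriv q j (dq j)"
  shows "bump_field (planar_field p q) (planar_grad p dp q dq)"
proof -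
  have sl: "smooth_limit (ccube 1) (\<lambda>x. h x * bump x) (\<lambda>x. \<chi> j. h x * bump_grad x $ j + bump x * dh j x)"
    if h: "\<And>j. poly_deriv h j (dh j)" for h dh
  proof -
    have H: "real_polynomial_function h" "\<And>x j. partial_deriv j h x = dh j x"
      using h by (auto simp: poly_deriv_def)
    have "smooth_limit UNIV h (\<lambda>x. \<chi> j. dh j x)"
      using smooth_limit_polynomial[OF H(1) C_k_SucD(1)[OF C_k_real_polynomial_function[OF H(1)]]]
      by (simp add: H(2)[unfolded partial_deriv_def])
    from smooth_limit_mult[OF this smooth_limit_bump] show ?thesis
      by (simp add: plus_vec_def scaleR_vec_def)
  qed
  have pp: "pw_poly (\<lambda>x. h x * bump x)" if "\<And>j. poly_deriv h j (dh j)" for h dh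
    using that[of undefined] by (intro pw_poly_mult pw_poly_bump pw_poly_polynomial) (auto simp: poly_deriv_def)
  have out: "planar_field p q x = 0" if "x \<notin> cube 1" for x
  proof -
    have "\<exists>i. \<not> \<bar>x $ i\<bar> < 1" using that by (simp add: cube_def)
    then obtain i where "1 \<le> \<bar>x $ i\<bar>" by (auto simp: not_less)
    then have "bump x = 0" by (rule bump_eq_0)
    then show ?thesis by (simp add: planar_field_def vec_eq_iff)
  qed
  have "smooth_limit (ccube 1) (\<lambda>x. planar_field p q x $ i) (\<lambda>x. planar_grad p dp q dq x $ i)" for i
    using sl[OF p] sl[OF q] smooth_limit_0[of "ccube 1"]
    by (cases "i = 1"; cases "i = 2") (auto simp: planar_field_def planar_grad_def zero_vec_def)
  moreover have "pw_poly (\<lambda>x. planar_field p q x $ i)" for i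
    using pp[OF p] pp[OF q] pw_poly_polynomial[OF real_polynomial_function.intros(2)[of 0]]
    by (cases "i = 1"; cases "i = 2") (auto simp: planar_field_def)
  ultimately show ?thesis using out by (simp add: bump_field_def)
qed

lemma linear_momentum_nth:
  assumes "\<And>i. ess_bounded cube_measure (\<lambda>x. w x $ i)"
  shows "linear_momentum (cube 3) w $ i = (\<integral>x. w x $ i \<partial>cube_measure)"
  unfolding linear_momentum_def LINT_eq_lebesgue_on[OF sets_cube]
  by (rule integral_vec_nth) (intro integrable_vec cube_integrable assms)

lemma ess_bounded_coord: "ess_bounded cube_measure (\<lambda>x. x $ i)"
  by (rule ess_bounded_polynomial[OF real_polynomial_function_coord])

lemma ess_bounded_cross:
  fixes w :: "'d::{finite,numeral} point \<Rightarrow> 'd point"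
  assumes w: "\<And>i. ess_bounded cube_measure (\<lambda>x. w x $ i)"
  shows "ess_bounded cube_measure (\<lambda>x. cross3 (ext3 (w x)) (ext3 x) $ k)"
proof -
  have e: "ess_bounded cube_measure (\<lambda>x. ext3 (v x) $ k)" if "\<And>i. ess_bounded cube_measure (\<lambda>x. v x $ i)"
    for k and v :: "'d point \<Rightarrow> 'd point"
    using exhaust_3[of k] that by (cases "CARD('d) = 3") (auto simp: ext3_nth intro: ess_bounded_const)
  show ?thesis
    using exhaust_3[of k] e[OF w] e[OF ess_bounded_coord]
    by (auto simp: cross3_nth intro!: ess_bounded_diff ess_bounded_mult)
qed

lemma angular_momentum_nth:
  fixes w :: "'d::{finite,numeral} point \<Rightarrow> 'd point"
  assumes "\<And>i. ess_bounded cube_measure (\<lambda>x. w x $ i)"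
  shows "angular_momentum (cube 3) w $ k = (\<integral>x. cross3 (ext3 (w x)) (ext3 x) $ k \<partial>cube_measure)"
  unfolding angular_momentum_def LINT_eq_lebesgue_on[OF sets_cube]
  by (intro integral_vec_nth integrable_vec cube_integrable ess_bounded_cross assms)

lemmas cube_bounded_intros = ess_bounded_intros ess_bounded_power ess_bounded_bump ess_bounded_coord

text \<open>The factor of (div u) u that separates a term from the conservative one: 1/2 for
  skew-symmetric, 1 for convective. It is 1 for rotational too, since (curl u) \<times> u is the
  convective term minus the gradient of |u|^2 / 2, which carries no total momentum.\<close>

definition skew_factor :: "formulation \<Rightarrow> real" where
  "skew_factor F = (if F = Skew_Symmetric then 1/2 else 1)"

lemma skew_factor_pos: "skew_factor F > 0"
  by (simp add: skew_factor_def)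

lemma nonconservative_cases:
  assumes "F \<in> {Convective, Skew_Symmetric, Rotational}"
    "F = Convective \<Longrightarrow> P" "F = Skew_Symmetric \<Longrightarrow> P" "F = Rotational \<Longrightarrow> P"
  shows P
  using assms by blast

abbreviation lin_args :: "(real \<Rightarrow> real \<Rightarrow> real \<Rightarrow> real \<Rightarrow> real \<Rightarrow> real \<Rightarrow> real) \<Rightarrow> 'd::{finite,numeral} point \<Rightarrow> real" where
  "lin_args N x \<equiv> N (x $ 1 * bump x) (bump x) (x $ 1 * bump_grad x $ 1 + bump x) (x $ 1 * bump_grad x $ 2)
     (bump_grad x $ 1) (bump_grad x $ 2)"

abbreviation ang_args :: "(real \<Rightarrow> real \<Rightarrow> real \<Rightarrow> real \<Rightarrow> real \<Rightarrow> real \<Rightarrow> real) \<Rightarrow> 'd::{finite,numeral} point \<Rightarrow> real" where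
  "ang_args N x \<equiv> N (x $ 2 * bump x) (x $ 2 ^ 3 * bump x) (x $ 2 * bump_grad x $ 1) (x $ 2 * bump_grad x $ 2 + bump x)
     (x $ 2 ^ 3 * bump_grad x $ 1) (x $ 2 ^ 3 * bump_grad x $ 2 + 3 * x $ 2 ^ 2 * bump x)"

section \<open>Counterexamples common to both dimensions\<close>

context
  assumes ne: "(1 :: 'd::{finite,numeral}) \<noteq> 2"
begin

text \<open>Each evaluation below writes the integrand as a remainder plus a divergence
  \<open>\<partial>\<^sub>1(P bump\<^sup>n) + \<partial>\<^sub>2(Q bump\<^sup>n) + \<partial>\<^sub>k(S bump\<^sup>n)\<close> with explicit polynomials \<open>P, Q, S\<close>.\<close>

lemma linear_NL1:
  assumes "F \<in> {Convective, Skew_Symmetric, Rotational}"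
  shows "(\<integral>x. lin_args (planar_NL1 F) x
      \<partial>(cube_measure :: 'd point measure)) = (\<integral>x. 0 \<partial>(cube_measure :: 'd point measure))"
proof (rule nonconservative_cases[OF assms])
  assume F: "F = Convective"
  show ?thesis unfolding F
    by (rule integral_by_parts[where n = 1 and P = "\<lambda>x. 1/2 * x $ 1 ^ 2" and i = 1 and dP = "\<lambda>x. x $ 1"
          and Q = "\<lambda>x. 1/2 * x $ 1" and j = 2 and dQ = "\<lambda>x. 0" and S = "\<lambda>x. 0" and dS = "\<lambda>x. 0" and k = 1];
        ((rule poly_deriv_cong, (rule poly_deriv_intros)+, simp add: ne ne[symmetric]) | (intro cube_bounded_intros) |
         (simp add: ibp_term_def skew_factor_def field_simps eval_nat_numeral)))
next
  assume F: "F = Skew_Symmetric"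
  show ?thesis unfolding F
    by (rule integral_by_parts[where n = 1 and P = "\<lambda>x. 3/4 * x $ 1 ^ 2" and i = 1 and dP = "\<lambda>x. 3/2 * x $ 1"
          and Q = "\<lambda>x. 3/4 * x $ 1" and j = 2 and dQ = "\<lambda>x. 0" and S = "\<lambda>x. 0" and dS = "\<lambda>x. 0" and k = 1];
        ((rule poly_deriv_cong, (rule poly_deriv_intros)+, simp add: ne ne[symmetric]) | (intro cube_bounded_intros) |
         (simp add: ibp_term_def skew_factor_def field_simps eval_nat_numeral)))
next
  assume F: "F = Rotational"
  show ?thesis unfolding F
    by (rule integral_by_parts[where n = 1 and P = "\<lambda>x. - 1/2" and i = 1 and dP = "\<lambda>x. 0"
          and Q = "\<lambda>x. 1/2 * x $ 1" and j = 2 and dQ = "\<lambda>x. 0" and S = "\<lambda>x. 0" and dS = "\<lambda>x. 0" and k = 1];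
        ((rule poly_deriv_cong, (rule poly_deriv_intros)+, simp add: ne ne[symmetric]) | (intro cube_bounded_intros) |
         (simp add: ibp_term_def skew_factor_def field_simps eval_nat_numeral)))
qed

lemma linear_NL2:
  assumes "F \<in> {Convective, Skew_Symmetric, Rotational}"
  shows "(\<integral>x. lin_args (planar_NL2 F) x
      \<partial>(cube_measure :: 'd point measure)) = (\<integral>x. - (skew_factor F / 2) * bump x ^ 2 \<partial>(cube_measure :: 'd point measure))"
proof (rule nonconservative_cases[OF assms])
  assume F: "F = Convective"
  show ?thesis unfolding F
    by (rule integral_by_parts[where n = 1 and P = "\<lambda>x. 1/2 * x $ 1" and i = 1 and dP = "\<lambda>x. 1/2"
          and Q = "\<lambda>x. 1/2" and j = 2 and dQ = "\<lambda>x. 0" and S = "\<lambda>x. 0" and dS = "\<lambda>x. 0" and k = 1];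
        ((rule poly_deriv_cong, (rule poly_deriv_intros)+, simp add: ne ne[symmetric]) | (intro cube_bounded_intros) |
         (simp add: ibp_term_def skew_factor_def field_simps eval_nat_numeral)))
next
  assume F: "F = Skew_Symmetric"
  show ?thesis unfolding F
    by (rule integral_by_parts[where n = 1 and P = "\<lambda>x. 3/4 * x $ 1" and i = 1 and dP = "\<lambda>x. 3/4"
          and Q = "\<lambda>x. 3/4" and j = 2 and dQ = "\<lambda>x. 0" and S = "\<lambda>x. 0" and dS = "\<lambda>x. 0" and k = 1];
        ((rule poly_deriv_cong, (rule poly_deriv_intros)+, simp add: ne ne[symmetric]) | (intro cube_bounded_intros) |
         (simp add: ibp_term_def skew_factor_def field_simps eval_nat_numeral)))
next
  assume F: "F = Rotational"
  show ?thesis unfolding F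
    by (rule integral_by_parts[where n = 1 and P = "\<lambda>x. 1/2 * x $ 1" and i = 1 and dP = "\<lambda>x. 1/2"
          and Q = "\<lambda>x. - 1/2 * x $ 1 ^ 2" and j = 2 and dQ = "\<lambda>x. 0" and S = "\<lambda>x. 0" and dS = "\<lambda>x. 0" and k = 1];
        ((rule poly_deriv_cong, (rule poly_deriv_intros)+, simp add: ne ne[symmetric]) | (intro cube_bounded_intros) |
         (simp add: ibp_term_def skew_factor_def field_simps eval_nat_numeral)))
qed

lemma angular_NL3:
  assumes "F \<in> {Convective, Skew_Symmetric, Rotational}"
  shows "(\<integral>x. ang_args (planar_NL1 F) x * x $ 2 - ang_args (planar_NL2 F) x * x $ 1
      \<partial>(cube_measure :: 'd point measure)) = (\<integral>x. - skew_factor F * (x $ 2 ^ 4 * bump x ^ 2) \<partial>(cube_measure :: 'd point measure))"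
proof (rule nonconservative_cases[OF assms])
  assume F: "F = Convective"
  show ?thesis unfolding F
    by (rule integral_by_parts[where n = 1 and P = "\<lambda>x. 1/2 * (x $ 2 ^ 3 + (- 1) * (x $ 1 * x $ 2 ^ 4))" and i = 1 and dP = "\<lambda>x. - 1/2 * x $ 2 ^ 4"
          and Q = "\<lambda>x. 1/2 * (x $ 2 ^ 5 + (- 1) * (x $ 1 * x $ 2 ^ 6))" and j = 2 and dQ = "\<lambda>x. 1/2 * (5 * x $ 2 ^ 4 - 6 * x $ 1 * x $ 2 ^ 5)" and S = "\<lambda>x. 0" and dS = "\<lambda>x. 0" and k = 1];
        ((rule poly_deriv_cong, (rule poly_deriv_intros)+, simp add: ne ne[symmetric]) | (intro cube_bounded_intros) |
         (simp add: ibp_term_def skew_factor_def field_simps eval_nat_numeral)))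
next
  assume F: "F = Skew_Symmetric"
  show ?thesis unfolding F
    by (rule integral_by_parts[where n = 1 and P = "\<lambda>x. 3/4 * (x $ 2 ^ 3 + (- 1) * (x $ 1 * x $ 2 ^ 4))" and i = 1 and dP = "\<lambda>x. - 3/4 * x $ 2 ^ 4"
          and Q = "\<lambda>x. 3/4 * (x $ 2 ^ 5 + (- 1) * (x $ 1 * x $ 2 ^ 6))" and j = 2 and dQ = "\<lambda>x. 3/4 * (5 * x $ 2 ^ 4 - 6 * x $ 1 * x $ 2 ^ 5)" and S = "\<lambda>x. 0" and dS = "\<lambda>x. 0" and k = 1];
        ((rule poly_deriv_cong, (rule poly_deriv_intros)+, simp add: ne ne[symmetric]) | (intro cube_bounded_intros) |
         (simp add: ibp_term_def skew_factor_def field_simps eval_nat_numeral)))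
next
  assume F: "F = Rotational"
  show ?thesis unfolding F
    by (rule integral_by_parts[where n = 1 and P = "\<lambda>x. - 1/2 * (x $ 2 ^ 7 + x $ 1 * x $ 2 ^ 4)" and i = 1 and dP = "\<lambda>x. - 1/2 * x $ 2 ^ 4"
          and Q = "\<lambda>x. 1/2 * (x $ 2 ^ 5 + x $ 1 * x $ 2 ^ 2)" and j = 2 and dQ = "\<lambda>x. 1/2 * (5 * x $ 2 ^ 4 + 2 * x $ 1 * x $ 2)" and S = "\<lambda>x. 0" and dS = "\<lambda>x. 0" and k = 1];
        ((rule poly_deriv_cong, (rule poly_deriv_intros)+, simp add: ne ne[symmetric]) | (intro cube_bounded_intros) |
         (simp add: ibp_term_def skew_factor_def field_simps eval_nat_numeral)))
qed

lemma conservative_energy_integral: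
  "(\<integral>x. lin_args (planar_NL1 Conservative) x * (x $ 1 * bump x) + lin_args (planar_NL2 Conservative) x * bump x
      \<partial>(cube_measure :: 'd point measure)) = (\<integral>x. 1/3 * bump x ^ 3 \<partial>(cube_measure :: 'd point measure))"
  by (rule integral_by_parts[where n = 2 and P = "\<lambda>x. 2/3 * (x $ 1 ^ 3 + x $ 1)" and i = 1 and dP = "\<lambda>x. 2 * x $ 1 ^ 2 + 2/3"
          and Q = "\<lambda>x. 2/3 * (x $ 1 ^ 2 + 1)" and j = 2 and dQ = "\<lambda>x. 0" and S = "\<lambda>x. 0" and dS = "\<lambda>x. 0" and k = 1];
        ((rule poly_deriv_cong, (rule poly_deriv_intros)+, simp add: ne ne[symmetric]) | (intro cube_bounded_intros) |
         (simp add: ibp_term_def skew_factor_def field_simps eval_nat_numeral)))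

text \<open>Strict positivity is asked for only on the half cube x_2 > 0, since weights such as
  x_2^4 vanish on its face; the sign outside the support of \<open>bump\<close> is left
  open.\<close>

lemma bump_pos_set:
  assumes "\<And>x. r x \<ge> 0 \<or> bump x = 0" "\<And>x. x \<in> cube 1 \<Longrightarrow> x $ 2 > 0 \<Longrightarrow> r x > 0"
    and r: "ess_bounded cube_measure r"
  shows "(\<integral>x. r x * bump x ^ Suc n \<partial>(cube_measure :: 'd point measure)) > 0"
proof (rule integral_pos)
  let ?U = "cube 1 \<inter> {x :: 'd point. x $ 2 > 0}"
  show "ess_bounded cube_measure (\<lambda>x. r x * bump x ^ Suc n)" by (intro cube_bounded_intros r)
  show "0 \<le> r x * bump x ^ Suc n" for x using assms(1)[of x] bump_nonneg[of x] by auto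
  show "open ?U" by (intro open_Int open_cube open_Collect_less continuous_intros)
  show "?U \<subseteq> cube 3" by (auto simp: cube_def intro: less_trans)
  have "(\<chi> i. 1/2) \<in> ?U" by (simp add: cube_def)
  then show "?U \<noteq> {}" by blast
  show "0 < r x * bump x ^ Suc n" if "x \<in> ?U" for x
    using that assms(2)[of x] bump_pos[of x] by (intro mult_pos_pos zero_less_power) auto
qed

lemma integral_coord_bump: "(\<integral>x. x $ 1 * bump x \<partial>(cube_measure :: 'd point measure)) = 0"
  by (rule integral_flip_odd[of _ 1]) (intro cube_bounded_intros, simp add: bump_flip, simp add: flip_def)

text \<open>By symmetry of \<open>bump\<close> its momentum points along e_2. So does the integral
  of (div u) u, whose second component is half the integral of bump^2; the two can therefore be
  balanced by one number.\<close>

abbreviation lin_field :: "'d point \<Rightarrow> 'd point" where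
  "lin_field \<equiv> planar_field (\<lambda>x. x $ 1) (\<lambda>x. 1)"

abbreviation lin_grad :: "'d point \<Rightarrow> 'd gradient" where
  "lin_grad \<equiv> planar_grad (\<lambda>x. x $ 1) (\<lambda>j x. if 1 = j then 1 else 0) (\<lambda>x. 1) (\<lambda>j x. 0)"

text \<open>With x_2^m as second factor, integration by parts gives the third component of the
  angular momentum of the nonlinear term as -(m - 1)/2 times \<open>skew_factor\<close> times the
  integral of x_2^(m+1) bump^2. It is zero for m = 1 and, by parity, for m = 0 and m = 2, so 3 is
  the first exponent that works.\<close>

abbreviation ang_field :: "'d point \<Rightarrow> 'd point" where
  "ang_field \<equiv> planar_field (\<lambda>x. x $ 2) (\<lambda>x. x $ 2 ^ 3)"

abbreviation ang_grad :: "'d point \<Rightarrow> 'd gradient" where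
  "ang_grad \<equiv> planar_grad (\<lambda>x. x $ 2) (\<lambda>j x. if 2 = j then 1 else 0)
     (\<lambda>x. x $ 2 ^ 3) (\<lambda>j x. 3 * x $ 2 ^ 2 * (if 2 = j then 1 else 0))"

lemma bump_field_lin: "bump_field lin_field lin_grad"
  by (intro bump_field_planar poly_deriv_coord poly_deriv_const)

lemma bump_field_ang: "bump_field ang_field ang_grad"
proof (rule bump_field_planar)
  show "poly_deriv (\<lambda>x::'d point. x $ 2 ^ 3) j (\<lambda>x. 3 * x $ 2 ^ 2 * (if 2 = j then 1 else 0))" for j
    by (rule poly_deriv_cong[OF poly_deriv_power[OF poly_deriv_coord]]) simp
qed (rule poly_deriv_coord)

text \<open>\<open>\<kappa>\<close> is the quotient that makes the second component of the force
  vanish in total; \<open>N1\<close> to \<open>N3\<close> isolate what depends on the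
  dimension.\<close>

lemma not_conserves_linear_momentum:
  assumes d: "restr3_adjoint TYPE('d)" and F: "F \<in> {Convective, Skew_Symmetric, Rotational}"
    and N1: "\<And>x :: 'd point. NL F (lin_grad x) (lin_field x) $ 1 = lin_args (planar_NL1 F) x"
    and N2: "\<And>x :: 'd point. NL F (lin_grad x) (lin_field x) $ 2 = lin_args (planar_NL2 F) x"
    and N3: "\<And>i :: 'd. i \<noteq> 1 \<Longrightarrow> i \<noteq> 2 \<Longrightarrow> (\<integral>x. NL F (lin_grad x) (lin_field x) $ i \<partial>cube_measure) = 0"
  shows "\<not> conserves_linear_momentum TYPE('d) F"
proof -
  let ?M = "cube_measure :: 'd point measure"
  let ?B1 = "\<integral>x. bump x \<partial>?M" and ?B2 = "\<integral>x. bump x ^ 2 \<partial>?M"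
  have pos: "?B1 > 0" "?B2 > 0"
    using bump_pos_set[of "\<lambda>x. 1" 0] bump_pos_set[of "\<lambda>x. 1" 1] by (simp_all add: ess_bounded_const numeral_2_eq_2)
  define \<kappa> where "\<kappa> = skew_factor F / 2 * ?B2 / ?B1"
  have \<kappa>: "\<kappa> \<noteq> 0" using pos skew_factor_pos[of F] by (simp add: \<kappa>_def)
  let ?h = "\<lambda>x. \<kappa> *\<^sub>R lin_field x + NL F (lin_grad x) (lin_field x)"
  have e: "ess_bounded ?M (\<lambda>x. lin_field x $ i)" "ess_bounded ?M (\<lambda>x. NL F (lin_grad x) (lin_field x) $ i)" for i
    by (intro ess_bounded_NL bump_field_ess_bounded[OF bump_field_lin])+
  have eh: "ess_bounded ?M (\<lambda>x. ?h x $ i)" for i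
    unfolding vector_add_component vector_scaleR_component real_scaleR_def by (intro ess_bounded_intros e)
  have "linear_momentum (cube 3) ?h $ i = 0" for i
  proof -
    have "linear_momentum (cube 3) ?h $ i = \<kappa> * (\<integral>x. lin_field x $ i \<partial>?M) + (\<integral>x. NL F (lin_grad x) (lin_field x) $ i \<partial>?M)"
      unfolding linear_momentum_nth[OF eh] vector_add_component vector_scaleR_component real_scaleR_def
        Bochner_Integration.integral_add[OF integrable_mult_right[OF cube_integrable[OF e(1)]] cube_integrable[OF e(2)]]
        integral_mult_right_zero ..
    also have "\<dots> = 0"
    proof -
      consider "i = 1" | "i = 2" | "i \<noteq> 1" "i \<noteq> 2" by blast
      then show ?thesis
      proof cases
        case 1
        have "(\<integral>x. lin_field x $ 1 \<partial>?M) = 0" using integral_coord_bump by (simp add: planar_field_def)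
        then show ?thesis unfolding 1 N1 linear_NL1[OF F] by simp
      next
        case 2
        then have "(\<integral>x. lin_field x $ i \<partial>?M) = ?B1" using ne by (simp add: planar_field_def)
        moreover have "(\<integral>x. NL F (lin_grad x) (lin_field x) $ i \<partial>?M) = - (skew_factor F / 2) * ?B2"
          unfolding 2 N2 linear_NL2[OF F] by simp
        ultimately show ?thesis using pos by (simp add: \<kappa>_def)
      next
        case 3
        then show ?thesis using N3[OF 3] by (simp add: planar_field_def)
      qed
    qed
    finally show ?thesis .
  qed
  then have "linear_momentum (cube 3) ?h = 0" by (simp add: vec_eq_iff)
  moreover have "linear_momentum (cube 3) lin_field $ 2 = ?B1"
    using ne by (simp add: linear_momentum_nth[OF e(1)] planar_field_def)
  then have "linear_momentum (cube 3) lin_field \<noteq> 0" using pos(1) by (metis less_irrefl zero_index)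
  ultimately show ?thesis using momentum_counterexample(1)[OF d bump_field_lin \<kappa>, of F] by blast
qed

text \<open>\<open>\<kappa>\<close> balances the third component. Hypothesis \<open>A\<close>
  disposes of the others, which are trivially zero in the plane and zero in space by parity and
  integration by parts.\<close>

lemma not_conserves_angular_momentum:
  assumes d: "restr3_adjoint TYPE('d)" and F: "F \<in> {Convective, Skew_Symmetric, Rotational}"
    and N1: "\<And>x :: 'd point. NL F (ang_grad x) (ang_field x) $ 1 = ang_args (planar_NL1 F) x"
    and N2: "\<And>x :: 'd point. NL F (ang_grad x) (ang_field x) $ 2 = ang_args (planar_NL2 F) x"
    and A: "\<And>k. k \<noteq> 3 \<Longrightarrow> (\<integral>x. cross3 (ext3 (ang_field x)) (ext3 x) $ k \<partial>(cube_measure :: 'd point measure)) = 0 \<and>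
        (\<integral>x. cross3 (ext3 (NL F (ang_grad x) (ang_field x))) (ext3 x) $ k \<partial>(cube_measure :: 'd point measure)) = 0"
  shows "\<not> conserves_angular_momentum TYPE('d) F"
proof -
  let ?M = "cube_measure :: 'd point measure"
  let ?B1 = "\<integral>x. (x $ 2 ^ 2 - x $ 1 * x $ 2 ^ 3) * bump x \<partial>?M" and ?B2 = "\<integral>x. x $ 2 ^ 4 * bump x ^ 2 \<partial>?M"
  \<comment> \<open>The factored form shows the sign: the weight is nonnegative where |x_1 x_2| < 1,
    in particular on the support of \<open>bump\<close>, but not everywhere.\<close>
  have r: "x $ 2 ^ 2 - x $ 1 * x $ 2 ^ 3 = x $ 2 ^ 2 * (1 - x $ 1 * x $ 2)" for x :: "'d point"
    by (simp add: algebra_simps power2_eq_square power3_eq_cube)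
  have lt: "x $ 1 * x $ 2 < 1" if "x \<in> cube 1" for x :: "'d point"
  proof -
    have "\<bar>x $ 1\<bar> * \<bar>x $ 2\<bar> < 1 * 1" using that by (intro mult_strict_mono) (auto simp: cube_def)
    then show ?thesis by (simp add: abs_mult[symmetric])
  qed
  have b0: "bump x = 0" if "x \<notin> cube 1" for x :: "'d point"
  proof -
    have "\<exists>i. \<not> \<bar>x $ i\<bar> < 1" using that by (simp add: cube_def)
    then show ?thesis by (auto simp: not_less intro: bump_eq_0)
  qed
  have "?B1 > 0"
    using bump_pos_set[of "\<lambda>x. x $ 2 ^ 2 * (1 - x $ 1 * x $ 2)" 0] lt b0
    unfolding r by (force intro: cube_bounded_intros simp: less_imp_le)
  moreover have "?B2 > 0"
  proof -
    have "(\<integral>x. x $ 2 ^ 4 * bump x ^ Suc 1 \<partial>?M) > 0"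
      by (rule bump_pos_set) (simp, simp, intro cube_bounded_intros)
    then show ?thesis by (simp only: Suc_1)
  qed
  ultimately have pos: "?B1 > 0" "?B2 > 0" by auto
  define \<kappa> where "\<kappa> = skew_factor F * ?B2 / ?B1"
  have \<kappa>: "\<kappa> \<noteq> 0" using pos skew_factor_pos[of F] by (simp add: \<kappa>_def)
  let ?N = "\<lambda>x. NL F (ang_grad x) (ang_field x)"
  let ?h = "\<lambda>x. \<kappa> *\<^sub>R ang_field x + ?N x"
  have e: "ess_bounded ?M (\<lambda>x. ang_field x $ i)" "ess_bounded ?M (\<lambda>x. ?N x $ i)" for i
    by (intro ess_bounded_NL bump_field_ess_bounded[OF bump_field_ang])+
  have eh: "ess_bounded ?M (\<lambda>x. ?h x $ i)" for i
    unfolding vector_add_component vector_scaleR_component real_scaleR_def by (intro ess_bounded_intros e)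
  have ec: "ess_bounded ?M (\<lambda>x. cross3 (ext3 (w x)) (ext3 x) $ k)" if "\<And>i. ess_bounded ?M (\<lambda>x. w x $ i)"
    for w :: "'d point \<Rightarrow> 'd point" and k
    by (rule ess_bounded_cross[OF that])
  have f3: "(\<integral>x. cross3 (ext3 (ang_field x)) (ext3 x) $ 3 \<partial>?M) = ?B1"
    using ne by (intro Bochner_Integration.integral_cong refl) (simp add: cross3_nth ext3_nth planar_field_def algebra_simps eval_nat_numeral)
  have n3: "(\<integral>x. cross3 (ext3 (?N x)) (ext3 x) $ 3 \<partial>?M) = - skew_factor F * ?B2"
    unfolding cross3_nth ext3_nth N1 N2 angular_NL3[OF F] by simp
  have "angular_momentum (cube 3) ?h $ k = 0" for k
  proof -
    have "angular_momentum (cube 3) ?h $ k = (\<integral>x. \<kappa> * cross3 (ext3 (ang_field x)) (ext3 x) $ k + cross3 (ext3 (?N x)) (ext3 x) $ k \<partial>?M)"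
      unfolding angular_momentum_nth[OF eh] linear_add[OF linear_ext3] linear_cmul[OF linear_ext3] cross_add_left
        cross_mult_left vector_add_component vector_scaleR_component real_scaleR_def ..
    also have "\<dots> = \<kappa> * (\<integral>x. cross3 (ext3 (ang_field x)) (ext3 x) $ k \<partial>?M) + (\<integral>x. cross3 (ext3 (?N x)) (ext3 x) $ k \<partial>?M)"
      unfolding Bochner_Integration.integral_add[OF integrable_mult_right[OF cube_integrable[OF ec[OF e(1)]]] cube_integrable[OF ec[OF e(2)]]]
        integral_mult_right_zero ..
    also have "\<dots> = 0"
      using A[of k] f3 n3 pos by (cases "k = 3") (simp_all add: \<kappa>_def)
    finally show ?thesis .
  qed
  then have "angular_momentum (cube 3) ?h = 0" by (simp add: vec_eq_iff)
  moreover have "angular_momentum (cube 3) ang_field $ 3 = ?B1"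
    by (simp only: angular_momentum_nth[OF e(1)] f3)
  then have "angular_momentum (cube 3) ang_field \<noteq> 0" using pos(1) by (metis less_irrefl zero_index)
  ultimately show ?thesis using momentum_counterexample(2)[OF d bump_field_ang \<kappa>, of F] by blast
qed

text \<open>This formulation keeps both momenta, so only its energy can set it apart from the EMA
  form. Tested with u, its nonlinear term leaves half the integral of (div u) |u|^2, for this field
  one third of the integral of bump^3; hence the negative sign of \<open>\<kappa>\<close>.\<close>

lemma not_conserves_energy_Conservative:
  assumes N: "\<And>x :: 'd point. inner (NL Conservative (lin_grad x) (lin_field x)) (lin_field x) =
      lin_args (planar_NL1 Conservative) x * (x $ 1 * bump x) + lin_args (planar_NL2 Conservative) x * bump x"
    and I: "\<And>x :: 'd point. inner (lin_field x) (lin_field x) = (x $ 1 ^ 2 + 1) * bump x ^ 2"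
  shows "\<not> conserves_energy TYPE('d) Conservative"
proof -
  let ?M = "cube_measure :: 'd point measure" and ?N = "\<lambda>x. NL Conservative (lin_grad x) (lin_field x)"
  let ?B2 = "\<integral>x. (x $ 1 ^ 2 + 1) * bump x ^ 2 \<partial>?M" and ?B3 = "\<integral>x. bump x ^ 3 \<partial>?M"
  have pos: "?B2 > 0" "?B3 > 0"
    using bump_pos_set[of "\<lambda>x. x $ 1 ^ 2 + 1" 1] bump_pos_set[of "\<lambda>x. 1" 2]
    by (simp_all add: cube_bounded_intros numeral_2_eq_2 numeral_3_eq_3 add_nonneg_pos)
  define \<kappa> where "\<kappa> = - (1/3 * ?B3) / ?B2"
  have \<kappa>: "\<kappa> \<noteq> 0" using pos by (simp add: \<kappa>_def)
  have e: "ess_bounded ?M (\<lambda>x. lin_field x $ i)" "ess_bounded ?M (\<lambda>x. ?N x $ i)" for i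
    by (intro ess_bounded_NL bump_field_ess_bounded[OF bump_field_lin])+
  have "ess_bounded ?M (\<lambda>x. inner (lin_field x) (lin_field x))" "ess_bounded ?M (\<lambda>x. inner (?N x) (lin_field x))"
    unfolding inner_vec_def inner_real_def by (intro ess_bounded_intros e)+
  note int = this[THEN cube_integrable]
  have "(\<integral>x. inner (\<kappa> *\<^sub>R lin_field x + ?N x) (lin_field x) \<partial>?M) = \<kappa> * ?B2 + 1/3 * ?B3"
    unfolding inner_add_left inner_scaleR_left Bochner_Integration.integral_add[OF integrable_mult_right[OF int(1)] int(2)]
    unfolding integral_mult_right_zero I N conservative_energy_integral ..
  also have "\<dots> = 0" using pos by (simp add: \<kappa>_def)
  finally have 0: "(\<integral>x. inner (\<kappa> *\<^sub>R lin_field x + ?N x) (lin_field x) \<partial>?M) = 0" .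
  have "kinetic_energy (cube 3) lin_field = 1/2 * ?B2"
    by (simp add: kinetic_energy_def LINT_eq_lebesgue_on[OF sets_cube] power2_norm_eq_inner I)
  then show ?thesis using energy_counterexample[OF bump_field_lin \<kappa> 0] pos by simp
qed

end

section \<open>Specialisation to two and three dimensions\<close>

lemma ne2: "(1::2) \<noteq> 2" and ne3: "(1::3) \<noteq> 2" "(1::3) \<noteq> 3" "(2::3) \<noteq> 3" "(2::3) \<noteq> 1" "(3::3) \<noteq> 1" "(3::3) \<noteq> 2"
  by simp_all

text \<open>In space \<open>bump\<close> depends on x_3, so even for a planar field the rotational
  term has a third component. The slot \<open>S\<close> with \<open>k = 3\<close> integrates it by
  parts.\<close>

lemma angular_NL_1:
  assumes "F \<in> {Convective, Skew_Symmetric, Rotational}"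
  shows "(\<integral>x. ang_args (planar_NL2 F) x * x $ 3 - (if F = Rotational then - (x $ 2 ^ 3 * bump_grad x $ 3) * (x $ 2 ^ 3 * bump x) - x $ 2 * bump_grad x $ 3 * (x $ 2 * bump x) else 0) * x $ 2
      \<partial>(cube_measure :: 3 point measure)) = (\<integral>x. 0 \<partial>(cube_measure :: 3 point measure))"
proof (rule nonconservative_cases[OF assms])
  assume F: "F = Convective"
  show ?thesis unfolding F
    by (rule integral_by_parts[where n = 1 and P = "\<lambda>x. 1/2 * (x $ 2 ^ 4 * x $ 3)" and i = 1 and dP = "\<lambda>x. 0"
          and Q = "\<lambda>x. 1/2 * (x $ 2 ^ 6 * x $ 3)" and j = 2 and dQ = "\<lambda>x. 3 * x $ 2 ^ 5 * x $ 3" and S = "\<lambda>x. 0" and dS = "\<lambda>x. 0" and k = 3];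
        ((rule poly_deriv_cong, (rule poly_deriv_intros)+, simp add: ne3) | (intro cube_bounded_intros) |
         (simp add: ibp_term_def skew_factor_def field_simps eval_nat_numeral)))
next
  assume F: "F = Skew_Symmetric"
  show ?thesis unfolding F
    by (rule integral_by_parts[where n = 1 and P = "\<lambda>x. 3/4 * (x $ 2 ^ 4 * x $ 3)" and i = 1 and dP = "\<lambda>x. 0"
          and Q = "\<lambda>x. 3/4 * (x $ 2 ^ 6 * x $ 3)" and j = 2 and dQ = "\<lambda>x. 9/2 * x $ 2 ^ 5 * x $ 3" and S = "\<lambda>x. 0" and dS = "\<lambda>x. 0" and k = 3];
        ((rule poly_deriv_cong, (rule poly_deriv_intros)+, simp add: ne3) | (intro cube_bounded_intros) |
         (simp add: ibp_term_def skew_factor_def field_simps eval_nat_numeral)))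
next
  assume F: "F = Rotational"
  show ?thesis unfolding F
    by (rule integral_by_parts[where n = 1 and P = "\<lambda>x. 1/2 * (x $ 2 ^ 4 * x $ 3)" and i = 1 and dP = "\<lambda>x. 0"
          and Q = "\<lambda>x. - 1/2 * (x $ 2 ^ 2 * x $ 3)" and j = 2 and dQ = "\<lambda>x. - x $ 2 * x $ 3" and S = "\<lambda>x. 1/2 * (x $ 2 ^ 7 + x $ 2 ^ 3)" and dS = "\<lambda>x. 0" and k = 3];
        ((rule poly_deriv_cong, (rule poly_deriv_intros)+, simp add: ne3) | (intro cube_bounded_intros) |
         (simp add: ibp_term_def skew_factor_def field_simps eval_nat_numeral)))
qed

text \<open>The remainder is odd in x_3, so it disappears by reflection when the counterexample is
  assembled.\<close>

lemma angular_NL_2: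
  assumes "F \<in> {Convective, Skew_Symmetric, Rotational}"
  shows "(\<integral>x. (if F = Rotational then - (x $ 2 ^ 3 * bump_grad x $ 3) * (x $ 2 ^ 3 * bump x) - x $ 2 * bump_grad x $ 3 * (x $ 2 * bump x) else 0) * x $ 1 - ang_args (planar_NL1 F) x * x $ 3
      \<partial>(cube_measure :: 3 point measure)) = (\<integral>x. skew_factor F * (x $ 2 ^ 3 * x $ 3 * bump x ^ 2) \<partial>(cube_measure :: 3 point measure))"
proof (rule nonconservative_cases[OF assms])
  assume F: "F = Convective"
  show ?thesis unfolding F
    by (rule integral_by_parts[where n = 1 and P = "\<lambda>x. - 1/2 * (x $ 2 ^ 2 * x $ 3)" and i = 1 and dP = "\<lambda>x. 0"
          and Q = "\<lambda>x. - 1/2 * (x $ 2 ^ 4 * x $ 3)" and j = 2 and dQ = "\<lambda>x. - 2 * x $ 2 ^ 3 * x $ 3" and S = "\<lambda>x. 0" and dS = "\<lambda>x. 0" and k = 3];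
        ((rule poly_deriv_cong, (rule poly_deriv_intros)+, simp add: ne3) | (intro cube_bounded_intros) |
         (simp add: ibp_term_def skew_factor_def field_simps eval_nat_numeral)))
next
  assume F: "F = Skew_Symmetric"
  show ?thesis unfolding F
    by (rule integral_by_parts[where n = 1 and P = "\<lambda>x. - 3/4 * (x $ 2 ^ 2 * x $ 3)" and i = 1 and dP = "\<lambda>x. 0"
          and Q = "\<lambda>x. - 3/4 * (x $ 2 ^ 4 * x $ 3)" and j = 2 and dQ = "\<lambda>x. - 3 * x $ 2 ^ 3 * x $ 3" and S = "\<lambda>x. 0" and dS = "\<lambda>x. 0" and k = 3];
        ((rule poly_deriv_cong, (rule poly_deriv_intros)+, simp add: ne3) | (intro cube_bounded_intros) |
         (simp add: ibp_term_def skew_factor_def field_simps eval_nat_numeral)))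
next
  assume F: "F = Rotational"
  show ?thesis unfolding F
    by (rule integral_by_parts[where n = 1 and P = "\<lambda>x. 1/2 * (x $ 2 ^ 6 * x $ 3)" and i = 1 and dP = "\<lambda>x. 0"
          and Q = "\<lambda>x. - 1/2 * (x $ 2 ^ 4 * x $ 3)" and j = 2 and dQ = "\<lambda>x. - 2 * x $ 2 ^ 3 * x $ 3" and S = "\<lambda>x. - 1/2 * ((x $ 2 ^ 6 + x $ 2 ^ 2) * x $ 1)" and dS = "\<lambda>x. 0" and k = 3];
        ((rule poly_deriv_cong, (rule poly_deriv_intros)+, simp add: ne3) | (intro cube_bounded_intros) |
         (simp add: ibp_term_def skew_factor_def field_simps eval_nat_numeral)))
qed


lemma integral_coord_3_odd:
  fixes r :: "3 point \<Rightarrow> real"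
  assumes "ess_bounded cube_measure r" "\<And>x. r (flip 3 x) = r x"
  shows "(\<integral>x. r x * x $ 3 \<partial>cube_measure) = 0"
proof (rule integral_flip_odd[of _ 3])
  have "flip 3 x $ 3 = - x $ 3" for x :: "3 point" by (simp add: flip_def)
  then show "r (flip 3 x) * flip 3 x $ 3 = - (r x * x $ 3)" for x by (simp add: assms(2))
qed (intro cube_bounded_intros assms)

lemma flip_3_nth: "flip 3 x $ 1 = x $ 1" "flip 3 x $ 2 = x $ 2" for x :: "3 point"
  using ne3 by (simp_all add: flip_def)

lemma nonconservative_2:
  assumes F: "F \<in> {Convective, Skew_Symmetric, Rotational}"
  shows "\<not> conserves_linear_momentum TYPE(2) F" "\<not> conserves_angular_momentum TYPE(2) F"
proof -
  show "\<not> conserves_linear_momentum TYPE(2) F"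
  proof (rule not_conserves_linear_momentum[OF ne2 restr3_adjoint_2 F])
    show "(\<integral>x. NL F (lin_grad x) (lin_field x) $ i \<partial>cube_measure) = 0" if "i \<noteq> 1" "i \<noteq> 2" for i :: 2
      using exhaust_2[of i] that by blast
  qed (simp_all add: NL_2 planar_field_def planar_grad_def)
  show "\<not> conserves_angular_momentum TYPE(2) F"
  proof (rule not_conserves_angular_momentum[OF ne2 restr3_adjoint_2 F])
    show "(\<integral>x. cross3 (ext3 (ang_field x)) (ext3 x) $ k \<partial>(cube_measure :: 2 point measure)) = 0 \<and>
        (\<integral>x. cross3 (ext3 (NL F (ang_grad x) (ang_field x))) (ext3 x) $ k \<partial>(cube_measure :: 2 point measure)) = 0"
      if "k \<noteq> 3" for k
      using exhaust_3[of k] that by (auto simp: cross3_nth ext3_nth)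
  qed (simp_all add: NL_2 planar_field_def planar_grad_def mult_ac)
qed

lemma nonconservative_3:
  assumes F: "F \<in> {Convective, Skew_Symmetric, Rotational}"
  shows "\<not> conserves_linear_momentum TYPE(3) F" "\<not> conserves_angular_momentum TYPE(3) F"
proof -
  have z: "planar_field p q x $ 3 = 0" "planar_grad p dp q dq x $ 3 = 0" for p dp q dq and x :: "3 point"
    using ne3 by (simp_all add: planar_field_def planar_grad_def zero_vec_def)
  have lin3: "(\<integral>x. NL F (lin_grad x) (lin_field x) $ 3 \<partial>(cube_measure :: 3 point measure)) = 0"
  proof (cases "F = Rotational")
    case True
    have r: "NL Rotational (lin_grad x) (lin_field x) $ 3 = - bump_grad x $ 3 * bump x - (x $ 1 * bump_grad x $ 3) * (x $ 1 * bump x)"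
      for x :: "3 point"
      unfolding NL_3(4)[OF z] by (simp add: planar_field_def planar_grad_def)
    have "(\<integral>x. NL F (lin_grad x) (lin_field x) $ 3 \<partial>(cube_measure :: 3 point measure)) = (\<integral>x. 0 \<partial>(cube_measure :: 3 point measure))"
      unfolding True r
      by (rule integral_by_parts[where n = 1 and P = "\<lambda>x. 0" and i = 1 and dP = "\<lambda>x. 0" and Q = "\<lambda>x. 0" and j = 2 and dQ = "\<lambda>x. 0"
            and S = "\<lambda>x. - 1/2 * (x $ 1 ^ 2 + 1)" and dS = "\<lambda>x. 0" and k = 3];
          ((rule poly_deriv_cong, (rule poly_deriv_intros)+, simp add: ne3) | (intro cube_bounded_intros) |
           (simp add: ibp_term_def field_simps eval_nat_numeral)))
    then show ?thesis by simp
  next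
    case False
    then show ?thesis using F by (simp add: NL_3(3) z)
  qed
  show "\<not> conserves_linear_momentum TYPE(3) F"
  proof (rule not_conserves_linear_momentum[OF ne3(1) restr3_adjoint_3 F])
    show "(\<integral>x. NL F (lin_grad x) (lin_field x) $ i \<partial>cube_measure) = 0" if "i \<noteq> 1" "i \<noteq> 2" for i :: 3
      using exhaust_3[of i] that lin3 by blast
  qed (simp_all add: NL_3(1,2) z, simp_all add: planar_field_def planar_grad_def)
  let ?N = "\<lambda>x. NL F (ang_grad x) (ang_field x)" and ?M = "cube_measure :: 3 point measure"
  have N12: "?N x $ 1 = ang_args (planar_NL1 F) x" "?N x $ 2 = ang_args (planar_NL2 F) x" for x :: "3 point"
    by (simp_all add: NL_3(1,2) z, simp_all add: planar_field_def planar_grad_def mult_ac)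
  have N3: "?N x $ 3 = (if F = Rotational then - (x $ 2 ^ 3 * bump_grad x $ 3) * (x $ 2 ^ 3 * bump x) -
      x $ 2 * bump_grad x $ 3 * (x $ 2 * bump x) else 0)" for x :: "3 point"
  proof (cases "F = Rotational")
    case True
    show ?thesis unfolding True NL_3(4)[OF z] by (simp add: planar_field_def planar_grad_def)
  next
    case False
    then show ?thesis using F by (simp add: NL_3(3) z)
  qed
  show "\<not> conserves_angular_momentum TYPE(3) F"
  proof (rule not_conserves_angular_momentum[OF ne3(1) restr3_adjoint_3 F N12])
    fix k :: 3 assume "k \<noteq> 3"
    then consider "k = 1" | "k = 2" using exhaust_3[of k] by blast
    then show "(\<integral>x. cross3 (ext3 (ang_field x)) (ext3 x) $ k \<partial>?M) = 0 \<and>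
        (\<integral>x. cross3 (ext3 (?N x)) (ext3 x) $ k \<partial>?M) = 0"
    proof cases
      case 1
      have "(\<integral>x. (x $ 2 ^ 3 * bump x) * x $ 3 \<partial>?M) = 0"
        by (rule integral_coord_3_odd) (intro cube_bounded_intros, simp add: flip_3_nth bump_flip)
      moreover have "cross3 (ext3 (ang_field x)) (ext3 x) $ 1 = (x $ 2 ^ 3 * bump x) * x $ 3" for x :: "3 point"
        by (simp add: cross3_nth ext3_nth z) (simp add: planar_field_def)
      moreover have "cross3 (ext3 (?N x)) (ext3 x) $ 1 = ?N x $ 2 * x $ 3 - ?N x $ 3 * x $ 2" for x :: "3 point"
        by (simp add: cross3_nth ext3_nth)
      ultimately show ?thesis using angular_NL_1[OF F] by (simp only: 1 N12 N3) simp
    next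
      case 2
      have "(\<integral>x. (- (x $ 2) * bump x) * x $ 3 \<partial>?M) = 0"
        by (rule integral_coord_3_odd) (intro cube_bounded_intros, simp add: flip_3_nth bump_flip)
      moreover have "cross3 (ext3 (ang_field x)) (ext3 x) $ 2 = (- (x $ 2) * bump x) * x $ 3" for x :: "3 point"
        by (simp add: cross3_nth ext3_nth z) (simp add: planar_field_def)
      moreover have "cross3 (ext3 (?N x)) (ext3 x) $ 2 = ?N x $ 3 * x $ 1 - ?N x $ 1 * x $ 3" for x :: "3 point"
        by (simp add: cross3_nth ext3_nth)
      moreover have "(\<integral>x. (skew_factor F * x $ 2 ^ 3 * bump x ^ 2) * x $ 3 \<partial>?M) = 0"
        by (rule integral_coord_3_odd) (intro cube_bounded_intros, simp add: flip_3_nth bump_flip)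
      then have "(\<integral>x. skew_factor F * (x $ 2 ^ 3 * x $ 3 * bump x ^ 2) \<partial>?M) = 0"
        by (simp add: mult_ac)
      ultimately show ?thesis using angular_NL_2[OF F] by (simp only: 2 N12 N3)
    qed
  qed
qed

lemma not_conserves_energy_Conservative_2: "\<not> conserves_energy TYPE(2) Conservative"
proof (rule not_conserves_energy_Conservative[OF ne2])
  show "inner (NL Conservative (lin_grad x) (lin_field x)) (lin_field x) =
      lin_args (planar_NL1 Conservative) x * (x $ 1 * bump x) + lin_args (planar_NL2 Conservative) x * bump x" for x :: "2 point"
    unfolding inner_vec_def sum_2 NL_2 by (simp add: planar_field_def planar_grad_def)
  show "inner (lin_field x) (lin_field x) = (x $ 1 ^ 2 + 1) * bump x ^ 2" for x :: "2 point"
    unfolding inner_vec_def sum_2 by (simp add: planar_field_def power2_eq_square algebra_simps)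
qed

lemma not_conserves_energy_Conservative_3: "\<not> conserves_energy TYPE(3) Conservative"
proof (rule not_conserves_energy_Conservative[OF ne3(1)])
  have z: "lin_field x $ 3 = 0" "lin_grad x $ 3 = 0" for x :: "3 point"
    using ne3 by (simp_all add: planar_field_def planar_grad_def zero_vec_def)
  show "inner (NL Conservative (lin_grad x) (lin_field x)) (lin_field x) =
      lin_args (planar_NL1 Conservative) x * (x $ 1 * bump x) + lin_args (planar_NL2 Conservative) x * bump x" for x :: "3 point"
    unfolding inner_vec_def sum_3 NL_3(1,2)[OF z] z by (simp add: planar_field_def planar_grad_def)
  show "inner (lin_field x) (lin_field x) = (x $ 1 ^ 2 + 1) * bump x ^ 2" for x :: "3 point"
    unfolding inner_vec_def sum_3 z by (simp add: planar_field_def power2_eq_square algebra_simps)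
qed

text \<open>For the uniqueness claim, three formulations are excluded by their momenta and
  \<open>Conservative\<close> by its energy.\<close>

lemma all_conservation_laws:
  assumes d: "restr3_adjoint TYPE('d::{finite,numeral})"
    and n: "\<And>F. F \<in> {Convective, Skew_Symmetric, Rotational} \<Longrightarrow>
      \<not> conserves_linear_momentum TYPE('d) F \<and> \<not> conserves_angular_momentum TYPE('d) F"
    and e: "\<not> conserves_energy TYPE('d) Conservative"
  shows "(\<forall>F \<in> {Skew_Symmetric, Rotational, EMA_Conserving}. conserves_energy TYPE('d) F) \<and>
      (\<forall>F. conserves_linear_momentum TYPE('d) F \<longleftrightarrow> F \<in> {EMA_Conserving, Conservative}) \<and>
      (\<forall>F. conserves_angular_momentum TYPE('d) F \<longleftrightarrow> F \<in> {EMA_Conserving, Conservative}) \<and>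
      (\<forall>F. conserves_energy TYPE('d) F \<and> conserves_linear_momentum TYPE('d) F \<and>
           conserves_angular_momentum TYPE('d) F \<longleftrightarrow> F = EMA_Conserving)"
proof -
  have E: "\<forall>F \<in> {Skew_Symmetric, Rotational, EMA_Conserving}. conserves_energy TYPE('d) F"
    using conserves_energyI[OF d] by blast
  have LA: "(conserves_linear_momentum TYPE('d) F \<longleftrightarrow> F \<in> {EMA_Conserving, Conservative}) \<and>
      (conserves_angular_momentum TYPE('d) F \<longleftrightarrow> F \<in> {EMA_Conserving, Conservative})" for F
    using n[of F] conserves_momentumI[OF d, of F] by (cases F) auto
  have "conserves_energy TYPE('d) F \<and> conserves_linear_momentum TYPE('d) F \<and>
           conserves_angular_momentum TYPE('d) F \<longleftrightarrow> F = EMA_Conserving" for F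
    using E LA[of F] e by (cases F) auto
  with E LA show ?thesis by blast
qed

theorem proposition3p1:
  shows
    "((\<forall>F \<in> {Skew_Symmetric, Rotational, EMA_Conserving}. conserves_energy TYPE(2) F) \<and>
      (\<forall>F. conserves_linear_momentum TYPE(2) F \<longleftrightarrow> F \<in> {EMA_Conserving, Conservative}) \<and>
      (\<forall>F. conserves_angular_momentum TYPE(2) F \<longleftrightarrow> F \<in> {EMA_Conserving, Conservative}) \<and>
      (\<forall>F. conserves_energy TYPE(2) F \<and> conserves_linear_momentum TYPE(2) F \<and>
           conserves_angular_momentum TYPE(2) F \<longleftrightarrow> F = EMA_Conserving)) \<and>
     ((\<forall>F \<in> {Skew_Symmetric, Rotational, EMA_Conserving}. conserves_energy TYPE(3) F) \<and>
      (\<forall>F. conserves_linear_momentum TYPE(3) F \<longleftrightarrow> F \<in> {EMA_Conserving, Conservative}) \<and>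
      (\<forall>F. conserves_angular_momentum TYPE(3) F \<longleftrightarrow> F \<in> {EMA_Conserving, Conservative}) \<and>
      (\<forall>F. conserves_energy TYPE(3) F \<and> conserves_linear_momentum TYPE(3) F \<and>
           conserves_angular_momentum TYPE(3) F \<longleftrightarrow> F = EMA_Conserving))"
proof
  show "(\<forall>F \<in> {Skew_Symmetric, Rotational, EMA_Conserving}. conserves_energy TYPE(2) F) \<and>
      (\<forall>F. conserves_linear_momentum TYPE(2) F \<longleftrightarrow> F \<in> {EMA_Conserving, Conservative}) \<and>
      (\<forall>F. conserves_angular_momentum TYPE(2) F \<longleftrightarrow> F \<in> {EMA_Conserving, Conservative}) \<and>
      (\<forall>F. conserves_energy TYPE(2) F \<and> conserves_linear_momentum TYPE(2) F \<and>
           conserves_angular_momentum TYPE(2) F \<longleftrightarrow> F = EMA_Conserving)"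
    by (rule all_conservation_laws[OF restr3_adjoint_2 _ not_conserves_energy_Conservative_2])
       (intro conjI nonconservative_2)
  show "(\<forall>F \<in> {Skew_Symmetric, Rotational, EMA_Conserving}. conserves_energy TYPE(3) F) \<and>
      (\<forall>F. conserves_linear_momentum TYPE(3) F \<longleftrightarrow> F \<in> {EMA_Conserving, Conservative}) \<and>
      (\<forall>F. conserves_angular_momentum TYPE(3) F \<longleftrightarrow> F \<in> {EMA_Conserving, Conservative}) \<and>
      (\<forall>F. conserves_energy TYPE(3) F \<and> conserves_linear_momentum TYPE(3) F \<and>
           conserves_angular_momentum TYPE(3) F \<longleftrightarrow> F = EMA_Conserving)"
    by (rule all_conservation_laws[OF restr3_adjoint_3 _ not_conserves_energy_Conservative_3])
       (intro conjI nonconservative_3)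
qed

end
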